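(* Let $(A,M)$ be a (discrete) log ring, with structure map $\alpha:M\to(A,\cdot)$. (1) The forgetful functor $\mathrm{Log}^{\mathrm{rep}}_{(A,M)//(A,M)}\to\mathrm{CRing}_{A//A}$, $(B,N)\mapsto B$, is an equivalence of categories. (2) The assignment $\mathrm{Mod}_A\to\mathrm{Ab}(\mathrm{Log}^{\mathrm{rep}}_{(A,M)//(A,M)})$, $J\mapsto(A\oplus J,M\oplus J)$, defines an equivalence of categories. (3) For log rings $(B,N)$ over $(A,M)$ there is a natural isomorphism $\mathrm{Ab}^{\mathrm{rep}}_+(B,N)\cong\Omega^1_{(B,N)}\otimes_BA$ of $A$-modules, where $\Omega^1_{(B,N)}$ is the module of log differentials.
   Context: A pre-log ring $(A,M,\alpha)$ is a commutative ring $A$, a commutative monoid $M$ and a monoid map $\alpha:M\to(A,\cdot)$. It is a log ring if $\alpha^{-1}\mathrm{GL}_1(A)\to\mathrm{GL}_1(A)$ is an isomorphism, where $\mathrm{GL}_1(A)=A^\times$. $\mathrm{PreLog}$ and $\mathrm{Log}$ are the categories of pre-log and log rings. The logification $(A,M)\mapsto(A,M^a)$, left adjoint to the inclusion $\mathrm{Log}\to\mathrm{PreLog}$, has $M^a$ the pushout of $M\leftarrow\alpha^{-1}\mathrm{GL}_1(A)\to\mathrm{GL}_1(A)$. For an object $X$ of a category $\mathcal C$, $\mathcal C_{/X}$ is the category of objects over $X$, and $\mathcal C_{X//X}$ the category of objects $Y$ with maps $X\to Y\to X$ composing to the identity. $\mathrm{Ab}(\mathcal C)$ is the category of abelian group objects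 of $\mathcal C$. $\mathrm{CRing}$ is the category of commutative rings. A map of commutative monoids $N\to M$ is exact if $N\to M\times_{M^{\mathrm{gp}}}N^{\mathrm{gp}}$ is an isomorphism, where $(-)^{\mathrm{gp}}$ is group completion; it is replete if it is exact and $N^{\mathrm{gp}}\to M^{\mathrm{gp}}$ is surjective. If $N^{\mathrm{gp}}\to M^{\mathrm{gp}}$ is surjective, the repletion of $N\to M$ is $N^{\mathrm{rep}}=M\times_{M^{\mathrm{gp}}}N^{\mathrm{gp}}\to M$. The repletion of a map of pre-log rings $(B,N)\to(A,M)$ with $N^{\mathrm{gp}}\to M^{\mathrm{gp}}$ surjective is $(B^{\mathrm{rep}},N^{\mathrm{rep}})\to(A,M)$ with $B^{\mathrm{rep}}=B\otimes_{\mathbb Z[N]}\mathbb Z[N^{\mathrm{rep}}]$. $\mathrm{Log}^{\mathrm{rep}}_{(A,M)//(A,M)}\subset\mathrm{Log}_{(A,M)//(A,M)}$ is the full subcategory of those $(B,N)$ for which $N\to M$ is replete. For an $A$-module $J$, $A\oplus J$ is the split square-zero extension, and $(A\oplus J,M\oplus J)$ has structure map $(m,j)\mapsto(\alpha(m),\alpha(m)j)$, with the evident maps from and to $(A,M)$. Replete abelianization. For $(B,N)\in\mathrm{PreLog}_{/(A,M)}$ let $(B,N)_+=(A\otimes_{\mathbb Z}B,M\oplus N)\in\mathrm{PreLog}_{(A,M)//(A,M)}$ (coproduct of pre-log rings, augmented via the identity of $(A,M)$ and $(B,N)\to(A,M)$). $\mathrm{Ab}^{\mathrm{rep}}_+(B,N)$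 is the $A$-module $I/I^2$, where $I$ is the kernel of the augmentation to $A$ of the underlying $A$-algebra of the repletion of $(B,N)_+$ over $(A,M)$, namely of $(A\otimes_{\mathbb Z}B)\otimes_{\mathbb Z[M\oplus N]}\mathbb Z[(M\oplus N)^{\mathrm{rep}}]\to A$, the repletion being formed with respect to $M\oplus N\to M$. (Via the equivalence of (2) it can be viewed as an abelian group object of $\mathrm{Log}^{\mathrm{rep}}_{(A,M)//(A,M)}$.) Log differentials. For a pre-log ring $(B,N,\beta)$, $\Omega^1_{(B,N)}$ is the quotient of the $B$-module $\Omega^1_B\oplus(B\otimes_{\mathbb Z}N^{\mathrm{gp}})$ by the relations $d\beta(n)\sim\beta(n)\otimes[n]$ for $n\in N$, where $[n]$ is the image of $n$ in $N^{\mathrm{gp}}$ and $\Omega^1_B$ is the module of Kähler differentials over $\mathbb Z$. *)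

theory Defs
  imports "HOL-Algebra.IntRing" "HOL-Algebra.Ideal_Product" "HOL-Algebra.Weak_Morphisms" "HOL-Algebra.Module"
    "HOL-Library.Poly_Mapping" "HOL-Library.FuncSet"
begin

section \<open>Categories\<close>

text \<open>Morphisms do not carry their source and target: \<open>Hom C X Y\<close> is a family of sets indexed
  by pairs of objects, and \<open>Comp C X Y Z g f\<close> is the composite of \<open>f : X \<rightarrow> Y\<close> and
  \<open>g : Y \<rightarrow> Z\<close>. In the concrete categories below morphisms are extensional functions, so that
  equality of morphisms is equality of functions on the carrier.\<close>

record ('o, 'm) cat =
  Obj :: "'o set"
  Hom :: "'o \<Rightarrow> 'o \<Rightarrow> 'm set"
  Ident :: "'o \<Rightarrow> 'm"
  Comp :: "'o \<Rightarrow> 'o \<Rightarrow> 'o \<Rightarrow> 'm \<Rightarrow> 'm \<Rightarrow> 'm"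

definition category :: "('o, 'm) cat \<Rightarrow> bool" where
  "category C \<longleftrightarrow>
     (\<forall>X\<in>Obj C. Ident C X \<in> Hom C X X) \<and>
     (\<forall>X\<in>Obj C. \<forall>Y\<in>Obj C. \<forall>Z\<in>Obj C. \<forall>f\<in>Hom C X Y. \<forall>g\<in>Hom C Y Z.
        Comp C X Y Z g f \<in> Hom C X Z) \<and>
     (\<forall>X\<in>Obj C. \<forall>Y\<in>Obj C. \<forall>f\<in>Hom C X Y.
        Comp C X X Y f (Ident C X) = f \<and> Comp C X Y Y (Ident C Y) f = f) \<and>
     (\<forall>W\<in>Obj C. \<forall>X\<in>Obj C. \<forall>Y\<in>Obj C. \<forall>Z\<in>Obj C.
        \<forall>f\<in>Hom C W X. \<forall>g\<in>Hom C X Y. \<forall>h\<in>Hom C Y Z.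
          Comp C W X Z (Comp C X Y Z h g) f = Comp C W Y Z h (Comp C W X Y g f))"

definition isomorphism :: "('o, 'm) cat \<Rightarrow> 'o \<Rightarrow> 'o \<Rightarrow> 'm \<Rightarrow> bool" where
  "isomorphism C X Y f \<longleftrightarrow> f \<in> Hom C X Y \<and>
     (\<exists>g\<in>Hom C Y X. Comp C X Y X g f = Ident C X \<and> Comp C Y X Y f g = Ident C Y)"

record ('o1, 'm1, 'o2, 'm2) fctr =
  fobj :: "'o1 \<Rightarrow> 'o2"
  fmor :: "'o1 \<Rightarrow> 'o1 \<Rightarrow> 'm1 \<Rightarrow> 'm2"

definition is_functor ::
    "('o1, 'm1) cat \<Rightarrow> ('o2, 'm2) cat \<Rightarrow> ('o1, 'm1, 'o2, 'm2) fctr \<Rightarrow> bool" where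
  "is_functor C D F \<longleftrightarrow> category C \<and> category D \<and>
     (\<forall>X\<in>Obj C. fobj F X \<in> Obj D) \<and>
     (\<forall>X\<in>Obj C. \<forall>Y\<in>Obj C. \<forall>f\<in>Hom C X Y. fmor F X Y f \<in> Hom D (fobj F X) (fobj F Y)) \<and>
     (\<forall>X\<in>Obj C. fmor F X X (Ident C X) = Ident D (fobj F X)) \<and>
     (\<forall>X\<in>Obj C. \<forall>Y\<in>Obj C. \<forall>Z\<in>Obj C. \<forall>f\<in>Hom C X Y. \<forall>g\<in>Hom C Y Z.
        fmor F X Z (Comp C X Y Z g f) =
          Comp D (fobj F X) (fobj F Y) (fobj F Z) (fmor F Y Z g) (fmor F X Y f))"

definition id_functor :: "('o, 'm, 'o, 'm) fctr" where
  "id_functor = \<lparr>fobj = (\<lambda>X. X), fmor = (\<lambda>X Y f. f)\<rparr>"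

definition comp_functor ::
    "('o2, 'm2, 'o3, 'm3) fctr \<Rightarrow> ('o1, 'm1, 'o2, 'm2) fctr \<Rightarrow> ('o1, 'm1, 'o3, 'm3) fctr" where
  "comp_functor G F = \<lparr>fobj = (\<lambda>X. fobj G (fobj F X)),
     fmor = (\<lambda>X Y f. fmor G (fobj F X) (fobj F Y) (fmor F X Y f))\<rparr>"

definition natural_iso ::
    "('o1, 'm1) cat \<Rightarrow> ('o2, 'm2) cat \<Rightarrow> ('o1, 'm1, 'o2, 'm2) fctr \<Rightarrow>
     ('o1, 'm1, 'o2, 'm2) fctr \<Rightarrow> ('o1 \<Rightarrow> 'm2) \<Rightarrow> bool" where
  "natural_iso C D F G \<eta> \<longleftrightarrow>
     (\<forall>X\<in>Obj C. isomorphism D (fobj F X) (fobj G X) (\<eta> X)) \<and>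
     (\<forall>X\<in>Obj C. \<forall>Y\<in>Obj C. \<forall>f\<in>Hom C X Y.
        Comp D (fobj F X) (fobj G X) (fobj G Y) (fmor G X Y f) (\<eta> X) =
        Comp D (fobj F X) (fobj F Y) (fobj G Y) (\<eta> Y) (fmor F X Y f))"

definition is_equivalence ::
    "('o1, 'm1) cat \<Rightarrow> ('o2, 'm2) cat \<Rightarrow> ('o1, 'm1, 'o2, 'm2) fctr \<Rightarrow> bool" where
  "is_equivalence C D F \<longleftrightarrow> is_functor C D F \<and>
     (\<exists>G. is_functor D C G \<and>
        (\<exists>\<eta>. natural_iso C C id_functor (comp_functor G F) \<eta>) \<and>
        (\<exists>\<epsilon>. natural_iso D D (comp_functor F G) id_functor \<epsilon>))"

definition full_subcat :: "('o, 'm) cat \<Rightarrow> ('o \<Rightarrow> bool) \<Rightarrow> ('o, 'm) cat" where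
  "full_subcat C P = C\<lparr>Obj := {X \<in> Obj C. P X}\<rparr>"

text \<open>\<open>C\<^sub>/\<^sub>X\<close>: objects are pairs \<open>(Y, p : Y \<rightarrow> X)\<close>.\<close>

definition over_cat :: "('o, 'm) cat \<Rightarrow> 'o \<Rightarrow> ('o \<times> 'm, 'm) cat" where
  "over_cat C X = \<lparr>
     Obj = {(Y, p). Y \<in> Obj C \<and> p \<in> Hom C Y X},
     Hom = (\<lambda>(Y, p) (Y', p'). {f \<in> Hom C Y Y'. Comp C Y Y' X p' f = p}),
     Ident = (\<lambda>(Y, p). Ident C Y),
     Comp = (\<lambda>(Y, _) (Y', _) (Y'', _). Comp C Y Y' Y'')\<rparr>"

text \<open>\<open>C\<^sub>X\<^sub>/\<^sub>/\<^sub>X\<close>: objects are triples \<open>(Y, s : X \<rightarrow> Y, p : Y \<rightarrow> X)\<close> with \<open>p s = id\<close>.\<close>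

definition under_over_cat :: "('o, 'm) cat \<Rightarrow> 'o \<Rightarrow> ('o \<times> 'm \<times> 'm, 'm) cat" where
  "under_over_cat C X = \<lparr>
     Obj = {(Y, s, p). Y \<in> Obj C \<and> s \<in> Hom C X Y \<and> p \<in> Hom C Y X \<and>
              Comp C X Y X p s = Ident C X},
     Hom = (\<lambda>(Y, s, p) (Y', s', p').
              {f \<in> Hom C Y Y'. Comp C X Y Y' f s = s' \<and> Comp C Y Y' X p' f = p}),
     Ident = (\<lambda>(Y, _, _). Ident C Y),
     Comp = (\<lambda>(Y, _, _) (Y', _, _) (Y'', _, _). Comp C Y Y' Y'')\<rparr>"


subsection \<open>Abelian group objects\<close>

definition is_terminal :: "('o, 'm) cat \<Rightarrow> 'o \<Rightarrow> bool" where
  "is_terminal C T \<longleftrightarrow> T \<in> Obj C \<and> (\<forall>Y\<in>Obj C. \<exists>!f. f \<in> Hom C Y T)"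

definition to_terminal :: "('o, 'm) cat \<Rightarrow> 'o \<Rightarrow> 'o \<Rightarrow> 'm" where
  "to_terminal C T Y = (THE f. f \<in> Hom C Y T)"

definition is_product :: "('o, 'm) cat \<Rightarrow> 'o \<Rightarrow> 'o \<Rightarrow> 'o \<Rightarrow> 'm \<Rightarrow> 'm \<Rightarrow> bool" where
  "is_product C X Y P p q \<longleftrightarrow> P \<in> Obj C \<and> p \<in> Hom C P X \<and> q \<in> Hom C P Y \<and>
     (\<forall>Z\<in>Obj C. \<forall>f\<in>Hom C Z X. \<forall>g\<in>Hom C Z Y.
        \<exists>!h. h \<in> Hom C Z P \<and> Comp C Z P X p h = f \<and> Comp C Z P Y q h = g)"

definition pairing ::
    "('o, 'm) cat \<Rightarrow> 'o \<Rightarrow> 'o \<Rightarrow> 'o \<Rightarrow> 'm \<Rightarrow> 'm \<Rightarrow> 'o \<Rightarrow> 'm \<Rightarrow> 'm \<Rightarrow> 'm" where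
  "pairing C X Y P p q Z f g =
     (THE h. h \<in> Hom C Z P \<and> Comp C Z P X p h = f \<and> Comp C Z P Y q h = g)"

text \<open>An abelian group object is recorded together with the product cone \<open>G \<leftarrow> G \<times> G \<rightarrow> G\<close> and
  the terminal object on which its addition and its zero are defined. The choice is immaterial:
  different choices give isomorphic objects of \<open>Ab C\<close>.\<close>

record ('o, 'm) abobj =
  ab_obj :: 'o
  ab_prod :: 'o
  ab_p1 :: 'm
  ab_p2 :: 'm
  ab_term :: 'o
  ab_add :: 'm
  ab_zero :: 'm
  ab_neg :: 'm

definition ab_plus :: "('o, 'm) cat \<Rightarrow> ('o, 'm) abobj \<Rightarrow> 'o \<Rightarrow> 'm \<Rightarrow> 'm \<Rightarrow> 'm" where
  "ab_plus C g Y f f' =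
     Comp C Y (ab_prod g) (ab_obj g) (ab_add g)
       (pairing C (ab_obj g) (ab_obj g) (ab_prod g) (ab_p1 g) (ab_p2 g) Y f f')"

definition ab_null :: "('o, 'm) cat \<Rightarrow> ('o, 'm) abobj \<Rightarrow> 'o \<Rightarrow> 'm" where
  "ab_null C g Y = Comp C Y (ab_term g) (ab_obj g) (ab_zero g) (to_terminal C (ab_term g) Y)"

text \<open>The group axioms are written with generalised elements \<open>Y \<rightarrow> G\<close>; taking \<open>Y\<close> to be a power
  of \<open>G\<close> and the elements to be projections gives the usual commutative diagrams.\<close>

definition is_abobj :: "('o, 'm) cat \<Rightarrow> ('o, 'm) abobj \<Rightarrow> bool" where
  "is_abobj C g \<longleftrightarrow>
     ab_obj g \<in> Obj C \<and>
     is_product C (ab_obj g) (ab_obj g) (ab_prod g) (ab_p1 g) (ab_p2 g) \<and>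
     is_terminal C (ab_term g) \<and>
     ab_add g \<in> Hom C (ab_prod g) (ab_obj g) \<and>
     ab_zero g \<in> Hom C (ab_term g) (ab_obj g) \<and>
     ab_neg g \<in> Hom C (ab_obj g) (ab_obj g) \<and>
     (\<forall>Y\<in>Obj C. \<forall>a\<in>Hom C Y (ab_obj g). \<forall>b\<in>Hom C Y (ab_obj g). \<forall>c\<in>Hom C Y (ab_obj g).
        ab_plus C g Y (ab_plus C g Y a b) c = ab_plus C g Y a (ab_plus C g Y b c)) \<and>
     (\<forall>Y\<in>Obj C. \<forall>a\<in>Hom C Y (ab_obj g). \<forall>b\<in>Hom C Y (ab_obj g).
        ab_plus C g Y a b = ab_plus C g Y b a) \<and>
     (\<forall>Y\<in>Obj C. \<forall>a\<in>Hom C Y (ab_obj g).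
        ab_plus C g Y (ab_null C g Y) a = a \<and>
        ab_plus C g Y (Comp C Y (ab_obj g) (ab_obj g) (ab_neg g) a) a = ab_null C g Y)"

definition Ab :: "('o, 'm) cat \<Rightarrow> (('o, 'm) abobj, 'm) cat" where
  "Ab C = \<lparr>
     Obj = {g. is_abobj C g},
     Hom = (\<lambda>g h. {f \<in> Hom C (ab_obj g) (ab_obj h).
        Comp C (ab_prod g) (ab_obj g) (ab_obj h) f (ab_add g) =
        ab_plus C h (ab_prod g)
          (Comp C (ab_prod g) (ab_obj g) (ab_obj h) f (ab_p1 g))
          (Comp C (ab_prod g) (ab_obj g) (ab_obj h) f (ab_p2 g))}),
     Ident = (\<lambda>g. Ident C (ab_obj g)),
     Comp = (\<lambda>g h k. Comp C (ab_obj g) (ab_obj h) (ab_obj k))\<rparr>"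


section \<open>Modules\<close>

definition mod_hom :: "'r ring \<Rightarrow> ('r, 'x) module \<Rightarrow> ('r, 'y) module \<Rightarrow> ('x \<Rightarrow> 'y) set" where
  "mod_hom R X Y = {h \<in> carrier X \<rightarrow> carrier Y.
     (\<forall>x\<in>carrier X. \<forall>y\<in>carrier X. h (x \<oplus>\<^bsub>X\<^esub> y) = h x \<oplus>\<^bsub>Y\<^esub> h y) \<and>
     (\<forall>r\<in>carrier R. \<forall>x\<in>carrier X. h (r \<odot>\<^bsub>X\<^esub> x) = r \<odot>\<^bsub>Y\<^esub> h x)}"

definition mod_iso :: "'r ring \<Rightarrow> ('r, 'x) module \<Rightarrow> ('r, 'y) module \<Rightarrow> ('x \<Rightarrow> 'y) set" where
  "mod_iso R X Y = {h \<in> mod_hom R X Y. bij_betw h (carrier X) (carrier Y)}"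

definition Mod_cat :: "'r ring \<Rightarrow> (('r, 'x) module, 'x \<Rightarrow> 'x) cat" where
  "Mod_cat R = \<lparr>
     Obj = {X. module R X},
     Hom = (\<lambda>X Y. mod_hom R X Y \<inter> extensional (carrier X)),
     Ident = (\<lambda>X. \<lambda>x\<in>carrier X. x),
     Comp = (\<lambda>X Y Z g f. compose (carrier X) g f)\<rparr>"

text \<open>Isomorphism of two functors with values in \<open>R\<close>-modules whose carriers live in different
  types.\<close>

definition natural_mod_iso ::
    "('o, 'm) cat \<Rightarrow> 'r ring \<Rightarrow> ('o, 'm, ('r, 'x) module, 'x \<Rightarrow> 'x) fctr \<Rightarrow>
     ('o, 'm, ('r, 'y) module, 'y \<Rightarrow> 'y) fctr \<Rightarrow> ('o \<Rightarrow> 'x \<Rightarrow> 'y) \<Rightarrow> bool" where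
  "natural_mod_iso C R F G \<phi> \<longleftrightarrow>
     (\<forall>X\<in>Obj C. \<phi> X \<in> mod_iso R (fobj F X) (fobj G X)) \<and>
     (\<forall>X\<in>Obj C. \<forall>Y\<in>Obj C. \<forall>f\<in>Hom C X Y. \<forall>x\<in>carrier (fobj F X).
        fmor G X Y f (\<phi> X x) = \<phi> Y (fmor F X Y f x))"

definition dsum_module :: "('r, 'x) module \<Rightarrow> ('r, 'y) module \<Rightarrow> ('r, 'x \<times> 'y) module" where
  "dsum_module X Y = \<lparr>carrier = carrier X \<times> carrier Y,
     mult = undefined, one = undefined,
     zero = (\<zero>\<^bsub>X\<^esub>, \<zero>\<^bsub>Y\<^esub>),
     add = (\<lambda>(x, y) (x', y'). (x \<oplus>\<^bsub>X\<^esub> x', y \<oplus>\<^bsub>Y\<^esub> y')),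
     smult = (\<lambda>r (x, y). (r \<odot>\<^bsub>X\<^esub> x, r \<odot>\<^bsub>Y\<^esub> y))\<rparr>"

definition image_module :: "('x \<Rightarrow> 'y) \<Rightarrow> ('r, 'x) module \<Rightarrow> ('r, 'y) module" where
  "image_module f X = \<lparr>carrier = f ` carrier X,
     mult = undefined, one = undefined,
     zero = f \<zero>\<^bsub>X\<^esub>,
     add = (\<lambda>a b. f (inv_into (carrier X) f a \<oplus>\<^bsub>X\<^esub> inv_into (carrier X) f b)),
     smult = (\<lambda>r a. f (r \<odot>\<^bsub>X\<^esub> inv_into (carrier X) f a))\<rparr>"

definition restrict_scalars :: "('s \<Rightarrow> 'r) \<Rightarrow> ('r, 'x) module \<Rightarrow> ('s, 'x) module" where
  "restrict_scalars u X = \<lparr>carrier = carrier X,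
     mult = undefined, one = undefined, zero = \<zero>\<^bsub>X\<^esub>, add = add X,
     smult = (\<lambda>s x. u s \<odot>\<^bsub>X\<^esub> x)\<rparr>"

definition gen_submodule :: "'r ring \<Rightarrow> ('r, 'x) module \<Rightarrow> 'x set \<Rightarrow> 'x set" where
  "gen_submodule R X E = \<Inter>{K. submodule K R X \<and> E \<subseteq> K}"

definition quot_module :: "('r, 'x) module \<Rightarrow> 'x set \<Rightarrow> ('r, 'x set) module" where
  "quot_module X K = \<lparr>carrier = a_rcosets\<^bsub>X\<^esub> K,
     mult = undefined, one = undefined, zero = K, add = set_add X,
     smult = (\<lambda>r U. \<Union>x\<in>U. K +>\<^bsub>X\<^esub> (r \<odot>\<^bsub>X\<^esub> x))\<rparr>"

definition free_module :: "'r ring \<Rightarrow> 's set \<Rightarrow> ('r, 's \<Rightarrow> 'r) module" where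
  "free_module R S = \<lparr>
     carrier = {c. c \<in> S \<rightarrow> carrier R \<and> (\<forall>s. s \<notin> S \<longrightarrow> c s = \<zero>\<^bsub>R\<^esub>) \<and> finite {s. c s \<noteq> \<zero>\<^bsub>R\<^esub>}},
     mult = undefined, one = undefined,
     zero = (\<lambda>s. \<zero>\<^bsub>R\<^esub>),
     add = (\<lambda>c d s. c s \<oplus>\<^bsub>R\<^esub> d s),
     smult = (\<lambda>r c s. r \<otimes>\<^bsub>R\<^esub> c s)\<rparr>"

definition basis_vec :: "'r ring \<Rightarrow> 's \<Rightarrow> 's \<Rightarrow> 'r" where
  "basis_vec R s = (\<lambda>t. if t = s then \<one>\<^bsub>R\<^esub> else \<zero>\<^bsub>R\<^esub>)"

definition lin_ext :: "'r ring \<Rightarrow> ('r, 'x) module \<Rightarrow> ('s \<Rightarrow> 'x) \<Rightarrow> ('s \<Rightarrow> 'r) \<Rightarrow> 'x" where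
  "lin_ext R X h c = (\<Oplus>\<^bsub>X\<^esub>s\<in>{s. c s \<noteq> \<zero>\<^bsub>R\<^esub>}. c s \<odot>\<^bsub>X\<^esub> h s)"

text \<open>The module generated by the symbols in \<open>S\<close> subject to the relations \<open>E\<close>, the class of the
  symbol \<open>s\<close>, and the linear map out of it determined by its values \<open>h s\<close> on the symbols.\<close>

definition presented_module ::
    "'r ring \<Rightarrow> 's set \<Rightarrow> ('s \<Rightarrow> 'r) set \<Rightarrow> ('r, ('s \<Rightarrow> 'r) set) module" where
  "presented_module R S E = quot_module (free_module R S) (gen_submodule R (free_module R S) E)"

definition presented_gen ::
    "'r ring \<Rightarrow> 's set \<Rightarrow> ('s \<Rightarrow> 'r) set \<Rightarrow> 's \<Rightarrow> ('s \<Rightarrow> 'r) set" where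
  "presented_gen R S E s =
     gen_submodule R (free_module R S) E +>\<^bsub>free_module R S\<^esub> basis_vec R s"

definition presented_lift ::
    "'r ring \<Rightarrow> ('r, 'x) module \<Rightarrow> ('s \<Rightarrow> 'x) \<Rightarrow> ('s \<Rightarrow> 'r) set \<Rightarrow> 'x" where
  "presented_lift R X h U = the_elem (lin_ext R X h ` U)"

text \<open>\<open>T \<otimes>\<^sub>R X\<close> as a \<open>T\<close>-module, for a ring map \<open>\<phi> : R \<rightarrow> T\<close> and an \<open>R\<close>-module \<open>X\<close>: generated by
  symbols \<open>(t, x)\<close> that are biadditive, \<open>R\<close>-balanced and \<open>T\<close>-linear in \<open>t\<close>.\<close>

definition ext_scalars_rels ::
    "'t ring \<Rightarrow> ('r \<Rightarrow> 't) \<Rightarrow> 'r ring \<Rightarrow> ('r, 'x) module \<Rightarrow> ('t \<times> 'x \<Rightarrow> 't) set" where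
  "ext_scalars_rels T \<phi> R X =
     (let F = free_module T (carrier T \<times> carrier X); e = basis_vec T in
       {e (s \<oplus>\<^bsub>T\<^esub> t, x) \<ominus>\<^bsub>F\<^esub> (e (s, x) \<oplus>\<^bsub>F\<^esub> e (t, x)) | s t x.
          s \<in> carrier T \<and> t \<in> carrier T \<and> x \<in> carrier X} \<union>
       {e (t, x \<oplus>\<^bsub>X\<^esub> y) \<ominus>\<^bsub>F\<^esub> (e (t, x) \<oplus>\<^bsub>F\<^esub> e (t, y)) | t x y.
          t \<in> carrier T \<and> x \<in> carrier X \<and> y \<in> carrier X} \<union>
       {e (t \<otimes>\<^bsub>T\<^esub> \<phi> r, x) \<ominus>\<^bsub>F\<^esub> e (t, r \<odot>\<^bsub>X\<^esub> x) | t r x.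
          t \<in> carrier T \<and> r \<in> carrier R \<and> x \<in> carrier X} \<union>
       {e (s \<otimes>\<^bsub>T\<^esub> t, x) \<ominus>\<^bsub>F\<^esub> (s \<odot>\<^bsub>F\<^esub> e (t, x)) | s t x.
          s \<in> carrier T \<and> t \<in> carrier T \<and> x \<in> carrier X})"

definition ext_scalars ::
    "'t ring \<Rightarrow> ('r \<Rightarrow> 't) \<Rightarrow> 'r ring \<Rightarrow> ('r, 'x) module \<Rightarrow> ('t, ('t \<times> 'x \<Rightarrow> 't) set) module" where
  "ext_scalars T \<phi> R X =
     presented_module T (carrier T \<times> carrier X) (ext_scalars_rels T \<phi> R X)"

definition ext_scalars_tens ::
    "'t ring \<Rightarrow> ('r \<Rightarrow> 't) \<Rightarrow> 'r ring \<Rightarrow> ('r, 'x) module \<Rightarrow> 't \<Rightarrow> 'x \<Rightarrow> ('t \<times> 'x \<Rightarrow> 't) set" where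
  "ext_scalars_tens T \<phi> R X t x =
     presented_gen T (carrier T \<times> carrier X) (ext_scalars_rels T \<phi> R X) (t, x)"


section \<open>Monoid rings and tensor products of commutative rings\<close>

text \<open>\<open>\<int>[N]\<close>; its elements are the finitely supported functions \<open>N \<rightarrow> \<int>\<close>.\<close>

definition monoid_ring :: "('n, 'z) monoid_scheme \<Rightarrow> ('n \<Rightarrow>\<^sub>0 int) ring" where
  "monoid_ring N = \<lparr>
     carrier = {c. Poly_Mapping.keys c \<subseteq> carrier N},
     mult = (\<lambda>c d. frag_extend (\<lambda>a. frag_extend (\<lambda>b. frag_of (a \<otimes>\<^bsub>N\<^esub> b)) d) c),
     one = frag_of \<one>\<^bsub>N\<^esub>,
     zero = 0,
     add = (+)\<rparr>"

definition monoid_ring_lift :: "'d ring \<Rightarrow> ('n \<Rightarrow> 'd) \<Rightarrow> ('n \<Rightarrow>\<^sub>0 int) \<Rightarrow> 'd" where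
  "monoid_ring_lift D h c =
     (\<Oplus>\<^bsub>D\<^esub>n\<in>Poly_Mapping.keys c. [Poly_Mapping.lookup c n] \<cdot>\<^bsub>D\<^esub> h n)"

text \<open>\<open>B \<otimes>\<^sub>R C\<close> for ring maps \<open>\<phi> : R \<rightarrow> B\<close> and \<open>\<psi> : R \<rightarrow> C\<close>. The free abelian group on \<open>B \<times> C\<close>
  is the monoid ring of the multiplicative monoid \<open>B \<times> C\<close>, and the subgroup generated by the
  usual relations is stable under multiplication by pairs \<open>(b, c)\<close> and hence is already the
  ideal generated by them. The quotient is therefore the usual tensor product, with product
  \<open>(b \<otimes> c) (b' \<otimes> c') = b b' \<otimes> c c'\<close>.\<close>

definition tensor_rels ::
    "'r ring \<Rightarrow> 'b ring \<Rightarrow> ('r \<Rightarrow> 'b) \<Rightarrow> 'c ring \<Rightarrow> ('r \<Rightarrow> 'c) \<Rightarrow> ('b \<times> 'c \<Rightarrow>\<^sub>0 int) set" where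
  "tensor_rels R B \<phi> C \<psi> =
     {frag_of (b \<oplus>\<^bsub>B\<^esub> b', c) - (frag_of (b, c) + frag_of (b', c)) | b b' c.
        b \<in> carrier B \<and> b' \<in> carrier B \<and> c \<in> carrier C} \<union>
     {frag_of (b, c \<oplus>\<^bsub>C\<^esub> c') - (frag_of (b, c) + frag_of (b, c')) | b c c'.
        b \<in> carrier B \<and> c \<in> carrier C \<and> c' \<in> carrier C} \<union>
     {frag_of (\<phi> r \<otimes>\<^bsub>B\<^esub> b, c) - frag_of (b, \<psi> r \<otimes>\<^bsub>C\<^esub> c) | r b c.
        r \<in> carrier R \<and> b \<in> carrier B \<and> c \<in> carrier C}"

definition tensor_ideal ::
    "'r ring \<Rightarrow> 'b ring \<Rightarrow> ('r \<Rightarrow> 'b) \<Rightarrow> 'c ring \<Rightarrow> ('r \<Rightarrow> 'c) \<Rightarrow> ('b \<times> 'c \<Rightarrow>\<^sub>0 int) set" where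
  "tensor_ideal R B \<phi> C \<psi> = Idl\<^bsub>monoid_ring (B \<times>\<times> C)\<^esub> (tensor_rels R B \<phi> C \<psi>)"

definition tensor_ring ::
    "'r ring \<Rightarrow> 'b ring \<Rightarrow> ('r \<Rightarrow> 'b) \<Rightarrow> 'c ring \<Rightarrow> ('r \<Rightarrow> 'c) \<Rightarrow> ('b \<times> 'c \<Rightarrow>\<^sub>0 int) set ring" where
  "tensor_ring R B \<phi> C \<psi> = monoid_ring (B \<times>\<times> C) Quot tensor_ideal R B \<phi> C \<psi>"

definition tens ::
    "'r ring \<Rightarrow> 'b ring \<Rightarrow> ('r \<Rightarrow> 'b) \<Rightarrow> 'c ring \<Rightarrow> ('r \<Rightarrow> 'c) \<Rightarrow> 'b \<Rightarrow> 'c \<Rightarrow>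
     ('b \<times> 'c \<Rightarrow>\<^sub>0 int) set" where
  "tens R B \<phi> C \<psi> b c =
     tensor_ideal R B \<phi> C \<psi> +>\<^bsub>monoid_ring (B \<times>\<times> C)\<^esub> frag_of (b, c)"

text \<open>The ring map \<open>B \<otimes>\<^sub>R C \<rightarrow> D\<close>, \<open>b \<otimes> c \<mapsto> u b * v c\<close>.\<close>

definition tensor_lift ::
    "'d ring \<Rightarrow> ('b \<Rightarrow> 'd) \<Rightarrow> ('c \<Rightarrow> 'd) \<Rightarrow> ('b \<times> 'c \<Rightarrow>\<^sub>0 int) set \<Rightarrow> 'd" where
  "tensor_lift D u v U = the_elem (monoid_ring_lift D (\<lambda>(b, c). u b \<otimes>\<^bsub>D\<^esub> v c) ` U)"

definition int_to :: "'b ring \<Rightarrow> int \<Rightarrow> 'b" where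
  "int_to B k = [k] \<cdot>\<^bsub>B\<^esub> \<one>\<^bsub>B\<^esub>"

definition CRing_cat :: "('a ring, 'a \<Rightarrow> 'a) cat" where
  "CRing_cat = \<lparr>
     Obj = {R. cring R},
     Hom = (\<lambda>R S. ring_hom R S \<inter> extensional (carrier R)),
     Ident = (\<lambda>R. \<lambda>x\<in>carrier R. x),
     Comp = (\<lambda>R S T g f. compose (carrier R) g f)\<rparr>"


section \<open>Group completion, exactness, repletion\<close>

text \<open>The library's \<open>hom\<close> does not require preservation of the unit.\<close>

definition mon_hom :: "('m, 'y) monoid_scheme \<Rightarrow> ('n, 'z) monoid_scheme \<Rightarrow> ('m \<Rightarrow> 'n) set" where
  "mon_hom M N = {h \<in> hom M N. h \<one>\<^bsub>M\<^esub> = \<one>\<^bsub>N\<^esub>}"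

text \<open>\<open>(a, b)\<close> represents the formal quotient \<open>a / b\<close>.\<close>

definition gp_rel :: "'m monoid \<Rightarrow> (('m \<times> 'm) \<times> ('m \<times> 'm)) set" where
  "gp_rel M = {((a, b), (c, d)). a \<in> carrier M \<and> b \<in> carrier M \<and> c \<in> carrier M \<and> d \<in> carrier M \<and>
     (\<exists>k\<in>carrier M. a \<otimes>\<^bsub>M\<^esub> d \<otimes>\<^bsub>M\<^esub> k = c \<otimes>\<^bsub>M\<^esub> b \<otimes>\<^bsub>M\<^esub> k)}"

definition gp :: "'m monoid \<Rightarrow> ('m \<times> 'm) set monoid" where
  "gp M = \<lparr>
     carrier = (carrier M \<times> carrier M) // gp_rel M,
     mult = (\<lambda>U V. \<Union>(a, b)\<in>U. \<Union>(c, d)\<in>V. gp_rel M `` {(a \<otimes>\<^bsub>M\<^esub> c, b \<otimes>\<^bsub>M\<^esub> d)}),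
     one = gp_rel M `` {(\<one>\<^bsub>M\<^esub>, \<one>\<^bsub>M\<^esub>)}\<rparr>"

definition to_gp :: "'m monoid \<Rightarrow> 'm \<Rightarrow> ('m \<times> 'm) set" where
  "to_gp M m = gp_rel M `` {(m, \<one>\<^bsub>M\<^esub>)}"

definition gp_map :: "'m monoid \<Rightarrow> ('n \<Rightarrow> 'm) \<Rightarrow> ('n \<times> 'n) set \<Rightarrow> ('m \<times> 'm) set" where
  "gp_map M f U = (\<Union>(a, b)\<in>U. gp_rel M `` {(f a, f b)})"

text \<open>For \<open>f : N \<rightarrow> M\<close>, the monoid \<open>N\<^sup>r\<^sup>e\<^sup>p\<close>, i.e. the fibre product of \<open>M\<close> and the group completion
  of \<open>N\<close> over the group completion of \<open>M\<close>.\<close>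

definition rep_monoid ::
    "'n monoid \<Rightarrow> 'm monoid \<Rightarrow> ('n \<Rightarrow> 'm) \<Rightarrow> ('m \<times> ('n \<times> 'n) set) monoid" where
  "rep_monoid N M f = (M \<times>\<times> gp N)\<lparr>carrier :=
     {(m, x). m \<in> carrier M \<and> x \<in> carrier (gp N) \<and> to_gp M m = gp_map M f x}\<rparr>"

definition to_rep :: "'n monoid \<Rightarrow> ('n \<Rightarrow> 'm) \<Rightarrow> 'n \<Rightarrow> 'm \<times> ('n \<times> 'n) set" where
  "to_rep N f n = (f n, to_gp N n)"

definition exact :: "'n monoid \<Rightarrow> 'm monoid \<Rightarrow> ('n \<Rightarrow> 'm) \<Rightarrow> bool" where
  "exact N M f \<longleftrightarrow> to_rep N f \<in> iso N (rep_monoid N M f)"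

definition replete :: "'n monoid \<Rightarrow> 'm monoid \<Rightarrow> ('n \<Rightarrow> 'm) \<Rightarrow> bool" where
  "replete N M f \<longleftrightarrow> exact N M f \<and> gp_map M f ` carrier (gp N) = carrier (gp M)"


section \<open>Pre-log rings and log rings\<close>

record ('a, 'm) prelog =
  PRing :: "'a ring"
  PMon :: "'m monoid"
  pstr :: "'m \<Rightarrow> 'a"

definition prelog_ring :: "('a, 'm) prelog \<Rightarrow> bool" where
  "prelog_ring P \<longleftrightarrow> cring (PRing P) \<and> comm_monoid (PMon P) \<and> pstr P \<in> mon_hom (PMon P) (PRing P)"

definition log_ring :: "('a, 'm) prelog \<Rightarrow> bool" where
  "log_ring P \<longleftrightarrow> prelog_ring P \<and>
     pstr P \<in> iso ((PMon P)\<lparr>carrier := {m \<in> carrier (PMon P). pstr P m \<in> Units (PRing P)}\<rparr>)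
                   (units_of (PRing P))"

definition prelog_hom ::
    "('a, 'm) prelog \<Rightarrow> ('b, 'n) prelog \<Rightarrow> (('a \<Rightarrow> 'b) \<times> ('m \<Rightarrow> 'n)) set" where
  "prelog_hom P Q = {(f, g). f \<in> ring_hom (PRing P) (PRing Q) \<and> g \<in> mon_hom (PMon P) (PMon Q) \<and>
     (\<forall>m\<in>carrier (PMon P). pstr Q (g m) = f (pstr P m))}"

definition PreLog_cat :: "(('a, 'm) prelog, ('a \<Rightarrow> 'a) \<times> ('m \<Rightarrow> 'm)) cat" where
  "PreLog_cat = \<lparr>
     Obj = {P. prelog_ring P},
     Hom = (\<lambda>P Q. prelog_hom P Q \<inter>
              extensional (carrier (PRing P)) \<times> extensional (carrier (PMon P))),
     Ident = (\<lambda>P. (\<lambda>x\<in>carrier (PRing P). x, \<lambda>x\<in>carrier (PMon P). x)),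
     Comp = (\<lambda>P Q R (g, g') (f, f').
              (compose (carrier (PRing P)) g f, compose (carrier (PMon P)) g' f'))\<rparr>"

definition Log_cat :: "(('a, 'm) prelog, ('a \<Rightarrow> 'a) \<times> ('m \<Rightarrow> 'm)) cat" where
  "Log_cat = full_subcat PreLog_cat log_ring"

type_synonym ('a, 'm) prelog_mor = "('a \<Rightarrow> 'a) \<times> ('m \<Rightarrow> 'm)"
type_synonym ('a, 'm) aug_prelog =
  "('a, 'm) prelog \<times> ('a, 'm) prelog_mor \<times> ('a, 'm) prelog_mor"

definition LogRep_cat ::
    "('a, 'm) prelog \<Rightarrow> (('a, 'm) aug_prelog, ('a, 'm) prelog_mor) cat" where
  "LogRep_cat P = full_subcat (under_over_cat Log_cat P)
     (\<lambda>(Q, s, p). replete (PMon Q) (PMon P) (snd p))"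

definition forget_log ::
    "(('a, 'm) aug_prelog, ('a, 'm) prelog_mor,
      'a ring \<times> ('a \<Rightarrow> 'a) \<times> ('a \<Rightarrow> 'a), 'a \<Rightarrow> 'a) fctr" where
  "forget_log = \<lparr>fobj = (\<lambda>(Q, s, p). (PRing Q, fst s, fst p)), fmor = (\<lambda>X Y f. fst f)\<rparr>"


section \<open>Split square-zero extensions\<close>

definition sqz_ring :: "'a ring \<Rightarrow> ('a, 'j) module \<Rightarrow> ('a \<times> 'j) ring" where
  "sqz_ring A J = \<lparr>
     carrier = carrier A \<times> carrier J,
     mult = (\<lambda>(a, j) (b, k). (a \<otimes>\<^bsub>A\<^esub> b, (a \<odot>\<^bsub>J\<^esub> k) \<oplus>\<^bsub>J\<^esub> (b \<odot>\<^bsub>J\<^esub> j))),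
     one = (\<one>\<^bsub>A\<^esub>, \<zero>\<^bsub>J\<^esub>),
     zero = (\<zero>\<^bsub>A\<^esub>, \<zero>\<^bsub>J\<^esub>),
     add = (\<lambda>(a, j) (b, k). (a \<oplus>\<^bsub>A\<^esub> b, j \<oplus>\<^bsub>J\<^esub> k))\<rparr>"

definition sqz_monoid :: "'m monoid \<Rightarrow> ('a, 'j) module \<Rightarrow> ('m \<times> 'j) monoid" where
  "sqz_monoid M J = M \<times>\<times> add_monoid J"

text \<open>All objects of a category have their carriers in one type \<open>'u\<close>, so the carriers
  \<open>A \<times> J\<close> and \<open>M \<times> J\<close> are moved from \<open>'u \<times> 'u\<close> to \<open>'u\<close> along an injection \<open>pr\<close>, which exists as soon as
  \<open>'u\<close> is infinite and only says that this universe is closed under pairs. Up to this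
  renaming of elements the following are \<open>(A \<oplus> J, M \<oplus> J)\<close>, its maps \<open>a \<mapsto> (a, 0)\<close>, \<open>m \<mapsto> (m, 0)\<close>
  from \<open>(A, M)\<close>, and its projections to \<open>(A, M)\<close>.\<close>

definition sqz_prelog ::
    "('u \<times> 'u \<Rightarrow> 'u) \<Rightarrow> ('u, 'u) prelog \<Rightarrow> ('u, 'u) module \<Rightarrow> ('u, 'u) prelog" where
  "sqz_prelog pr P J = \<lparr>
     PRing = image_ring pr (sqz_ring (PRing P) J),
     PMon = image_group pr (sqz_monoid (PMon P) J),
     pstr = (\<lambda>z. case inv_into UNIV pr z of (m, j) \<Rightarrow> pr (pstr P m, pstr P m \<odot>\<^bsub>J\<^esub> j))\<rparr>"

definition sqz_sec ::
    "('u \<times> 'u \<Rightarrow> 'u) \<Rightarrow> ('u, 'u) prelog \<Rightarrow> ('u, 'u) module \<Rightarrow> ('u, 'u) prelog_mor" where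
  "sqz_sec pr P J = (\<lambda>a\<in>carrier (PRing P). pr (a, \<zero>\<^bsub>J\<^esub>), \<lambda>m\<in>carrier (PMon P). pr (m, \<zero>\<^bsub>J\<^esub>))"

definition sqz_proj ::
    "('u \<times> 'u \<Rightarrow> 'u) \<Rightarrow> ('u, 'u) prelog \<Rightarrow> ('u, 'u) module \<Rightarrow> ('u, 'u) prelog_mor" where
  "sqz_proj pr P J =
     (\<lambda>z\<in>carrier (PRing (sqz_prelog pr P J)). fst (inv_into UNIV pr z),
      \<lambda>z\<in>carrier (PMon (sqz_prelog pr P J)). fst (inv_into UNIV pr z))"

definition sqz_obj ::
    "('u \<times> 'u \<Rightarrow> 'u) \<Rightarrow> ('u, 'u) prelog \<Rightarrow> ('u, 'u) module \<Rightarrow> ('u, 'u) aug_prelog" where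
  "sqz_obj pr P J = (sqz_prelog pr P J, sqz_sec pr P J, sqz_proj pr P J)"

definition sqz_mor ::
    "('u \<times> 'u \<Rightarrow> 'u) \<Rightarrow> ('u, 'u) prelog \<Rightarrow> ('u, 'u) module \<Rightarrow> ('u \<Rightarrow> 'u) \<Rightarrow> ('u, 'u) prelog_mor" where
  "sqz_mor pr P J h =
     (\<lambda>z\<in>carrier (PRing (sqz_prelog pr P J)). case inv_into UNIV pr z of (a, j) \<Rightarrow> pr (a, h j),
      \<lambda>z\<in>carrier (PMon (sqz_prelog pr P J)). case inv_into UNIV pr z of (m, j) \<Rightarrow> pr (m, h j))"

text \<open>The abelian group structure of \<open>(A \<oplus> J, M \<oplus> J)\<close> is the one induced by the addition
  \<open>J \<oplus> J \<rightarrow> J\<close>: its product with itself over \<open>(A, M)\<close> is \<open>(A \<oplus> J \<oplus> J, M \<oplus> J \<oplus> J)\<close>, the terminal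
  object is \<open>(A, M)\<close>, and the zero is the map from \<open>(A, M)\<close>.\<close>

definition sqz_ab ::
    "('u \<times> 'u \<Rightarrow> 'u) \<Rightarrow> ('u, 'u) prelog \<Rightarrow> ('u, 'u) module \<Rightarrow>
     (('u, 'u) aug_prelog, ('u, 'u) prelog_mor) abobj" where
  "sqz_ab pr P J =
     (let JJ = image_module pr (dsum_module J J) in \<lparr>
       ab_obj = sqz_obj pr P J,
       ab_prod = sqz_obj pr P JJ,
       ab_p1 = sqz_mor pr P JJ (\<lambda>z. fst (inv_into UNIV pr z)),
       ab_p2 = sqz_mor pr P JJ (\<lambda>z. snd (inv_into UNIV pr z)),
       ab_term = (P, Ident Log_cat P, Ident Log_cat P),
       ab_add = sqz_mor pr P JJ (\<lambda>z. case inv_into UNIV pr z of (j, k) \<Rightarrow> j \<oplus>\<^bsub>J\<^esub> k),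
       ab_zero = sqz_sec pr P J,
       ab_neg = sqz_mor pr P J (\<lambda>j. \<ominus>\<^bsub>J\<^esub> j)\<rparr>)"

definition sqz_functor ::
    "('u \<times> 'u \<Rightarrow> 'u) \<Rightarrow> ('u, 'u) prelog \<Rightarrow>
     (('u, 'u) module, 'u \<Rightarrow> 'u,
      (('u, 'u) aug_prelog, ('u, 'u) prelog_mor) abobj, ('u, 'u) prelog_mor) fctr" where
  "sqz_functor pr P = \<lparr>fobj = sqz_ab pr P, fmor = (\<lambda>J J' h. sqz_mor pr P J h)\<rparr>"


section \<open>Replete abelianization\<close>

subsection \<open>Repletion of a map of pre-log rings\<close>

text \<open>For \<open>(f, g) : (B, N) \<rightarrow> (A, M)\<close>; here \<open>P = (B, N)\<close> and \<open>Q = (A, M)\<close>. The ring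
  \<open>\<int>[N\<^sup>r\<^sup>e\<^sup>p]\<close> is a \<open>\<int>[N]\<close>-algebra through \<open>N \<rightarrow> N\<^sup>r\<^sup>e\<^sup>p\<close>, and \<open>B\<close> through its structure map.\<close>

definition prelog_rep_tens ::
    "('b, 'n) prelog \<Rightarrow> ('a, 'm) prelog \<Rightarrow> ('n \<Rightarrow> 'm) \<Rightarrow>
     'b \<Rightarrow> ('m \<times> ('n \<times> 'n) set \<Rightarrow>\<^sub>0 int) \<Rightarrow> ('b \<times> ('m \<times> ('n \<times> 'n) set \<Rightarrow>\<^sub>0 int) \<Rightarrow>\<^sub>0 int) set" where
  "prelog_rep_tens P Q g =
     (let ZN = monoid_ring (PMon P); ZR = monoid_ring (rep_monoid (PMon P) (PMon Q) g) in
       tens ZN (PRing P) (monoid_ring_lift (PRing P) (pstr P))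
         ZR (monoid_ring_lift ZR (\<lambda>n. frag_of (to_rep (PMon P) g n))))"

definition prelog_rep ::
    "('b, 'n) prelog \<Rightarrow> ('a, 'm) prelog \<Rightarrow> ('n \<Rightarrow> 'm) \<Rightarrow>
     (('b \<times> ('m \<times> ('n \<times> 'n) set \<Rightarrow>\<^sub>0 int) \<Rightarrow>\<^sub>0 int) set, 'm \<times> ('n \<times> 'n) set) prelog" where
  "prelog_rep P Q g =
     (let ZN = monoid_ring (PMon P); ZR = monoid_ring (rep_monoid (PMon P) (PMon Q) g) in \<lparr>
       PRing = tensor_ring ZN (PRing P) (monoid_ring_lift (PRing P) (pstr P))
         ZR (monoid_ring_lift ZR (\<lambda>n. frag_of (to_rep (PMon P) g n))),
       PMon = rep_monoid (PMon P) (PMon Q) g,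
       pstr = (\<lambda>x. prelog_rep_tens P Q g \<one>\<^bsub>PRing P\<^esub> (frag_of x))\<rparr>)"

definition prelog_rep_aug ::
    "('a, 'm) prelog \<Rightarrow> ('b \<Rightarrow> 'a) \<Rightarrow>
     (('b \<times> ('m \<times> ('n \<times> 'n) set \<Rightarrow>\<^sub>0 int) \<Rightarrow>\<^sub>0 int) set \<Rightarrow> 'a) \<times> ('m \<times> ('n \<times> 'n) set \<Rightarrow> 'm)" where
  "prelog_rep_aug Q f =
     (tensor_lift (PRing Q) f (monoid_ring_lift (PRing Q) (\<lambda>(m, x). pstr Q m)), fst)"

text \<open>The map of repletions over \<open>Q\<close> induced by a map \<open>(u, v) : P \<rightarrow> P'\<close> over \<open>Q\<close>, on rings.\<close>

definition prelog_rep_map ::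
    "('b, 'n) prelog \<Rightarrow> ('b', 'n') prelog \<Rightarrow> ('a, 'm) prelog \<Rightarrow> ('n' \<Rightarrow> 'm) \<Rightarrow>
     ('b \<Rightarrow> 'b') \<times> ('n \<Rightarrow> 'n') \<Rightarrow>
     ('b \<times> ('m \<times> ('n \<times> 'n) set \<Rightarrow>\<^sub>0 int) \<Rightarrow>\<^sub>0 int) set \<Rightarrow>
     ('b' \<times> ('m \<times> ('n' \<times> 'n') set \<Rightarrow>\<^sub>0 int) \<Rightarrow>\<^sub>0 int) set" where
  "prelog_rep_map P P' Q g' = (\<lambda>(u, v).
     let ZR' = monoid_ring (rep_monoid (PMon P') (PMon Q) g') in
     tensor_lift (PRing (prelog_rep P' Q g'))
       (\<lambda>b. prelog_rep_tens P' Q g' (u b) \<one>\<^bsub>ZR'\<^esub>)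
       (\<lambda>z. prelog_rep_tens P' Q g' \<one>\<^bsub>PRing P'\<^esub>
              (monoid_ring_lift ZR' (\<lambda>(m, x). frag_of (m, gp_map (PMon P') v x)) z)))"


subsection \<open>The coproduct with (A, M)\<close>

definition coprod_tens ::
    "('a, 'm) prelog \<Rightarrow> ('b, 'n) prelog \<Rightarrow> 'a \<Rightarrow> 'b \<Rightarrow> ('a \<times> 'b \<Rightarrow>\<^sub>0 int) set" where
  "coprod_tens P Q = tens \<Z> (PRing P) (int_to (PRing P)) (PRing Q) (int_to (PRing Q))"

definition coprod_prelog ::
    "('a, 'm) prelog \<Rightarrow> ('b, 'n) prelog \<Rightarrow> (('a \<times> 'b \<Rightarrow>\<^sub>0 int) set, 'm \<times> 'n) prelog" where
  "coprod_prelog P Q = \<lparr>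
     PRing = tensor_ring \<Z> (PRing P) (int_to (PRing P)) (PRing Q) (int_to (PRing Q)),
     PMon = PMon P \<times>\<times> PMon Q,
     pstr = (\<lambda>(m, n). coprod_tens P Q (pstr P m) (pstr Q n))\<rparr>"

definition coprod_aug ::
    "('a, 'm) prelog \<Rightarrow> ('b \<Rightarrow> 'a) \<times> ('n \<Rightarrow> 'm) \<Rightarrow>
     (('a \<times> 'b \<Rightarrow>\<^sub>0 int) set \<Rightarrow> 'a) \<times> ('m \<times> 'n \<Rightarrow> 'm)" where
  "coprod_aug P = (\<lambda>(f, g).
     (tensor_lift (PRing P) (\<lambda>a. a) f, \<lambda>(m, n). m \<otimes>\<^bsub>PMon P\<^esub> g n))"

definition coprod_map ::
    "('a, 'm) prelog \<Rightarrow> ('b, 'n) prelog \<Rightarrow> ('c \<Rightarrow> 'b) \<times> ('k \<Rightarrow> 'n) \<Rightarrow>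
     (('a \<times> 'c \<Rightarrow>\<^sub>0 int) set \<Rightarrow> ('a \<times> 'b \<Rightarrow>\<^sub>0 int) set) \<times> ('m \<times> 'k \<Rightarrow> 'm \<times> 'n)" where
  "coprod_map P Q = (\<lambda>(u, v).
     (tensor_lift (PRing (coprod_prelog P Q))
        (\<lambda>a. coprod_tens P Q a \<one>\<^bsub>PRing Q\<^esub>) (\<lambda>c. coprod_tens P Q \<one>\<^bsub>PRing P\<^esub> (u c)),
      \<lambda>(m, k). (m, v k)))"


subsection \<open>The functor \<open>Ab\<^sup>r\<^sup>e\<^sup>p\<^sub>+\<close>\<close>

text \<open>\<open>I / I\<^sup>2\<close> for an ideal \<open>I\<close> of \<open>C\<close>, as an \<open>A\<close>-module through a ring map \<open>s : A \<rightarrow> C\<close>; it is a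
  part of the ring \<open>C / I\<^sup>2\<close>.\<close>

definition conormal_module :: "'c ring \<Rightarrow> 'c set \<Rightarrow> ('a \<Rightarrow> 'c) \<Rightarrow> ('a, 'c set) module" where
  "conormal_module C I s =
     (let K = ideal_prod C I I in \<lparr>
       carrier = (\<lambda>x. K +>\<^bsub>C\<^esub> x) ` I,
       mult = undefined, one = undefined,
       zero = \<zero>\<^bsub>C Quot K\<^esub>,
       add = add (C Quot K),
       smult = (\<lambda>a U. (K +>\<^bsub>C\<^esub> s a) \<otimes>\<^bsub>C Quot K\<^esub> U)\<rparr>)"

type_synonym ('a, 'm, 'b, 'n) rep_elem =
  "(('a \<times> 'b \<Rightarrow>\<^sub>0 int) set \<times> ('m \<times> (('m \<times> 'n) \<times> ('m \<times> 'n)) set \<Rightarrow>\<^sub>0 int) \<Rightarrow>\<^sub>0 int) set"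

text \<open>For \<open>X = (A, M)\<close> and \<open>Y = ((B, N), (f, g))\<close> over \<open>X\<close>: the ring
  \<open>(A \<otimes>\<^sub>\<int> B) \<otimes> \<int>[(M \<oplus> N)\<^sup>r\<^sup>e\<^sup>p]\<close>, the structure map from \<open>A\<close>, and the kernel of the
  augmentation to \<open>A\<close>.\<close>

definition ab_rep_ring ::
    "('a, 'm) prelog \<Rightarrow> ('b, 'n) prelog \<times> ('b \<Rightarrow> 'a) \<times> ('n \<Rightarrow> 'm) \<Rightarrow>
     ('a, 'm, 'b, 'n) rep_elem ring" where
  "ab_rep_ring X = (\<lambda>(Y, p).
     PRing (prelog_rep (coprod_prelog X Y) X (snd (coprod_aug X p))))"

definition ab_rep_unit ::
    "('a, 'm) prelog \<Rightarrow> ('b, 'n) prelog \<times> ('b \<Rightarrow> 'a) \<times> ('n \<Rightarrow> 'm) \<Rightarrow>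
     'a \<Rightarrow> ('a, 'm, 'b, 'n) rep_elem" where
  "ab_rep_unit X = (\<lambda>(Y, p) a.
     prelog_rep_tens (coprod_prelog X Y) X (snd (coprod_aug X p))
       (coprod_tens X Y a \<one>\<^bsub>PRing Y\<^esub>)
       \<one>\<^bsub>monoid_ring (rep_monoid (PMon (coprod_prelog X Y)) (PMon X) (snd (coprod_aug X p)))\<^esub>)"

definition ab_rep_ideal ::
    "('a, 'm) prelog \<Rightarrow> ('b, 'n) prelog \<times> ('b \<Rightarrow> 'a) \<times> ('n \<Rightarrow> 'm) \<Rightarrow>
     ('a, 'm, 'b, 'n) rep_elem set" where
  "ab_rep_ideal X = (\<lambda>(Y, p).
     a_kernel (ab_rep_ring X (Y, p)) (PRing X) (fst (prelog_rep_aug X (fst (coprod_aug X p)))))"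

definition Ab_rep_obj ::
    "('a, 'm) prelog \<Rightarrow> ('b, 'n) prelog \<times> ('b \<Rightarrow> 'a) \<times> ('n \<Rightarrow> 'm) \<Rightarrow>
     ('a, ('a, 'm, 'b, 'n) rep_elem set) module" where
  "Ab_rep_obj X Z = conormal_module (ab_rep_ring X Z) (ab_rep_ideal X Z) (ab_rep_unit X Z)"

definition ab_rep_ring_map ::
    "('a, 'm) prelog \<Rightarrow> ('b, 'n) prelog \<times> ('b \<Rightarrow> 'a) \<times> ('n \<Rightarrow> 'm) \<Rightarrow>
     ('c, 'k) prelog \<times> ('c \<Rightarrow> 'a) \<times> ('k \<Rightarrow> 'm) \<Rightarrow> ('b \<Rightarrow> 'c) \<times> ('n \<Rightarrow> 'k) \<Rightarrow>
     ('a, 'm, 'b, 'n) rep_elem \<Rightarrow> ('a, 'm, 'c, 'k) rep_elem" where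
  "ab_rep_ring_map X = (\<lambda>(Y, p) (Y', p') h.
     prelog_rep_map (coprod_prelog X Y) (coprod_prelog X Y') X (snd (coprod_aug X p'))
       (coprod_map X Y' h))"

definition Ab_rep_mor ::
    "('a, 'm) prelog \<Rightarrow> ('b, 'n) prelog \<times> ('b \<Rightarrow> 'a) \<times> ('n \<Rightarrow> 'm) \<Rightarrow>
     ('c, 'k) prelog \<times> ('c \<Rightarrow> 'a) \<times> ('k \<Rightarrow> 'm) \<Rightarrow> ('b \<Rightarrow> 'c) \<times> ('n \<Rightarrow> 'k) \<Rightarrow>
     ('a, 'm, 'b, 'n) rep_elem set \<Rightarrow> ('a, 'm, 'c, 'k) rep_elem set" where
  "Ab_rep_mor X Z Z' h = (\<lambda>U\<in>carrier (Ab_rep_obj X Z).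
     the_elem ((\<lambda>x. ideal_prod (ab_rep_ring X Z') (ab_rep_ideal X Z') (ab_rep_ideal X Z')
                      +>\<^bsub>ab_rep_ring X Z'\<^esub> ab_rep_ring_map X Z Z' h x) ` U))"

definition Ab_rep_functor ::
    "('a, 'm) prelog \<Rightarrow>
     (('b, 'n) prelog \<times> ('b \<Rightarrow> 'a) \<times> ('n \<Rightarrow> 'm), ('b \<Rightarrow> 'b) \<times> ('n \<Rightarrow> 'n),
      ('a, ('a, 'm, 'b, 'n) rep_elem set) module,
      ('a, 'm, 'b, 'n) rep_elem set \<Rightarrow> ('a, 'm, 'b, 'n) rep_elem set) fctr" where
  "Ab_rep_functor X = \<lparr>fobj = Ab_rep_obj X, fmor = Ab_rep_mor X\<rparr>"


section \<open>Log differentials\<close>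

text \<open>\<open>\<Omega>\<^sup>1\<^sub>B\<close>, generated by the symbols \<open>d b\<close> for \<open>b \<in> B\<close>; \<open>\<int>\<close>-linearity of \<open>d\<close> follows from
  additivity and the Leibniz rule.\<close>

definition kaehler_rels :: "'b ring \<Rightarrow> ('b \<Rightarrow> 'b) set" where
  "kaehler_rels B =
     (let F = free_module B (carrier B); d = basis_vec B in
       {d (b \<oplus>\<^bsub>B\<^esub> c) \<ominus>\<^bsub>F\<^esub> (d b \<oplus>\<^bsub>F\<^esub> d c) | b c. b \<in> carrier B \<and> c \<in> carrier B} \<union>
       {d (b \<otimes>\<^bsub>B\<^esub> c) \<ominus>\<^bsub>F\<^esub> (b \<odot>\<^bsub>F\<^esub> d c \<oplus>\<^bsub>F\<^esub> c \<odot>\<^bsub>F\<^esub> d b) | b c. b \<in> carrier B \<and> c \<in> carrier B})"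

definition kaehler :: "'b ring \<Rightarrow> ('b, ('b \<Rightarrow> 'b) set) module" where
  "kaehler B = presented_module B (carrier B) (kaehler_rels B)"

definition kaehler_d :: "'b ring \<Rightarrow> 'b \<Rightarrow> ('b \<Rightarrow> 'b) set" where
  "kaehler_d B b = presented_gen B (carrier B) (kaehler_rels B) b"

definition kaehler_map :: "'b ring \<Rightarrow> 'c ring \<Rightarrow> ('b \<Rightarrow> 'c) \<Rightarrow> ('b \<Rightarrow> 'b) set \<Rightarrow> ('c \<Rightarrow> 'c) set" where
  "kaehler_map B C u =
     presented_lift B (restrict_scalars u (kaehler C)) (\<lambda>b. kaehler_d C (u b))"

text \<open>\<open>N\<^sup>g\<^sup>p\<close> as an additively written \<open>\<int>\<close>-module.\<close>

definition gp_module :: "'n monoid \<Rightarrow> (int, ('n \<times> 'n) set) module" where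
  "gp_module N = \<lparr>carrier = carrier (gp N),
     mult = undefined, one = undefined,
     zero = \<one>\<^bsub>gp N\<^esub>, add = monoid.mult (gp N),
     smult = (\<lambda>k x. x [^]\<^bsub>gp N\<^esub> k)\<rparr>"

type_synonym ('b, 'n) dlog_elem = "('b \<times> ('n \<times> 'n) set \<Rightarrow> 'b) set"

definition dlog_module :: "('b, 'n) prelog \<Rightarrow> ('b, ('b, 'n) dlog_elem) module" where
  "dlog_module P = ext_scalars (PRing P) (int_to (PRing P)) \<Z> (gp_module (PMon P))"

definition dlog_tens ::
    "('b, 'n) prelog \<Rightarrow> 'b \<Rightarrow> ('n \<times> 'n) set \<Rightarrow> ('b, 'n) dlog_elem" where
  "dlog_tens P = ext_scalars_tens (PRing P) (int_to (PRing P)) \<Z> (gp_module (PMon P))"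

definition dlog_map ::
    "('b, 'n) prelog \<Rightarrow> ('c, 'k) prelog \<Rightarrow> ('b \<Rightarrow> 'c) \<times> ('n \<Rightarrow> 'k) \<Rightarrow>
     ('b, 'n) dlog_elem \<Rightarrow> ('c, 'k) dlog_elem" where
  "dlog_map P Q = (\<lambda>(u, v).
     presented_lift (PRing P) (restrict_scalars u (dlog_module Q))
       (\<lambda>(b, x). dlog_tens Q (u b) (gp_map (PMon Q) v x)))"

type_synonym ('b, 'n) log_form = "(('b \<Rightarrow> 'b) set \<times> ('b, 'n) dlog_elem) set"

definition log_omega_sum ::
    "('b, 'n) prelog \<Rightarrow> ('b, ('b \<Rightarrow> 'b) set \<times> ('b, 'n) dlog_elem) module" where
  "log_omega_sum P = dsum_module (kaehler (PRing P)) (dlog_module P)"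

definition log_omega_ker :: "('b, 'n) prelog \<Rightarrow> ('b, 'n) log_form" where
  "log_omega_ker P = gen_submodule (PRing P) (log_omega_sum P)
     {(kaehler_d (PRing P) (pstr P n), \<zero>\<^bsub>dlog_module P\<^esub>)
        \<ominus>\<^bsub>log_omega_sum P\<^esub> (\<zero>\<^bsub>kaehler (PRing P)\<^esub>, dlog_tens P (pstr P n) (to_gp (PMon P) n))
      | n. n \<in> carrier (PMon P)}"

definition log_omega :: "('b, 'n) prelog \<Rightarrow> ('b, ('b, 'n) log_form) module" where
  "log_omega P = quot_module (log_omega_sum P) (log_omega_ker P)"

definition log_omega_map ::
    "('b, 'n) prelog \<Rightarrow> ('c, 'k) prelog \<Rightarrow> ('b \<Rightarrow> 'c) \<times> ('n \<Rightarrow> 'k) \<Rightarrow>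
     ('b, 'n) log_form \<Rightarrow> ('c, 'k) log_form" where
  "log_omega_map P Q h U =
     the_elem ((\<lambda>(w, t). log_omega_ker Q +>\<^bsub>log_omega_sum Q\<^esub>
                  (kaehler_map (PRing P) (PRing Q) (fst h) w, dlog_map P Q h t)) ` U)"

text \<open>The functor \<open>(B, N) \<mapsto> A \<otimes>\<^sub>B \<Omega>\<^sup>1\<close> (log differentials of \<open>(B, N)\<close>) on pre-log rings over
  \<open>X = (A, M)\<close>.\<close>

definition LogDiff_obj ::
    "('a, 'm) prelog \<Rightarrow> ('b, 'n) prelog \<times> ('b \<Rightarrow> 'a) \<times> ('n \<Rightarrow> 'm) \<Rightarrow>
     ('a, ('a \<times> ('b, 'n) log_form \<Rightarrow> 'a) set) module" where
  "LogDiff_obj X = (\<lambda>(Y, f, g). ext_scalars (PRing X) f (PRing Y) (log_omega Y))"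

definition LogDiff_mor ::
    "('a, 'm) prelog \<Rightarrow> ('b, 'n) prelog \<times> ('b \<Rightarrow> 'a) \<times> ('n \<Rightarrow> 'm) \<Rightarrow>
     ('c, 'k) prelog \<times> ('c \<Rightarrow> 'a) \<times> ('k \<Rightarrow> 'm) \<Rightarrow> ('b \<Rightarrow> 'c) \<times> ('n \<Rightarrow> 'k) \<Rightarrow>
     ('a \<times> ('b, 'n) log_form \<Rightarrow> 'a) set \<Rightarrow> ('a \<times> ('c, 'k) log_form \<Rightarrow> 'a) set" where
  "LogDiff_mor X = (\<lambda>(Y, f, g) (Y', f', g') h.
     \<lambda>U\<in>carrier (LogDiff_obj X (Y, f, g)).
       presented_lift (PRing X) (LogDiff_obj X (Y', f', g'))
         (\<lambda>(a, w). ext_scalars_tens (PRing X) f' (PRing Y') (log_omega Y') a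
                     (log_omega_map Y Y' h w)) U)"

definition LogDiff_functor ::
    "('a, 'm) prelog \<Rightarrow>
     (('b, 'n) prelog \<times> ('b \<Rightarrow> 'a) \<times> ('n \<Rightarrow> 'm), ('b \<Rightarrow> 'b) \<times> ('n \<Rightarrow> 'n),
      ('a, ('a \<times> ('b, 'n) log_form \<Rightarrow> 'a) set) module,
      ('a \<times> ('b, 'n) log_form \<Rightarrow> 'a) set \<Rightarrow> ('a \<times> ('b, 'n) log_form \<Rightarrow> 'a) set) fctr" where
  "LogDiff_functor X = \<lparr>fobj = LogDiff_obj X, fmor = LogDiff_mor X\<rparr>"

end

theory Submission
  imports Defs
begin

text \<open>
  The proof rests on one observation: a replete extension of a log ring \<open>(A, M)\<close> that has a section
  carries the same information as its underlying augmented ring.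

  Part 1. Let \<open>p : N \<rightarrow> M\<close> be a map of monoids with a section \<open>s\<close>. It is replete exactly when its
  kernel is a group and \<open>N\<close> is the direct product of \<open>s(M)\<close> and this kernel (locale \<open>split_mon\<close>).
  If \<open>N\<close> belongs to a log ring \<open>B\<close>, the elements of the kernel are invertible and lie over \<open>1\<close>, so the
  structure map identifies the kernel with the group \<open>U\<close> of the units of \<open>B\<close> over \<open>1 \<in> A\<close>. Hence
  \<open>N \<cong> M \<times> U\<close> with structure map \<open>(m, u) \<mapsto> s(\<alpha> m) u\<close>, and everything is determined by the ring:
  a map of augmented rings extends uniquely to the monoids (locale \<open>split_log_pair\<close>), and \<open>M \<times> U\<close> is
  a replete log structure on any augmented ring (\<open>split_log_image_group\<close>). So the forgetful functor is
  full, faithful and surjective on objects.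

  Part 2. By the first part this is a statement on augmented rings \<open>B \<rightarrow> A\<close>. An addition is a ring
  homomorphism \<open>B \<times>\<^sub>A B \<rightarrow> B\<close> that is the identity on both copies of \<open>B\<close>. Its additivity forces
  \<open>(b, c) \<mapsto> b + c - s(p b)\<close>, and its multiplicativity forces the augmentation ideal \<open>J\<close> to have
  square zero (\<open>ab_structure\<close>). Therefore every morphism between abelian group objects is additive
  (\<open>Ab_hom_iff\<close>), and \<open>B \<cong> A \<oplus> J\<close> (\<open>ab_ess_surj\<close>). Conversely, maps into \<open>A \<oplus> J\<close> are derivations
  into \<open>J\<close>, which can be added; this makes \<open>A \<oplus> J\<close> an abelian group object.

  Part 3. Both modules represent log derivations. On the side of the differentials this is
  immediate from the generators \<open>d b\<close>, \<open>dlog x\<close> and their relations (\<open>T_ext\<close>, \<open>T_universal\<close>). On the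
  other side, \<open>(M \<oplus> N)\<^sup>r\<^sup>e\<^sup>p \<cong> M \<times> N\<^sup>g\<^sup>p\<close> (\<open>rep_decomp\<close>), so that the ring \<open>C\<close> of the repletion is the
  \<open>A\<close>-algebra generated by copies of the ring \<open>B\<close> and of the group \<open>N\<^sup>g\<^sup>p\<close> subject to the relations
  \<open>\<beta>(n) = f(\<beta>(n)) [n]\<close> (\<open>C_ext\<close>, \<open>C_lift\<close>). Maps \<open>C \<rightarrow> A \<oplus> J\<close> of augmented \<open>A\<close>-algebras are
  therefore log derivations of \<open>(B, N)\<close> in \<open>J\<close>; on the other hand they are linear maps \<open>I / I\<^sup>2 \<rightarrow> J\<close>.
  Comparing the universal elements gives mutually inverse maps between \<open>I / I\<^sup>2\<close> and the base
  changed log differentials (\<open>ab_rep_log_forms\<close>). As both modules are generated by the \<open>d b\<close> and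
  \<open>dlog x\<close>, functoriality and naturality only have to be checked on these.
\<close>

section \<open>Equivalences of categories and abelian group objects\<close>

lemma categoryD:
  assumes "category C"
  shows "X \<in> Obj C \<Longrightarrow> Ident C X \<in> Hom C X X"
    and "X \<in> Obj C \<Longrightarrow> Y \<in> Obj C \<Longrightarrow> Z \<in> Obj C \<Longrightarrow> f \<in> Hom C X Y \<Longrightarrow> g \<in> Hom C Y Z \<Longrightarrow>
      Comp C X Y Z g f \<in> Hom C X Z"
    and "X \<in> Obj C \<Longrightarrow> Y \<in> Obj C \<Longrightarrow> f \<in> Hom C X Y \<Longrightarrow> Comp C X X Y f (Ident C X) = f"
    and "X \<in> Obj C \<Longrightarrow> Y \<in> Obj C \<Longrightarrow> f \<in> Hom C X Y \<Longrightarrow> Comp C X Y Y (Ident C Y) f = f"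
    and "W \<in> Obj C \<Longrightarrow> X \<in> Obj C \<Longrightarrow> Y \<in> Obj C \<Longrightarrow> Z \<in> Obj C \<Longrightarrow>
      f \<in> Hom C W X \<Longrightarrow> g \<in> Hom C X Y \<Longrightarrow> h \<in> Hom C Y Z \<Longrightarrow>
      Comp C W X Z (Comp C X Y Z h g) f = Comp C W Y Z h (Comp C W X Y g f)"
  using assms unfolding category_def by simp_all

lemma categoryI:
  assumes "\<And>X. X \<in> Obj C \<Longrightarrow> Ident C X \<in> Hom C X X"
    and "\<And>X Y Z f g. X \<in> Obj C \<Longrightarrow> Y \<in> Obj C \<Longrightarrow> Z \<in> Obj C \<Longrightarrow> f \<in> Hom C X Y \<Longrightarrow> g \<in> Hom C Y Z \<Longrightarrow>
      Comp C X Y Z g f \<in> Hom C X Z"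
    and "\<And>X Y f. X \<in> Obj C \<Longrightarrow> Y \<in> Obj C \<Longrightarrow> f \<in> Hom C X Y \<Longrightarrow> Comp C X X Y f (Ident C X) = f"
    and "\<And>X Y f. X \<in> Obj C \<Longrightarrow> Y \<in> Obj C \<Longrightarrow> f \<in> Hom C X Y \<Longrightarrow> Comp C X Y Y (Ident C Y) f = f"
    and "\<And>W X Y Z f g h. W \<in> Obj C \<Longrightarrow> X \<in> Obj C \<Longrightarrow> Y \<in> Obj C \<Longrightarrow> Z \<in> Obj C \<Longrightarrow>
      f \<in> Hom C W X \<Longrightarrow> g \<in> Hom C X Y \<Longrightarrow> h \<in> Hom C Y Z \<Longrightarrow>
      Comp C W X Z (Comp C X Y Z h g) f = Comp C W Y Z h (Comp C W X Y g f)"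
  shows "category C"
  using assms unfolding category_def by simp

lemma functorD:
  assumes "is_functor C D F"
  shows "category C" "category D"
    and "X \<in> Obj C \<Longrightarrow> fobj F X \<in> Obj D"
    and "X \<in> Obj C \<Longrightarrow> Y \<in> Obj C \<Longrightarrow> f \<in> Hom C X Y \<Longrightarrow> fmor F X Y f \<in> Hom D (fobj F X) (fobj F Y)"
    and "X \<in> Obj C \<Longrightarrow> fmor F X X (Ident C X) = Ident D (fobj F X)"
    and "X \<in> Obj C \<Longrightarrow> Y \<in> Obj C \<Longrightarrow> Z \<in> Obj C \<Longrightarrow> f \<in> Hom C X Y \<Longrightarrow> g \<in> Hom C Y Z \<Longrightarrow>
      fmor F X Z (Comp C X Y Z g f) =
        Comp D (fobj F X) (fobj F Y) (fobj F Z) (fmor F Y Z g) (fmor F X Y f)"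
  using assms unfolding is_functor_def by simp_all

lemma full_subcat_simps [simp]:
  "Obj (full_subcat C P) = {X \<in> Obj C. P X}" "Hom (full_subcat C P) = Hom C"
  "Ident (full_subcat C P) = Ident C" "Comp (full_subcat C P) = Comp C"
  by (simp_all add: full_subcat_def)

lemma category_full_subcat: "category C \<Longrightarrow> category (full_subcat C P)"
  unfolding category_def by simp

lemma over_cat_simps:
  "(Y, p) \<in> Obj (over_cat C X) \<longleftrightarrow> Y \<in> Obj C \<and> p \<in> Hom C Y X"
  "f \<in> Hom (over_cat C X) (Y, p) (Y', p') \<longleftrightarrow> f \<in> Hom C Y Y' \<and> Comp C Y Y' X p' f = p"
  "Ident (over_cat C X) (Y, p) = Ident C Y"
  "Comp (over_cat C X) (Y, p) (Y', p') (Y'', p'') = Comp C Y Y' Y''"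
  by (simp_all add: over_cat_def)

lemma under_over_cat_simps:
  "(Y, s, p) \<in> Obj (under_over_cat C X) \<longleftrightarrow> Y \<in> Obj C \<and> s \<in> Hom C X Y \<and> p \<in> Hom C Y X \<and>
     Comp C X Y X p s = Ident C X"
  "f \<in> Hom (under_over_cat C X) (Y, s, p) (Y', s', p') \<longleftrightarrow>
     f \<in> Hom C Y Y' \<and> Comp C X Y Y' f s = s' \<and> Comp C Y Y' X p' f = p"
  "Ident (under_over_cat C X) (Y, s, p) = Ident C Y"
  "Comp (under_over_cat C X) (Y, s, p) (Y', s', p') (Y'', s'', p'') = Comp C Y Y' Y''"
  by (simp_all add: under_over_cat_def)

lemma category_over_cat:
  assumes C: "category C" and X: "X \<in> Obj C"
  shows "category (over_cat C X)"
proof (rule categoryI, goal_cases)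
  case (1 Y)
  then show ?case by (cases Y) (simp add: over_cat_simps categoryD(1,3)[OF C] X)
next
  case (2 Y Y' Y'' f g)
  obtain Y0 p where e0: "Y = (Y0, p)" by (cases Y)
  obtain Y1 p' where e1: "Y' = (Y1, p')" by (cases Y')
  obtain Y2 p'' where e2: "Y'' = (Y2, p'')" by (cases Y'')
  note e = e0 e1 e2
  from 2 have h: "Y0 \<in> Obj C" "Y1 \<in> Obj C" "Y2 \<in> Obj C" "f \<in> Hom C Y0 Y1" "g \<in> Hom C Y1 Y2"
    "p'' \<in> Hom C Y2 X" "Comp C Y0 Y1 X p' f = p" "Comp C Y1 Y2 X p'' g = p'"
    unfolding e over_cat_simps by blast+
  then have "Comp C Y0 Y2 X p'' (Comp C Y0 Y1 Y2 g f) = p"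
    using categoryD(5)[OF C h(1,2,3) X h(4,5,6)] by simp
  with h show ?case by (simp add: over_cat_simps e categoryD(2)[OF C h(1,2,3)])
next
  case (3 Y Y' f)
  obtain Y0 p where e0: "Y = (Y0, p)" by (cases Y)
  obtain Y1 p' where e1: "Y' = (Y1, p')" by (cases Y')
  from 3 have h: "Y0 \<in> Obj C" "Y1 \<in> Obj C" "f \<in> Hom C Y0 Y1"
    unfolding e0 e1 over_cat_simps by blast+
  show ?case unfolding e0 e1 over_cat_simps by (rule categoryD(3)[OF C h])
next
  case (4 Y Y' f)
  obtain Y0 p where e0: "Y = (Y0, p)" by (cases Y)
  obtain Y1 p' where e1: "Y' = (Y1, p')" by (cases Y')
  from 4 have h: "Y0 \<in> Obj C" "Y1 \<in> Obj C" "f \<in> Hom C Y0 Y1"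
    unfolding e0 e1 over_cat_simps by blast+
  show ?case unfolding e0 e1 over_cat_simps by (rule categoryD(4)[OF C h])
next
  case (5 W Y Y' Y'' f g h)
  obtain a0 ap where e0: "W = (a0, ap)" by (cases W)
  obtain b0 bp where e1: "Y = (b0, bp)" by (cases Y)
  obtain c0 cp where e2: "Y' = (c0, cp)" by (cases Y')
  obtain d0 dp where e3: "Y'' = (d0, dp)" by (cases Y'')
  note e = e0 e1 e2 e3
  from 5 have h: "a0 \<in> Obj C" "b0 \<in> Obj C" "c0 \<in> Obj C" "d0 \<in> Obj C"
    "f \<in> Hom C a0 b0" "g \<in> Hom C b0 c0" "h \<in> Hom C c0 d0"
    unfolding e over_cat_simps by blast+
  show ?case unfolding e over_cat_simps by (rule categoryD(5)[OF C h])
qed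

lemma category_under_over_cat:
  assumes C: "category C" and X: "X \<in> Obj C"
  shows "category (under_over_cat C X)"
proof (rule categoryI, goal_cases)
  case (1 Y)
  then show ?case by (cases Y) (use categoryD(1,3,4)[OF C] X in \<open>auto simp: under_over_cat_simps\<close>)
next
  case (2 Y Y' Y'' f g)
  obtain Y0 s p where e0: "Y = (Y0, s, p)" by (cases Y)
  obtain Y1 s' p' where e1: "Y' = (Y1, s', p')" by (cases Y')
  obtain Y2 s'' p'' where e2: "Y'' = (Y2, s'', p'')" by (cases Y'')
  note e = e0 e1 e2
  from 2 have h: "Y0 \<in> Obj C" "Y1 \<in> Obj C" "Y2 \<in> Obj C" "f \<in> Hom C Y0 Y1" "g \<in> Hom C Y1 Y2"
    "s \<in> Hom C X Y0" "p'' \<in> Hom C Y2 X"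
    "Comp C X Y0 Y1 f s = s'" "Comp C Y0 Y1 X p' f = p" "Comp C X Y1 Y2 g s' = s''" "Comp C Y1 Y2 X p'' g = p'"
    unfolding e under_over_cat_simps by blast+
  then have "Comp C X Y0 Y2 (Comp C Y0 Y1 Y2 g f) s = s''" "Comp C Y0 Y2 X p'' (Comp C Y0 Y1 Y2 g f) = p"
    using categoryD(5)[OF C X h(1,2,3) h(6,4,5)] categoryD(5)[OF C h(1,2,3) X h(4,5,7)] by auto
  with h show ?case by (auto simp: under_over_cat_simps e categoryD(2)[OF C])
next
  case (3 Y Y' f)
  obtain Y0 s p where e0: "Y = (Y0, s, p)" by (cases Y)
  obtain Y1 s' p' where e1: "Y' = (Y1, s', p')" by (cases Y')
  from 3 have h: "Y0 \<in> Obj C" "Y1 \<in> Obj C" "f \<in> Hom C Y0 Y1"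
    unfolding e0 e1 under_over_cat_simps by blast+
  show ?case unfolding e0 e1 under_over_cat_simps by (rule categoryD(3)[OF C h])
next
  case (4 Y Y' f)
  obtain Y0 s p where e0: "Y = (Y0, s, p)" by (cases Y)
  obtain Y1 s' p' where e1: "Y' = (Y1, s', p')" by (cases Y')
  from 4 have h: "Y0 \<in> Obj C" "Y1 \<in> Obj C" "f \<in> Hom C Y0 Y1"
    unfolding e0 e1 under_over_cat_simps by blast+
  show ?case unfolding e0 e1 under_over_cat_simps by (rule categoryD(4)[OF C h])
next
  case (5 W Y Y' Y'' f g h)
  obtain a0 as ap where e0: "W = (a0, as, ap)" by (cases W)
  obtain b0 bs bp where e1: "Y = (b0, bs, bp)" by (cases Y)
  obtain c0 cs cp where e2: "Y' = (c0, cs, cp)" by (cases Y')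
  obtain d0 ds dp where e3: "Y'' = (d0, ds, dp)" by (cases Y'')
  note e = e0 e1 e2 e3
  from 5 have h: "a0 \<in> Obj C" "b0 \<in> Obj C" "c0 \<in> Obj C" "d0 \<in> Obj C"
    "f \<in> Hom C a0 b0" "g \<in> Hom C b0 c0" "h \<in> Hom C c0 d0"
    unfolding e under_over_cat_simps by blast+
  show ?case unfolding e under_over_cat_simps by (rule categoryD(5)[OF C h])
qed

text \<open>The quasi-inverse picks a preimage of every object up to isomorphism, and transports
  morphisms by conjugating with the chosen isomorphisms and lifting along the fully faithful
  functor.\<close>

lemma equivalenceI:
  assumes F: "is_functor C D F"
    and full: "\<And>X Y g. X \<in> Obj C \<Longrightarrow> Y \<in> Obj C \<Longrightarrow> g \<in> Hom D (fobj F X) (fobj F Y) \<Longrightarrow>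
      \<exists>f\<in>Hom C X Y. fmor F X Y f = g"
    and faithful: "\<And>X Y f f'. X \<in> Obj C \<Longrightarrow> Y \<in> Obj C \<Longrightarrow> f \<in> Hom C X Y \<Longrightarrow> f' \<in> Hom C X Y \<Longrightarrow>
      fmor F X Y f = fmor F X Y f' \<Longrightarrow> f = f'"
    and ess: "\<And>Y. Y \<in> Obj D \<Longrightarrow> \<exists>X\<in>Obj C. \<exists>e. isomorphism D (fobj F X) Y e"
  shows "is_equivalence C D F"
proof -
  note C = categoryD[OF functorD(1)[OF F]]
  note D = categoryD[OF functorD(2)[OF F]]
  note FF = functorD[OF F]
  have "\<forall>Y\<in>Obj D. \<exists>X e e'. X \<in> Obj C \<and> e \<in> Hom D (fobj F X) Y \<and> e' \<in> Hom D Y (fobj F X) \<and>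
     Comp D (fobj F X) Y (fobj F X) e' e = Ident D (fobj F X) \<and> Comp D Y (fobj F X) Y e e' = Ident D Y"
    using ess unfolding isomorphism_def by blast
  then obtain r e e' where
    r: "\<And>Y. Y \<in> Obj D \<Longrightarrow> r Y \<in> Obj C"
    and e: "\<And>Y. Y \<in> Obj D \<Longrightarrow> e Y \<in> Hom D (fobj F (r Y)) Y"
    and e': "\<And>Y. Y \<in> Obj D \<Longrightarrow> e' Y \<in> Hom D Y (fobj F (r Y))"
    and e'e: "\<And>Y. Y \<in> Obj D \<Longrightarrow> Comp D (fobj F (r Y)) Y (fobj F (r Y)) (e' Y) (e Y) = Ident D (fobj F (r Y))"
    and ee': "\<And>Y. Y \<in> Obj D \<Longrightarrow> Comp D Y (fobj F (r Y)) Y (e Y) (e' Y) = Ident D Y"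
    by metis
  define lift where "lift X Y g = (SOME f. f \<in> Hom C X Y \<and> fmor F X Y f = g)" for X Y g
  have lift: "lift X Y g \<in> Hom C X Y" "fmor F X Y (lift X Y g) = g"
    if "X \<in> Obj C" "Y \<in> Obj C" "g \<in> Hom D (fobj F X) (fobj F Y)" for X Y g
    unfolding lift_def using someI_ex[of "\<lambda>f. f \<in> Hom C X Y \<and> fmor F X Y f = g"] full[OF that]
    by blast+
  define conj where "conj X Y g = Comp D (fobj F (r X)) Y (fobj F (r Y)) (e' Y) (Comp D (fobj F (r X)) X Y g (e X))" for X Y g
  have conj: "conj X Y g \<in> Hom D (fobj F (r X)) (fobj F (r Y))"
    if "X \<in> Obj D" "Y \<in> Obj D" "g \<in> Hom D X Y" for X Y g
    unfolding conj_def using that by (simp add: r e e' FF(3) D(2))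
  define G where "G = \<lparr>fobj = r, fmor = (\<lambda>X Y g. lift (r X) (r Y) (conj X Y g))\<rparr>"
  have e_conj: "Comp D (fobj F (r X)) (fobj F (r Y)) Y (e Y) (conj X Y g) = Comp D (fobj F (r X)) X Y g (e X)"
    if "X \<in> Obj D" "Y \<in> Obj D" "g \<in> Hom D X Y" for X Y g
  proof -
    have ge: "Comp D (fobj F (r X)) X Y g (e X) \<in> Hom D (fobj F (r X)) Y"
      using that by (simp add: r e FF(3) D(2))
    show ?thesis unfolding conj_def
      using D(5)[OF _ _ _ _ ge e' e] ee' D(4)[OF _ _ ge] that r FF(3) by simp
  qed
  have cancel: "a = b" if "Z \<in> Obj D" "Y \<in> Obj D" "a \<in> Hom D Z (fobj F (r Y))" "b \<in> Hom D Z (fobj F (r Y))"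
     "Comp D Z (fobj F (r Y)) Y (e Y) a = Comp D Z (fobj F (r Y)) Y (e Y) b" for Z Y a b
  proof -
    have "x = Comp D Z Y (fobj F (r Y)) (e' Y) (Comp D Z (fobj F (r Y)) Y (e Y) x)"
      if "x \<in> Hom D Z (fobj F (r Y))" for x
      using D(5)[OF \<open>Z \<in> Obj D\<close> _ \<open>Y \<in> Obj D\<close> _ that e e'] D(4)[OF \<open>Z \<in> Obj D\<close> _ that] FF(3) r e'e \<open>Y \<in> Obj D\<close> by simp
    then show ?thesis using that by metis
  qed
  have cconj: "conj X Z (Comp D X Y Z g f) = Comp D (fobj F (r X)) (fobj F (r Y)) (fobj F (r Z)) (conj Y Z g) (conj X Y f)"
    if o: "X \<in> Obj D" "Y \<in> Obj D" "Z \<in> Obj D" and f: "f \<in> Hom D X Y" and g: "g \<in> Hom D Y Z" for X Y Z f g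
  proof (rule cancel[OF _ o(3)])
    let ?X = "fobj F (r X)" and ?Y = "fobj F (r Y)" and ?Z = "fobj F (r Z)"
    have O: "?X \<in> Obj D" "?Y \<in> Obj D" "?Z \<in> Obj D" using o r FF(3) by auto
    show "?X \<in> Obj D" by fact
    show "conj X Z (Comp D X Y Z g f) \<in> Hom D ?X ?Z" by (rule conj[OF o(1,3) D(2)[OF o f g]])
    show "Comp D ?X ?Y ?Z (conj Y Z g) (conj X Y f) \<in> Hom D ?X ?Z"
      by (rule D(2)[OF O conj[OF o(1,2) f] conj[OF o(2,3) g]])
    have "Comp D ?X ?Z Z (e Z) (Comp D ?X ?Y ?Z (conj Y Z g) (conj X Y f)) =
        Comp D ?X Y Z g (Comp D ?X X Y f (e X))"
      using D(5)[OF O o(3) conj[OF o(1,2) f] conj[OF o(2,3) g] e[OF o(3)]] e_conj[OF o(2,3) g]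
        D(5)[OF O(1,2) o(2,3) conj[OF o(1,2) f] e[OF o(2)] g] e_conj[OF o(1,2) f] by simp
    also have "\<dots> = Comp D ?X X Z (Comp D X Y Z g f) (e X)"
      using D(5)[OF O(1) o e[OF o(1)] f g] by simp
    also have "\<dots> = Comp D ?X ?Z Z (e Z) (conj X Z (Comp D X Y Z g f))"
      using e_conj[OF o(1,3) D(2)[OF o f g]] by simp
    finally show "Comp D ?X ?Z Z (e Z) (conj X Z (Comp D X Y Z g f)) =
        Comp D ?X ?Z Z (e Z) (Comp D ?X ?Y ?Z (conj Y Z g) (conj X Y f))" by simp
  qed
  have G: "is_functor D C G"
    unfolding is_functor_def
  proof (intro conjI ballI)
    show "category D" "category C" using F unfolding is_functor_def by auto
    show "fobj G X \<in> Obj C" if "X \<in> Obj D" for X using r that by (simp add: G_def)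
    show "fmor G X Y f \<in> Hom C (fobj G X) (fobj G Y)"
      if "X \<in> Obj D" "Y \<in> Obj D" "f \<in> Hom D X Y" for X Y f
      using lift(1)[OF _ _ conj] r that by (simp add: G_def)
    show "fmor G X X (Ident D X) = Ident C (fobj G X)" if X: "X \<in> Obj D" for X
    proof -
      have "conj X X (Ident D X) = Ident D (fobj F (r X))"
        unfolding conj_def using D(4)[OF _ X e] FF(3) r X e'e by simp
      then have c: "conj X X (Ident D X) = fmor F (r X) (r X) (Ident C (r X))" and
        m: "conj X X (Ident D X) \<in> Hom D (fobj F (r X)) (fobj F (r X))"
        using FF(5) r X conj[OF X X D(1)[OF X]] by simp_all
      show ?thesis
        unfolding G_def fctr.simps
        by (rule faithful[OF r[OF X] r[OF X] lift(1)[OF r[OF X] r[OF X] m] C(1)[OF r[OF X]]])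
          (simp only: lift(2)[OF r[OF X] r[OF X] m], rule c)
    qed
    show "fmor G X Z (Comp D X Y Z g f) =
         Comp C (fobj G X) (fobj G Y) (fobj G Z) (fmor G Y Z g) (fmor G X Y f)"
      if o: "X \<in> Obj D" "Y \<in> Obj D" "Z \<in> Obj D" and f: "f \<in> Hom D X Y" and g: "g \<in> Hom D Y Z" for X Y Z f g
    proof -
      have l: "lift (r X) (r Y) (conj X Y f) \<in> Hom C (r X) (r Y)" "lift (r Y) (r Z) (conj Y Z g) \<in> Hom C (r Y) (r Z)"
        using o f g by (simp_all add: lift(1) r conj)
      have c: "conj X Z (Comp D X Y Z g f) \<in> Hom D (fobj F (r X)) (fobj F (r Z))"
        by (rule conj[OF o(1,3) D(2)[OF o f g]])
      show ?thesis unfolding G_def fctr.simps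
      proof (rule faithful)
        show "lift (r X) (r Z) (conj X Z (Comp D X Y Z g f)) \<in> Hom C (r X) (r Z)"
          using o c by (simp add: lift(1) r)
        show "Comp C (r X) (r Y) (r Z) (lift (r Y) (r Z) (conj Y Z g)) (lift (r X) (r Y) (conj X Y f)) \<in> Hom C (r X) (r Z)"
          using l o by (simp add: C(2) r)
        show "fmor F (r X) (r Z) (lift (r X) (r Z) (conj X Z (Comp D X Y Z g f))) =
           fmor F (r X) (r Z) (Comp C (r X) (r Y) (r Z) (lift (r Y) (r Z) (conj Y Z g)) (lift (r X) (r Y) (conj X Y f)))"
          using lift(2) r o c FF(6) l conj f g cconj by simp
      qed (use r o in auto)
    qed
  qed
  have FX: "fobj F X \<in> Obj D" "r (fobj F X) \<in> Obj C" "fobj F (r (fobj F X)) \<in> Obj D" if "X \<in> Obj C" for X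
    using that by (simp_all add: FF(3) r)
  have eta: "natural_iso C C id_functor (comp_functor G F) (\<lambda>X. lift X (r (fobj F X)) (e' (fobj F X)))"
    unfolding natural_iso_def id_functor_def comp_functor_def fctr.simps
  proof (intro conjI ballI)
    fix X assume X: "X \<in> Obj C"
    let ?F = "fobj F X"
    have l: "lift X (r ?F) (e' ?F) \<in> Hom C X (r ?F)" "lift (r ?F) X (e ?F) \<in> Hom C (r ?F) X"
      "fmor F X (r ?F) (lift X (r ?F) (e' ?F)) = e' ?F" "fmor F (r ?F) X (lift (r ?F) X (e ?F)) = e ?F"
      using X by (simp_all add: lift FX e e')
    have 1: "Comp C X (r ?F) X (lift (r ?F) X (e ?F)) (lift X (r ?F) (e' ?F)) = Ident C X"
      by (rule faithful[of X X]) (use X l in \<open>simp_all add: FX C(1,2) FF(5,6) ee'\<close>)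
    have 2: "Comp C (r ?F) X (r ?F) (lift X (r ?F) (e' ?F)) (lift (r ?F) X (e ?F)) = Ident C (r ?F)"
      by (rule faithful[of "r ?F" "r ?F"]) (use X l in \<open>simp_all add: FX C(1,2) FF(5,6) e'e\<close>)
    show "isomorphism C X (fobj G (fobj F X)) (lift X (r (fobj F X)) (e' (fobj F X)))"
      unfolding isomorphism_def G_def fctr.simps using l 1 2 by blast
  next
    fix X Y f assume X: "X \<in> Obj C" and Y: "Y \<in> Obj C" and f: "f \<in> Hom C X Y"
    let ?F = "fobj F X" and ?H = "fobj F Y" and ?g = "fmor F X Y f"
    have g: "?g \<in> Hom D ?F ?H" by (rule FF(4)[OF X Y f])
    have cj: "conj ?F ?H ?g \<in> Hom D (fobj F (r ?F)) (fobj F (r ?H))" by (rule conj[OF FX(1)[OF X] FX(1)[OF Y] g])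
    have l: "lift X (r ?F) (e' ?F) \<in> Hom C X (r ?F)" "lift Y (r ?H) (e' ?H) \<in> Hom C Y (r ?H)"
      "lift (r ?F) (r ?H) (conj ?F ?H ?g) \<in> Hom C (r ?F) (r ?H)"
      "fmor F X (r ?F) (lift X (r ?F) (e' ?F)) = e' ?F" "fmor F Y (r ?H) (lift Y (r ?H) (e' ?H)) = e' ?H"
      "fmor F (r ?F) (r ?H) (lift (r ?F) (r ?H) (conj ?F ?H ?g)) = conj ?F ?H ?g"
      using X Y cj by (simp_all add: lift FX e')
    have "Comp D ?F (fobj F (r ?F)) (fobj F (r ?H)) (conj ?F ?H ?g) (e' ?F) = Comp D ?F ?H (fobj F (r ?H)) (e' ?H) ?g"
    proof (rule cancel[of _ ?H])
      have "Comp D ?F (fobj F (r ?H)) ?H (e ?H) (Comp D ?F (fobj F (r ?F)) (fobj F (r ?H)) (conj ?F ?H ?g) (e' ?F))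
          = Comp D ?F (fobj F (r ?F)) ?H (Comp D (fobj F (r ?F)) ?F ?H ?g (e ?F)) (e' ?F)"
        using D(5)[OF FX(1)[OF X] FX(3)[OF X] FX(3)[OF Y] FX(1)[OF Y] e' cj e] e_conj g FX X Y by simp
      also have "\<dots> = ?g"
        using D(5)[OF FX(1)[OF X] FX(3)[OF X] FX(1)[OF X] FX(1)[OF Y] e' e g] ee' D(3) g FX X Y by simp
      also have "\<dots> = Comp D ?F (fobj F (r ?H)) ?H (e ?H) (Comp D ?F ?H (fobj F (r ?H)) (e' ?H) ?g)"
        using D(5)[OF FX(1)[OF X] FX(1)[OF Y] FX(3)[OF Y] FX(1)[OF Y] g e' e] ee' D(4) g FX X Y by simp
      finally show "Comp D ?F (fobj F (r ?H)) ?H (e ?H) (Comp D ?F (fobj F (r ?F)) (fobj F (r ?H)) (conj ?F ?H ?g) (e' ?F)) =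
         Comp D ?F (fobj F (r ?H)) ?H (e ?H) (Comp D ?F ?H (fobj F (r ?H)) (e' ?H) ?g)" .
    qed (use cj g X Y in \<open>simp_all add: D(2) e' FX\<close>)
    then show "Comp C X (fobj G ?F) (fobj G ?H) (fmor G ?F ?H ?g) (lift X (r ?F) (e' ?F)) =
         Comp C X Y (fobj G ?H) (lift Y (r ?H) (e' ?H)) f"
      unfolding G_def fctr.simps
      by (intro faithful[of X "r ?H"]) (use X Y f l in \<open>simp_all add: FX C(2) FF(6)\<close>)
  qed
  have eps: "natural_iso D D (comp_functor F G) id_functor e"
    unfolding natural_iso_def id_functor_def comp_functor_def fctr.simps
  proof (intro conjI ballI)
    fix X assume "X \<in> Obj D"
    then show "isomorphism D (fobj F (fobj G X)) X (e X)"
      unfolding isomorphism_def G_def fctr.simps by (intro conjI bexI[of _ "e' X"]) (simp_all add: e e' ee' e'e)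
  next
    fix X Y f assume X: "X \<in> Obj D" and Y: "Y \<in> Obj D" and f: "f \<in> Hom D X Y"
    then show "Comp D (fobj F (fobj G X)) X Y f (e X) =
         Comp D (fobj F (fobj G X)) (fobj F (fobj G Y)) Y (e Y) (fmor F (fobj G X) (fobj G Y) (fmor G X Y f))"
      unfolding G_def fctr.simps using lift(2)[OF r r conj] e_conj by simp
  qed
  show ?thesis
    unfolding is_equivalence_def using F G eta eps by blast
qed

lemma pairing:
  assumes "is_product C X Y P p q" "Z \<in> Obj C" "f \<in> Hom C Z X" "g \<in> Hom C Z Y"
  shows "pairing C X Y P p q Z f g \<in> Hom C Z P"
    and "Comp C Z P X p (pairing C X Y P p q Z f g) = f"
    and "Comp C Z P Y q (pairing C X Y P p q Z f g) = g"
    and "h \<in> Hom C Z P \<Longrightarrow> Comp C Z P X p h = f \<Longrightarrow> Comp C Z P Y q h = g \<Longrightarrow>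
      pairing C X Y P p q Z f g = h"
proof -
  let ?Q = "\<lambda>h. h \<in> Hom C Z P \<and> Comp C Z P X p h = f \<and> Comp C Z P Y q h = g"
  have ex: "\<exists>!h. ?Q h" using assms unfolding is_product_def by blast
  have "?Q (pairing C X Y P p q Z f g)" unfolding pairing_def by (rule theI'[OF ex])
  then show "pairing C X Y P p q Z f g \<in> Hom C Z P" "Comp C Z P X p (pairing C X Y P p q Z f g) = f"
    "Comp C Z P Y q (pairing C X Y P p q Z f g) = g" by auto
  show "h \<in> Hom C Z P \<Longrightarrow> Comp C Z P X p h = f \<Longrightarrow> Comp C Z P Y q h = g \<Longrightarrow>
      pairing C X Y P p q Z f g = h"
    unfolding pairing_def by (rule the1_equality[OF ex]) auto
qed

lemma to_terminal:
  assumes "is_terminal C T" "Z \<in> Obj C"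
  shows "to_terminal C T Z \<in> Hom C Z T" "f \<in> Hom C Z T \<Longrightarrow> to_terminal C T Z = f"
proof -
  have ex: "\<exists>!f. f \<in> Hom C Z T" using assms unfolding is_terminal_def by simp
  show "to_terminal C T Z \<in> Hom C Z T" unfolding to_terminal_def by (rule theI'[OF ex])
  show "f \<in> Hom C Z T \<Longrightarrow> to_terminal C T Z = f" unfolding to_terminal_def by (rule the1_equality[OF ex])
qed

lemma abobjD:
  assumes g: "is_abobj C g"
  shows "ab_obj g \<in> Obj C"
    and "is_product C (ab_obj g) (ab_obj g) (ab_prod g) (ab_p1 g) (ab_p2 g)"
    and "is_terminal C (ab_term g)"
    and "ab_prod g \<in> Obj C" "ab_term g \<in> Obj C"
    and "ab_p1 g \<in> Hom C (ab_prod g) (ab_obj g)" "ab_p2 g \<in> Hom C (ab_prod g) (ab_obj g)"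
    and "ab_add g \<in> Hom C (ab_prod g) (ab_obj g)"
    and "ab_zero g \<in> Hom C (ab_term g) (ab_obj g)"
    and "ab_neg g \<in> Hom C (ab_obj g) (ab_obj g)"
    and "Y \<in> Obj C \<Longrightarrow> a \<in> Hom C Y (ab_obj g) \<Longrightarrow> b \<in> Hom C Y (ab_obj g) \<Longrightarrow>
      ab_plus C g Y a b = ab_plus C g Y b a"
    and "Y \<in> Obj C \<Longrightarrow> a \<in> Hom C Y (ab_obj g) \<Longrightarrow> ab_plus C g Y (ab_null C g Y) a = a"
proof -
  show P: "is_product C (ab_obj g) (ab_obj g) (ab_prod g) (ab_p1 g) (ab_p2 g)" and T: "is_terminal C (ab_term g)"
    using g unfolding is_abobj_def by simp_all
  show "ab_obj g \<in> Obj C" "ab_add g \<in> Hom C (ab_prod g) (ab_obj g)" "ab_zero g \<in> Hom C (ab_term g) (ab_obj g)"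
    "ab_neg g \<in> Hom C (ab_obj g) (ab_obj g)"
    using g unfolding is_abobj_def by simp_all
  show "ab_prod g \<in> Obj C" "ab_p1 g \<in> Hom C (ab_prod g) (ab_obj g)" "ab_p2 g \<in> Hom C (ab_prod g) (ab_obj g)"
    using P unfolding is_product_def by simp_all
  show "ab_term g \<in> Obj C" using T unfolding is_terminal_def by simp
  show "Y \<in> Obj C \<Longrightarrow> a \<in> Hom C Y (ab_obj g) \<Longrightarrow> b \<in> Hom C Y (ab_obj g) \<Longrightarrow>
      ab_plus C g Y a b = ab_plus C g Y b a"
    using g unfolding is_abobj_def by (elim conjE) metis
  show "Y \<in> Obj C \<Longrightarrow> a \<in> Hom C Y (ab_obj g) \<Longrightarrow> ab_plus C g Y (ab_null C g Y) a = a"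
    using g unfolding is_abobj_def by (elim conjE) metis
qed

lemma ab_plus_closed:
  assumes C: "category C" and g: "is_abobj C g" and Y: "Y \<in> Obj C"
    and a: "a \<in> Hom C Y (ab_obj g)" and b: "b \<in> Hom C Y (ab_obj g)"
  shows "ab_plus C g Y a b \<in> Hom C Y (ab_obj g)"
  unfolding ab_plus_def
  by (rule categoryD(2)[OF C Y _ _ pairing(1)[OF abobjD(2)[OF g] Y a b]]) (simp_all add: abobjD[OF g])

lemma ab_null_closed:
  assumes C: "category C" and g: "is_abobj C g" and Y: "Y \<in> Obj C"
  shows "ab_null C g Y \<in> Hom C Y (ab_obj g)"
  unfolding ab_null_def
  by (rule categoryD(2)[OF C Y _ _ to_terminal(1)[OF abobjD(3)[OF g] Y]]) (simp_all add: abobjD[OF g])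

lemma ab_plus_natural:
  assumes C: "category C" and g: "is_abobj C g" and Y: "Y \<in> Obj C" and Z: "Z \<in> Obj C"
    and a: "a \<in> Hom C Y (ab_obj g)" and b: "b \<in> Hom C Y (ab_obj g)" and h: "h \<in> Hom C Z Y"
  shows "Comp C Z Y (ab_obj g) (ab_plus C g Y a b) h =
    ab_plus C g Z (Comp C Z Y (ab_obj g) a h) (Comp C Z Y (ab_obj g) b h)"
proof -
  note A = abobjD[OF g] and D = categoryD[OF C]
  let ?G = "ab_obj g" and ?P = "ab_prod g"
  let ?q = "pairing C ?G ?G ?P (ab_p1 g) (ab_p2 g)"
  note q = pairing[OF A(2) Y a b]
  have ah: "Comp C Z Y ?G a h \<in> Hom C Z ?G" "Comp C Z Y ?G b h \<in> Hom C Z ?G"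
    using a b h Y Z by (simp_all add: A D(2))
  have "?q Z (Comp C Z Y ?G a h) (Comp C Z Y ?G b h) = Comp C Z Y ?P (?q Y a b) h"
  proof (rule pairing(4)[OF A(2) Z ah])
    show "Comp C Z Y ?P (?q Y a b) h \<in> Hom C Z ?P" using q(1) Y Z h by (simp add: A D(2))
    show "Comp C Z ?P ?G (ab_p1 g) (Comp C Z Y ?P (?q Y a b) h) = Comp C Z Y ?G a h"
      using D(5)[OF Z Y A(4) A(1) h q(1) A(6)] q(2) by simp
    show "Comp C Z ?P ?G (ab_p2 g) (Comp C Z Y ?P (?q Y a b) h) = Comp C Z Y ?G b h"
      using D(5)[OF Z Y A(4) A(1) h q(1) A(7)] q(3) by simp
  qed
  then show ?thesis
    unfolding ab_plus_def using D(5)[OF Z Y A(4) A(1) h q(1) A(8)] by simp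
qed

lemma ab_plus_projections:
  assumes C: "category C" and g: "is_abobj C g"
  shows "ab_plus C g (ab_prod g) (ab_p1 g) (ab_p2 g) = ab_add g"
proof -
  note A = abobjD[OF g] and D = categoryD[OF C]
  have "pairing C (ab_obj g) (ab_obj g) (ab_prod g) (ab_p1 g) (ab_p2 g) (ab_prod g) (ab_p1 g) (ab_p2 g)
     = Ident C (ab_prod g)"
    by (rule pairing(4)[OF A(2) A(4) A(6) A(7)]) (simp_all add: D A(1,4,6,7))
  then show ?thesis unfolding ab_plus_def using D(3)[OF A(4) A(1) A(8)] by simp
qed

text \<open>A composite of additive maps is additive because a map of group objects commutes with sums of
  arbitrary generalised elements, not only of the two projections.\<close>

lemma category_Ab:
  assumes C: "category C"
  shows "category (Ab C)"
proof -
  note D = categoryD[OF C]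
  have s: "Obj (Ab C) = {g. is_abobj C g}" "Ident (Ab C) g = Ident C (ab_obj g)"
    "Comp (Ab C) g h k = Comp C (ab_obj g) (ab_obj h) (ab_obj k)" for g h k
    by (simp_all add: Ab_def)
  have H: "f \<in> Hom (Ab C) g h \<longleftrightarrow> f \<in> Hom C (ab_obj g) (ab_obj h) \<and>
        Comp C (ab_prod g) (ab_obj g) (ab_obj h) f (ab_add g) =
        ab_plus C h (ab_prod g)
          (Comp C (ab_prod g) (ab_obj g) (ab_obj h) f (ab_p1 g))
          (Comp C (ab_prod g) (ab_obj g) (ab_obj h) f (ab_p2 g))" for f g h
    by (simp add: Ab_def)
  show ?thesis
  proof (rule categoryI, goal_cases)
    case (1 g)
    then have g: "is_abobj C g" by (simp add: s)
    then show ?case by (simp add: H s ab_plus_projections[OF C g] D(1,4) abobjD(1,4,6,7,8)[OF g])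
  next
    case (2 g h k f f')
    then have g: "is_abobj C g" and h: "is_abobj C h" and k: "is_abobj C k" by (auto simp: s)
    note G = abobjD[OF g] and K = abobjD[OF k] and HH = abobjD[OF h]
    from 2 have f: "f \<in> Hom C (ab_obj g) (ab_obj h)" and f': "f' \<in> Hom C (ab_obj h) (ab_obj k)"
      by (auto simp: H)
    let ?P = "ab_prod g" and ?f = "Comp C (ab_prod g) (ab_obj g) (ab_obj h) f"
    let ?q = "pairing C (ab_obj h) (ab_obj h) (ab_prod h) (ab_p1 h) (ab_p2 h) ?P (?f (ab_p1 g)) (?f (ab_p2 g))"
    let ?f' = "Comp C (ab_prod h) (ab_obj h) (ab_obj k) f'"
    have fp: "?f (ab_p1 g) \<in> Hom C ?P (ab_obj h)" "?f (ab_p2 g) \<in> Hom C ?P (ab_obj h)"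
      using f by (simp_all add: D(2) G HH)
    note q = pairing[OF HH(2) G(4) fp]
    have r: "Comp C ?P (ab_prod h) (ab_obj k) (?f' (ab_p1 h)) ?q = Comp C ?P (ab_obj h) (ab_obj k) f' (?f (ab_p1 g))"
       "Comp C ?P (ab_prod h) (ab_obj k) (?f' (ab_p2 h)) ?q = Comp C ?P (ab_obj h) (ab_obj k) f' (?f (ab_p2 g))"
      using D(5)[OF G(4) HH(4) HH(1) K(1) q(1) HH(6) f'] D(5)[OF G(4) HH(4) HH(1) K(1) q(1) HH(7) f'] q(2,3) by simp_all
    have f'p: "?f' (ab_p1 h) \<in> Hom C (ab_prod h) (ab_obj k)" "?f' (ab_p2 h) \<in> Hom C (ab_prod h) (ab_obj k)"
      using f' by (simp_all add: D(2) K HH)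
    have "Comp C ?P (ab_obj g) (ab_obj k) (Comp C (ab_obj g) (ab_obj h) (ab_obj k) f' f) (ab_add g)
       = Comp C ?P (ab_obj h) (ab_obj k) f' (?f (ab_add g))"
      using D(5)[OF G(4) G(1) HH(1) K(1) G(8) f f'] .
    also have "\<dots> = Comp C ?P (ab_obj h) (ab_obj k) f' (Comp C ?P (ab_prod h) (ab_obj h) (ab_add h) ?q)"
      using 2(4) by (simp add: H ab_plus_def)
    also have "\<dots> = Comp C ?P (ab_prod h) (ab_obj k) (?f' (ab_add h)) ?q"
      using D(5)[OF G(4) HH(4) HH(1) K(1) q(1) HH(8) f'] by simp
    also have "\<dots> = Comp C ?P (ab_prod h) (ab_obj k) (ab_plus C k (ab_prod h) (?f' (ab_p1 h)) (?f' (ab_p2 h))) ?q"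
      using 2(5) by (simp add: H)
    also have "\<dots> = ab_plus C k ?P (Comp C ?P (ab_obj h) (ab_obj k) f' (?f (ab_p1 g)))
           (Comp C ?P (ab_obj h) (ab_obj k) f' (?f (ab_p2 g)))"
      using ab_plus_natural[OF C k HH(4) G(4) f'p q(1)] by (simp add: r)
    also have "\<dots> = ab_plus C k ?P (Comp C ?P (ab_obj g) (ab_obj k) (Comp C (ab_obj g) (ab_obj h) (ab_obj k) f' f) (ab_p1 g))
      (Comp C ?P (ab_obj g) (ab_obj k) (Comp C (ab_obj g) (ab_obj h) (ab_obj k) f' f) (ab_p2 g))"
      using D(5)[OF G(4) G(1) HH(1) K(1) G(6) f f'] D(5)[OF G(4) G(1) HH(1) K(1) G(7) f f'] by simp
    finally show ?case using D(2)[OF G(1) HH(1) K(1) f f'] by (simp add: H s)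
  next
    case (3 g h f)
    then show ?case by (simp add: s H D abobjD(1))
  next
    case (4 g h f)
    then show ?case by (simp add: s H D abobjD(1))
  next
    case (5 g h k l f f' f'')
    then show ?case using D(5) by (simp add: s H abobjD(1))
  qed
qed

section \<open>Group completion and split replete maps\<close>

lemma mon_homI:
  assumes "\<And>x. x \<in> carrier M \<Longrightarrow> h x \<in> carrier N"
    and "\<And>x y. x \<in> carrier M \<Longrightarrow> y \<in> carrier M \<Longrightarrow> h (x \<otimes>\<^bsub>M\<^esub> y) = h x \<otimes>\<^bsub>N\<^esub> h y"
    and "h \<one>\<^bsub>M\<^esub> = \<one>\<^bsub>N\<^esub>"
  shows "h \<in> mon_hom M N"
  using assms by (auto simp: mon_hom_def hom_def)

lemma mon_homD:
  assumes "h \<in> mon_hom M N"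
  shows "x \<in> carrier M \<Longrightarrow> h x \<in> carrier N"
    and "x \<in> carrier M \<Longrightarrow> y \<in> carrier M \<Longrightarrow> h (x \<otimes>\<^bsub>M\<^esub> y) = h x \<otimes>\<^bsub>N\<^esub> h y"
    and "h \<one>\<^bsub>M\<^esub> = \<one>\<^bsub>N\<^esub>"
  using assms by (auto simp: mon_hom_def hom_def)

text \<open>The fraction \<open>a / b\<close> in the group completion.\<close>

definition gfrac :: "'m monoid \<Rightarrow> 'm \<Rightarrow> 'm \<Rightarrow> ('m \<times> 'm) set" where
  "gfrac M a b = gp_rel M `` {(a, b)}"

lemma gp_rel_equiv:
  assumes "comm_monoid M"
  shows "equiv (carrier M \<times> carrier M) (gp_rel M)"
proof -
  interpret comm_monoid M by fact
  show ?thesis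
  proof (rule equivI)
    show "gp_rel M \<subseteq> (carrier M \<times> carrier M) \<times> (carrier M \<times> carrier M)"
      by (auto simp: gp_rel_def)
    show "refl_on (carrier M \<times> carrier M) (gp_rel M)"
      by (rule refl_onI) (auto simp: gp_rel_def)
    show "sym (gp_rel M)"
    proof (rule symI)
      fix x y assume "(x, y) \<in> gp_rel M"
      then obtain a b c d k where e: "x = (a, b)" "y = (c, d)"
        and h: "a \<in> carrier M" "b \<in> carrier M" "c \<in> carrier M" "d \<in> carrier M" "k \<in> carrier M"
        "a \<otimes>\<^bsub>M\<^esub> d \<otimes>\<^bsub>M\<^esub> k = c \<otimes>\<^bsub>M\<^esub> b \<otimes>\<^bsub>M\<^esub> k"
        by (auto simp: gp_rel_def)
      from h(6) have "c \<otimes>\<^bsub>M\<^esub> b \<otimes>\<^bsub>M\<^esub> k = a \<otimes>\<^bsub>M\<^esub> d \<otimes>\<^bsub>M\<^esub> k" by simp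
      with h show "(y, x) \<in> gp_rel M" by (auto simp: gp_rel_def e)
    qed
    show "trans (gp_rel M)"
    proof (rule transI)
      fix x y z assume "(x, y) \<in> gp_rel M" "(y, z) \<in> gp_rel M"
      then obtain a b c d e f k l where eq: "x = (a, b)" "y = (c, d)" "z = (e, f)"
        and h: "a \<in> carrier M" "b \<in> carrier M" "c \<in> carrier M" "d \<in> carrier M" "e \<in> carrier M" "f \<in> carrier M"
          "k \<in> carrier M" "l \<in> carrier M"
        and k: "a \<otimes>\<^bsub>M\<^esub> d \<otimes>\<^bsub>M\<^esub> k = c \<otimes>\<^bsub>M\<^esub> b \<otimes>\<^bsub>M\<^esub> k" and l: "c \<otimes>\<^bsub>M\<^esub> f \<otimes>\<^bsub>M\<^esub> l = e \<otimes>\<^bsub>M\<^esub> d \<otimes>\<^bsub>M\<^esub> l"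
        by (auto simp: gp_rel_def)
      have "a \<otimes>\<^bsub>M\<^esub> f \<otimes>\<^bsub>M\<^esub> (d \<otimes>\<^bsub>M\<^esub> k \<otimes>\<^bsub>M\<^esub> l) = (a \<otimes>\<^bsub>M\<^esub> d \<otimes>\<^bsub>M\<^esub> k) \<otimes>\<^bsub>M\<^esub> (f \<otimes>\<^bsub>M\<^esub> l)"
        using h by (simp add: m_ac)
      also have "\<dots> = (c \<otimes>\<^bsub>M\<^esub> f \<otimes>\<^bsub>M\<^esub> l) \<otimes>\<^bsub>M\<^esub> (b \<otimes>\<^bsub>M\<^esub> k)"
        unfolding k using h by (simp add: m_ac)
      also have "\<dots> = e \<otimes>\<^bsub>M\<^esub> b \<otimes>\<^bsub>M\<^esub> (d \<otimes>\<^bsub>M\<^esub> k \<otimes>\<^bsub>M\<^esub> l)"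
        unfolding l using h by (simp add: m_ac)
      finally have "\<exists>j\<in>carrier M. a \<otimes>\<^bsub>M\<^esub> f \<otimes>\<^bsub>M\<^esub> j = e \<otimes>\<^bsub>M\<^esub> b \<otimes>\<^bsub>M\<^esub> j"
        using h by (intro bexI[of _ "d \<otimes>\<^bsub>M\<^esub> k \<otimes>\<^bsub>M\<^esub> l"]) simp_all
      with h show "(x, z) \<in> gp_rel M" by (simp add: gp_rel_def eq)
    qed
  qed
qed

lemma gfrac_eq_iff:
  assumes "comm_monoid M" "a \<in> carrier M" "b \<in> carrier M" "c \<in> carrier M" "d \<in> carrier M"
  shows "gfrac M a b = gfrac M c d \<longleftrightarrow> (\<exists>k\<in>carrier M. a \<otimes>\<^bsub>M\<^esub> d \<otimes>\<^bsub>M\<^esub> k = c \<otimes>\<^bsub>M\<^esub> b \<otimes>\<^bsub>M\<^esub> k)"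
proof -
  have "gfrac M a b = gfrac M c d \<longleftrightarrow> ((a, b), (c, d)) \<in> gp_rel M"
    unfolding gfrac_def using eq_equiv_class_iff[OF gp_rel_equiv[OF assms(1)]] assms by simp
  then show ?thesis using assms by (simp add: gp_rel_def)
qed

lemma gp_carrier: "carrier (gp M) = {gfrac M a b | a b. a \<in> carrier M \<and> b \<in> carrier M}"
  by (auto simp: gp_def gfrac_def quotient_def)

lemma gfrac_memD:
  assumes "comm_monoid M" "(a', b') \<in> gfrac M a b"
  shows "a' \<in> carrier M" "b' \<in> carrier M" "gfrac M a' b' = gfrac M a b"
proof -
  have r: "((a, b), (a', b')) \<in> gp_rel M" using assms(2) by (simp add: gfrac_def)
  then show "a' \<in> carrier M" "b' \<in> carrier M" by (simp_all add: gp_rel_def)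
  show "gfrac M a' b' = gfrac M a b"
    unfolding gfrac_def using equiv_class_eq[OF gp_rel_equiv[OF assms(1)] r] by simp
qed

lemma gfrac_self:
  assumes "comm_monoid M" "a \<in> carrier M" "b \<in> carrier M"
  shows "(a, b) \<in> gfrac M a b"
  unfolding gfrac_def using assms equiv_class_self[OF gp_rel_equiv] by fastforce

lemma gfrac_mult:
  assumes M: "comm_monoid M" and a: "a \<in> carrier M" "b \<in> carrier M" "c \<in> carrier M" "d \<in> carrier M"
  shows "gfrac M a b \<otimes>\<^bsub>gp M\<^esub> gfrac M c d = gfrac M (a \<otimes>\<^bsub>M\<^esub> c) (b \<otimes>\<^bsub>M\<^esub> d)"
proof -
  interpret comm_monoid M by fact
  have wd: "gfrac M (a' \<otimes>\<^bsub>M\<^esub> c') (b' \<otimes>\<^bsub>M\<^esub> d') = gfrac M (a \<otimes>\<^bsub>M\<^esub> c) (b \<otimes>\<^bsub>M\<^esub> d)"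
    if 1: "(a', b') \<in> gfrac M a b" and 2: "(c', d') \<in> gfrac M c d" for a' b' c' d'
  proof -
    note h = gfrac_memD[OF M 1] gfrac_memD[OF M 2]
    obtain k where k: "k \<in> carrier M" "a' \<otimes>\<^bsub>M\<^esub> b \<otimes>\<^bsub>M\<^esub> k = a \<otimes>\<^bsub>M\<^esub> b' \<otimes>\<^bsub>M\<^esub> k"
      using h(3) by (auto simp: gfrac_eq_iff[OF M h(1,2) a(1,2)])
    obtain l where l: "l \<in> carrier M" "c' \<otimes>\<^bsub>M\<^esub> d \<otimes>\<^bsub>M\<^esub> l = c \<otimes>\<^bsub>M\<^esub> d' \<otimes>\<^bsub>M\<^esub> l"
      using h(6) by (auto simp: gfrac_eq_iff[OF M h(4,5) a(3,4)])
    have "a' \<otimes>\<^bsub>M\<^esub> c' \<otimes>\<^bsub>M\<^esub> (b \<otimes>\<^bsub>M\<^esub> d) \<otimes>\<^bsub>M\<^esub> (k \<otimes>\<^bsub>M\<^esub> l) = (a' \<otimes>\<^bsub>M\<^esub> b \<otimes>\<^bsub>M\<^esub> k) \<otimes>\<^bsub>M\<^esub> (c' \<otimes>\<^bsub>M\<^esub> d \<otimes>\<^bsub>M\<^esub> l)"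
      using h a k(1) l(1) by (simp add: m_ac)
    also have "\<dots> = a \<otimes>\<^bsub>M\<^esub> c \<otimes>\<^bsub>M\<^esub> (b' \<otimes>\<^bsub>M\<^esub> d') \<otimes>\<^bsub>M\<^esub> (k \<otimes>\<^bsub>M\<^esub> l)"
      unfolding k(2) l(2) using h a k(1) l(1) by (simp add: m_ac)
    finally show ?thesis
      using h a k(1) l(1) by (subst gfrac_eq_iff[OF M]) (auto intro!: bexI[of _ "k \<otimes>\<^bsub>M\<^esub> l"])
  qed
  have "gfrac M a b \<otimes>\<^bsub>gp M\<^esub> gfrac M c d =
     (\<Union>(a', b')\<in>gfrac M a b. \<Union>(c', d')\<in>gfrac M c d. gfrac M (a' \<otimes>\<^bsub>M\<^esub> c') (b' \<otimes>\<^bsub>M\<^esub> d'))"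
    by (simp add: gp_def gfrac_def)
  also have "\<dots> = (\<Union>(a', b')\<in>gfrac M a b. \<Union>(c', d')\<in>gfrac M c d. gfrac M (a \<otimes>\<^bsub>M\<^esub> c) (b \<otimes>\<^bsub>M\<^esub> d))"
    by (intro SUP_cong refl) (auto simp: wd)
  also have "\<dots> = gfrac M (a \<otimes>\<^bsub>M\<^esub> c) (b \<otimes>\<^bsub>M\<^esub> d)"
    using gfrac_self[OF M a(1,2)] gfrac_self[OF M a(3,4)] by auto
  finally show ?thesis .
qed

lemma gp_one: "\<one>\<^bsub>gp M\<^esub> = gfrac M \<one>\<^bsub>M\<^esub> \<one>\<^bsub>M\<^esub>"
  by (simp add: gp_def gfrac_def)

lemma gfrac_closed: "a \<in> carrier M \<Longrightarrow> b \<in> carrier M \<Longrightarrow> gfrac M a b \<in> carrier (gp M)"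
  by (auto simp: gp_carrier)

lemma gfrac_diag:
  assumes "comm_monoid M" "a \<in> carrier M"
  shows "gfrac M a a = \<one>\<^bsub>gp M\<^esub>"
proof -
  interpret comm_monoid M by fact
  show ?thesis unfolding gp_one using assms(2) by (subst gfrac_eq_iff[OF assms(1)]) (auto intro!: bexI[of _ "\<one>\<^bsub>M\<^esub>"])
qed

lemma comm_group_gp:
  assumes M: "comm_monoid M"
  shows "comm_group (gp M)"
proof -
  interpret comm_monoid M by fact
  show ?thesis
  proof (rule comm_groupI)
    fix x y z assume "x \<in> carrier (gp M)" "y \<in> carrier (gp M)"
    then obtain a b c d where e: "x = gfrac M a b" "y = gfrac M c d"
      and h: "a \<in> carrier M" "b \<in> carrier M" "c \<in> carrier M" "d \<in> carrier M"
      by (auto simp: gp_carrier)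
    show "x \<otimes>\<^bsub>gp M\<^esub> y \<in> carrier (gp M)" using h by (simp add: e gfrac_mult[OF M] gfrac_closed)
    show "x \<otimes>\<^bsub>gp M\<^esub> y = y \<otimes>\<^bsub>gp M\<^esub> x" using h by (simp add: e gfrac_mult[OF M] m_comm)
    assume "z \<in> carrier (gp M)"
    then obtain f g where "z = gfrac M f g" "f \<in> carrier M" "g \<in> carrier M"
      by (auto simp: gp_carrier)
    then show "x \<otimes>\<^bsub>gp M\<^esub> y \<otimes>\<^bsub>gp M\<^esub> z = x \<otimes>\<^bsub>gp M\<^esub> (y \<otimes>\<^bsub>gp M\<^esub> z)" using h by (simp add: e gfrac_mult[OF M] m_assoc)
  next
    show "\<one>\<^bsub>gp M\<^esub> \<in> carrier (gp M)" by (simp add: gp_one gfrac_closed)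
  next
    fix x assume "x \<in> carrier (gp M)"
    then obtain a b where e: "x = gfrac M a b" and h: "a \<in> carrier M" "b \<in> carrier M"
      by (auto simp: gp_carrier)
    show "\<one>\<^bsub>gp M\<^esub> \<otimes>\<^bsub>gp M\<^esub> x = x" using h by (simp add: e gp_one gfrac_mult[OF M])
    show "\<exists>y\<in>carrier (gp M). y \<otimes>\<^bsub>gp M\<^esub> x = \<one>\<^bsub>gp M\<^esub>"
      using h by (intro bexI[of _ "gfrac M b a"]) (simp_all add: e gfrac_mult[OF M] gfrac_diag[OF M] m_comm[of b a] gfrac_closed)
  qed
qed

lemma to_gp_gfrac: "to_gp M m = gfrac M m \<one>\<^bsub>M\<^esub>"
  by (simp add: to_gp_def gfrac_def)

lemma to_gp_mon_hom:
  assumes M: "comm_monoid M"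
  shows "to_gp M \<in> mon_hom M (gp M)"
proof -
  interpret comm_monoid M by fact
  show ?thesis
    by (rule mon_homI) (simp_all add: to_gp_gfrac gfrac_mult[OF M] gp_one gfrac_closed)
qed

lemma to_gp_eqD:
  assumes M: "comm_monoid M" and "a \<in> carrier M" "b \<in> carrier M" "to_gp M a = to_gp M b"
  shows "\<exists>k\<in>carrier M. a \<otimes>\<^bsub>M\<^esub> k = b \<otimes>\<^bsub>M\<^esub> k"
proof -
  interpret comm_monoid M by fact
  show ?thesis using assms(2-4) by (simp add: to_gp_gfrac gfrac_eq_iff[OF M])
qed

lemma gfrac_inv:
  assumes M: "comm_monoid M" and "a \<in> carrier M" "b \<in> carrier M"
  shows "inv\<^bsub>gp M\<^esub> (gfrac M a b) = gfrac M b a"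
proof -
  interpret comm_monoid M by fact
  interpret G: comm_group "gp M" by (rule comm_group_gp[OF M])
  show ?thesis
    using assms(2,3) by (intro G.inv_equality) (simp_all add: gfrac_mult[OF M] gfrac_diag[OF M] m_comm[of b a] gfrac_closed)
qed

lemma gfrac_to_gp:
  assumes M: "comm_monoid M" and "a \<in> carrier M" "b \<in> carrier M"
  shows "gfrac M a b = to_gp M a \<otimes>\<^bsub>gp M\<^esub> inv\<^bsub>gp M\<^esub> (to_gp M b)"
proof -
  interpret comm_monoid M by fact
  show ?thesis using assms(2,3) by (simp add: to_gp_gfrac gfrac_inv[OF M] gfrac_mult[OF M])
qed

lemma gp_elemE:
  assumes "comm_monoid M" "x \<in> carrier (gp M)"
  obtains a b where "a \<in> carrier M" "b \<in> carrier M" "x = to_gp M a \<otimes>\<^bsub>gp M\<^esub> inv\<^bsub>gp M\<^esub> (to_gp M b)"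
  using assms by (auto simp: gp_carrier gfrac_to_gp)

lemma gp_map_gfrac:
  assumes N: "comm_monoid N" and M: "comm_monoid M" and f: "f \<in> mon_hom N M"
    and a: "a \<in> carrier N" and b: "b \<in> carrier N"
  shows "gp_map M f (gfrac N a b) = gfrac M (f a) (f b)"
proof -
  note F = mon_homD[OF f]
  have "gfrac M (f a') (f b') = gfrac M (f a) (f b)" if 1: "(a', b') \<in> gfrac N a b" for a' b'
  proof -
    note h = gfrac_memD[OF N 1]
    obtain k where k: "k \<in> carrier N" "a' \<otimes>\<^bsub>N\<^esub> b \<otimes>\<^bsub>N\<^esub> k = a \<otimes>\<^bsub>N\<^esub> b' \<otimes>\<^bsub>N\<^esub> k"
      using h(3) by (auto simp: gfrac_eq_iff[OF N h(1,2) a b])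
    have "f a' \<otimes>\<^bsub>M\<^esub> f b \<otimes>\<^bsub>M\<^esub> f k = f a \<otimes>\<^bsub>M\<^esub> f b' \<otimes>\<^bsub>M\<^esub> f k"
      using arg_cong[OF k(2), of f] h a b k(1) comm_monoid.axioms(1)[OF N] by (simp add: F(2) monoid.m_closed)
    then show ?thesis
      using h a b k(1) F(1) by (subst gfrac_eq_iff[OF M]) (auto intro!: bexI[of _ "f k"])
  qed
  then have "gp_map M f (gfrac N a b) = (\<Union>(a', b')\<in>gfrac N a b. gfrac M (f a) (f b))"
    unfolding gp_map_def gfrac_def[of M, symmetric] by (intro SUP_cong refl) auto
  also have "\<dots> = gfrac M (f a) (f b)" using gfrac_self[OF N a b] by auto
  finally show ?thesis .
qed

lemma gp_map_to_gp:
  assumes N: "comm_monoid N" and M: "comm_monoid M" and f: "f \<in> mon_hom N M" and n: "n \<in> carrier N"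
  shows "gp_map M f (to_gp N n) = to_gp M (f n)"
  using assms mon_homD(3)[OF f] monoid.one_closed[OF comm_monoid.axioms(1)[OF N]]
  by (simp add: to_gp_gfrac gp_map_gfrac)

lemma gp_map_mon_hom:
  assumes N: "comm_monoid N" and M: "comm_monoid M" and f: "f \<in> mon_hom N M"
  shows "gp_map M f \<in> mon_hom (gp N) (gp M)"
proof -
  interpret N: comm_monoid N by fact
  note F = mon_homD[OF f]
  show ?thesis
  proof (rule mon_homI)
    fix x assume "x \<in> carrier (gp N)"
    then obtain a b where x: "x = gfrac N a b" "a \<in> carrier N" "b \<in> carrier N" by (auto simp: gp_carrier)
    then show "gp_map M f x \<in> carrier (gp M)" by (simp add: gp_map_gfrac[OF N M f] gfrac_closed F)
    fix y assume "y \<in> carrier (gp N)"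
    then obtain c d where "y = gfrac N c d" "c \<in> carrier N" "d \<in> carrier N" by (auto simp: gp_carrier)
    with x show "gp_map M f (x \<otimes>\<^bsub>gp N\<^esub> y) = gp_map M f x \<otimes>\<^bsub>gp M\<^esub> gp_map M f y"
      by (simp add: gp_map_gfrac[OF N M f] gfrac_mult[OF N] gfrac_mult[OF M] F)
  next
    show "gp_map M f \<one>\<^bsub>gp N\<^esub> = \<one>\<^bsub>gp M\<^esub>" by (simp add: gp_one gp_map_gfrac[OF N M f] F)
  qed
qed

lemma gp_map_inv:
  assumes N: "comm_monoid N" and M: "comm_monoid M" and f: "f \<in> mon_hom N M" and x: "x \<in> carrier (gp N)"
  shows "gp_map M f (inv\<^bsub>gp N\<^esub> x) = inv\<^bsub>gp M\<^esub> (gp_map M f x)"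
proof -
  interpret group_hom "gp N" "gp M" "gp_map M f"
    using comm_group_gp[OF N] comm_group_gp[OF M] gp_map_mon_hom[OF N M f]
    by (simp add: group_hom_def group_hom_axioms_def comm_group_def mon_hom_def)
  show ?thesis using x by simp
qed

lemma gp_map_comp:
  assumes L: "comm_monoid L" and N: "comm_monoid N" and M: "comm_monoid M"
    and f: "f \<in> mon_hom L N" and g: "g \<in> mon_hom N M" and x: "x \<in> carrier (gp L)"
    and h: "\<And>l. l \<in> carrier L \<Longrightarrow> h l = g (f l)"
  shows "gp_map M g (gp_map N f x) = gp_map M h x"
proof -
  have hh: "h \<in> mon_hom L M"
    using mon_homD[OF f] mon_homD[OF g] comm_monoid.axioms(1)[OF L]
    by (intro mon_homI) (simp_all add: h monoid.m_closed monoid.one_closed)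
  show ?thesis
    using x mon_homD(1)[OF f] by (auto simp: gp_carrier gp_map_gfrac[OF L N f] gp_map_gfrac[OF N M g] gp_map_gfrac[OF L M hh] h)
qed

lemma gp_map_ident:
  assumes N: "comm_monoid N" and x: "x \<in> carrier (gp N)" and h: "\<And>n. n \<in> carrier N \<Longrightarrow> h n = n"
  shows "gp_map N h x = x"
proof -
  have "h \<in> mon_hom N N"
    using comm_monoid.axioms(1)[OF N] by (intro mon_homI) (simp_all add: h monoid.m_closed monoid.one_closed)
  then show ?thesis using x by (auto simp: gp_carrier gp_map_gfrac[OF N N] h)
qed

lemma rep_monoid_simps:
  "carrier (rep_monoid N M f) = {(m, x). m \<in> carrier M \<and> x \<in> carrier (gp N) \<and> to_gp M m = gp_map M f x}"
  "(m, x) \<otimes>\<^bsub>rep_monoid N M f\<^esub> (m', x') = (m \<otimes>\<^bsub>M\<^esub> m', x \<otimes>\<^bsub>gp N\<^esub> x')"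
  "\<one>\<^bsub>rep_monoid N M f\<^esub> = (\<one>\<^bsub>M\<^esub>, \<one>\<^bsub>gp N\<^esub>)"
  by (simp_all add: rep_monoid_def DirProd_def)

text \<open>A map \<open>p : N \<rightarrow> M\<close> with a section \<open>s\<close> is replete exactly when \<open>N\<close> is the direct product of
  \<open>s(M)\<close> and the kernel of \<open>p\<close>, and this kernel is a group. Indeed \<open>N\<^sup>g\<^sup>p\<close> is then the product of
  \<open>M\<^sup>g\<^sup>p\<close> and the kernel of \<open>N\<^sup>g\<^sup>p \<rightarrow> M\<^sup>g\<^sup>p\<close>, and exactness identifies this kernel with the
  kernel of \<open>p\<close>.\<close>

locale split_mon =
  fixes N :: "'n monoid" and M :: "'m monoid" and s :: "'m \<Rightarrow> 'n" and p :: "'n \<Rightarrow> 'm"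
  assumes N: "comm_monoid N" and M: "comm_monoid M"
    and s: "s \<in> mon_hom M N" and p: "p \<in> mon_hom N M"
    and ps: "m \<in> carrier M \<Longrightarrow> p (s m) = m"
begin

definition ker :: "'n set" where "ker = {n \<in> carrier N. p n = \<one>\<^bsub>M\<^esub>}"

text \<open>Exactness provides elements of \<open>N\<close> from compatible pairs in \<open>M\<close> and \<open>N\<^sup>g\<^sup>p\<close>; in the lemmas below it also serves to
  compare elements of \<open>N\<close> by their images in both.\<close>

lemma replete_preimage:
  assumes "replete N M p" "m \<in> carrier M" "x \<in> carrier (gp N)" "to_gp M m = gp_map M p x"
  shows "\<exists>n. n \<in> carrier N \<and> p n = m \<and> to_gp N n = x"
proof -
  have "to_rep N p ` carrier N = carrier (rep_monoid N M p)"
    using assms(1) by (simp add: replete_def exact_def iso_def bij_betw_def)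
  moreover have "(m, x) \<in> carrier (rep_monoid N M p)" using assms(2-4) by (simp add: rep_monoid_simps)
  ultimately obtain n where "n \<in> carrier N" "(m, x) = to_rep N p n" by (metis imageE)
  then show ?thesis by (auto simp: to_rep_def)
qed

lemma replete_ker_inverse:
  assumes "replete N M p" and k: "k \<in> ker"
  shows "\<exists>k'\<in>ker. k \<otimes>\<^bsub>N\<^esub> k' = \<one>\<^bsub>N\<^esub>"
proof -
  interpret N: comm_monoid N by (rule N)
  interpret M: comm_monoid M by (rule M)
  interpret G: comm_group "gp N" by (rule comm_group_gp[OF N])
  interpret H: comm_group "gp M" by (rule comm_group_gp[OF M])
  note P = mon_homD[OF p] and T = mon_homD[OF to_gp_mon_hom[OF N]] and T' = mon_homD[OF to_gp_mon_hom[OF M]]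
  have bij: "bij_betw (to_rep N p) (carrier N) (carrier (rep_monoid N M p))"
    using assms by (simp add: replete_def exact_def iso_def)
  have k: "k \<in> carrier N" "p k = \<one>\<^bsub>M\<^esub>" using k by (auto simp: ker_def)
  \<comment> \<open>The inverse of \<open>k\<close> in \<open>N\<^sup>g\<^sup>p\<close> lies over \<open>1\<close>, so it comes from \<open>N\<close>.\<close>
  have "to_gp M \<one>\<^bsub>M\<^esub> = gp_map M p (inv\<^bsub>gp N\<^esub> (to_gp N k))"
    using k by (simp add: gp_map_inv[OF N M p] T gp_map_to_gp[OF N M p] T')
  then obtain k' where k': "k' \<in> carrier N" "p k' = \<one>\<^bsub>M\<^esub>" "to_gp N k' = inv\<^bsub>gp N\<^esub> (to_gp N k)"
    using replete_preimage[OF assms(1) M.one_closed] k T(1) G.inv_closed by metis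
  have "to_rep N p (k \<otimes>\<^bsub>N\<^esub> k') = to_rep N p \<one>\<^bsub>N\<^esub>"
    using k k' by (simp add: to_rep_def P T)
  then have "k \<otimes>\<^bsub>N\<^esub> k' = \<one>\<^bsub>N\<^esub>"
    by (rule inj_onD[OF bij_betw_imp_inj_on[OF bij]]) (use k k' in simp_all)
  then show ?thesis using k' by (auto simp: ker_def)
qed

lemma replete_decomposition:
  assumes "replete N M p" and n: "n \<in> carrier N"
  shows "\<exists>k\<in>ker. n = s (p n) \<otimes>\<^bsub>N\<^esub> k"
proof -
  interpret N: comm_monoid N by (rule N)
  interpret M: comm_monoid M by (rule M)
  interpret G: comm_group "gp N" by (rule comm_group_gp[OF N])
  interpret H: comm_group "gp M" by (rule comm_group_gp[OF M])
  note P = mon_homD[OF p] and T = mon_homD[OF to_gp_mon_hom[OF N]] and T' = mon_homD[OF to_gp_mon_hom[OF M]]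
    and S = mon_homD[OF s] and Q = mon_homD[OF gp_map_mon_hom[OF N M p]]
  have bij: "bij_betw (to_rep N p) (carrier N) (carrier (rep_monoid N M p))"
    using assms by (simp add: replete_def exact_def iso_def)
  \<comment> \<open>The quotient \<open>n / s(p n)\<close> lies over \<open>1\<close>, so it comes from \<open>N\<close>.\<close>
  let ?x = "to_gp N n \<otimes>\<^bsub>gp N\<^esub> inv\<^bsub>gp N\<^esub> (to_gp N (s (p n)))"
  have "to_gp M \<one>\<^bsub>M\<^esub> = gp_map M p ?x" "?x \<in> carrier (gp N)"
    using n by (simp_all add: gp_map_inv[OF N M p] T gp_map_to_gp[OF N M p] T' Q S P ps)
  then obtain k where k: "k \<in> carrier N" "p k = \<one>\<^bsub>M\<^esub>" "to_gp N k = ?x"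
    using replete_preimage[OF assms(1) M.one_closed] by metis
  have "to_gp N n = to_gp N (s (p n)) \<otimes>\<^bsub>gp N\<^esub> to_gp N k"
    unfolding k(3) using n by (simp add: T S P G.m_ac)
  then have "to_rep N p n = to_rep N p (s (p n) \<otimes>\<^bsub>N\<^esub> k)"
    using n k(1,2) by (simp add: to_rep_def P S T ps)
  then have "n = s (p n) \<otimes>\<^bsub>N\<^esub> k"
    by (rule inj_onD[OF bij_betw_imp_inj_on[OF bij]]) (use n k in \<open>simp_all add: P S\<close>)
  then show "\<exists>k\<in>ker. n = s (p n) \<otimes>\<^bsub>N\<^esub> k" using k by (auto simp: ker_def)
qed

lemma replete_decomposition_unique:
  assumes "replete N M p" and m: "m \<in> carrier M" and kk: "k \<in> ker" "k' \<in> ker"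
    and eq: "s m \<otimes>\<^bsub>N\<^esub> k = s m \<otimes>\<^bsub>N\<^esub> k'"
  shows "k = k'"
proof -
  interpret N: comm_monoid N by (rule N)
  interpret M: comm_monoid M by (rule M)
  interpret G: comm_group "gp N" by (rule comm_group_gp[OF N])
  note T = mon_homD[OF to_gp_mon_hom[OF N]] and S = mon_homD[OF s]
  have bij: "bij_betw (to_rep N p) (carrier N) (carrier (rep_monoid N M p))"
    using assms by (simp add: replete_def exact_def iso_def)
  have c: "k \<in> carrier N" "k' \<in> carrier N" "p k = \<one>\<^bsub>M\<^esub>" "p k' = \<one>\<^bsub>M\<^esub>" using kk by (auto simp: ker_def)
  have "to_gp N (s m) \<otimes>\<^bsub>gp N\<^esub> to_gp N k = to_gp N (s m) \<otimes>\<^bsub>gp N\<^esub> to_gp N k'"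
    using arg_cong[OF eq, of "to_gp N"] c m by (simp add: T S)
  then have "to_gp N k = to_gp N k'" using c m by (simp add: T S)
  then have "to_rep N p k = to_rep N p k'" using c by (simp add: to_rep_def)
  then show ?thesis by (rule inj_onD[OF bij_betw_imp_inj_on[OF bij]]) (use c in simp_all)
qed

text \<open>The converse. Uniqueness is asked for \<open>s m\<close> times an element of the kernel, since \<open>M\<close> need not be
  cancellative.\<close>

lemma repleteI:
  assumes inv: "\<And>k. k \<in> ker \<Longrightarrow> \<exists>k'\<in>ker. k \<otimes>\<^bsub>N\<^esub> k' = \<one>\<^bsub>N\<^esub>"
    and dec: "\<And>n. n \<in> carrier N \<Longrightarrow> \<exists>k\<in>ker. n = s (p n) \<otimes>\<^bsub>N\<^esub> k"
    and unique: "\<And>m k k'. m \<in> carrier M \<Longrightarrow> k \<in> ker \<Longrightarrow> k' \<in> ker \<Longrightarrow> s m \<otimes>\<^bsub>N\<^esub> k = s m \<otimes>\<^bsub>N\<^esub> k' \<Longrightarrow> k = k'"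
  shows "replete N M p"
proof -
  interpret N: comm_monoid N by (rule N)
  interpret M: comm_monoid M by (rule M)
  interpret G: comm_group "gp N" by (rule comm_group_gp[OF N])
  interpret H: comm_group "gp M" by (rule comm_group_gp[OF M])
  note P = mon_homD[OF p] and T = mon_homD[OF to_gp_mon_hom[OF N]] and T' = mon_homD[OF to_gp_mon_hom[OF M]]
    and S = mon_homD[OF s] and Q = mon_homD[OF gp_map_mon_hom[OF N M p]] and Q' = mon_homD[OF gp_map_mon_hom[OF M N s]]
  have "to_rep N p \<in> hom N (rep_monoid N M p)"
    by (rule homI) (simp_all add: to_rep_def rep_monoid_simps P T gp_map_to_gp[OF N M p])
  moreover have "inj_on (to_rep N p) (carrier N)"
  proof (rule inj_onI)
    fix n n' assume n: "n \<in> carrier N" "n' \<in> carrier N" and eq: "to_rep N p n = to_rep N p n'"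
    obtain k k' where k: "k \<in> ker" "n = s (p n) \<otimes>\<^bsub>N\<^esub> k" "k' \<in> ker" "n' = s (p n') \<otimes>\<^bsub>N\<^esub> k'"
      using dec n by meson
    have c: "k \<in> carrier N" "k' \<in> carrier N" "p k = \<one>\<^bsub>M\<^esub>" "p k' = \<one>\<^bsub>M\<^esub>" using k by (auto simp: ker_def)
    have pn: "p n = p n'" and "to_gp N n = to_gp N n'" using eq by (auto simp: to_rep_def)
    then have "to_gp N (s (p n) \<otimes>\<^bsub>N\<^esub> k) = to_gp N (s (p n) \<otimes>\<^bsub>N\<^esub> k')" using k by simp
    then have "to_gp N k = to_gp N k'" using c n by (simp add: T S P)
    then obtain d where d: "d \<in> carrier N" "k \<otimes>\<^bsub>N\<^esub> d = k' \<otimes>\<^bsub>N\<^esub> d"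
      using to_gp_eqD[OF N] c by blast
    obtain l where l: "l \<in> ker" "d = s (p d) \<otimes>\<^bsub>N\<^esub> l" using dec d by blast
    obtain l' where l': "l' \<in> ker" "l \<otimes>\<^bsub>N\<^esub> l' = \<one>\<^bsub>N\<^esub>" using inv l by blast
    have lc: "l \<in> carrier N" "l' \<in> carrier N" using l l' by (auto simp: ker_def)
    \<comment> \<open>The cancelling factor may be taken in \<open>s(M)\<close>, its other factor being invertible.\<close>
    have dl: "d \<otimes>\<^bsub>N\<^esub> l' = s (p d)"
    proof -
      have "d \<otimes>\<^bsub>N\<^esub> l' = s (p d) \<otimes>\<^bsub>N\<^esub> (l \<otimes>\<^bsub>N\<^esub> l')"
        using l(2) N.m_assoc[of "s (p d)" l l'] lc d by (simp add: S P)
      then show ?thesis using l' d by (simp add: S P)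
    qed
    have "s (p d) \<otimes>\<^bsub>N\<^esub> k = (k \<otimes>\<^bsub>N\<^esub> d) \<otimes>\<^bsub>N\<^esub> l'" unfolding dl[symmetric] using d(1) lc c by (simp add: N.m_ac)
    also have "\<dots> = (k' \<otimes>\<^bsub>N\<^esub> d) \<otimes>\<^bsub>N\<^esub> l'" by (simp only: d(2))
    also have "\<dots> = s (p d) \<otimes>\<^bsub>N\<^esub> k'" unfolding dl[symmetric] using d(1) lc c by (simp add: N.m_ac)
    finally have "k = k'" using unique[OF P(1)[OF d(1)] k(1,3)] by blast
    then show "n = n'" using k pn by simp
  qed
  moreover have "carrier (rep_monoid N M p) \<subseteq> to_rep N p ` carrier N"
  proof
    fix z assume "z \<in> carrier (rep_monoid N M p)"
    then obtain m x where z: "z = (m, x)" and m: "m \<in> carrier M" and x: "x \<in> carrier (gp N)"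
      and mx: "to_gp M m = gp_map M p x" by (auto simp: rep_monoid_simps)
    obtain n1 n2 where n: "n1 \<in> carrier N" "n2 \<in> carrier N" and xn: "x = to_gp N n1 \<otimes>\<^bsub>gp N\<^esub> inv\<^bsub>gp N\<^esub> (to_gp N n2)"
      using gp_elemE[OF N x] .
    obtain k1 k2 where k: "k1 \<in> ker" "n1 = s (p n1) \<otimes>\<^bsub>N\<^esub> k1" "k2 \<in> ker" "n2 = s (p n2) \<otimes>\<^bsub>N\<^esub> k2"
      using dec n by meson
    obtain k2' where k2': "k2' \<in> ker" "k2 \<otimes>\<^bsub>N\<^esub> k2' = \<one>\<^bsub>N\<^esub>" using inv k by blast
    have c: "k1 \<in> carrier N" "k2 \<in> carrier N" "k2' \<in> carrier N" "p k1 = \<one>\<^bsub>M\<^esub>" "p k2' = \<one>\<^bsub>M\<^esub>"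
      using k k2' by (auto simp: ker_def)
    have "to_gp N (s m) = gp_map N s (gp_map M p x)"
      using m by (simp add: mx[symmetric] gp_map_to_gp[OF M N s])
    also have "\<dots> = to_gp N (s (p n1)) \<otimes>\<^bsub>gp N\<^esub> inv\<^bsub>gp N\<^esub> (to_gp N (s (p n2)))"
      unfolding xn using n by (simp add: Q Q' T T' P S gp_map_to_gp[OF N M p] gp_map_to_gp[OF M N s] gp_map_inv[OF N M p] gp_map_inv[OF M N s])
    finally have sm: "to_gp N (s m) = to_gp N (s (p n1)) \<otimes>\<^bsub>gp N\<^esub> inv\<^bsub>gp N\<^esub> (to_gp N (s (p n2)))" .
    have "to_gp N k2 \<otimes>\<^bsub>gp N\<^esub> to_gp N k2' = \<one>\<^bsub>gp N\<^esub>" using k2' c T(2)[of k2 k2'] T(3) by simp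
    then have i2: "to_gp N k2' = inv\<^bsub>gp N\<^esub> (to_gp N k2)" using c by (metis G.inv_equality G.m_comm T(1))
    have tn: "to_gp N n1 = to_gp N (s (p n1)) \<otimes>\<^bsub>gp N\<^esub> to_gp N k1" "to_gp N n2 = to_gp N (s (p n2)) \<otimes>\<^bsub>gp N\<^esub> to_gp N k2"
      using k n c by (metis T(2) S(1) P(1))+
    have "to_gp N (s m \<otimes>\<^bsub>N\<^esub> (k1 \<otimes>\<^bsub>N\<^esub> k2')) = x"
      unfolding xn tn using m n c by (simp add: T S P sm i2 G.inv_mult G.m_ac)
    then have "to_rep N p (s m \<otimes>\<^bsub>N\<^esub> (k1 \<otimes>\<^bsub>N\<^esub> k2')) = z"
      using m c by (simp add: z to_rep_def P S ps)
    moreover have "s m \<otimes>\<^bsub>N\<^esub> (k1 \<otimes>\<^bsub>N\<^esub> k2') \<in> carrier N" using m c by (simp add: S)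
    ultimately show "z \<in> to_rep N p ` carrier N" by blast
  qed
  ultimately have "exact N M p"
    unfolding exact_def iso_def bij_betw_def hom_def by auto
  moreover have "carrier (gp M) \<subseteq> gp_map M p ` carrier (gp N)"
  proof
    fix x assume "x \<in> carrier (gp M)"
    then obtain a b where "x = gfrac M a b" "a \<in> carrier M" "b \<in> carrier M" by (auto simp: gp_carrier)
    then have "x = gp_map M p (gfrac N (s a) (s b))" "gfrac N (s a) (s b) \<in> carrier (gp N)"
      by (simp_all add: gp_map_gfrac[OF N M p] S ps gfrac_closed)
    then show "x \<in> gp_map M p ` carrier (gp N)" by blast
  qed
  ultimately show ?thesis unfolding replete_def using Q(1) by auto
qed

end

section \<open>Log rings and their replete split extensions\<close>

lemma ring_hom_Units:
  assumes "ring R" "ring S" "h \<in> ring_hom R S" "u \<in> Units R"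
  shows "h u \<in> Units S"
proof -
  interpret R: ring R by fact
  interpret S: ring S by fact
  have c: "u \<in> carrier R" "inv\<^bsub>R\<^esub> u \<in> carrier R" using assms(4) R.Units_closed by simp_all
  have "h u \<otimes>\<^bsub>S\<^esub> h (inv\<^bsub>R\<^esub> u) = \<one>\<^bsub>S\<^esub>" "h (inv\<^bsub>R\<^esub> u) \<otimes>\<^bsub>S\<^esub> h u = \<one>\<^bsub>S\<^esub>"
    using ring_hom_mult[OF assms(3) c] ring_hom_mult[OF assms(3) c(2,1)] assms(4)
    by (simp_all add: ring_hom_one[OF assms(3)])
  then show ?thesis using ring_hom_closed[OF assms(3)] c unfolding Units_def by blast
qed

lemma ring_hom_compose_restrict:
  assumes "ring R" "f \<in> ring_hom R S" "g \<in> ring_hom S T"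
  shows "compose (carrier R) g f \<in> ring_hom R T"
proof -
  interpret R: ring R by fact
  show ?thesis
    using assms(2,3)
    by (intro ring_hom_memI) (simp_all add: compose_def ring_hom_closed ring_hom_mult ring_hom_add ring_hom_one)
qed

lemma mon_hom_compose_restrict:
  assumes "monoid R" "f \<in> mon_hom R S" "g \<in> mon_hom S T"
  shows "compose (carrier R) g f \<in> mon_hom R T"
proof -
  interpret R: monoid R by fact
  show ?thesis
    using mon_homD[OF assms(2)] mon_homD[OF assms(3)]
    by (intro mon_homI) (simp_all add: compose_def)
qed

lemma ring_hom_restrict_id: "ring R \<Longrightarrow> (\<lambda>x\<in>carrier R. x) \<in> ring_hom R R"
  by (rule ring_hom_memI) (simp_all add: ring.ring_simprules(1,5,6))

lemma mon_hom_restrict_id: "monoid R \<Longrightarrow> (\<lambda>x\<in>carrier R. x) \<in> mon_hom R R"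
  by (rule mon_homI) (simp_all add: monoid.m_closed)

lemma compose_apply: "x \<in> A \<Longrightarrow> compose A g f x = g (f x)"
  by (simp add: compose_def)

lemma mon_hom_Pi: "f \<in> mon_hom M N \<Longrightarrow> f \<in> carrier M \<rightarrow> carrier N"
  by (auto simp: mon_hom_def hom_def)

lemma ring_hom_Pi: "f \<in> ring_hom M N \<Longrightarrow> f \<in> carrier M \<rightarrow> carrier N"
  by (auto simp: ring_hom_def)

lemma compose_restrict_id: "f \<in> extensional A \<Longrightarrow> compose A f (\<lambda>x\<in>A. x) = f"
  by (auto simp: compose_def extensional_def)

lemma compose_compose:
  "f \<in> A \<rightarrow> B \<Longrightarrow> compose A (compose B h g) f = compose A h (compose A g f)"
  by (rule compose_assoc[symmetric])

lemma CRing_cat_simps: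
  "R \<in> Obj CRing_cat \<longleftrightarrow> cring R"
  "f \<in> Hom CRing_cat R S \<longleftrightarrow> f \<in> ring_hom R S \<and> f \<in> extensional (carrier R)"
  "Ident CRing_cat R = (\<lambda>x\<in>carrier R. x)"
  "Comp CRing_cat R S T g f = compose (carrier R) g f"
  by (simp_all add: CRing_cat_def)

lemma category_CRing_cat: "category CRing_cat"
proof (rule categoryI, unfold CRing_cat_simps, goal_cases)
  case (1 X)
  then show ?case by (simp add: ring_hom_restrict_id cring.axioms(1))
next
  case (2 X Y Z f g)
  then show ?case using ring_hom_compose_restrict[of X f Y g Z] by (simp add: cring.axioms(1))
next
  case (3 X Y f)
  then show ?case by (simp add: compose_restrict_id)
next
  case (4 X Y f)
  then show ?case by (simp add: Id_compose ring_hom_Pi)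
next
  case (5 W X Y Z f g h)
  then show ?case by (simp add: compose_compose[OF ring_hom_Pi])
qed

lemma PreLog_cat_simps:
  "P \<in> Obj PreLog_cat \<longleftrightarrow> prelog_ring P"
  "(f, g) \<in> Hom PreLog_cat P Q \<longleftrightarrow> f \<in> ring_hom (PRing P) (PRing Q) \<and> g \<in> mon_hom (PMon P) (PMon Q) \<and>
     (\<forall>m\<in>carrier (PMon P). pstr Q (g m) = f (pstr P m)) \<and>
     f \<in> extensional (carrier (PRing P)) \<and> g \<in> extensional (carrier (PMon P))"
  "Ident PreLog_cat P = (\<lambda>x\<in>carrier (PRing P). x, \<lambda>x\<in>carrier (PMon P). x)"
  "Comp PreLog_cat P Q R (f', g') (f, g) =
     (compose (carrier (PRing P)) f' f, compose (carrier (PMon P)) g' g)"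
  by (auto simp: PreLog_cat_def prelog_hom_def)

lemma prelog_ringD:
  assumes "prelog_ring P"
  shows "cring (PRing P)" "comm_monoid (PMon P)" "pstr P \<in> mon_hom (PMon P) (PRing P)"
    "ring (PRing P)" "monoid (PMon P)"
  using assms by (simp_all add: prelog_ring_def cring.axioms(1) comm_monoid.axioms(1))

lemma category_PreLog_cat: "category PreLog_cat"
proof (rule categoryI, goal_cases)
  case (1 X)
  then show ?case
    using mon_homD[OF prelog_ringD(3)[of X]]
    by (simp add: PreLog_cat_simps ring_hom_restrict_id mon_hom_restrict_id prelog_ringD)
next
  case (2 X Y Z f g)
  obtain f1 f2 where f: "f = (f1, f2)" by (cases f)
  obtain g1 g2 where g: "g = (g1, g2)" by (cases g)
  from 2 show ?case
    using mon_homD[OF prelog_ringD(3)[of X]] mon_homD(1)[of f2 "PMon X" "PMon Y"]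
      ring_hom_compose_restrict[of "PRing X" f1 "PRing Y" g1 "PRing Z"]
      mon_hom_compose_restrict[of "PMon X" f2 "PMon Y" g2 "PMon Z"]
    by (simp add: f g PreLog_cat_simps prelog_ringD compose_apply)
next
  case (3 X Y f)
  then show ?case by (cases f) (simp add: PreLog_cat_simps compose_restrict_id)
next
  case (4 X Y f)
  then show ?case by (cases f) (simp add: PreLog_cat_simps Id_compose ring_hom_Pi mon_hom_Pi)
next
  case (5 W X Y Z f g h)
  then show ?case
    by (cases f; cases g; cases h)
      (simp add: PreLog_cat_simps compose_compose[OF ring_hom_Pi] compose_compose[OF mon_hom_Pi])
qed

lemma Log_cat_simps:
  "P \<in> Obj Log_cat \<longleftrightarrow> log_ring P" "Hom Log_cat = Hom PreLog_cat"
  "Ident Log_cat = Ident PreLog_cat" "Comp Log_cat = Comp PreLog_cat"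
  by (auto simp: Log_cat_def PreLog_cat_simps log_ring_def)

lemma category_Log_cat: "category Log_cat"
  unfolding Log_cat_def by (rule category_full_subcat[OF category_PreLog_cat])

lemma log_ring_unit_lift:
  assumes "log_ring P" "u \<in> Units (PRing P)"
  shows "\<exists>m\<in>carrier (PMon P). pstr P m = u"
proof -
  have "pstr P ` {m \<in> carrier (PMon P). pstr P m \<in> Units (PRing P)} = Units (PRing P)"
    using assms(1) by (simp add: log_ring_def iso_def bij_betw_def units_of_def)
  with assms(2) have "u \<in> pstr P ` {m \<in> carrier (PMon P). pstr P m \<in> Units (PRing P)}" by simp
  then show ?thesis by blast
qed

lemma log_ring_unit_inj:
  assumes "log_ring P" "m \<in> carrier (PMon P)" "m' \<in> carrier (PMon P)"
    "pstr P m \<in> Units (PRing P)" "pstr P m' = pstr P m"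
  shows "m' = m"
proof -
  have "inj_on (pstr P) {m \<in> carrier (PMon P). pstr P m \<in> Units (PRing P)}"
    using assms(1) by (simp add: log_ring_def iso_def bij_betw_def units_of_def)
  from inj_onD[OF this assms(5)] show ?thesis using assms by simp
qed

lemma log_ringI:
  assumes P: "prelog_ring P"
    and ex: "\<And>u. u \<in> Units (PRing P) \<Longrightarrow> \<exists>m\<in>carrier (PMon P). pstr P m = u"
    and inj: "\<And>m m'. m \<in> carrier (PMon P) \<Longrightarrow> m' \<in> carrier (PMon P) \<Longrightarrow> pstr P m \<in> Units (PRing P) \<Longrightarrow>
      pstr P m' = pstr P m \<Longrightarrow> m' = m"
  shows "log_ring P"
proof -
  have "bij_betw (pstr P) {m \<in> carrier (PMon P). pstr P m \<in> Units (PRing P)} (Units (PRing P))"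
  proof (rule bij_betwI')
    fix x y assume "x \<in> {m \<in> carrier (PMon P). pstr P m \<in> Units (PRing P)}"
      "y \<in> {m \<in> carrier (PMon P). pstr P m \<in> Units (PRing P)}"
    then show "(pstr P x = pstr P y) = (x = y)" using inj[of y x] by auto
  next
    fix y assume "y \<in> Units (PRing P)"
    then show "\<exists>x\<in>{m \<in> carrier (PMon P). pstr P m \<in> Units (PRing P)}. y = pstr P x"
      using ex[of y] by auto
  qed auto
  then show ?thesis
    using P mon_homD(2)[OF prelog_ringD(3)[OF P]]
    by (auto simp: log_ring_def iso_def hom_def units_of_def)
qed

text \<open>A log ring \<open>Q\<close> with a replete retraction onto \<open>P\<close>. The map \<open>unit_lift\<close> inverts the
  structure map over the units of \<open>Q\<close>. Every element of the monoid of \<open>Q\<close> is \<open>s2 m\<close> times the lift of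
  a unit \<open>u\<close> over \<open>1\<close>, for a unique pair \<open>(m, u)\<close>; hence everything about \<open>Q\<close> is determined by its ring.\<close>

locale split_log =
  fixes P :: "('a, 'm) prelog" and Q :: "('b, 'n) prelog"
    and s1 :: "'a \<Rightarrow> 'b" and s2 :: "'m \<Rightarrow> 'n" and p1 :: "'b \<Rightarrow> 'a" and p2 :: "'n \<Rightarrow> 'm"
  assumes P: "log_ring P" and Q: "log_ring Q"
    and s1: "s1 \<in> ring_hom (PRing P) (PRing Q)" and s2: "s2 \<in> mon_hom (PMon P) (PMon Q)"
    and s: "m \<in> carrier (PMon P) \<Longrightarrow> pstr Q (s2 m) = s1 (pstr P m)"
    and p1: "p1 \<in> ring_hom (PRing Q) (PRing P)" and p2: "p2 \<in> mon_hom (PMon Q) (PMon P)"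
    and p: "n \<in> carrier (PMon Q) \<Longrightarrow> pstr P (p2 n) = p1 (pstr Q n)"
    and ps1: "a \<in> carrier (PRing P) \<Longrightarrow> p1 (s1 a) = a"
    and ps2: "m \<in> carrier (PMon P) \<Longrightarrow> p2 (s2 m) = m"
    and replete: "replete (PMon Q) (PMon P) p2"
begin

lemma prelogs: "prelog_ring P" "prelog_ring Q"
  using P Q by (auto simp: log_ring_def)

sublocale A: cring "PRing P" by (rule prelog_ringD(1)[OF prelogs(1)])
sublocale B: cring "PRing Q" by (rule prelog_ringD(1)[OF prelogs(2)])
sublocale M: comm_monoid "PMon P" by (rule prelog_ringD(2)[OF prelogs(1)])
sublocale N: comm_monoid "PMon Q" by (rule prelog_ringD(2)[OF prelogs(2)])
sublocale mon: split_mon "PMon Q" "PMon P" s2 p2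
  by unfold_locales (simp_all add: s2 p2 ps2)

lemmas alpha = mon_homD[OF prelog_ringD(3)[OF prelogs(1)]]
lemmas beta = mon_homD[OF prelog_ringD(3)[OF prelogs(2)]]
lemmas s2_simps = mon_homD[OF s2]
lemmas p2_simps = mon_homD[OF p2]
lemmas s1_simps = ring_hom_closed[OF s1] ring_hom_mult[OF s1] ring_hom_add[OF s1] ring_hom_one[OF s1]
lemmas p1_simps = ring_hom_closed[OF p1] ring_hom_mult[OF p1] ring_hom_add[OF p1] ring_hom_one[OF p1]

definition units1 :: "'b set" where
  "units1 = {u \<in> Units (PRing Q). p1 u = \<one>\<^bsub>PRing P\<^esub>}"

definition unit_lift :: "'b \<Rightarrow> 'n" where
  "unit_lift u = (SOME n. n \<in> carrier (PMon Q) \<and> pstr Q n = u)"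

lemma units1D: "u \<in> units1 \<Longrightarrow> u \<in> Units (PRing Q)" "u \<in> units1 \<Longrightarrow> u \<in> carrier (PRing Q)"
  "u \<in> units1 \<Longrightarrow> p1 u = \<one>\<^bsub>PRing P\<^esub>"
  by (auto simp: units1_def)

lemma units1_closed: "\<one>\<^bsub>PRing Q\<^esub> \<in> units1" "u \<in> units1 \<Longrightarrow> u' \<in> units1 \<Longrightarrow> u \<otimes>\<^bsub>PRing Q\<^esub> u' \<in> units1"
  by (auto simp: units1_def p1_simps B.Units_closed)

lemma unit_lift: "u \<in> Units (PRing Q) \<Longrightarrow> unit_lift u \<in> carrier (PMon Q)"
  "u \<in> Units (PRing Q) \<Longrightarrow> pstr Q (unit_lift u) = u"
  using someI_ex[of "\<lambda>n. n \<in> carrier (PMon Q) \<and> pstr Q n = u"] log_ring_unit_lift[OF Q, of u]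
  unfolding unit_lift_def by blast+

lemma unit_lift_unique:
  "n \<in> carrier (PMon Q) \<Longrightarrow> u \<in> Units (PRing Q) \<Longrightarrow> pstr Q n = u \<Longrightarrow> n = unit_lift u"
  using log_ring_unit_inj[OF Q, of "unit_lift u" n] by (simp add: unit_lift)

lemma unit_lift_one: "unit_lift \<one>\<^bsub>PRing Q\<^esub> = \<one>\<^bsub>PMon Q\<^esub>"
  by (rule unit_lift_unique[symmetric]) (simp_all add: beta)

lemma unit_lift_mult: "u \<in> Units (PRing Q) \<Longrightarrow> u' \<in> Units (PRing Q) \<Longrightarrow>
    unit_lift (u \<otimes>\<^bsub>PRing Q\<^esub> u') = unit_lift u \<otimes>\<^bsub>PMon Q\<^esub> unit_lift u'"
  by (rule unit_lift_unique[symmetric]) (simp_all add: beta unit_lift)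

lemma unit_lift_ker: "u \<in> units1 \<Longrightarrow> unit_lift u \<in> mon.ker"
proof -
  assume u: "u \<in> units1"
  then have "pstr P (p2 (unit_lift u)) = pstr P \<one>\<^bsub>PMon P\<^esub>"
    by (simp add: p unit_lift units1D alpha)
  then have "p2 (unit_lift u) = \<one>\<^bsub>PMon P\<^esub>"
    using u by (intro log_ring_unit_inj[OF P]) (simp_all add: p2_simps unit_lift units1D alpha)
  then show ?thesis using u by (simp add: mon.ker_def unit_lift units1D)
qed

text \<open>The kernel is a group because the retraction is replete, so the structure map sends it to units.\<close>

lemma ker_unit_lift:
  assumes k: "k \<in> mon.ker"
  shows "pstr Q k \<in> units1" "k = unit_lift (pstr Q k)"
proof -
  obtain k' where k': "k' \<in> mon.ker" "k \<otimes>\<^bsub>PMon Q\<^esub> k' = \<one>\<^bsub>PMon Q\<^esub>"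
    using mon.replete_ker_inverse[OF replete k] by blast
  have c: "k \<in> carrier (PMon Q)" "k' \<in> carrier (PMon Q)" "p2 k = \<one>\<^bsub>PMon P\<^esub>" using k k' by (auto simp: mon.ker_def)
  have e: "pstr Q k \<otimes>\<^bsub>PRing Q\<^esub> pstr Q k' = \<one>\<^bsub>PRing Q\<^esub>" using arg_cong[OF k'(2), of "pstr Q"] c by (simp add: beta)
  then have "pstr Q k' \<otimes>\<^bsub>PRing Q\<^esub> pstr Q k = \<one>\<^bsub>PRing Q\<^esub>" using c by (simp add: B.m_comm beta)
  then have "pstr Q k \<in> Units (PRing Q)" using c e beta(1) unfolding Units_def by blast
  moreover have "p1 (pstr Q k) = \<one>\<^bsub>PRing P\<^esub>" using c by (simp flip: p add: alpha)
  ultimately show 1: "pstr Q k \<in> units1" by (simp add: units1_def)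
  show "k = unit_lift (pstr Q k)" by (rule unit_lift_unique) (simp_all add: c units1D[OF 1])
qed

lemma normal_form_ex: "n \<in> carrier (PMon Q) \<Longrightarrow> \<exists>u. u \<in> units1 \<and> n = s2 (p2 n) \<otimes>\<^bsub>PMon Q\<^esub> unit_lift u"
  using mon.replete_decomposition[OF replete, of n] ker_unit_lift by metis

lemma normal_form_unique:
  assumes "m \<in> carrier (PMon P)" "u \<in> units1" "u' \<in> units1"
    "s2 m \<otimes>\<^bsub>PMon Q\<^esub> unit_lift u = s2 m \<otimes>\<^bsub>PMon Q\<^esub> unit_lift u'"
  shows "u = u'"
proof -
  have "unit_lift u = unit_lift u'"
    by (rule mon.replete_decomposition_unique[OF replete assms(1)]) (use assms in \<open>simp_all add: unit_lift_ker\<close>)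
  then show ?thesis using assms(2,3) unit_lift(2) units1D(1) by metis
qed

definition unit_part :: "'n \<Rightarrow> 'b" where
  "unit_part n = (SOME u. u \<in> units1 \<and> n = s2 (p2 n) \<otimes>\<^bsub>PMon Q\<^esub> unit_lift u)"

lemma unit_part:
  assumes "n \<in> carrier (PMon Q)"
  shows "unit_part n \<in> units1" "s2 (p2 n) \<otimes>\<^bsub>PMon Q\<^esub> unit_lift (unit_part n) = n"
  using someI_ex[OF normal_form_ex[OF assms]] unfolding unit_part_def by metis+

lemma normal_form:
  assumes "m \<in> carrier (PMon P)" "u \<in> units1"
  shows "s2 m \<otimes>\<^bsub>PMon Q\<^esub> unit_lift u \<in> carrier (PMon Q)" "p2 (s2 m \<otimes>\<^bsub>PMon Q\<^esub> unit_lift u) = m"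
    "unit_part (s2 m \<otimes>\<^bsub>PMon Q\<^esub> unit_lift u) = u"
    "pstr Q (s2 m \<otimes>\<^bsub>PMon Q\<^esub> unit_lift u) = s1 (pstr P m) \<otimes>\<^bsub>PRing Q\<^esub> u"
proof -
  have k: "unit_lift u \<in> carrier (PMon Q)" "p2 (unit_lift u) = \<one>\<^bsub>PMon P\<^esub>"
    using unit_lift_ker[OF assms(2)] by (auto simp: mon.ker_def)
  show 1: "s2 m \<otimes>\<^bsub>PMon Q\<^esub> unit_lift u \<in> carrier (PMon Q)" "p2 (s2 m \<otimes>\<^bsub>PMon Q\<^esub> unit_lift u) = m"
    using assms k by (simp_all add: s2_simps p2_simps ps2)
  show "unit_part (s2 m \<otimes>\<^bsub>PMon Q\<^esub> unit_lift u) = u"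
    by (rule normal_form_unique[OF assms(1)]) (use unit_part[OF 1(1)] 1 assms in simp_all)
  show "pstr Q (s2 m \<otimes>\<^bsub>PMon Q\<^esub> unit_lift u) = s1 (pstr P m) \<otimes>\<^bsub>PRing Q\<^esub> u"
    using assms k by (simp add: beta s2_simps s unit_lift units1D)
qed

lemma unit_part_mult:
  assumes n: "n \<in> carrier (PMon Q)" "n' \<in> carrier (PMon Q)"
  shows "unit_part (n \<otimes>\<^bsub>PMon Q\<^esub> n') = unit_part n \<otimes>\<^bsub>PRing Q\<^esub> unit_part n'"
proof -
  note u = unit_part[OF n(1)] unit_part[OF n(2)]
  have "n \<otimes>\<^bsub>PMon Q\<^esub> n' = (s2 (p2 n) \<otimes>\<^bsub>PMon Q\<^esub> unit_lift (unit_part n)) \<otimes>\<^bsub>PMon Q\<^esub>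
     (s2 (p2 n') \<otimes>\<^bsub>PMon Q\<^esub> unit_lift (unit_part n'))"
    by (simp only: u)
  also have "\<dots> = s2 (p2 n \<otimes>\<^bsub>PMon P\<^esub> p2 n') \<otimes>\<^bsub>PMon Q\<^esub> unit_lift (unit_part n \<otimes>\<^bsub>PRing Q\<^esub> unit_part n')"
    using n u(1,3) by (simp add: s2_simps p2_simps unit_lift_mult units1D unit_lift N.m_ac)
  finally show ?thesis using normal_form(3)[of "p2 n \<otimes>\<^bsub>PMon P\<^esub> p2 n'" "unit_part n \<otimes>\<^bsub>PRing Q\<^esub> unit_part n'"] n u
    by (simp add: p2_simps units1_closed)
qed

lemma unit_part_section: "m \<in> carrier (PMon P) \<Longrightarrow> unit_part (s2 m) = \<one>\<^bsub>PRing Q\<^esub>"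
  using normal_form(3)[of m "\<one>\<^bsub>PRing Q\<^esub>"] by (simp add: units1_closed unit_lift_one s2_simps)

lemma structure_normal_form:
  "n \<in> carrier (PMon Q) \<Longrightarrow> pstr Q n = s1 (pstr P (p2 n)) \<otimes>\<^bsub>PRing Q\<^esub> unit_part n"
  using normal_form(4)[of "p2 n" "unit_part n"] unit_part[of n] by (simp add: p2_simps)

end

text \<open>In the normal form \<open>(m, u)\<close> of monoid elements, a ring map \<open>r\<close> over and under \<open>P\<close> can only act by
  \<open>(m, u) \<mapsto> (m, r u)\<close>.\<close>

locale split_log_pair = X: split_log P Q s1 s2 p1 p2 + Y: split_log P Q' s1' s2' p1' p2'
  for P :: "('a, 'm) prelog" and Q :: "('b, 'n) prelog" and s1 s2 p1 p2
    and Q' :: "('c, 'k) prelog" and s1' s2' p1' p2' +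
  fixes r :: "'b \<Rightarrow> 'c"
  assumes r: "r \<in> ring_hom (PRing Q) (PRing Q')"
    and rs: "a \<in> carrier (PRing P) \<Longrightarrow> r (s1 a) = s1' a"
    and pr: "b \<in> carrier (PRing Q) \<Longrightarrow> p1' (r b) = p1 b"
begin

definition mon_map :: "'n \<Rightarrow> 'k" where
  "mon_map n = s2' (p2 n) \<otimes>\<^bsub>PMon Q'\<^esub> Y.unit_lift (r (X.unit_part n))"

lemma r_units: "u \<in> Units (PRing Q) \<Longrightarrow> r u \<in> Units (PRing Q')"
  by (rule ring_hom_Units[OF X.B.ring_axioms Y.B.ring_axioms r])

lemma r_units1: "u \<in> X.units1 \<Longrightarrow> r u \<in> Y.units1"
  by (auto simp: X.units1_def Y.units1_def r_units pr)

lemma mon_map: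
  shows "mon_map \<in> mon_hom (PMon Q) (PMon Q')"
    and "n \<in> carrier (PMon Q) \<Longrightarrow> pstr Q' (mon_map n) = r (pstr Q n)"
    and "m \<in> carrier (PMon P) \<Longrightarrow> mon_map (s2 m) = s2' m"
    and "n \<in> carrier (PMon Q) \<Longrightarrow> p2' (mon_map n) = p2 n"
proof -
  show "mon_map \<in> mon_hom (PMon Q) (PMon Q')"
  proof (rule mon_homI)
    fix n n' assume n: "n \<in> carrier (PMon Q)" "n' \<in> carrier (PMon Q)"
    note u = r_units1[OF X.unit_part(1)[OF n(1)]] r_units1[OF X.unit_part(1)[OF n(2)]]
    have c: "X.unit_part n \<in> carrier (PRing Q)" "X.unit_part n' \<in> carrier (PRing Q)"
      using X.unit_part(1) n X.units1D by blast+
    show "mon_map n \<in> carrier (PMon Q')" unfolding mon_map_def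
      using u n by (simp add: Y.normal_form X.p2_simps)
    show "mon_map (n \<otimes>\<^bsub>PMon Q\<^esub> n') = mon_map n \<otimes>\<^bsub>PMon Q'\<^esub> mon_map n'"
      unfolding mon_map_def using n u c
      by (simp add: X.p2_simps X.unit_part_mult ring_hom_mult[OF r] Y.unit_lift_mult Y.units1D Y.s2_simps Y.unit_lift Y.N.m_ac)
  next
    show "mon_map \<one>\<^bsub>PMon Q\<^esub> = \<one>\<^bsub>PMon Q'\<^esub>"
      using X.unit_part_section[of "\<one>\<^bsub>PMon P\<^esub>"]
      by (simp add: mon_map_def X.p2_simps X.s2_simps Y.s2_simps ring_hom_one[OF r] Y.unit_lift_one)
  qed
  show "m \<in> carrier (PMon P) \<Longrightarrow> mon_map (s2 m) = s2' m"
    by (simp add: mon_map_def X.ps2 X.unit_part_section ring_hom_one[OF r] Y.unit_lift_one Y.s2_simps)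
  show "p2' (mon_map n) = p2 n" if n: "n \<in> carrier (PMon Q)"
    unfolding mon_map_def using n by (simp add: Y.normal_form X.p2_simps r_units1 X.unit_part)
  show "pstr Q' (mon_map n) = r (pstr Q n)" if n: "n \<in> carrier (PMon Q)"
    using n X.unit_part(1)[OF n]
    by (simp add: mon_map_def Y.normal_form X.p2_simps r_units1 X.structure_normal_form ring_hom_mult[OF r]
        X.s1_simps X.alpha X.units1D rs)
qed

lemma mon_map_unique:
  assumes v: "v \<in> mon_hom (PMon Q) (PMon Q')"
    and b: "\<And>n. n \<in> carrier (PMon Q) \<Longrightarrow> pstr Q' (v n) = r (pstr Q n)"
    and vs: "\<And>m. m \<in> carrier (PMon P) \<Longrightarrow> v (s2 m) = s2' m"
    and n: "n \<in> carrier (PMon Q)"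
  shows "v n = mon_map n"
proof -
  let ?u = "X.unit_part n"
  note u = X.unit_part[OF n] and V = mon_homD[OF v]
  have l: "X.unit_lift ?u \<in> carrier (PMon Q)" using u by (simp add: X.unit_lift X.units1D)
  have "v n = v (s2 (p2 n) \<otimes>\<^bsub>PMon Q\<^esub> X.unit_lift ?u)" by (simp only: u)
  also have "\<dots> = s2' (p2 n) \<otimes>\<^bsub>PMon Q'\<^esub> v (X.unit_lift ?u)"
    using n l by (simp add: V X.s2_simps X.p2_simps vs)
  also have "v (X.unit_lift ?u) = Y.unit_lift (r ?u)"
    using l u by (intro Y.unit_lift_unique) (simp_all add: V r_units X.units1D b X.unit_lift)
  finally show ?thesis by (simp add: mon_map_def)
qed

end

section \<open>The forgetful functor to augmented rings\<close>

lemma Log_simps: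
  "P \<in> Obj Log_cat \<longleftrightarrow> log_ring P"
  "(f, g) \<in> Hom Log_cat P Q \<longleftrightarrow> f \<in> ring_hom (PRing P) (PRing Q) \<and> g \<in> mon_hom (PMon P) (PMon Q) \<and>
     (\<forall>m\<in>carrier (PMon P). pstr Q (g m) = f (pstr P m)) \<and>
     f \<in> extensional (carrier (PRing P)) \<and> g \<in> extensional (carrier (PMon P))"
  "Ident Log_cat P = (\<lambda>x\<in>carrier (PRing P). x, \<lambda>x\<in>carrier (PMon P). x)"
  "Comp Log_cat P Q R (f', g') (f, g) =
     (compose (carrier (PRing P)) f' f, compose (carrier (PMon P)) g' g)"
  by (simp_all add: Log_cat_simps PreLog_cat_simps)

lemma compose_eq_restrict_iff:
  "compose A g f = (\<lambda>x\<in>A. x) \<longleftrightarrow> (\<forall>x\<in>A. g (f x) = x)"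
  by (auto simp: compose_def fun_eq_iff)

lemma compose_eq_iff:
  "h \<in> extensional A \<Longrightarrow> compose A g f = h \<longleftrightarrow> (\<forall>x\<in>A. g (f x) = h x)"
  by (auto simp: compose_def fun_eq_iff extensional_def)

lemma LogRep_cat_simps:
  "Ident (LogRep_cat P) (Q, s, p) = (\<lambda>x\<in>carrier (PRing Q). x, \<lambda>x\<in>carrier (PMon Q). x)"
  "Comp (LogRep_cat P) (Q, s, p) (Q', s', p') (Q'', s'', p'') (f', g') (f, g) =
     (compose (carrier (PRing Q)) f' f, compose (carrier (PMon Q)) g' g)"
  by (simp_all add: LogRep_cat_def under_over_cat_simps Log_simps)

lemma LogRep_obj_iff:
  assumes P: "log_ring P"
  shows "(Q, (s1, s2), (p1, p2)) \<in> Obj (LogRep_cat P) \<longleftrightarrow> split_log P Q s1 s2 p1 p2 \<and>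
    s1 \<in> extensional (carrier (PRing P)) \<and> s2 \<in> extensional (carrier (PMon P)) \<and>
    p1 \<in> extensional (carrier (PRing Q)) \<and> p2 \<in> extensional (carrier (PMon Q))"
  unfolding LogRep_cat_def full_subcat_simps mem_Collect_eq under_over_cat_simps split_log_def Log_simps
    prod.case prod.inject compose_eq_restrict_iff snd_conv
  using P by blast

lemma LogRep_hom_iff:
  "(f, g) \<in> Hom (LogRep_cat P) (Q, (s1, s2), (p1, p2)) (Q', (s1', s2'), (p1', p2')) \<longleftrightarrow>
    (f, g) \<in> Hom Log_cat Q Q' \<and>
    compose (carrier (PRing P)) f s1 = s1' \<and> compose (carrier (PMon P)) g s2 = s2' \<and>
    compose (carrier (PRing Q)) p1' f = p1 \<and> compose (carrier (PMon Q)) p2' g = p2"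
  unfolding LogRep_cat_def full_subcat_simps under_over_cat_simps Log_simps prod.inject by blast

lemma category_LogRep_cat:
  assumes "log_ring P"
  shows "category (LogRep_cat P)"
  unfolding LogRep_cat_def
  by (intro category_full_subcat category_under_over_cat category_Log_cat) (simp add: Log_simps assms)

lemma augRing_simps:
  "(B, s, p) \<in> Obj (under_over_cat CRing_cat A) \<longleftrightarrow> cring B \<and> s \<in> ring_hom A B \<and> s \<in> extensional (carrier A) \<and>
     p \<in> ring_hom B A \<and> p \<in> extensional (carrier B) \<and> (\<forall>a\<in>carrier A. p (s a) = a)"
  "f \<in> Hom (under_over_cat CRing_cat A) (B, s, p) (B', s', p') \<longleftrightarrow>
     f \<in> ring_hom B B' \<and> f \<in> extensional (carrier B) \<and>
     compose (carrier A) f s = s' \<and> compose (carrier B) p' f = p"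
  "Ident (under_over_cat CRing_cat A) (B, s, p) = (\<lambda>x\<in>carrier B. x)"
  "Comp (under_over_cat CRing_cat A) (B, s, p) (B', s', p') (B'', s'', p'') g f = compose (carrier B) g f"
  by (auto simp: under_over_cat_simps CRing_cat_simps compose_eq_restrict_iff)

lemma forget_log_simps [simp]:
  "fobj forget_log (Q, s, p) = (PRing Q, fst s, fst p)" "fmor forget_log X Y f = fst f"
  by (simp_all add: forget_log_def)

text \<open>The locale turns a map of augmented rings into a map of log rings, in exactly one way (\<open>mon_map\<close>,
  \<open>mon_map_unique\<close>). This is the source of fullness and faithfulness below.\<close>

lemma LogRep_hom_split_log_pair:
  assumes P: "log_ring P"
    and X: "(Q, (s1, s2), (p1, p2)) \<in> Obj (LogRep_cat P)"
    and Y: "(Q', (s1', s2'), (p1', p2')) \<in> Obj (LogRep_cat P)"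
    and r: "r \<in> Hom (under_over_cat CRing_cat (PRing P)) (PRing Q, s1, p1) (PRing Q', s1', p1')"
  shows "split_log_pair P Q s1 s2 p1 p2 Q' s1' s2' p1' p2' r"
proof -
  interpret X: split_log P Q s1 s2 p1 p2 using X LogRep_obj_iff[OF P] by blast
  interpret Y: split_log P Q' s1' s2' p1' p2' using Y LogRep_obj_iff[OF P] by blast
  have h: "compose (carrier (PRing P)) r s1 = s1'" "compose (carrier (PRing Q)) p1' r = p1" "r \<in> ring_hom (PRing Q) (PRing Q')"
    using r by (simp_all add: augRing_simps)
  show ?thesis
  proof unfold_locales
    show "r \<in> ring_hom (PRing Q) (PRing Q')" by fact
    show "r (s1 a) = s1' a" if "a \<in> carrier (PRing P)" for a using h(1) compose_apply[OF that, of r s1] by simp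
    show "p1' (r b) = p1 b" if "b \<in> carrier (PRing Q)" for b using h(2) compose_apply[OF that, of p1' r] by simp
  qed
qed

lemma LogRep_hom_fst:
  assumes "f \<in> Hom (LogRep_cat P) X Y"
  shows "fst f \<in> Hom (under_over_cat CRing_cat (PRing P)) (fobj forget_log X) (fobj forget_log Y)"
  using assms by (cases f; cases X; cases Y) (auto simp: LogRep_hom_iff augRing_simps Log_simps split: prod.splits)

lemma LogRep_hom_lift:
  assumes P: "log_ring P" and X: "X \<in> Obj (LogRep_cat P)" and Y: "Y \<in> Obj (LogRep_cat P)"
    and r: "r \<in> Hom (under_over_cat CRing_cat (PRing P)) (fobj forget_log X) (fobj forget_log Y)"
  shows "\<exists>v. (r, v) \<in> Hom (LogRep_cat P) X Y"
proof -
  obtain Q s1 s2 p1 p2 where X': "X = (Q, (s1, s2), (p1, p2))" by (metis prod.exhaust)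
  obtain Q' s1' s2' p1' p2' where Y': "Y = (Q', (s1', s2'), (p1', p2'))" by (metis prod.exhaust)
  note e = X' Y'
  have r': "r \<in> Hom (under_over_cat CRing_cat (PRing P)) (PRing Q, s1, p1) (PRing Q', s1', p1')"
    using r by (simp add: e)
  interpret split_log_pair P Q s1 s2 p1 p2 Q' s1' s2' p1' p2' r
    by (rule LogRep_hom_split_log_pair[OF P X[unfolded e] Y[unfolded e] r'])
  have ext: "s2' \<in> extensional (carrier (PMon P))" "p2 \<in> extensional (carrier (PMon Q))"
    using X Y by (simp_all add: e LogRep_obj_iff[OF P])
  have "restrict mon_map (carrier (PMon Q)) \<in> mon_hom (PMon Q) (PMon Q')"
    using mon_homD[OF mon_map(1)] by (intro mon_homI) simp_all
  moreover have "compose (carrier (PMon P)) (restrict mon_map (carrier (PMon Q))) s2 = s2'"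
    using ext by (simp add: compose_eq_iff X.s2_simps mon_map)
  moreover have "compose (carrier (PMon Q)) p2' (restrict mon_map (carrier (PMon Q))) = p2"
    using ext by (simp add: compose_eq_iff mon_map)
  ultimately have "(r, restrict mon_map (carrier (PMon Q))) \<in> Hom (LogRep_cat P) X Y"
    using r' by (simp add: e LogRep_hom_iff Log_simps augRing_simps mon_map)
  from exI[of "\<lambda>v. (r, v) \<in> Hom (LogRep_cat P) X Y", OF this] show ?thesis .
qed

lemma LogRep_hom_eqI:
  assumes P: "log_ring P" and X: "X \<in> Obj (LogRep_cat P)" and Y: "Y \<in> Obj (LogRep_cat P)"
    and f: "f \<in> Hom (LogRep_cat P) X Y" and g: "g \<in> Hom (LogRep_cat P) X Y"
    and eq: "\<And>b. b \<in> carrier (PRing (fst X)) \<Longrightarrow> fst f b = fst g b"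
  shows "f = g"
proof -
  obtain Q s1 s2 p1 p2 where X': "X = (Q, (s1, s2), (p1, p2))" by (metis prod.exhaust)
  obtain Q' s1' s2' p1' p2' where Y': "Y = (Q', (s1', s2'), (p1', p2'))" by (metis prod.exhaust)
  note e = X' Y'
  obtain r v where f': "f = (r, v)" by (cases f)
  obtain r' v' where g': "g = (r', v')" by (cases g)
  have F: "(r, v) \<in> Hom Log_cat Q Q'" "compose (carrier (PMon P)) v s2 = s2'"
    using f by (simp_all add: e f' LogRep_hom_iff)
  have G: "(r', v') \<in> Hom Log_cat Q Q'" "compose (carrier (PMon P)) v' s2 = s2'"
    using g by (simp_all add: e g' LogRep_hom_iff)
  have rr: "r' = r"
    using F(1) G(1) eq by (intro extensionalityI[of _ "carrier (PRing Q)"]) (simp_all add: e f' g' Log_simps)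
  have "r \<in> Hom (under_over_cat CRing_cat (PRing P)) (PRing Q, s1, p1) (PRing Q', s1', p1')"
    using LogRep_hom_fst[OF f] by (simp add: e f')
  then interpret split_log_pair P Q s1 s2 p1 p2 Q' s1' s2' p1' p2' r
    by (rule LogRep_hom_split_log_pair[OF P X[unfolded e] Y[unfolded e]])
  have "v n = mon_map n" if n: "n \<in> carrier (PMon Q)" for n
    using F compose_apply[of _ "carrier (PMon P)" v s2] by (intro mon_map_unique n) (simp_all add: Log_simps)
  moreover have "v' n = mon_map n" if n: "n \<in> carrier (PMon Q)" for n
    using G compose_apply[of _ "carrier (PMon P)" v' s2] rr by (intro mon_map_unique n) (simp_all add: Log_simps)
  ultimately have "v = v'"
    using F(1) G(1) by (intro extensionalityI[of _ "carrier (PMon Q)"]) (simp_all add: Log_simps)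
  with rr show ?thesis by (simp add: f' g')
qed

subsection \<open>The replete log structure on an augmented ring\<close>

lemma image_group_inj:
  assumes "inj f"
  shows "carrier (image_group f G) = f ` carrier G"
    and "x \<in> carrier G \<Longrightarrow> y \<in> carrier G \<Longrightarrow> f x \<otimes>\<^bsub>image_group f G\<^esub> f y = f (x \<otimes>\<^bsub>G\<^esub> y)"
    and "\<one>\<^bsub>image_group f G\<^esub> = f \<one>\<^bsub>G\<^esub>"
  using inj_on_subset[OF assms, of "carrier G"] by (simp_all add: image_group_def)

lemma comm_monoid_image_group:
  assumes f: "inj f" and G: "comm_monoid G"
  shows "comm_monoid (image_group f G)"
proof -
  interpret comm_monoid G by fact
  show ?thesis
    by (rule comm_monoidI) (auto simp: image_group_inj[OF f] m_ac)
qed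

lemma comm_monoid_DirProd: "comm_monoid G \<Longrightarrow> comm_monoid H \<Longrightarrow> comm_monoid (G \<times>\<times> H)"
proof -
  assume "comm_monoid G" "comm_monoid H"
  then interpret G: comm_monoid G + H: comm_monoid H .
  show ?thesis
    by (rule comm_monoidI) (auto simp: G.m_ac H.m_ac mult_DirProd')
qed

text \<open>The replete log structure on an augmented ring \<open>(B, s, p)\<close> is \<open>M \<oplus> U\<close>, where \<open>U\<close> is the group
  of the units \<open>u\<close> with \<open>p u = 1\<close>. Here \<open>U\<close> is given up to an isomorphism \<open>\<kappa> : K \<rightarrow> U\<close>, since for
  a square-zero extension \<open>A \<oplus> J\<close> one takes \<open>K = J\<close> and \<open>\<kappa> j = (1, j)\<close>.\<close>

lemma split_log_image_group:
  fixes P :: "('a, 'm) prelog" and pr :: "'m \<times> 'k \<Rightarrow> 'n" and K :: "('k, 'z) monoid_scheme"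
  assumes pr: "inj pr" and P: "log_ring P" and B: "cring (PRing Q)"
    and s1: "s1 \<in> ring_hom (PRing P) (PRing Q)" and p1: "p1 \<in> ring_hom (PRing Q) (PRing P)"
    and ps1: "\<And>a. a \<in> carrier (PRing P) \<Longrightarrow> p1 (s1 a) = a"
    and K: "comm_group K" and \<kappa>: "\<kappa> \<in> mon_hom K (PRing Q)"
    and \<kappa>_bij: "bij_betw \<kappa> (carrier K) {u \<in> Units (PRing Q). p1 u = \<one>\<^bsub>PRing P\<^esub>}"
    and N: "PMon Q = image_group pr (PMon P \<times>\<times> K)"
    and str: "\<And>m k. m \<in> carrier (PMon P) \<Longrightarrow> k \<in> carrier K \<Longrightarrow>
      pstr Q (pr (m, k)) = s1 (pstr P m) \<otimes>\<^bsub>PRing Q\<^esub> \<kappa> k"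
    and s2: "\<And>m. m \<in> carrier (PMon P) \<Longrightarrow> s2 m = pr (m, \<one>\<^bsub>K\<^esub>)"
    and p2: "\<And>m k. m \<in> carrier (PMon P) \<Longrightarrow> k \<in> carrier K \<Longrightarrow> p2 (pr (m, k)) = m"
  shows "split_log P Q s1 s2 p1 p2"
proof -
  have preP: "prelog_ring P" using P by (simp add: log_ring_def)
  interpret A: cring "PRing P" by (rule prelog_ringD(1)[OF preP])
  interpret B: cring "PRing Q" by (rule B)
  interpret M: comm_monoid "PMon P" by (rule prelog_ringD(2)[OF preP])
  interpret K: comm_group K by (rule K)
  note alpha = mon_homD[OF prelog_ringD(3)[OF preP]]
  note kappa = mon_homD[OF \<kappa>]
  note s1' = ring_hom_closed[OF s1] ring_hom_mult[OF s1] ring_hom_one[OF s1]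
  note p1' = ring_hom_closed[OF p1] ring_hom_mult[OF p1] ring_hom_one[OF p1]
  have kU: "\<kappa> k \<in> Units (PRing Q)" "p1 (\<kappa> k) = \<one>\<^bsub>PRing P\<^esub>" if "k \<in> carrier K" for k
    using bij_betwE[OF \<kappa>_bij] that by auto
  have carrN: "carrier (PMon Q) = pr ` (carrier (PMon P) \<times> carrier K)"
    by (simp add: N image_group_inj[OF pr])
  have multN: "pr (m, k) \<otimes>\<^bsub>PMon Q\<^esub> pr (m', k') = pr (m \<otimes>\<^bsub>PMon P\<^esub> m', k \<otimes>\<^bsub>K\<^esub> k')"
    if "m \<in> carrier (PMon P)" "k \<in> carrier K" "m' \<in> carrier (PMon P)" "k' \<in> carrier K" for m k m' k'
    using that by (simp add: N image_group_inj[OF pr])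
  have oneN: "\<one>\<^bsub>PMon Q\<^esub> = pr (\<one>\<^bsub>PMon P\<^esub>, \<one>\<^bsub>K\<^esub>)" by (simp add: N image_group_inj[OF pr])
  have cmN: "comm_monoid (PMon Q)"
    unfolding N using K.comm_monoid_axioms M.comm_monoid_axioms by (intro comm_monoid_image_group pr comm_monoid_DirProd)
  have strN: "pstr Q \<in> mon_hom (PMon Q) (PRing Q)"
    by (rule mon_homI) (auto simp: carrN multN oneN str s1' alpha kappa B.m_ac)
  have preQ: "prelog_ring Q" using B cmN strN by (simp add: prelog_ring_def)
  have s2m: "s2 \<in> mon_hom (PMon P) (PMon Q)"
    by (rule mon_homI) (auto simp: carrN multN oneN s2)
  have p2m: "p2 \<in> mon_hom (PMon Q) (PMon P)"
    by (rule mon_homI) (auto simp: carrN multN oneN p2)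
  have ps2: "p2 (s2 m) = m" if "m \<in> carrier (PMon P)" for m using that by (simp add: s2 p2)
  have s: "pstr Q (s2 m) = s1 (pstr P m)" if "m \<in> carrier (PMon P)" for m
    using that by (simp add: s2 str kappa s1' alpha)
  have p: "pstr P (p2 n) = p1 (pstr Q n)" if "n \<in> carrier (PMon Q)" for n
    using that by (auto simp: carrN p2 str p1' s1' alpha kappa kU ps1)
  have logQ: "log_ring Q"
  proof (rule log_ringI[OF preQ])
    fix u assume u: "u \<in> Units (PRing Q)"
    have pu: "p1 u \<in> Units (PRing P)" by (rule ring_hom_Units[OF B.ring_axioms A.ring_axioms p1 u])
    obtain m where m: "m \<in> carrier (PMon P)" "pstr P m = p1 u" using log_ring_unit_lift[OF P pu] by blast
    have su: "s1 (p1 u) \<in> Units (PRing Q)" by (rule ring_hom_Units[OF A.ring_axioms B.ring_axioms s1 pu])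
    \<comment> \<open>A unit \<open>u\<close> is \<open>s1 (p1 u)\<close>, which comes from the log ring \<open>P\<close>, times a unit \<open>w\<close> over \<open>1\<close>.\<close>
    define w where "w = inv\<^bsub>PRing Q\<^esub> (s1 (p1 u)) \<otimes>\<^bsub>PRing Q\<^esub> u"
    have uc: "u \<in> carrier (PRing Q)" "s1 (p1 u) \<in> carrier (PRing Q)" "p1 u \<in> carrier (PRing P)"
      using u su pu by (simp_all add: A.Units_closed B.Units_closed)
    have w: "w \<in> Units (PRing Q)" "w \<in> carrier (PRing Q)" using u su by (simp_all add: w_def B.Units_closed)
    have sw: "s1 (p1 u) \<otimes>\<^bsub>PRing Q\<^esub> w = u" using u su uc by (simp add: w_def flip: B.m_assoc)
    then have "p1 u \<otimes>\<^bsub>PRing P\<^esub> p1 w = p1 u \<otimes>\<^bsub>PRing P\<^esub> \<one>\<^bsub>PRing P\<^esub>"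
      using p1'(2)[OF uc(2) w(2)] uc by (simp add: ps1)
    then have "p1 w = \<one>\<^bsub>PRing P\<^esub>"
      using A.Units_l_cancel[OF pu p1'(1)[OF w(2)] A.one_closed] by blast
    then have "w \<in> {u \<in> Units (PRing Q). p1 u = \<one>\<^bsub>PRing P\<^esub>}" using w by simp
    then have "w \<in> \<kappa> ` carrier K" using \<kappa>_bij by (simp add: bij_betw_def)
    then obtain k where k: "k \<in> carrier K" "\<kappa> k = w" by blast
    have "pstr Q (pr (m, k)) = u" using m k sw by (simp add: str)
    then show "\<exists>m\<in>carrier (PMon Q). pstr Q m = u" using m k carrN by blast
  next
    fix n n' assume "n \<in> carrier (PMon Q)" "n' \<in> carrier (PMon Q)"
      and u: "pstr Q n \<in> Units (PRing Q)" and eq: "pstr Q n' = pstr Q n"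
    then obtain m k m' k' where e: "n = pr (m, k)" "n' = pr (m', k')"
      and c: "m \<in> carrier (PMon P)" "k \<in> carrier K" "m' \<in> carrier (PMon P)" "k' \<in> carrier K"
      by (auto simp: carrN)
    have pc: "p1 (pstr Q (pr (m, k))) = pstr P m" if "m \<in> carrier (PMon P)" "k \<in> carrier K" for m k
      using that by (simp add: str p1' s1' alpha kappa kU ps1)
    have um: "pstr P m \<in> Units (PRing P)"
      using ring_hom_Units[OF B.ring_axioms A.ring_axioms p1 u] c by (simp add: e pc)
    have "pstr P m' = pstr P m" using arg_cong[OF eq, of p1] c by (simp add: e pc)
    then have mm: "m' = m" using log_ring_unit_inj[OF P] c um by blast
    have "s1 (pstr P m) \<in> Units (PRing Q)" by (rule ring_hom_Units[OF A.ring_axioms B.ring_axioms s1 um])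
    then have "\<kappa> k' = \<kappa> k" using eq c by (simp add: e mm str B.Units_l_cancel kappa)
    then have "k' = k" using \<kappa>_bij c by (auto simp: bij_betw_def inj_on_def)
    then show "n' = n" by (simp add: e mm)
  qed
  interpret S: split_mon "PMon Q" "PMon P" s2 p2
    by (rule split_mon.intro) (simp_all add: cmN M.comm_monoid_axioms s2m p2m ps2)
  have ker: "S.ker = (\<lambda>k. pr (\<one>\<^bsub>PMon P\<^esub>, k)) ` carrier K"
    unfolding S.ker_def carrN by (auto simp: p2)
  have "replete (PMon Q) (PMon P) p2"
  proof (rule S.repleteI)
    fix k assume "k \<in> S.ker"
    then obtain l where "k = pr (\<one>\<^bsub>PMon P\<^esub>, l)" "l \<in> carrier K" by (auto simp: ker)
    then show "\<exists>k'\<in>S.ker. k \<otimes>\<^bsub>PMon Q\<^esub> k' = \<one>\<^bsub>PMon Q\<^esub>"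
      by (intro bexI[of _ "pr (\<one>\<^bsub>PMon P\<^esub>, inv\<^bsub>K\<^esub> l)"]) (simp_all add: ker multN oneN)
  next
    fix n assume "n \<in> carrier (PMon Q)"
    then show "\<exists>k\<in>S.ker. n = s2 (p2 n) \<otimes>\<^bsub>PMon Q\<^esub> k"
      by (auto simp: carrN ker p2 s2 multN)
  next
    fix m k k' assume "m \<in> carrier (PMon P)" "k \<in> S.ker" "k' \<in> S.ker" "s2 m \<otimes>\<^bsub>PMon Q\<^esub> k = s2 m \<otimes>\<^bsub>PMon Q\<^esub> k'"
    then show "k = k'" by (auto simp: ker s2 multN inj_eq[OF pr])
  qed
  then show ?thesis
    by (intro split_log.intro) (simp_all add: P logQ s1 s2m s p1 p2m p ps1 ps2)
qed

lemma forget_log_surj: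
  fixes P :: "('u, 'u) prelog" and pr :: "'u \<times> 'u \<Rightarrow> 'u"
  assumes pr: "inj pr" and P: "log_ring P" and Y: "Y \<in> Obj (under_over_cat CRing_cat (PRing P))"
  shows "\<exists>X\<in>Obj (LogRep_cat P). fobj forget_log X = Y"
proof -
  obtain B s p where e: "Y = (B, s, p)" by (cases Y)
  have h: "cring B" "s \<in> ring_hom (PRing P) B" "s \<in> extensional (carrier (PRing P))"
     "p \<in> ring_hom B (PRing P)" "p \<in> extensional (carrier B)" "\<And>a. a\<in>carrier (PRing P) \<Longrightarrow> p (s a) = a"
    using Y by (auto simp: e augRing_simps)
  have preP: "prelog_ring P" using P by (simp add: log_ring_def)
  interpret A: cring "PRing P" by (rule prelog_ringD(1)[OF preP])
  interpret B: cring B by (rule h)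
  note p' = ring_hom_closed[OF h(4)] ring_hom_mult[OF h(4)] ring_hom_one[OF h(4)]
  define U where "U = {u \<in> Units B. p u = \<one>\<^bsub>PRing P\<^esub>}"
  define K where "K = (units_of B)\<lparr>carrier := U\<rparr>"
  have K: "comm_group K"
  proof -
    interpret G: comm_group "units_of B" by (rule B.units_comm_group)
    have "subgroup U (units_of B)"
    proof (rule G.subgroupI)
      show "U \<subseteq> carrier (units_of B)" by (auto simp: U_def units_of_def)
      show "U \<noteq> {}" using p' by (auto simp: U_def)
      show "inv\<^bsub>units_of B\<^esub> u \<in> U" if u: "u \<in> U" for u
      proof -
        have "p (inv\<^bsub>B\<^esub> u) = p u \<otimes>\<^bsub>PRing P\<^esub> p (inv\<^bsub>B\<^esub> u)" using u p' by (simp add: U_def)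
        also have "\<dots> = \<one>\<^bsub>PRing P\<^esub>" using u p'(2)[of u "inv\<^bsub>B\<^esub> u"] p'(3) by (simp add: U_def B.Units_closed)
        finally have "p (inv\<^bsub>B\<^esub> u) = \<one>\<^bsub>PRing P\<^esub>" .
        then show ?thesis using u by (simp add: U_def B.units_of_inv)
      qed
      show "u \<otimes>\<^bsub>units_of B\<^esub> v \<in> U" if "u \<in> U" "v \<in> U" for u v
        using that by (simp add: U_def units_of_def p' B.Units_closed)
    qed
    then have "group K" unfolding K_def by (rule subgroup.subgroup_is_group[OF _ G.is_group])
    then show ?thesis
      by (rule group.group_comm_groupI) (auto simp: K_def U_def units_of_def B.Units_closed B.m_comm)
  qed
  define Q where "Q = \<lparr>PRing = B, PMon = image_group pr (PMon P \<times>\<times> K),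
    pstr = (\<lambda>z. case inv_into UNIV pr z of (m, k) \<Rightarrow> s (pstr P m) \<otimes>\<^bsub>B\<^esub> k)\<rparr>"
  define s2 where "s2 = (\<lambda>m\<in>carrier (PMon P). pr (m, \<one>\<^bsub>K\<^esub>))"
  define p2 where "p2 = (\<lambda>z\<in>carrier (PMon Q). fst (inv_into UNIV pr z))"
  have "split_log P Q s s2 p p2"
  proof (rule split_log_image_group[OF pr P, where K = K and \<kappa> = "\<lambda>k. k"])
    show "(\<lambda>k. k) \<in> mon_hom K (PRing Q)"
      by (rule mon_homI) (auto simp: K_def U_def Q_def units_of_def)
    show "bij_betw (\<lambda>k. k) (carrier K) {u \<in> Units (PRing Q). p u = \<one>\<^bsub>PRing P\<^esub>}"
      by (simp add: K_def U_def Q_def bij_betw_def)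
  qed (simp_all add: Q_def h K s2_def p2_def image_group_inj[OF pr] inv_f_f[OF pr])
  then have "(Q, (s, s2), (p, p2)) \<in> Obj (LogRep_cat P)"
    using h by (simp add: LogRep_obj_iff[OF P] s2_def p2_def Q_def)
  then show ?thesis by (intro bexI[of _ "(Q, (s, s2), (p, p2))"]) (simp_all add: e Q_def)
qed

lemma is_functor_forget_log:
  assumes P: "log_ring P"
  shows "is_functor (LogRep_cat P) (under_over_cat CRing_cat (PRing P)) forget_log"
  unfolding is_functor_def
proof (intro conjI ballI)
  show "category (LogRep_cat P)" by (rule category_LogRep_cat[OF P])
  have "cring (PRing P)" using P by (simp add: log_ring_def prelog_ringD)
  then show "category (under_over_cat CRing_cat (PRing P))"
    by (intro category_under_over_cat category_CRing_cat) (simp add: CRing_cat_simps)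
next
  fix X assume "X \<in> Obj (LogRep_cat P)"
  moreover obtain Q s1 s2 p1 p2 where X': "X = (Q, (s1, s2), (p1, p2))" by (metis prod.exhaust)
  ultimately have o: "(Q, (s1, s2), (p1, p2)) \<in> Obj (LogRep_cat P)" by simp
  then interpret split_log P Q s1 s2 p1 p2 using LogRep_obj_iff[OF P] by blast
  show "fobj forget_log X \<in> Obj (under_over_cat CRing_cat (PRing P))"
    using o by (simp add: X' LogRep_obj_iff[OF P] augRing_simps s1 p1 ps1 B.cring_axioms)
  show "fmor forget_log X X (Ident (LogRep_cat P) X) = Ident (under_over_cat CRing_cat (PRing P)) (fobj forget_log X)"
    by (simp add: X' LogRep_cat_simps augRing_simps)
next
  fix X Y f assume "f \<in> Hom (LogRep_cat P) X Y"
  then show "fmor forget_log X Y f \<in> Hom (under_over_cat CRing_cat (PRing P)) (fobj forget_log X) (fobj forget_log Y)"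
    by (simp add: LogRep_hom_fst)
next
  fix X Y Z f g
  show "fmor forget_log X Z (Comp (LogRep_cat P) X Y Z g f) =
    Comp (under_over_cat CRing_cat (PRing P)) (fobj forget_log X) (fobj forget_log Y) (fobj forget_log Z)
     (fmor forget_log Y Z g) (fmor forget_log X Y f)"
    by (cases X; cases Y; cases Z; cases f; cases g) (simp add: LogRep_cat_simps augRing_simps)
qed

theorem forget_log_equivalence:
  fixes P :: "('u, 'u) prelog" and pr :: "'u \<times> 'u \<Rightarrow> 'u"
  assumes pr: "inj pr" and P: "log_ring P"
  shows "is_equivalence (LogRep_cat P) (under_over_cat CRing_cat (PRing P)) forget_log"
proof (rule equivalenceI[OF is_functor_forget_log[OF P]])
  fix X Y g assume "X \<in> Obj (LogRep_cat P)" "Y \<in> Obj (LogRep_cat P)"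
    "g \<in> Hom (under_over_cat CRing_cat (PRing P)) (fobj forget_log X) (fobj forget_log Y)"
  from LogRep_hom_lift[OF P this] show "\<exists>f\<in>Hom (LogRep_cat P) X Y. fmor forget_log X Y f = g" by force
next
  fix X Y f f' assume "X \<in> Obj (LogRep_cat P)" "Y \<in> Obj (LogRep_cat P)"
    "f \<in> Hom (LogRep_cat P) X Y" "f' \<in> Hom (LogRep_cat P) X Y" "fmor forget_log X Y f = fmor forget_log X Y f'"
  then show "f = f'" by (intro LogRep_hom_eqI[OF P]) simp_all
next
  fix Y assume Y: "Y \<in> Obj (under_over_cat CRing_cat (PRing P))"
  have C: "category (under_over_cat CRing_cat (PRing P))" by (rule functorD(2)[OF is_functor_forget_log[OF P]])
  obtain X where X: "X \<in> Obj (LogRep_cat P)" "fobj forget_log X = Y" using forget_log_surj[OF pr P Y] by blast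
  have "isomorphism (under_over_cat CRing_cat (PRing P)) Y Y (Ident (under_over_cat CRing_cat (PRing P)) Y)"
    unfolding isomorphism_def
    using categoryD(1)[OF C Y] categoryD(3)[OF C Y Y categoryD(1)[OF C Y]] by blast
  with X show "\<exists>X\<in>Obj (LogRep_cat P). \<exists>e. isomorphism (under_over_cat CRing_cat (PRing P)) (fobj forget_log X) Y e"
    by blast
qed

section \<open>Abelian group objects\<close>

lemma ring_hom_zero_minus:
  assumes "ring R" "ring S" "h \<in> ring_hom R S"
  shows "h \<zero>\<^bsub>R\<^esub> = \<zero>\<^bsub>S\<^esub>"
    and "x \<in> carrier R \<Longrightarrow> h (\<ominus>\<^bsub>R\<^esub> x) = \<ominus>\<^bsub>S\<^esub> h x"
    and "x \<in> carrier R \<Longrightarrow> y \<in> carrier R \<Longrightarrow> h (x \<ominus>\<^bsub>R\<^esub> y) = h x \<ominus>\<^bsub>S\<^esub> h y"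
proof -
  interpret R: ring R by fact
  interpret S: ring S by fact
  show z: "h \<zero>\<^bsub>R\<^esub> = \<zero>\<^bsub>S\<^esub>" by (rule ring_hom_zero[OF assms(3,1,2)])
  show m: "h (\<ominus>\<^bsub>R\<^esub> x) = \<ominus>\<^bsub>S\<^esub> h x" if x: "x \<in> carrier R" for x
  proof -
    have "h (\<ominus>\<^bsub>R\<^esub> x) \<oplus>\<^bsub>S\<^esub> h x = \<zero>\<^bsub>S\<^esub>"
      using x by (simp flip: ring_hom_add[OF assms(3)] add: R.l_neg z)
    then show ?thesis using x S.minus_equality ring_hom_closed[OF assms(3)] by simp
  qed
  show "x \<in> carrier R \<Longrightarrow> y \<in> carrier R \<Longrightarrow> h (x \<ominus>\<^bsub>R\<^esub> y) = h x \<ominus>\<^bsub>S\<^esub> h y"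
    by (simp add: a_minus_def ring_hom_add[OF assms(3)] m)
qed

lemma image_ring_inj:
  assumes "inj f"
  shows "carrier (image_ring f R) = f ` carrier R"
    and "x \<in> carrier R \<Longrightarrow> y \<in> carrier R \<Longrightarrow> f x \<otimes>\<^bsub>image_ring f R\<^esub> f y = f (x \<otimes>\<^bsub>R\<^esub> y)"
    and "x \<in> carrier R \<Longrightarrow> y \<in> carrier R \<Longrightarrow> f x \<oplus>\<^bsub>image_ring f R\<^esub> f y = f (x \<oplus>\<^bsub>R\<^esub> y)"
    and "\<one>\<^bsub>image_ring f R\<^esub> = f \<one>\<^bsub>R\<^esub>"
    and "\<zero>\<^bsub>image_ring f R\<^esub> = f \<zero>\<^bsub>R\<^esub>"
  using inj_on_subset[OF assms, of "carrier R"] by (simp_all add: image_ring_def image_group_def monoid.defs)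

lemma cring_image_ring:
  assumes f: "inj f" and R: "cring R"
  shows "cring (image_ring f R)"
proof -
  interpret R: cring R by fact
  show ?thesis
  proof (rule cringI)
    show "abelian_group (image_ring f R)"
      by (rule abelian_groupI) (auto simp: image_ring_inj[OF f] R.a_ac inj_eq[OF f] R.r_neg intro!: bexI[of _ "\<ominus>\<^bsub>R\<^esub> _"])
    show "Group.comm_monoid (image_ring f R)"
      by (rule comm_monoidI) (auto simp: image_ring_inj[OF f] R.m_ac)
  qed (auto simp: image_ring_inj[OF f] R.l_distr)
qed

text \<open>The fibre product of a ring with itself over \<open>A\<close>; it serves as a test object for additions.\<close>

definition fibre_square :: "'b ring \<Rightarrow> ('b \<Rightarrow> 'a) \<Rightarrow> ('b \<times> 'b) ring" where
  "fibre_square B p = \<lparr>carrier = {(b, c). b \<in> carrier B \<and> c \<in> carrier B \<and> p b = p c},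
     mult = (\<lambda>(b, c) (b', c'). (b \<otimes>\<^bsub>B\<^esub> b', c \<otimes>\<^bsub>B\<^esub> c')), one = (\<one>\<^bsub>B\<^esub>, \<one>\<^bsub>B\<^esub>),
     zero = (\<zero>\<^bsub>B\<^esub>, \<zero>\<^bsub>B\<^esub>), add = (\<lambda>(b, c) (b', c'). (b \<oplus>\<^bsub>B\<^esub> b', c \<oplus>\<^bsub>B\<^esub> c'))\<rparr>"

lemma fibre_square_simps:
  "(b, c) \<in> carrier (fibre_square B p) \<longleftrightarrow> b \<in> carrier B \<and> c \<in> carrier B \<and> p b = p c"
  "(b, c) \<otimes>\<^bsub>fibre_square B p\<^esub> (b', c') = (b \<otimes>\<^bsub>B\<^esub> b', c \<otimes>\<^bsub>B\<^esub> c')"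
  "(b, c) \<oplus>\<^bsub>fibre_square B p\<^esub> (b', c') = (b \<oplus>\<^bsub>B\<^esub> b', c \<oplus>\<^bsub>B\<^esub> c')"
  "\<one>\<^bsub>fibre_square B p\<^esub> = (\<one>\<^bsub>B\<^esub>, \<one>\<^bsub>B\<^esub>)" "\<zero>\<^bsub>fibre_square B p\<^esub> = (\<zero>\<^bsub>B\<^esub>, \<zero>\<^bsub>B\<^esub>)"
  by (simp_all add: fibre_square_def)

lemma cring_fibre_square:
  assumes B: "cring B" and A: "cring A" and p: "p \<in> ring_hom B A"
  shows "cring (fibre_square B p)"
proof -
  interpret B: cring B by fact
  note p' = ring_hom_closed[OF p] ring_hom_mult[OF p] ring_hom_add[OF p]
    ring_hom_zero_minus[OF B.ring_axioms cring.axioms(1)[OF A] p]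
  show ?thesis
  proof (rule cringI)
    show "abelian_group (fibre_square B p)"
    proof (rule abelian_groupI)
      fix x assume "x \<in> carrier (fibre_square B p)"
      then show "\<exists>y\<in>carrier (fibre_square B p). y \<oplus>\<^bsub>fibre_square B p\<^esub> x = \<zero>\<^bsub>fibre_square B p\<^esub>"
        by (cases x) (auto simp: fibre_square_simps p' B.l_neg intro!: bexI[of _ "(\<ominus>\<^bsub>B\<^esub> fst x, \<ominus>\<^bsub>B\<^esub> snd x)"])
    qed (auto simp: fibre_square_simps p' B.a_ac)
    show "Group.comm_monoid (fibre_square B p)"
      by (rule comm_monoidI) (auto simp: fibre_square_simps p' B.m_ac)
  qed (auto simp: fibre_square_simps B.l_distr)
qed

abbreviation aug_ring :: "('a, 'm) aug_prelog \<Rightarrow> 'a ring" where "aug_ring X \<equiv> PRing (fst X)"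
abbreviation aug_sec :: "('a, 'm) aug_prelog \<Rightarrow> 'a \<Rightarrow> 'a" where "aug_sec X \<equiv> fst (fst (snd X))"
abbreviation aug_prj :: "('a, 'm) aug_prelog \<Rightarrow> 'a \<Rightarrow> 'a" where "aug_prj X \<equiv> fst (snd (snd X))"

locale log_base =
  fixes P :: "('u, 'u) prelog" and pr :: "'u \<times> 'u \<Rightarrow> 'u"
  assumes pr: "inj pr" and P: "log_ring P"
begin

abbreviation "C \<equiv> LogRep_cat P"

lemma preP: "prelog_ring P" using P by (simp add: log_ring_def)

sublocale A: cring "PRing P" by (rule prelog_ringD(1)[OF preP])
sublocale M: comm_monoid "PMon P" by (rule prelog_ringD(2)[OF preP])
lemmas alpha = mon_homD[OF prelog_ringD(3)[OF preP]]

lemma catC: "category C" by (rule category_LogRep_cat[OF P])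
lemmas CD = categoryD[OF catC]

lemma pr_eq [simp]: "pr x = pr y \<longleftrightarrow> x = y" by (rule inj_eq[OF pr])
lemma inv_pr [simp]: "inv_into UNIV pr (pr x) = x" by (rule inv_f_f[OF pr])

lemma objD:
  assumes "X \<in> Obj C"
  shows "cring (aug_ring X)" "aug_sec X \<in> ring_hom (PRing P) (aug_ring X)"
    "aug_prj X \<in> ring_hom (aug_ring X) (PRing P)"
    "a \<in> carrier (PRing P) \<Longrightarrow> aug_prj X (aug_sec X a) = a"
proof -
  have "fobj forget_log X \<in> Obj (under_over_cat CRing_cat (PRing P))"
    by (rule functorD(3)[OF is_functor_forget_log[OF P] assms])
  then show "cring (aug_ring X)" "aug_sec X \<in> ring_hom (PRing P) (aug_ring X)"
    "aug_prj X \<in> ring_hom (aug_ring X) (PRing P)"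
    "a \<in> carrier (PRing P) \<Longrightarrow> aug_prj X (aug_sec X a) = a"
    by (cases X; simp add: augRing_simps)+
qed

lemma sec_simps:
  assumes "X \<in> Obj C"
  shows "a \<in> carrier (PRing P) \<Longrightarrow> aug_sec X a \<in> carrier (aug_ring X)"
    "a \<in> carrier (PRing P) \<Longrightarrow> b \<in> carrier (PRing P) \<Longrightarrow>
      aug_sec X (a \<otimes>\<^bsub>PRing P\<^esub> b) = aug_sec X a \<otimes>\<^bsub>aug_ring X\<^esub> aug_sec X b"
    "a \<in> carrier (PRing P) \<Longrightarrow> b \<in> carrier (PRing P) \<Longrightarrow>
      aug_sec X (a \<oplus>\<^bsub>PRing P\<^esub> b) = aug_sec X a \<oplus>\<^bsub>aug_ring X\<^esub> aug_sec X b"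
    "aug_sec X \<one>\<^bsub>PRing P\<^esub> = \<one>\<^bsub>aug_ring X\<^esub>"
    "aug_sec X \<zero>\<^bsub>PRing P\<^esub> = \<zero>\<^bsub>aug_ring X\<^esub>"
    "a \<in> carrier (PRing P) \<Longrightarrow> aug_prj X (aug_sec X a) = a"
  using objD[OF assms] ring_hom_zero_minus(1)[OF A.ring_axioms cring.axioms(1)[OF objD(1)[OF assms]]]
  by (simp_all add: ring_hom_closed ring_hom_mult ring_hom_add ring_hom_one)

lemma prj_simps:
  assumes "X \<in> Obj C"
  shows "a \<in> carrier (aug_ring X) \<Longrightarrow> aug_prj X a \<in> carrier (PRing P)"
    "a \<in> carrier (aug_ring X) \<Longrightarrow> b \<in> carrier (aug_ring X) \<Longrightarrow>
      aug_prj X (a \<otimes>\<^bsub>aug_ring X\<^esub> b) = aug_prj X a \<otimes>\<^bsub>PRing P\<^esub> aug_prj X b"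
    "a \<in> carrier (aug_ring X) \<Longrightarrow> b \<in> carrier (aug_ring X) \<Longrightarrow>
      aug_prj X (a \<oplus>\<^bsub>aug_ring X\<^esub> b) = aug_prj X a \<oplus>\<^bsub>PRing P\<^esub> aug_prj X b"
    "aug_prj X \<one>\<^bsub>aug_ring X\<^esub> = \<one>\<^bsub>PRing P\<^esub>"
    "aug_prj X \<zero>\<^bsub>aug_ring X\<^esub> = \<zero>\<^bsub>PRing P\<^esub>"
    "a \<in> carrier (aug_ring X) \<Longrightarrow> b \<in> carrier (aug_ring X) \<Longrightarrow>
      aug_prj X (a \<ominus>\<^bsub>aug_ring X\<^esub> b) = aug_prj X a \<ominus>\<^bsub>PRing P\<^esub> aug_prj X b"
    "a \<in> carrier (aug_ring X) \<Longrightarrow> aug_prj X (\<ominus>\<^bsub>aug_ring X\<^esub> a) = \<ominus>\<^bsub>PRing P\<^esub> aug_prj X a"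
  using ring_hom_zero_minus[OF cring.axioms(1)[OF objD(1)[OF assms]] A.ring_axioms objD(3)[OF assms]] objD(3)[OF assms]
  by (simp_all add: ring_hom_closed ring_hom_mult ring_hom_add ring_hom_one)

lemma homD:
  assumes "f \<in> Hom C X Y"
  shows "fst f \<in> ring_hom (aug_ring X) (aug_ring Y)"
    "a \<in> carrier (PRing P) \<Longrightarrow> fst f (aug_sec X a) = aug_sec Y a"
    "x \<in> carrier (aug_ring X) \<Longrightarrow> aug_prj Y (fst f x) = aug_prj X x"
proof -
  obtain Q s p where X: "X = (Q, s, p)" by (cases X)
  obtain Q' s' p' where Y: "Y = (Q', s', p')" by (cases Y)
  have h: "fst f \<in> ring_hom (PRing Q) (PRing Q')" "compose (carrier (PRing P)) (fst f) (fst s) = fst s'"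
    "compose (carrier (PRing Q)) (fst p') (fst f) = fst p"
    using LogRep_hom_fst[OF assms] by (simp_all add: X Y augRing_simps)
  show "fst f \<in> ring_hom (aug_ring X) (aug_ring Y)" using h(1) by (simp add: X Y)
  show "a \<in> carrier (PRing P) \<Longrightarrow> fst f (aug_sec X a) = aug_sec Y a"
    using h(2) by (simp add: X Y compose_def fun_eq_iff) metis
  show "x \<in> carrier (aug_ring X) \<Longrightarrow> aug_prj Y (fst f x) = aug_prj X x"
    using h(3) by (simp add: X Y compose_def fun_eq_iff) metis
qed

lemma hom_closed: "f \<in> Hom C X Y \<Longrightarrow> x \<in> carrier (aug_ring X) \<Longrightarrow> fst f x \<in> carrier (aug_ring Y)"
  by (rule ring_hom_closed[OF homD(1)])

text \<open>Fullness of the forgetful functor, for ring maps that need not be extensional.\<close>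

lemma hom_lift:
  assumes X: "X \<in> Obj C" and Y: "Y \<in> Obj C" and r: "r \<in> ring_hom (aug_ring X) (aug_ring Y)"
    and s: "\<And>a. a \<in> carrier (PRing P) \<Longrightarrow> r (aug_sec X a) = aug_sec Y a"
    and p: "\<And>x. x \<in> carrier (aug_ring X) \<Longrightarrow> aug_prj Y (r x) = aug_prj X x"
  shows "\<exists>f\<in>Hom C X Y. \<forall>x\<in>carrier (aug_ring X). fst f x = r x"
proof -
  obtain Q s p where X': "X = (Q, s, p)" by (cases X)
  obtain Q' s' p' where Y': "Y = (Q', s', p')" by (cases Y)
  have "fobj forget_log X \<in> Obj (under_over_cat CRing_cat (PRing P))"
    "fobj forget_log Y \<in> Obj (under_over_cat CRing_cat (PRing P))"
    by (rule functorD(3)[OF is_functor_forget_log[OF P]], fact)+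
  then have o: "cring (PRing Q)" "fst p \<in> extensional (carrier (PRing Q))" "fst s' \<in> extensional (carrier (PRing P))"
    "fst s \<in> ring_hom (PRing P) (PRing Q)"
    by (simp_all add: X' Y' augRing_simps)
  interpret B: cring "PRing Q" by (rule o)
  have "restrict r (carrier (PRing Q)) \<in> ring_hom (PRing Q) (PRing Q')"
    using r by (intro ring_hom_memI) (simp_all add: X' Y' ring_hom_closed ring_hom_mult ring_hom_add ring_hom_one)
  then have "restrict r (carrier (PRing Q)) \<in> Hom (under_over_cat CRing_cat (PRing P)) (fobj forget_log X) (fobj forget_log Y)"
    using assms(4,5) o by (simp add: X' Y' augRing_simps compose_eq_iff ring_hom_closed)
  from LogRep_hom_lift[OF P X Y this] obtain v where "(restrict r (carrier (PRing Q)), v) \<in> Hom C X Y" by blast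
  then show ?thesis by (intro bexI[of _ "(restrict r (carrier (PRing Q)), v)"]) (simp_all add: X')
qed

lemma hom_eqI:
  assumes "f \<in> Hom C X Y" "g \<in> Hom C X Y" "X \<in> Obj C" "Y \<in> Obj C"
    "\<And>x. x \<in> carrier (aug_ring X) \<Longrightarrow> fst f x = fst g x"
  shows "f = g"
  using LogRep_hom_eqI[OF P assms(3,4,1,2,5)] .

lemma fst_Comp: "x \<in> carrier (aug_ring X) \<Longrightarrow> fst (Comp C X Y Z g f) x = fst g (fst f x)"
  by (cases X; cases Y; cases Z; cases f; cases g) (simp add: LogRep_cat_simps compose_apply)

lemma fst_Ident: "x \<in> carrier (aug_ring X) \<Longrightarrow> fst (Ident C X) x = x"
  by (cases X) (simp add: LogRep_cat_simps)

subsection \<open>The terminal object\<close>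

text \<open>The terminal object is \<open>(A, M)\<close> itself: a morphism to it is determined by its ring component, which
  can only be the augmentation.\<close>

definition base_obj where "base_obj = (P, Ident Log_cat P, Ident Log_cat P)"

lemma base_obj: "base_obj \<in> Obj C"
proof -
  have id: "(\<lambda>x\<in>carrier (PMon P). x) \<in> mon_hom (PMon P) (PMon P)"
    by (rule mon_hom_restrict_id) (rule M.monoid_axioms)
  interpret S: split_mon "PMon P" "PMon P" "\<lambda>x\<in>carrier (PMon P). x" "\<lambda>x\<in>carrier (PMon P). x"
    by (rule split_mon.intro) (simp_all add: M.comm_monoid_axioms id)
  have k: "S.ker = {\<one>\<^bsub>PMon P\<^esub>}" by (auto simp: S.ker_def)
  have "replete (PMon P) (PMon P) (\<lambda>x\<in>carrier (PMon P). x)"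
    by (rule S.repleteI) (simp_all add: k)
  then show ?thesis
    unfolding base_obj_def Log_simps
    by (simp add: LogRep_obj_iff[OF P] split_log_def P id ring_hom_restrict_id A.ring_axioms alpha)
qed

lemma base_obj_simps: "aug_ring base_obj = PRing P" "a \<in> carrier (PRing P) \<Longrightarrow> aug_sec base_obj a = a"
  "a \<in> carrier (PRing P) \<Longrightarrow> aug_prj base_obj a = a"
  by (simp_all add: base_obj_def Log_simps)

lemma to_base:
  assumes "Y \<in> Obj C"
  shows "\<exists>f\<in>Hom C Y base_obj. \<forall>x\<in>carrier (aug_ring Y). fst f x = aug_prj Y x"
  by (rule hom_lift[OF assms base_obj]) (simp_all add: base_obj_simps objD[OF assms] prj_simps[OF assms])

lemma terminal_base_obj: "is_terminal C base_obj"
  unfolding is_terminal_def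
proof (intro conjI ballI)
  show "base_obj \<in> Obj C" by (rule base_obj)
  fix Y assume Y: "Y \<in> Obj C"
  obtain f where f: "f \<in> Hom C Y base_obj" using to_base[OF Y] by blast
  show "\<exists>!f. f \<in> Hom C Y base_obj"
  proof (rule ex1I[of _ f])
    fix g assume g: "g \<in> Hom C Y base_obj"
    show "g = f"
    proof (rule hom_eqI[OF g f Y base_obj])
      fix x assume x: "x \<in> carrier (aug_ring Y)"
      then show "fst g x = fst f x"
        using homD(3)[OF f x] homD(3)[OF g x] hom_closed[OF f x] hom_closed[OF g x] by (simp add: base_obj_simps)
    qed
  qed (rule f)
qed

text \<open>The zero map factors over \<open>A\<close>; on rings it is therefore \<open>y \<mapsto> s(p y)\<close>.\<close>

lemma ab_null_apply:
  assumes g: "is_abobj C g" and Y: "Y \<in> Obj C" and y: "y \<in> carrier (aug_ring Y)"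
  shows "fst (ab_null C g Y) y = aug_sec (ab_obj g) (aug_prj Y y)"
proof -
  note G = abobjD[OF g]
  obtain q where q: "q \<in> Hom C Y base_obj" "\<forall>x\<in>carrier (aug_ring Y). fst q x = aug_prj Y x"
    using to_base[OF Y] by blast
  let ?t = "to_terminal C (ab_term g) base_obj"
  have t: "?t \<in> Hom C base_obj (ab_term g)" by (rule to_terminal(1)[OF G(3) base_obj])
  have "to_terminal C (ab_term g) Y = Comp C Y base_obj (ab_term g) ?t q"
    by (rule to_terminal(2)[OF G(3) Y]) (rule CD(2)[OF Y base_obj G(5) q(1) t])
  then have "fst (ab_null C g Y) y = fst (ab_zero g) (fst ?t (aug_prj Y y))"
    unfolding ab_null_def using y q(2) by (simp add: fst_Comp)
  also have "\<dots> = fst (Comp C base_obj (ab_term g) (ab_obj g) (ab_zero g) ?t) (aug_sec base_obj (aug_prj Y y))"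
    using y by (simp add: fst_Comp base_obj_simps prj_simps[OF Y])
  also have "\<dots> = aug_sec (ab_obj g) (aug_prj Y y)"
    by (rule homD(2)[OF CD(2)[OF base_obj G(5) G(1) t G(9)]]) (simp add: prj_simps[OF Y] y)
  finally show ?thesis .
qed

subsection \<open>Additions are forced\<close>

text \<open>Any abelian group structure on an object with ring \<open>B\<close> adds two points \<open>a\<close>, \<open>b\<close> to
  \<open>a + b - s p\<close>: on the fibre square \<open>B \<times>\<^sub>A B\<close> the addition is a ring homomorphism that restricts to
  the identity on both copies of \<open>B\<close>. Since \<open>(i, 0) (0, j) = 0\<close>, its multiplicativity forces
  \<open>i j = 0\<close> on the augmentation ideal.\<close>

lemma ab_structure:
  assumes g: "is_abobj C g"
  shows ab_plus_apply: "\<And>Y a b y. \<lbrakk>Y \<in> Obj C; a \<in> Hom C Y (ab_obj g); b \<in> Hom C Y (ab_obj g); y \<in> carrier (aug_ring Y)\<rbrakk> \<Longrightarrow>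
      fst (ab_plus C g Y a b) y = fst a y \<oplus>\<^bsub>aug_ring (ab_obj g)\<^esub> fst b y
         \<ominus>\<^bsub>aug_ring (ab_obj g)\<^esub> aug_sec (ab_obj g) (aug_prj Y y)"
    and ab_square_zero: "\<And>i j. \<lbrakk>i \<in> carrier (aug_ring (ab_obj g)); j \<in> carrier (aug_ring (ab_obj g));
      aug_prj (ab_obj g) i = \<zero>\<^bsub>PRing P\<^esub>; aug_prj (ab_obj g) j = \<zero>\<^bsub>PRing P\<^esub>\<rbrakk> \<Longrightarrow>
      i \<otimes>\<^bsub>aug_ring (ab_obj g)\<^esub> j = \<zero>\<^bsub>aug_ring (ab_obj g)\<^esub>"
proof -
  let ?G = "ab_obj g"
  define B s p where "B = aug_ring ?G" and "s = aug_sec ?G" and "p = aug_prj ?G"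
  note G = abobjD[OF g]
  have o: "?G \<in> Obj C" by (rule G(1))
  interpret B: cring B unfolding B_def by (rule objD(1)[OF o])
  note S = sec_simps[OF o, folded B_def s_def p_def] and PP = prj_simps[OF o, folded B_def s_def p_def]
  have p_hom: "p \<in> ring_hom B (PRing P)" unfolding B_def p_def by (rule objD(3)[OF o])
  \<comment> \<open>The ring \<open>B \<times>\<^sub>A B\<close>, moved into the universe along \<open>pr\<close>, is the ring of an object \<open>X\<close> of the category.\<close>
  define D where "D = image_ring pr (fibre_square B p)"
  have D: "carrier D = {pr (b, c) | b c. b \<in> carrier B \<and> c \<in> carrier B \<and> p b = p c}"
    by (auto simp: D_def image_ring_inj[OF pr] fibre_square_simps image_iff)
  have D': "pr (b, c) \<otimes>\<^bsub>D\<^esub> pr (b', c') = pr (b \<otimes>\<^bsub>B\<^esub> b', c \<otimes>\<^bsub>B\<^esub> c')"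
    "pr (b, c) \<oplus>\<^bsub>D\<^esub> pr (b', c') = pr (b \<oplus>\<^bsub>B\<^esub> b', c \<oplus>\<^bsub>B\<^esub> c')"
    if "b \<in> carrier B" "c \<in> carrier B" "b' \<in> carrier B" "c' \<in> carrier B" "p b = p c" "p b' = p c'" for b c b' c'
    using that by (simp_all add: D_def image_ring_inj[OF pr] fibre_square_simps)
  have D1: "\<one>\<^bsub>D\<^esub> = pr (\<one>\<^bsub>B\<^esub>, \<one>\<^bsub>B\<^esub>)" by (simp add: D_def image_ring_inj[OF pr] fibre_square_simps)
  have cD: "cring D" unfolding D_def
    by (intro cring_image_ring pr cring_fibre_square[OF B.cring_axioms A.cring_axioms p_hom])
  define sD where "sD = (\<lambda>a\<in>carrier (PRing P). pr (s a, s a))"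
  define pD where "pD = (\<lambda>z\<in>carrier D. p (fst (inv_into UNIV pr z)))"
  have "(D, sD, pD) \<in> Obj (under_over_cat CRing_cat (PRing P))"
    unfolding augRing_simps
  proof (intro conjI)
    show "sD \<in> ring_hom (PRing P) D"
      by (rule ring_hom_memI) (auto simp: sD_def D D' D1 S)
    show "pD \<in> ring_hom D (PRing P)"
    proof (rule ring_hom_memI)
      have "\<one>\<^bsub>D\<^esub> \<in> carrier D" by (simp add: cring.cring_simprules(6)[OF cD])
      then show "pD \<one>\<^bsub>D\<^esub> = \<one>\<^bsub>PRing P\<^esub>" by (simp add: pD_def) (simp add: D1 PP)
      fix x y assume x: "x \<in> carrier D" and y: "y \<in> carrier D"
      from x show "pD x \<in> carrier (PRing P)" by (auto simp: pD_def D PP)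
      have "x \<otimes>\<^bsub>D\<^esub> y \<in> carrier D" "x \<oplus>\<^bsub>D\<^esub> y \<in> carrier D" using x y cD by (simp_all add: cring.cring_simprules)
      then show "pD (x \<otimes>\<^bsub>D\<^esub> y) = pD x \<otimes>\<^bsub>PRing P\<^esub> pD y" "pD (x \<oplus>\<^bsub>D\<^esub> y) = pD x \<oplus>\<^bsub>PRing P\<^esub> pD y"
        using x y by (simp_all add: pD_def) (auto simp: D D' PP)
    qed
  qed (auto simp: cD sD_def pD_def D S)
  from forget_log_surj[OF pr P this] obtain X where X: "X \<in> Obj C" and fX: "fobj forget_log X = (D, sD, pD)" by blast
  have X': "aug_ring X = D" "aug_sec X = sD" "aug_prj X = pD" using fX by (cases X; simp)+
  have pDv: "pD (pr (b, c)) = p b" if "b \<in> carrier B" "c \<in> carrier B" "p b = p c" for b c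
    using that by (auto simp: pD_def D)
  have sDv: "sD a = pr (s a, s a)" if "a \<in> carrier (PRing P)" for a using that by (simp add: sD_def)
  have toX: "\<exists>h\<in>Hom C Y X. \<forall>y\<in>carrier (aug_ring Y). fst h y = pr (fst a y, fst b y)"
    if Y: "Y \<in> Obj C" and a: "a \<in> Hom C Y ?G" and b: "b \<in> Hom C Y ?G" for Y a b
  proof (rule hom_lift[OF Y X])
    interpret Y: cring "aug_ring Y" by (rule objD(1)[OF Y])
    note a' = homD[OF a, folded B_def s_def p_def] and b' = homD[OF b, folded B_def s_def p_def]
    have c: "fst a y \<in> carrier B" "fst b y \<in> carrier B" "p (fst a y) = p (fst b y)" "p (fst a y) = aug_prj Y y" if "y \<in> carrier (aug_ring Y)" for y
      using that a' b' ring_hom_closed[OF a'(1)] ring_hom_closed[OF b'(1)] by simp_all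
    show "(\<lambda>y. pr (fst a y, fst b y)) \<in> ring_hom (aug_ring Y) (aug_ring X)"
      unfolding X' by (rule ring_hom_memI)
        (auto simp: D D' D1 c ring_hom_mult[OF a'(1)] ring_hom_mult[OF b'(1)] ring_hom_add[OF a'(1)] ring_hom_add[OF b'(1)]
           ring_hom_one[OF a'(1)] ring_hom_one[OF b'(1)] simp flip: c(3))
    show "pr (fst a (aug_sec Y x), fst b (aug_sec Y x)) = aug_sec X x" if "x \<in> carrier (PRing P)" for x
      using that a'(2) b'(2) by (simp add: X' sDv)
    show "aug_prj X (pr (fst a y, fst b y)) = aug_prj Y y" if "y \<in> carrier (aug_ring Y)" for y
      using that c by (simp add: X' pDv)
  qed
  have fromX: "\<exists>h\<in>Hom C X ?G. \<forall>x\<in>carrier D. fst h x = f (inv_into UNIV pr x)"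
    if f: "f = fst \<or> f = snd" for f
  proof -
    have "\<exists>h\<in>Hom C X ?G. \<forall>x\<in>carrier (aug_ring X). fst h x = (\<lambda>x. f (inv_into UNIV pr x)) x"
    proof (rule hom_lift[OF X o])
      show "(\<lambda>x. f (inv_into UNIV pr x)) \<in> ring_hom (aug_ring X) (aug_ring ?G)"
        unfolding X' B_def[symmetric] using f by (intro ring_hom_memI) (auto simp: D D' D1)
      show "f (inv_into UNIV pr (aug_sec X a)) = aug_sec ?G a" if "a \<in> carrier (PRing P)" for a
        using f that by (auto simp: X' sDv s_def)
      show "aug_prj ?G (f (inv_into UNIV pr x)) = aug_prj X x" if "x \<in> carrier (aug_ring X)" for x
        using f that unfolding p_def[symmetric] X' by (auto simp: pDv D)
    qed
    then show ?thesis by (simp add: X')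
  qed
  obtain q1 where q1: "q1 \<in> Hom C X ?G" "\<And>x. x \<in> carrier D \<Longrightarrow> fst q1 x = fst (inv_into UNIV pr x)"
    using fromX[of fst] by auto
  obtain q2 where q2: "q2 \<in> Hom C X ?G" "\<And>x. x \<in> carrier D \<Longrightarrow> fst q2 x = snd (inv_into UNIV pr x)"
    using fromX[of snd] by auto
  \<comment> \<open>The universal sum: all other sums are obtained from it by naturality.\<close>
  define m where "m = ab_plus C g X q1 q2"
  have m: "m \<in> Hom C X ?G" unfolding m_def by (rule ab_plus_closed[OF catC g X q1(1) q2(1)])
  have plus: "ab_plus C g Y a b = Comp C Y X ?G m h"
    if Y: "Y \<in> Obj C" and a: "a \<in> Hom C Y ?G" and b: "b \<in> Hom C Y ?G" and h: "h \<in> Hom C Y X"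
      "\<And>y. y \<in> carrier (aug_ring Y) \<Longrightarrow> fst h y = pr (fst a y, fst b y)" for Y a b h
  proof -
    have hc: "pr (fst a y, fst b y) \<in> carrier D" if "y \<in> carrier (aug_ring Y)" for y
      using hom_closed[OF h(1) that] h(2)[OF that] by (simp add: X')
    have "Comp C Y X ?G q1 h = a"
      by (rule hom_eqI[OF CD(2)[OF Y X o h(1) q1(1)] a Y o]) (simp add: fst_Comp h(2) q1(2) hc)
    moreover have "Comp C Y X ?G q2 h = b"
      by (rule hom_eqI[OF CD(2)[OF Y X o h(1) q2(1)] b Y o]) (simp add: fst_Comp h(2) q2(2) hc)
    ultimately show ?thesis unfolding m_def using ab_plus_natural[OF catC g X Y q1(1) q2(1) h(1)] by simp
  qed
  note I = CD(1)[OF o] and N = ab_null_closed[OF catC g o]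
  have Nv: "fst (ab_null C g ?G) b = s (p b)" if "b \<in> carrier B" for b
    using ab_null_apply[OF g o] that by (simp add: B_def s_def p_def)
  have Iv: "fst (Ident C ?G) b = b" if "b \<in> carrier B" for b using that by (simp add: fst_Ident B_def)
  \<comment> \<open>The zero is neutral, so \<open>m\<close> is the identity on the two copies of \<open>B\<close> in \<open>B \<times>\<^sub>A B\<close>.\<close>
  have m1: "fst m (pr (s (p b), b)) = b" if b: "b \<in> carrier B" for b
  proof -
    obtain h where h: "h \<in> Hom C ?G X" "\<And>y. y \<in> carrier B \<Longrightarrow> fst h y = pr (fst (ab_null C g ?G) y, fst (Ident C ?G) y)"
      using toX[OF o N I] by (auto simp: B_def)
    have "fst (Comp C ?G X ?G m h) b = b"
      using plus[OF o N I h[unfolded B_def]] G(12)[OF o I] Iv[OF b] by simp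
    then show ?thesis using b h(2)[OF b] Nv Iv by (simp add: fst_Comp B_def)
  qed
  have m2: "fst m (pr (b, s (p b))) = b" if b: "b \<in> carrier B" for b
  proof -
    obtain h where h: "h \<in> Hom C ?G X" "\<And>y. y \<in> carrier B \<Longrightarrow> fst h y = pr (fst (Ident C ?G) y, fst (ab_null C g ?G) y)"
      using toX[OF o I N] by (auto simp: B_def)
    have "fst (Comp C ?G X ?G m h) b = b"
      using plus[OF o I N h[unfolded B_def]] G(11)[OF o I N] G(12)[OF o I] Iv[OF b] by simp
    then show ?thesis using b h(2)[OF b] Nv Iv by (simp add: fst_Comp B_def)
  qed
  note mh = homD(1)[OF m, unfolded X', folded B_def]
  have mv: "fst m (pr (b, c)) = b \<oplus>\<^bsub>B\<^esub> c \<ominus>\<^bsub>B\<^esub> s (p b)" if bc: "b \<in> carrier B" "c \<in> carrier B" "p b = p c" for b c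
  proof -
    let ?a = "s (p b)"
    have a: "?a \<in> carrier B" "p ?a = p b" using bc by (simp_all add: S PP)
    have bp: "p b \<in> carrier (PRing P)" using bc by (simp add: PP)
    have dc: "pr (b, c) \<in> carrier D" "pr (?a, ?a) \<in> carrier D" "pr (b, ?a) \<in> carrier D" "pr (?a, c) \<in> carrier D"
      using bc a by (auto simp: D)
    \<comment> \<open>With \<open>a = s(p b)\<close>: \<open>(b, c) + (a, a) = (b, a) + (a, c)\<close>, and \<open>m\<close> is known on all terms but the first.\<close>
    have "fst m (pr (b, c) \<oplus>\<^bsub>D\<^esub> pr (?a, ?a)) = fst m (pr (b, ?a) \<oplus>\<^bsub>D\<^esub> pr (?a, c))"
      using bc a by (simp add: D' B.a_comm)
    moreover have "fst m (pr (?a, ?a)) = ?a" using m1[OF a(1)] a(2) by simp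
    moreover have "fst m (pr (?a, c)) = c" using m1[OF bc(2)] bc(3) by simp
    moreover have "fst m (pr (b, ?a)) = b" using m2[OF bc(1)] by simp
    ultimately have "fst m (pr (b, c)) \<oplus>\<^bsub>B\<^esub> ?a = b \<oplus>\<^bsub>B\<^esub> c"
      using dc by (simp add: ring_hom_add[OF mh])
    moreover have "fst m (pr (b, c)) \<in> carrier B" using dc ring_hom_closed[OF mh] by simp
    ultimately have "fst m (pr (b, c)) = (b \<oplus>\<^bsub>B\<^esub> c) \<ominus>\<^bsub>B\<^esub> ?a"
      using a(1) bc by (metis B.add.inv_solve_right B.a_closed a_minus_def a_inv_def)
    then show ?thesis .
  qed
  show "fst (ab_plus C g Y a b) y = fst a y \<oplus>\<^bsub>aug_ring ?G\<^esub> fst b y \<ominus>\<^bsub>aug_ring ?G\<^esub> aug_sec ?G (aug_prj Y y)"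
    if Y: "Y \<in> Obj C" and a: "a \<in> Hom C Y ?G" and b: "b \<in> Hom C Y ?G" and y: "y \<in> carrier (aug_ring Y)" for Y a b y
  proof -
    obtain h where h: "h \<in> Hom C Y X" "\<And>y. y \<in> carrier (aug_ring Y) \<Longrightarrow> fst h y = pr (fst a y, fst b y)"
      using toX[OF Y a b] by auto
    have "fst (ab_plus C g Y a b) y = fst m (pr (fst a y, fst b y))"
      using plus[OF Y a b h] h(2)[OF y] y by (simp add: fst_Comp)
    also have "\<dots> = fst a y \<oplus>\<^bsub>B\<^esub> fst b y \<ominus>\<^bsub>B\<^esub> s (p (fst a y))"
      using mv hom_closed[OF a y] hom_closed[OF b y] homD(3)[OF a y] homD(3)[OF b y] by (simp add: B_def p_def)
    also have "p (fst a y) = aug_prj Y y" using homD(3)[OF a y] by (simp add: p_def)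
    finally show ?thesis by (simp add: B_def s_def)
  qed
  show "i \<otimes>\<^bsub>aug_ring ?G\<^esub> j = \<zero>\<^bsub>aug_ring ?G\<^esub>"
    if ij': "i \<in> carrier (aug_ring ?G)" "j \<in> carrier (aug_ring ?G)" "aug_prj ?G i = \<zero>\<^bsub>PRing P\<^esub>" "aug_prj ?G j = \<zero>\<^bsub>PRing P\<^esub>" for i j
  proof -
    have ij: "i \<in> carrier B" "j \<in> carrier B" "p i = \<zero>\<^bsub>PRing P\<^esub>" "p j = \<zero>\<^bsub>PRing P\<^esub>" using ij' by (simp_all add: B_def p_def)
    have dc: "pr (i, \<zero>\<^bsub>B\<^esub>) \<in> carrier D" "pr (\<zero>\<^bsub>B\<^esub>, j) \<in> carrier D" using ij by (auto simp: D PP)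
    \<comment> \<open>The product \<open>(i, 0) (0, j)\<close> vanishes, while \<open>m\<close> maps its factors to \<open>i\<close> and \<open>j\<close>.\<close>
    have "fst m (pr (i, \<zero>\<^bsub>B\<^esub>) \<otimes>\<^bsub>D\<^esub> pr (\<zero>\<^bsub>B\<^esub>, j)) = \<zero>\<^bsub>B\<^esub>"
      using ij m1[of "\<zero>\<^bsub>B\<^esub>"] by (simp add: D' PP S)
    moreover have "fst m (pr (i, \<zero>\<^bsub>B\<^esub>)) = i" "fst m (pr (\<zero>\<^bsub>B\<^esub>, j)) = j" using m2[OF ij(1)] m1[OF ij(2)] ij by (simp_all add: S)
    ultimately have "i \<otimes>\<^bsub>B\<^esub> j = \<zero>\<^bsub>B\<^esub>" using dc by (simp add: ring_hom_mult[OF mh])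
    then show ?thesis by (simp add: B_def)
  qed
qed

text \<open>Abelian group objects form a full subcategory: the formula for the sum involves only ring
  operations, the section and the augmentation, all of which are preserved by every morphism.\<close>

lemma Ab_hom_iff:
  assumes g: "is_abobj C g" and h: "is_abobj C h"
  shows "f \<in> Hom (Ab C) g h \<longleftrightarrow> f \<in> Hom C (ab_obj g) (ab_obj h)"
proof -
  have "Comp C (ab_prod g) (ab_obj g) (ab_obj h) f (ab_add g) =
        ab_plus C h (ab_prod g)
          (Comp C (ab_prod g) (ab_obj g) (ab_obj h) f (ab_p1 g))
          (Comp C (ab_prod g) (ab_obj g) (ab_obj h) f (ab_p2 g))"
    if f: "f \<in> Hom C (ab_obj g) (ab_obj h)"
  proof -
    note G = abobjD[OF g] and H = abobjD[OF h]
    interpret B: cring "aug_ring (ab_obj g)" by (rule objD(1)[OF G(1)])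
    interpret B': cring "aug_ring (ab_obj h)" by (rule objD(1)[OF H(1)])
    have c: "Comp C (ab_prod g) (ab_obj g) (ab_obj h) f (ab_p1 g) \<in> Hom C (ab_prod g) (ab_obj h)"
      "Comp C (ab_prod g) (ab_obj g) (ab_obj h) f (ab_p2 g) \<in> Hom C (ab_prod g) (ab_obj h)"
      "Comp C (ab_prod g) (ab_obj g) (ab_obj h) f (ab_add g) \<in> Hom C (ab_prod g) (ab_obj h)"
      using f by (simp_all add: CD(2) G H)
    show ?thesis
    proof (rule hom_eqI[OF c(3) ab_plus_closed[OF catC h G(4) c(1,2)] G(4) H(1)])
      fix x assume x: "x \<in> carrier (aug_ring (ab_prod g))"
      have pc: "fst (ab_p1 g) x \<in> carrier (aug_ring (ab_obj g))" "fst (ab_p2 g) x \<in> carrier (aug_ring (ab_obj g))"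
        using x hom_closed[OF G(6)] hom_closed[OF G(7)] by simp_all
      have px: "aug_prj (ab_prod g) x \<in> carrier (PRing P)" using x by (simp add: prj_simps[OF G(4)])
      have "fst (ab_add g) x = fst (ab_p1 g) x \<oplus>\<^bsub>aug_ring (ab_obj g)\<^esub> fst (ab_p2 g) x
         \<ominus>\<^bsub>aug_ring (ab_obj g)\<^esub> aug_sec (ab_obj g) (aug_prj (ab_prod g) x)"
        using ab_plus_apply[OF g G(4) G(6) G(7) x] by (simp add: ab_plus_projections[OF catC g])
      then show "fst (Comp C (ab_prod g) (ab_obj g) (ab_obj h) f (ab_add g)) x = fst (ab_plus C h (ab_prod g)
          (Comp C (ab_prod g) (ab_obj g) (ab_obj h) f (ab_p1 g))
          (Comp C (ab_prod g) (ab_obj g) (ab_obj h) f (ab_p2 g))) x"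
        using ab_plus_apply[OF h G(4) c(1,2) x] x pc px
        by (simp add: fst_Comp ring_hom_zero_minus[OF B.ring_axioms B'.ring_axioms homD(1)[OF f]]
          ring_hom_add[OF homD(1)[OF f]] sec_simps[OF G(1)] homD(2)[OF f])
    qed
  qed
  then show ?thesis by (auto simp: Ab_def)
qed

end

section \<open>Square-zero extensions\<close>

lemma mod_homD:
  assumes "h \<in> mod_hom R X Y"
  shows "x \<in> carrier X \<Longrightarrow> h x \<in> carrier Y"
    "x \<in> carrier X \<Longrightarrow> y \<in> carrier X \<Longrightarrow> h (x \<oplus>\<^bsub>X\<^esub> y) = h x \<oplus>\<^bsub>Y\<^esub> h y"
    "r \<in> carrier R \<Longrightarrow> x \<in> carrier X \<Longrightarrow> h (r \<odot>\<^bsub>X\<^esub> x) = r \<odot>\<^bsub>Y\<^esub> h x"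
  using assms by (auto simp: mod_hom_def)

lemma mod_homI:
  assumes "\<And>x. x \<in> carrier X \<Longrightarrow> h x \<in> carrier Y"
    "\<And>x y. x \<in> carrier X \<Longrightarrow> y \<in> carrier X \<Longrightarrow> h (x \<oplus>\<^bsub>X\<^esub> y) = h x \<oplus>\<^bsub>Y\<^esub> h y"
    "\<And>r x. r \<in> carrier R \<Longrightarrow> x \<in> carrier X \<Longrightarrow> h (r \<odot>\<^bsub>X\<^esub> x) = r \<odot>\<^bsub>Y\<^esub> h x"
  shows "h \<in> mod_hom R X Y"
  using assms by (auto simp: mod_hom_def)

lemma mod_hom_zero:
  assumes "module R X" "module R Y" "h \<in> mod_hom R X Y"
  shows "h \<zero>\<^bsub>X\<^esub> = \<zero>\<^bsub>Y\<^esub>"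
proof -
  interpret X: module R X by fact
  interpret Y: module R Y by fact
  have "h (\<zero>\<^bsub>R\<^esub> \<odot>\<^bsub>X\<^esub> \<zero>\<^bsub>X\<^esub>) = \<zero>\<^bsub>R\<^esub> \<odot>\<^bsub>Y\<^esub> h \<zero>\<^bsub>X\<^esub>" by (rule mod_homD(3)[OF assms(3)]) simp_all
  then show ?thesis using mod_homD(1)[OF assms(3), of "\<zero>\<^bsub>X\<^esub>"] by simp
qed

lemma sqz_ring_simps:
  "carrier (sqz_ring A J) = carrier A \<times> carrier J"
  "(a, j) \<otimes>\<^bsub>sqz_ring A J\<^esub> (b, k) = (a \<otimes>\<^bsub>A\<^esub> b, (a \<odot>\<^bsub>J\<^esub> k) \<oplus>\<^bsub>J\<^esub> (b \<odot>\<^bsub>J\<^esub> j))"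
  "(a, j) \<oplus>\<^bsub>sqz_ring A J\<^esub> (b, k) = (a \<oplus>\<^bsub>A\<^esub> b, j \<oplus>\<^bsub>J\<^esub> k)"
  "\<one>\<^bsub>sqz_ring A J\<^esub> = (\<one>\<^bsub>A\<^esub>, \<zero>\<^bsub>J\<^esub>)" "\<zero>\<^bsub>sqz_ring A J\<^esub> = (\<zero>\<^bsub>A\<^esub>, \<zero>\<^bsub>J\<^esub>)"
  by (simp_all add: sqz_ring_def)

lemma cring_sqz_ring:
  assumes "module A J"
  shows "cring (sqz_ring A J)"
proof -
  interpret J: module A J by fact
  show ?thesis
  proof (rule cringI)
    show "abelian_group (sqz_ring A J)"
    proof (rule abelian_groupI)
      fix x assume "x \<in> carrier (sqz_ring A J)"
      then show "\<exists>y\<in>carrier (sqz_ring A J). y \<oplus>\<^bsub>sqz_ring A J\<^esub> x = \<zero>\<^bsub>sqz_ring A J\<^esub>"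
        by (cases x) (auto simp: sqz_ring_simps J.R.l_neg J.M.l_neg intro!: bexI[of _ "(\<ominus>\<^bsub>A\<^esub> fst x, \<ominus>\<^bsub>J\<^esub> snd x)"])
    qed (auto simp: sqz_ring_simps J.R.a_ac J.M.a_ac)
    show "Group.comm_monoid (sqz_ring A J)"
    proof (rule comm_monoidI)
      fix x y z assume "x \<in> carrier (sqz_ring A J)" "y \<in> carrier (sqz_ring A J)" "z \<in> carrier (sqz_ring A J)"
      then obtain a i b j c k where e: "x = (a, i)" "y = (b, j)" "z = (c, k)"
        and h: "a \<in> carrier A" "b \<in> carrier A" "c \<in> carrier A" "i \<in> carrier J" "j \<in> carrier J" "k \<in> carrier J"
        by (auto simp: sqz_ring_simps)
      have s: "c \<odot>\<^bsub>J\<^esub> (a \<odot>\<^bsub>J\<^esub> j) = a \<odot>\<^bsub>J\<^esub> (c \<odot>\<^bsub>J\<^esub> j)" "c \<odot>\<^bsub>J\<^esub> (b \<odot>\<^bsub>J\<^esub> i) = b \<odot>\<^bsub>J\<^esub> (c \<odot>\<^bsub>J\<^esub> i)"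
        using h by (simp_all flip: J.smult_assoc1 add: J.R.m_comm)
      show "x \<otimes>\<^bsub>sqz_ring A J\<^esub> y \<otimes>\<^bsub>sqz_ring A J\<^esub> z = x \<otimes>\<^bsub>sqz_ring A J\<^esub> (y \<otimes>\<^bsub>sqz_ring A J\<^esub> z)"
        unfolding e using h s
        by (simp add: sqz_ring_simps J.R.m_assoc J.smult_r_distr J.smult_assoc1 J.M.a_assoc)
    qed (auto simp: sqz_ring_simps J.R.m_comm J.M.a_comm)
  next
    fix x y z assume "x \<in> carrier (sqz_ring A J)" "y \<in> carrier (sqz_ring A J)" "z \<in> carrier (sqz_ring A J)"
    then show "(x \<oplus>\<^bsub>sqz_ring A J\<^esub> y) \<otimes>\<^bsub>sqz_ring A J\<^esub> z =
        x \<otimes>\<^bsub>sqz_ring A J\<^esub> z \<oplus>\<^bsub>sqz_ring A J\<^esub> y \<otimes>\<^bsub>sqz_ring A J\<^esub> z"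
      by (auto simp: sqz_ring_simps J.R.l_distr J.smult_l_distr J.smult_r_distr J.M.a_ac)
  qed
qed

lemma dsum_module_simps [simp]:
  "carrier (dsum_module X Y) = carrier X \<times> carrier Y"
  "\<zero>\<^bsub>dsum_module X Y\<^esub> = (\<zero>\<^bsub>X\<^esub>, \<zero>\<^bsub>Y\<^esub>)"
  "(x, y) \<oplus>\<^bsub>dsum_module X Y\<^esub> (x', y') = (x \<oplus>\<^bsub>X\<^esub> x', y \<oplus>\<^bsub>Y\<^esub> y')"
  "r \<odot>\<^bsub>dsum_module X Y\<^esub> (x, y) = (r \<odot>\<^bsub>X\<^esub> x, r \<odot>\<^bsub>Y\<^esub> y)"
  by (simp_all add: dsum_module_def)

lemma module_dsum:
  assumes "module R X" "module R Y"
  shows "module R (dsum_module X Y)"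
proof -
  interpret X: module R X by fact
  interpret Y: module R Y by fact
  show ?thesis
  proof (rule moduleI)
    show "abelian_group (dsum_module X Y)"
    proof (rule abelian_groupI)
      fix x assume "x \<in> carrier (dsum_module X Y)"
      then show "\<exists>y\<in>carrier (dsum_module X Y). y \<oplus>\<^bsub>dsum_module X Y\<^esub> x = \<zero>\<^bsub>dsum_module X Y\<^esub>"
        by (cases x) (auto simp: X.M.l_neg Y.M.l_neg intro!: bexI[of _ "(\<ominus>\<^bsub>X\<^esub> fst x, \<ominus>\<^bsub>Y\<^esub> snd x)"])
    qed (auto simp: X.M.a_ac Y.M.a_ac)
  qed (auto simp: X.R.cring_axioms X.smult_l_distr Y.smult_l_distr X.smult_r_distr Y.smult_r_distr X.smult_assoc1 Y.smult_assoc1)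
qed

lemma image_module_simps:
  assumes "inj f"
  shows "carrier (image_module f X) = f ` carrier X"
    and "\<zero>\<^bsub>image_module f X\<^esub> = f \<zero>\<^bsub>X\<^esub>"
    and "x \<in> carrier X \<Longrightarrow> y \<in> carrier X \<Longrightarrow> f x \<oplus>\<^bsub>image_module f X\<^esub> f y = f (x \<oplus>\<^bsub>X\<^esub> y)"
    and "x \<in> carrier X \<Longrightarrow> r \<odot>\<^bsub>image_module f X\<^esub> f x = f (r \<odot>\<^bsub>X\<^esub> x)"
  using inj_on_subset[OF assms, of "carrier X"] by (simp_all add: image_module_def)

lemma module_image_module:
  assumes f: "inj f" and X: "module R X"
  shows "module R (image_module f X)"
proof -
  interpret X: module R X by fact
  note [simp] = image_module_simps[OF f]
  show ?thesis
  proof (rule moduleI)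
    show "abelian_group (image_module f X)"
      by (rule abelian_groupI) (auto simp: X.M.a_ac inj_eq[OF f] X.M.r_neg intro!: bexI[of _ "\<ominus>\<^bsub>X\<^esub> _"])
  qed (auto simp: X.R.cring_axioms X.smult_l_distr X.smult_r_distr X.smult_assoc1)
qed

lemma Mod_cat_simps:
  "X \<in> Obj (Mod_cat R) \<longleftrightarrow> module R X"
  "f \<in> Hom (Mod_cat R) X Y \<longleftrightarrow> f \<in> mod_hom R X Y \<and> f \<in> extensional (carrier X)"
  "Ident (Mod_cat R) X = (\<lambda>x\<in>carrier X. x)" "Comp (Mod_cat R) X Y Z g f = compose (carrier X) g f"
  by (simp_all add: Mod_cat_def)

lemma Ab_simps:
  "g \<in> Obj (Ab D) \<longleftrightarrow> is_abobj D g" "Ident (Ab D) g = Ident D (ab_obj g)"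
  "Comp (Ab D) g h k = Comp D (ab_obj g) (ab_obj h) (ab_obj k)"
  by (simp_all add: Ab_def)

lemma mod_hom_compose:
  assumes "module R X" "f \<in> mod_hom R X Y" "g \<in> mod_hom R Y Z"
  shows "compose (carrier X) g f \<in> mod_hom R X Z"
proof -
  interpret module R X by fact
  show ?thesis
    using mod_homD[OF assms(2)] mod_homD[OF assms(3)] by (intro mod_homI) (simp_all add: compose_apply)
qed

lemma category_Mod_cat: "category (Mod_cat R)"
proof (rule categoryI, unfold Mod_cat_simps, goal_cases)
  case (1 X)
  then interpret module R X .
  show ?case by (auto intro!: mod_homI)
next
  case (2 X Y Z f g)
  then show ?case using mod_hom_compose[of R X f Y g Z] by simp
next
  case (3 X Y f)
  then show ?case by (simp add: compose_restrict_id)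
next
  case (4 X Y f)
  then have "f \<in> carrier X \<rightarrow> carrier Y" by (simp add: mod_hom_def)
  with 4 show ?case by (simp add: Id_compose)
next
  case (5 W X Y Z f g h)
  then have "f \<in> carrier W \<rightarrow> carrier X" by (simp add: mod_hom_def)
  then show ?case by (rule compose_compose)
qed

context log_base
begin

abbreviation "A_mod J \<equiv> module (PRing P) J"
abbreviation "sq J \<equiv> sqz_obj pr P J"

lemma sq_ring:
  "carrier (aug_ring (sq J)) = {pr (a, j) | a j. a \<in> carrier (PRing P) \<and> j \<in> carrier J}"
  "aug_ring (sq J) = image_ring pr (sqz_ring (PRing P) J)"
  "\<one>\<^bsub>aug_ring (sq J)\<^esub> = pr (\<one>\<^bsub>PRing P\<^esub>, \<zero>\<^bsub>J\<^esub>)"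
  by (auto simp: sqz_obj_def sqz_prelog_def image_ring_inj[OF pr] sqz_ring_simps)

lemma sq_ring_ops:
  assumes "a \<in> carrier (PRing P)" "b \<in> carrier (PRing P)" "j \<in> carrier J" "k \<in> carrier J"
  shows "pr (a, j) \<otimes>\<^bsub>aug_ring (sq J)\<^esub> pr (b, k) = pr (a \<otimes>\<^bsub>PRing P\<^esub> b, (a \<odot>\<^bsub>J\<^esub> k) \<oplus>\<^bsub>J\<^esub> (b \<odot>\<^bsub>J\<^esub> j))"
    "pr (a, j) \<oplus>\<^bsub>aug_ring (sq J)\<^esub> pr (b, k) = pr (a \<oplus>\<^bsub>PRing P\<^esub> b, j \<oplus>\<^bsub>J\<^esub> k)"
  using assms by (simp_all add: sq_ring(2) image_ring_inj[OF pr] sqz_ring_simps)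

lemma sq_sec: "a \<in> carrier (PRing P) \<Longrightarrow> aug_sec (sq J) a = pr (a, \<zero>\<^bsub>J\<^esub>)"
  by (simp add: sqz_obj_def sqz_sec_def)

lemma sq_prj: "a \<in> carrier (PRing P) \<Longrightarrow> j \<in> carrier J \<Longrightarrow> aug_prj (sq J) (pr (a, j)) = a"
  by (auto simp: sqz_obj_def sqz_proj_def sqz_prelog_def image_ring_inj[OF pr] sqz_ring_simps)

text \<open>The units of \<open>A \<oplus> J\<close> over \<open>1\<close> are the \<open>(1, j)\<close>, so the replete log structure on \<open>A \<oplus> J\<close> has monoid
  \<open>M \<oplus> J\<close>.\<close>

lemma sq_obj:
  assumes J: "A_mod J"
  shows "sq J \<in> Obj C"
proof -
  interpret J: module "PRing P" J by fact
  let ?Q = "sqz_prelog pr P J"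
  have ring: "PRing ?Q = image_ring pr (sqz_ring (PRing P) J)" by (simp add: sqz_prelog_def)
  note R = image_ring_inj[OF pr] sqz_ring_simps
  have cB: "cring (PRing ?Q)" unfolding ring by (intro cring_image_ring pr cring_sqz_ring J)
  then interpret B: cring "PRing ?Q" .
  have car: "pr (a, j) \<in> carrier (PRing ?Q)" if "a \<in> carrier (PRing P)" "j \<in> carrier J" for a j
    using that by (simp add: ring R)
  have mu: "pr (a, j) \<otimes>\<^bsub>PRing ?Q\<^esub> pr (b, k) = pr (a \<otimes>\<^bsub>PRing P\<^esub> b, (a \<odot>\<^bsub>J\<^esub> k) \<oplus>\<^bsub>J\<^esub> (b \<odot>\<^bsub>J\<^esub> j))"
    if "a \<in> carrier (PRing P)" "b \<in> carrier (PRing P)" "j \<in> carrier J" "k \<in> carrier J" for a b j k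
    using that by (simp add: ring R)
  have one: "\<one>\<^bsub>PRing ?Q\<^esub> = pr (\<one>\<^bsub>PRing P\<^esub>, \<zero>\<^bsub>J\<^esub>)" by (simp add: ring R)
  define p where "p = fst (sqz_proj pr P J)"
  have pv: "p (pr (a, j)) = a" if "a \<in> carrier (PRing P)" "j \<in> carrier J" for a j
    using car[OF that] by (simp add: p_def sqz_proj_def)
  define s where "s = fst (sqz_sec pr P J)"
  have sv: "s a = pr (a, \<zero>\<^bsub>J\<^esub>)" if "a \<in> carrier (PRing P)" for a
    using that by (simp add: s_def sqz_sec_def)
  have "split_log P ?Q s (snd (sqz_sec pr P J)) p (snd (sqz_proj pr P J))"
  proof (rule split_log_image_group[OF pr P, where K = "add_monoid J" and \<kappa> = "\<lambda>j. pr (\<one>\<^bsub>PRing P\<^esub>, j)"])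
    show "cring (PRing ?Q)" by (rule cB)
    show "s \<in> ring_hom (PRing P) (PRing ?Q)"
      by (rule ring_hom_memI) (simp_all add: sv ring R)
    show "p \<in> ring_hom (PRing ?Q) (PRing P)"
    proof (rule ring_hom_memI)
      show "p \<one>\<^bsub>PRing ?Q\<^esub> = \<one>\<^bsub>PRing P\<^esub>" by (simp add: one pv)
    qed (auto simp: ring R pv)
    show "p (s a) = a" if "a \<in> carrier (PRing P)" for a using that by (simp add: sv pv)
    show "comm_group (add_monoid J)" by (rule J.M.a_comm_group)
    show "(\<lambda>j. pr (\<one>\<^bsub>PRing P\<^esub>, j)) \<in> mon_hom (add_monoid J) (PRing ?Q)"
      by (rule mon_homI) (simp_all add: ring R J.M.a_comm)
    have un: "pr (\<one>\<^bsub>PRing P\<^esub>, j) \<in> Units (PRing ?Q)" if j: "j \<in> carrier J" for j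
    proof -
      have "pr (\<one>\<^bsub>PRing P\<^esub>, j) \<otimes>\<^bsub>PRing ?Q\<^esub> pr (\<one>\<^bsub>PRing P\<^esub>, \<ominus>\<^bsub>J\<^esub> j) = \<one>\<^bsub>PRing ?Q\<^esub>"
        "pr (\<one>\<^bsub>PRing P\<^esub>, \<ominus>\<^bsub>J\<^esub> j) \<otimes>\<^bsub>PRing ?Q\<^esub> pr (\<one>\<^bsub>PRing P\<^esub>, j) = \<one>\<^bsub>PRing ?Q\<^esub>"
        using j by (simp_all add: mu one J.M.l_neg J.M.r_neg)
      then show ?thesis using car j unfolding Units_def by blast
    qed
    show "bij_betw (\<lambda>j. pr (\<one>\<^bsub>PRing P\<^esub>, j)) (carrier (add_monoid J)) {u \<in> Units (PRing ?Q). p u = \<one>\<^bsub>PRing P\<^esub>}"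
    proof (rule bij_betwI')
      fix u assume u: "u \<in> {u \<in> Units (PRing ?Q). p u = \<one>\<^bsub>PRing P\<^esub>}"
      then have "u \<in> carrier (PRing ?Q)" "p u = \<one>\<^bsub>PRing P\<^esub>" by (simp_all add: B.Units_closed)
      then obtain a j where "u = pr (a, j)" "a \<in> carrier (PRing P)" "j \<in> carrier J" "a = \<one>\<^bsub>PRing P\<^esub>"
        by (auto simp: ring R pv)
      then show "\<exists>j\<in>carrier (add_monoid J). u = pr (\<one>\<^bsub>PRing P\<^esub>, j)" by auto
    qed (auto simp: un pv)
    show "PMon ?Q = image_group pr (PMon P \<times>\<times> add_monoid J)" by (simp add: sqz_prelog_def sqz_monoid_def)
    show "pstr ?Q (pr (m, k)) = s (pstr P m) \<otimes>\<^bsub>PRing ?Q\<^esub> pr (\<one>\<^bsub>PRing P\<^esub>, k)"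
      if "m \<in> carrier (PMon P)" "k \<in> carrier (add_monoid J)" for m k
      using that by (simp add: sv alpha mu) (simp add: sqz_prelog_def)
    show "snd (sqz_sec pr P J) m = pr (m, \<one>\<^bsub>add_monoid J\<^esub>)" if "m \<in> carrier (PMon P)" for m
      using that by (simp add: sqz_sec_def)
    show "snd (sqz_proj pr P J) (pr (m, k)) = m" if "m \<in> carrier (PMon P)" "k \<in> carrier (add_monoid J)" for m k
      using that by (auto simp: sqz_proj_def sqz_prelog_def sqz_monoid_def image_group_inj[OF pr])
  qed
  then have "(?Q, (s, snd (sqz_sec pr P J)), (p, snd (sqz_proj pr P J))) \<in> Obj C"
    by (simp add: LogRep_obj_iff[OF P] s_def p_def sqz_sec_def sqz_proj_def)
  then show ?thesis by (simp add: sqz_obj_def s_def p_def)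
qed

text \<open>Maps into \<open>A \<oplus> J\<close> over and under \<open>A\<close> are derivations into \<open>J\<close> that vanish on \<open>A\<close>; \<open>der f\<close> is the
  derivation that belongs to \<open>f\<close>.\<close>

definition derivation where
  "derivation Y J d \<longleftrightarrow> (\<forall>y\<in>carrier (aug_ring Y). d y \<in> carrier J) \<and>
     (\<forall>y\<in>carrier (aug_ring Y). \<forall>z\<in>carrier (aug_ring Y). d (y \<oplus>\<^bsub>aug_ring Y\<^esub> z) = d y \<oplus>\<^bsub>J\<^esub> d z) \<and>
     (\<forall>y\<in>carrier (aug_ring Y). \<forall>z\<in>carrier (aug_ring Y).
        d (y \<otimes>\<^bsub>aug_ring Y\<^esub> z) = (aug_prj Y y \<odot>\<^bsub>J\<^esub> d z) \<oplus>\<^bsub>J\<^esub> (aug_prj Y z \<odot>\<^bsub>J\<^esub> d y)) \<and>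
     (\<forall>a\<in>carrier (PRing P). d (aug_sec Y a) = \<zero>\<^bsub>J\<^esub>)"

definition der where "der f y = snd (inv_into UNIV pr (fst f y))"

lemma sq_hom_form:
  assumes J: "A_mod J" and Y: "Y \<in> Obj C" and f: "f \<in> Hom C Y (sq J)" and y: "y \<in> carrier (aug_ring Y)"
  shows "fst f y = pr (aug_prj Y y, der f y)" "der f y \<in> carrier J"
proof -
  have "fst f y \<in> carrier (aug_ring (sq J))" by (rule hom_closed[OF f y])
  then obtain a j where e: "fst f y = pr (a, j)" "a \<in> carrier (PRing P)" "j \<in> carrier J" by (auto simp: sq_ring(1))
  then have "aug_prj Y y = a" using homD(3)[OF f y] by (simp add: sq_prj)
  with e show "fst f y = pr (aug_prj Y y, der f y)" "der f y \<in> carrier J" by (simp_all add: der_def)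
qed

lemma derivation_der:
  assumes J: "A_mod J" and Y: "Y \<in> Obj C" and f: "f \<in> Hom C Y (sq J)"
  shows "derivation Y J (der f)"
proof -
  interpret Y: cring "aug_ring Y" by (rule objD(1)[OF Y])
  interpret J: module "PRing P" J by fact
  note F = sq_hom_form[OF J Y f] and H = homD(1)[OF f]
  have "pr (aug_prj Y (y \<oplus>\<^bsub>aug_ring Y\<^esub> z), der f (y \<oplus>\<^bsub>aug_ring Y\<^esub> z)) =
      pr (aug_prj Y y, der f y) \<oplus>\<^bsub>aug_ring (sq J)\<^esub> pr (aug_prj Y z, der f z)"
     "pr (aug_prj Y (y \<otimes>\<^bsub>aug_ring Y\<^esub> z), der f (y \<otimes>\<^bsub>aug_ring Y\<^esub> z)) =
      pr (aug_prj Y y, der f y) \<otimes>\<^bsub>aug_ring (sq J)\<^esub> pr (aug_prj Y z, der f z)"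
    if "y \<in> carrier (aug_ring Y)" "z \<in> carrier (aug_ring Y)" for y z
    using that ring_hom_add[OF H, of y z] ring_hom_mult[OF H, of y z] by (simp_all add: F)
  moreover have "pr (a, der f (aug_sec Y a)) = pr (a, \<zero>\<^bsub>J\<^esub>)" if "a \<in> carrier (PRing P)" for a
    using that homD(2)[OF f that] F(1)[of "aug_sec Y a"] by (simp add: sq_sec sec_simps[OF Y])
  ultimately show ?thesis unfolding derivation_def
    by (simp add: F(2) sq_ring_ops prj_simps[OF Y])
qed

lemma derivation_hom:
  assumes J: "A_mod J" and Y: "Y \<in> Obj C" and d: "derivation Y J d"
  shows "\<exists>f\<in>Hom C Y (sq J). \<forall>y\<in>carrier (aug_ring Y). der f y = d y"
proof -
  interpret Y: cring "aug_ring Y" by (rule objD(1)[OF Y])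
  interpret J: module "PRing P" J by fact
  have D: "\<And>y. y \<in> carrier (aug_ring Y) \<Longrightarrow> d y \<in> carrier J"
    "\<And>y z. y \<in> carrier (aug_ring Y) \<Longrightarrow> z \<in> carrier (aug_ring Y) \<Longrightarrow> d (y \<oplus>\<^bsub>aug_ring Y\<^esub> z) = d y \<oplus>\<^bsub>J\<^esub> d z"
    "\<And>y z. y \<in> carrier (aug_ring Y) \<Longrightarrow> z \<in> carrier (aug_ring Y) \<Longrightarrow>
        d (y \<otimes>\<^bsub>aug_ring Y\<^esub> z) = (aug_prj Y y \<odot>\<^bsub>J\<^esub> d z) \<oplus>\<^bsub>J\<^esub> (aug_prj Y z \<odot>\<^bsub>J\<^esub> d y)"
    "\<And>a. a\<in>carrier (PRing P) \<Longrightarrow> d (aug_sec Y a) = \<zero>\<^bsub>J\<^esub>"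
    using d unfolding derivation_def by simp_all
  have d1: "d \<one>\<^bsub>aug_ring Y\<^esub> = \<zero>\<^bsub>J\<^esub>" using D(4)[of "\<one>\<^bsub>PRing P\<^esub>"] by (simp add: sec_simps[OF Y])
  have "\<exists>f\<in>Hom C Y (sq J). \<forall>y\<in>carrier (aug_ring Y). fst f y = pr (aug_prj Y y, d y)"
  proof (rule hom_lift[OF Y sq_obj[OF J]])
    show "(\<lambda>y. pr (aug_prj Y y, d y)) \<in> ring_hom (aug_ring Y) (aug_ring (sq J))"
      by (rule ring_hom_memI) (auto simp: sq_ring(1,3) sq_ring_ops D d1 prj_simps[OF Y])
  qed (simp_all add: sq_sec sec_simps[OF Y] D sq_prj prj_simps[OF Y])
  then obtain f where "f \<in> Hom C Y (sq J)" "\<And>y. y \<in> carrier (aug_ring Y) \<Longrightarrow> fst f y = pr (aug_prj Y y, d y)" by blast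
  then show ?thesis by (intro bexI[of _ f]) (simp_all add: der_def)
qed

lemma sq_hom_eqI:
  assumes J: "A_mod J" and Y: "Y \<in> Obj C" and f: "f \<in> Hom C Y (sq J)" and g: "g \<in> Hom C Y (sq J)"
    and e: "\<And>y. y \<in> carrier (aug_ring Y) \<Longrightarrow> der f y = der g y"
  shows "f = g"
  by (rule hom_eqI[OF f g Y sq_obj[OF J]]) (simp add: sq_hom_form[OF J Y f] sq_hom_form[OF J Y g] e)

lemma sq_mor:
  assumes J: "A_mod J" and J': "A_mod J'" and h: "h \<in> mod_hom (PRing P) J J'"
  shows "sqz_mor pr P J h \<in> Hom C (sq J) (sq J')"
    and "a \<in> carrier (PRing P) \<Longrightarrow> j \<in> carrier J \<Longrightarrow> fst (sqz_mor pr P J h) (pr (a, j)) = pr (a, h j)"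
proof -
  interpret J: module "PRing P" J by fact
  interpret J': module "PRing P" J' by fact
  note H = mod_homD[OF h] mod_hom_zero[OF J J' h]
  define r v where "r = fst (sqz_mor pr P J h)" and "v = snd (sqz_mor pr P J h)"
  have rc: "carrier (PRing (sqz_prelog pr P X)) = {pr (a, j) | a j. a \<in> carrier (PRing P) \<and> j \<in> carrier X}" for X
    using sq_ring(1)[of X] by (simp add: sqz_obj_def)
  have mc: "carrier (PMon (sqz_prelog pr P X)) = {pr (a, j) | a j. a \<in> carrier (PMon P) \<and> j \<in> carrier X}" for X
    by (auto simp: sqz_prelog_def sqz_monoid_def image_group_inj[OF pr])
  have mm: "pr (a, j) \<otimes>\<^bsub>PMon (sqz_prelog pr P X)\<^esub> pr (b, k) = pr (a \<otimes>\<^bsub>PMon P\<^esub> b, j \<oplus>\<^bsub>X\<^esub> k)"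
    if "a \<in> carrier (PMon P)" "b \<in> carrier (PMon P)" "j \<in> carrier X" "k \<in> carrier X" for a b j k X
    using that by (simp add: sqz_prelog_def sqz_monoid_def image_group_inj[OF pr])
  have m1: "\<one>\<^bsub>PMon (sqz_prelog pr P X)\<^esub> = pr (\<one>\<^bsub>PMon P\<^esub>, \<zero>\<^bsub>X\<^esub>)" for X
    by (simp add: sqz_prelog_def sqz_monoid_def image_group_inj[OF pr])
  have rv: "r (pr (a, j)) = pr (a, h j)" if "a \<in> carrier (PRing P)" "j \<in> carrier J" for a j
    using that by (auto simp: r_def sqz_mor_def rc)
  have vv: "v (pr (a, j)) = pr (a, h j)" if "a \<in> carrier (PMon P)" "j \<in> carrier J" for a j
    using that by (auto simp: v_def sqz_mor_def mc)
  show "a \<in> carrier (PRing P) \<Longrightarrow> j \<in> carrier J \<Longrightarrow> fst (sqz_mor pr P J h) (pr (a, j)) = pr (a, h j)"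
    using rv by (simp add: r_def)
  have rext: "r \<in> extensional (carrier (PRing (sqz_prelog pr P J)))" "v \<in> extensional (carrier (PMon (sqz_prelog pr P J)))"
    by (simp_all add: r_def v_def sqz_mor_def)
  have rh: "r \<in> ring_hom (PRing (sqz_prelog pr P J)) (PRing (sqz_prelog pr P J'))"
    by (rule ring_hom_memI)
      (auto simp: rc rv H sq_ring(3)[unfolded sqz_obj_def fst_conv] sq_ring_ops[unfolded sqz_obj_def fst_conv])
  have vh: "v \<in> mon_hom (PMon (sqz_prelog pr P J)) (PMon (sqz_prelog pr P J'))"
    by (rule mon_homI) (auto simp: mc vv H m1 mm)
  have str: "pstr (sqz_prelog pr P J') (v m) = r (pstr (sqz_prelog pr P J) m)"
    if "m \<in> carrier (PMon (sqz_prelog pr P J))" for m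
    using that by (auto simp: mc vv) (simp add: sqz_prelog_def rv alpha H)
  have "compose (carrier (PRing P)) r (fst (sqz_sec pr P J)) = fst (sqz_sec pr P J')"
    "compose (carrier (PMon P)) v (snd (sqz_sec pr P J)) = snd (sqz_sec pr P J')"
    by (simp_all add: compose_eq_iff sqz_sec_def rv vv H)
  moreover have "compose (carrier (PRing (sqz_prelog pr P J))) (fst (sqz_proj pr P J')) r = fst (sqz_proj pr P J)"
    "compose (carrier (PMon (sqz_prelog pr P J))) (snd (sqz_proj pr P J')) v = snd (sqz_proj pr P J)"
    by (auto simp: compose_eq_iff sqz_proj_def rc mc rv vv H)
  ultimately have "(r, v) \<in> Hom C (sqz_prelog pr P J, (fst (sqz_sec pr P J), snd (sqz_sec pr P J)), (fst (sqz_proj pr P J), snd (sqz_proj pr P J)))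
    (sqz_prelog pr P J', (fst (sqz_sec pr P J'), snd (sqz_sec pr P J')), (fst (sqz_proj pr P J'), snd (sqz_proj pr P J')))"
    unfolding LogRep_hom_iff Log_simps using rext rh vh str by blast
  then show "sqz_mor pr P J h \<in> Hom C (sq J) (sq J')" by (simp add: r_def v_def sqz_obj_def)
qed

lemma der_comp_sq_mor:
  assumes J: "A_mod J" and J': "A_mod J'" and h: "h \<in> mod_hom (PRing P) J J'"
    and Y: "Y \<in> Obj C" and f: "f \<in> Hom C Y (sq J)" and y: "y \<in> carrier (aug_ring Y)"
  shows "der (Comp C Y (sq J) (sq J') (sqz_mor pr P J h) f) y = h (der f y)"
  using y sq_hom_form[OF J Y f y] by (simp add: der_def[of "Comp C Y (sq J) (sq J') (sqz_mor pr P J h) f"] fst_Comp sq_mor(2)[OF J J' h] prj_simps[OF Y])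

lemma der_comp:
  assumes f: "f \<in> Hom C Z Y" and y: "z \<in> carrier (aug_ring Z)"
  shows "der (Comp C Z Y W g f) z = der g (fst f z)"
  using y by (simp add: der_def fst_Comp)

text \<open>The module \<open>J \<oplus> J\<close> inside the universe; its square-zero extension is the product of two copies of
  \<open>A \<oplus> J\<close>, since a derivation into \<open>J \<oplus> J\<close> is a pair of derivations.\<close>

definition "pair_mod J = image_module pr (dsum_module J J)"

lemma pair_mod:
  assumes J: "A_mod J"
  shows "A_mod (pair_mod J)" "carrier (pair_mod J) = {pr (j, k) | j k. j \<in> carrier J \<and> k \<in> carrier J}"
    "(\<lambda>z. fst (inv_into UNIV pr z)) \<in> mod_hom (PRing P) (pair_mod J) J"
    "(\<lambda>z. snd (inv_into UNIV pr z)) \<in> mod_hom (PRing P) (pair_mod J) J"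
    "(\<lambda>z. case inv_into UNIV pr z of (j, k) \<Rightarrow> j \<oplus>\<^bsub>J\<^esub> k) \<in> mod_hom (PRing P) (pair_mod J) J"
    "\<zero>\<^bsub>pair_mod J\<^esub> = pr (\<zero>\<^bsub>J\<^esub>, \<zero>\<^bsub>J\<^esub>)"
    "j \<in> carrier J \<Longrightarrow> k \<in> carrier J \<Longrightarrow> j' \<in> carrier J \<Longrightarrow> k' \<in> carrier J \<Longrightarrow>
      pr (j, k) \<oplus>\<^bsub>pair_mod J\<^esub> pr (j', k') = pr (j \<oplus>\<^bsub>J\<^esub> j', k \<oplus>\<^bsub>J\<^esub> k')"
    "j \<in> carrier J \<Longrightarrow> k \<in> carrier J \<Longrightarrow> r \<odot>\<^bsub>pair_mod J\<^esub> pr (j, k) = pr (r \<odot>\<^bsub>J\<^esub> j, r \<odot>\<^bsub>J\<^esub> k)"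
proof -
  interpret J: module "PRing P" J by fact
  show "A_mod (pair_mod J)" unfolding pair_mod_def by (intro module_image_module pr module_dsum J)
  show c: "carrier (pair_mod J) = {pr (j, k) | j k. j \<in> carrier J \<and> k \<in> carrier J}"
    by (auto simp: pair_mod_def image_module_simps[OF pr])
  show "\<zero>\<^bsub>pair_mod J\<^esub> = pr (\<zero>\<^bsub>J\<^esub>, \<zero>\<^bsub>J\<^esub>)" by (simp add: pair_mod_def image_module_simps[OF pr])
  show a: "j \<in> carrier J \<Longrightarrow> k \<in> carrier J \<Longrightarrow> j' \<in> carrier J \<Longrightarrow> k' \<in> carrier J \<Longrightarrow>
      pr (j, k) \<oplus>\<^bsub>pair_mod J\<^esub> pr (j', k') = pr (j \<oplus>\<^bsub>J\<^esub> j', k \<oplus>\<^bsub>J\<^esub> k')" for j k j' k'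
    by (simp add: pair_mod_def image_module_simps[OF pr])
  show s: "j \<in> carrier J \<Longrightarrow> k \<in> carrier J \<Longrightarrow> r \<odot>\<^bsub>pair_mod J\<^esub> pr (j, k) = pr (r \<odot>\<^bsub>J\<^esub> j, r \<odot>\<^bsub>J\<^esub> k)" for j k r
    by (simp add: pair_mod_def image_module_simps[OF pr])
  show "(\<lambda>z. fst (inv_into UNIV pr z)) \<in> mod_hom (PRing P) (pair_mod J) J"
    "(\<lambda>z. snd (inv_into UNIV pr z)) \<in> mod_hom (PRing P) (pair_mod J) J"
    "(\<lambda>z. case inv_into UNIV pr z of (j, k) \<Rightarrow> j \<oplus>\<^bsub>J\<^esub> k) \<in> mod_hom (PRing P) (pair_mod J) J"
    by (rule mod_homI; auto simp: c a s J.M.a_ac J.smult_r_distr)+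
qed

lemma neg_mod_hom:
  assumes J: "A_mod J"
  shows "(\<lambda>j. \<ominus>\<^bsub>J\<^esub> j) \<in> mod_hom (PRing P) J J"
proof -
  interpret J: module "PRing P" J by fact
  show ?thesis by (rule mod_homI) (simp_all add: J.M.minus_add J.smult_r_minus)
qed

lemma sq_ab_simps:
  "ab_obj (sqz_ab pr P J) = sq J" "ab_prod (sqz_ab pr P J) = sq (pair_mod J)"
  "ab_p1 (sqz_ab pr P J) = sqz_mor pr P (pair_mod J) (\<lambda>z. fst (inv_into UNIV pr z))"
  "ab_p2 (sqz_ab pr P J) = sqz_mor pr P (pair_mod J) (\<lambda>z. snd (inv_into UNIV pr z))"
  "ab_term (sqz_ab pr P J) = base_obj"
  "ab_add (sqz_ab pr P J) = sqz_mor pr P (pair_mod J) (\<lambda>z. case inv_into UNIV pr z of (j, k) \<Rightarrow> j \<oplus>\<^bsub>J\<^esub> k)"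
  "ab_zero (sqz_ab pr P J) = sqz_sec pr P J"
  "ab_neg (sqz_ab pr P J) = sqz_mor pr P J (\<lambda>j. \<ominus>\<^bsub>J\<^esub> j)"
  by (simp_all add: sqz_ab_def pair_mod_def Let_def base_obj_def)

lemma sq_product:
  assumes J: "A_mod J"
  defines "p1 \<equiv> sqz_mor pr P (pair_mod J) (\<lambda>z. fst (inv_into UNIV pr z))"
    and "p2 \<equiv> sqz_mor pr P (pair_mod J) (\<lambda>z. snd (inv_into UNIV pr z))"
  shows "is_product C (sq J) (sq J) (sq (pair_mod J)) p1 p2"
    and "\<And>Z f g h z. Z \<in> Obj C \<Longrightarrow> f \<in> Hom C Z (sq J) \<Longrightarrow> g \<in> Hom C Z (sq J) \<Longrightarrow> h \<in> Hom C Z (sq (pair_mod J)) \<Longrightarrow>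
      Comp C Z (sq (pair_mod J)) (sq J) p1 h = f \<Longrightarrow> Comp C Z (sq (pair_mod J)) (sq J) p2 h = g \<Longrightarrow>
      z \<in> carrier (aug_ring Z) \<Longrightarrow> der h z = pr (der f z, der g z)"
proof -
  interpret J: module "PRing P" J by fact
  note JJ = pair_mod[OF J]
  have p: "p1 \<in> Hom C (sq (pair_mod J)) (sq J)" "p2 \<in> Hom C (sq (pair_mod J)) (sq J)"
    unfolding p1_def p2_def using sq_mor(1)[OF JJ(1) J] JJ(3,4) by blast+
  have comp: "der h z = pr (der (Comp C Z (sq (pair_mod J)) (sq J) p1 h) z, der (Comp C Z (sq (pair_mod J)) (sq J) p2 h) z)"
    if Z: "Z \<in> Obj C" and h: "h \<in> Hom C Z (sq (pair_mod J))" and z: "z \<in> carrier (aug_ring Z)" for Z h z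
    unfolding p1_def p2_def
    using sq_hom_form(2)[OF JJ(1) Z h z]
    by (auto simp: der_comp_sq_mor[OF JJ(1) J JJ(3) Z h z] der_comp_sq_mor[OF JJ(1) J JJ(4) Z h z] JJ(2))
  then show fm: "\<And>Z f g h z. Z \<in> Obj C \<Longrightarrow> f \<in> Hom C Z (sq J) \<Longrightarrow> g \<in> Hom C Z (sq J) \<Longrightarrow> h \<in> Hom C Z (sq (pair_mod J)) \<Longrightarrow>
      Comp C Z (sq (pair_mod J)) (sq J) p1 h = f \<Longrightarrow> Comp C Z (sq (pair_mod J)) (sq J) p2 h = g \<Longrightarrow>
      z \<in> carrier (aug_ring Z) \<Longrightarrow> der h z = pr (der f z, der g z)" by blast
  show "is_product C (sq J) (sq J) (sq (pair_mod J)) p1 p2"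
    unfolding is_product_def
  proof (intro conjI ballI)
    show "sq (pair_mod J) \<in> Obj C" by (rule sq_obj[OF JJ(1)])
    fix Z f g assume Z: "Z \<in> Obj C" and f: "f \<in> Hom C Z (sq J)" and g: "g \<in> Hom C Z (sq J)"
    interpret Z: cring "aug_ring Z" by (rule objD(1)[OF Z])
    have "derivation Z (pair_mod J) (\<lambda>z. pr (der f z, der g z))"
      using derivation_der[OF J Z f] derivation_der[OF J Z g]
      unfolding derivation_def by (auto simp: JJ(2,6,7,8) prj_simps[OF Z])
    then obtain h where h: "h \<in> Hom C Z (sq (pair_mod J))" "\<And>z. z \<in> carrier (aug_ring Z) \<Longrightarrow> der h z = pr (der f z, der g z)"
      using derivation_hom[OF JJ(1) Z] by blast
    have ph: "Comp C Z (sq (pair_mod J)) (sq J) p1 h \<in> Hom C Z (sq J)" "Comp C Z (sq (pair_mod J)) (sq J) p2 h \<in> Hom C Z (sq J)"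
      by (rule CD(2)[OF Z sq_obj[OF JJ(1)] sq_obj[OF J] h(1)], rule p)+
    have h1: "Comp C Z (sq (pair_mod J)) (sq J) p1 h = f" "Comp C Z (sq (pair_mod J)) (sq J) p2 h = g"
      using comp[OF Z h(1)] h(2) by (auto intro!: sq_hom_eqI[OF J Z ph(1) f] sq_hom_eqI[OF J Z ph(2) g])
    show "\<exists>!h. h \<in> Hom C Z (sq (pair_mod J)) \<and> Comp C Z (sq (pair_mod J)) (sq J) p1 h = f \<and>
       Comp C Z (sq (pair_mod J)) (sq J) p2 h = g"
    proof (rule ex1I[of _ h])
      fix h' assume h': "h' \<in> Hom C Z (sq (pair_mod J)) \<and> Comp C Z (sq (pair_mod J)) (sq J) p1 h' = f \<and>
       Comp C Z (sq (pair_mod J)) (sq J) p2 h' = g"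
      show "h' = h"
        by (rule sq_hom_eqI[OF JJ(1) Z]) (use h' h fm[OF Z f g] in auto)
    qed (use h(1) h1 in blast)
  qed (rule p)+
qed

lemma sq_zero: "A_mod J \<Longrightarrow> sqz_sec pr P J \<in> Hom C base_obj (sq J)"
proof -
  assume J: "A_mod J"
  let ?s = "sqz_sec pr P J" and ?Q = "sqz_prelog pr P J"
  have "(?Q, (fst ?s, snd ?s), (fst (sqz_proj pr P J), snd (sqz_proj pr P J))) \<in> Obj C"
    using sq_obj[OF J] by (simp add: sqz_obj_def)
  then have sl: "split_log P ?Q (fst ?s) (snd ?s) (fst (sqz_proj pr P J)) (snd (sqz_proj pr P J))"
    and ext: "fst ?s \<in> extensional (carrier (PRing P))" "snd ?s \<in> extensional (carrier (PMon P))"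
    using LogRep_obj_iff[OF P] by blast+
  interpret split_log P ?Q "fst ?s" "snd ?s" "fst (sqz_proj pr P J)" "snd (sqz_proj pr P J)" by (rule sl)
  have "(fst ?s, snd ?s) \<in> Hom C (P, (\<lambda>x\<in>carrier (PRing P). x, \<lambda>x\<in>carrier (PMon P). x), (\<lambda>x\<in>carrier (PRing P). x, \<lambda>x\<in>carrier (PMon P). x))
    (?Q, (fst ?s, snd ?s), (fst (sqz_proj pr P J), snd (sqz_proj pr P J)))"
    unfolding LogRep_hom_iff Log_simps using ext
    by (simp add: s1 s2 s compose_eq_restrict_iff ps1 ps2 compose_restrict_id)
  then show ?thesis by (simp add: sqz_obj_def base_obj_def Log_simps)
qed

lemma sq_ab_plus:
  assumes J: "A_mod J" and Y: "Y \<in> Obj C" and a: "a \<in> Hom C Y (sq J)" and b: "b \<in> Hom C Y (sq J)"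
  shows "ab_plus C (sqz_ab pr P J) Y a b \<in> Hom C Y (sq J)"
    and "y \<in> carrier (aug_ring Y) \<Longrightarrow> der (ab_plus C (sqz_ab pr P J) Y a b) y = der a y \<oplus>\<^bsub>J\<^esub> der b y"
proof -
  note JJ = pair_mod[OF J] and PR = sq_product[OF J]
  note q = pairing[OF PR(1) Y a b]
  show "ab_plus C (sqz_ab pr P J) Y a b \<in> Hom C Y (sq J)"
    unfolding ab_plus_def sq_ab_simps by (rule CD(2)[OF Y sq_obj[OF JJ(1)] sq_obj[OF J] q(1) sq_mor(1)[OF JJ(1) J JJ(5)]])
  show "der (ab_plus C (sqz_ab pr P J) Y a b) y = der a y \<oplus>\<^bsub>J\<^esub> der b y" if y: "y \<in> carrier (aug_ring Y)"
    unfolding ab_plus_def sq_ab_simps der_comp_sq_mor[OF JJ(1) J JJ(5) Y q(1) y] PR(2)[OF Y a b q(1-3) y] by simp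
qed

lemma sq_ab_null:
  assumes J: "A_mod J" and Y: "Y \<in> Obj C"
  shows "ab_null C (sqz_ab pr P J) Y \<in> Hom C Y (sq J)"
    and "y \<in> carrier (aug_ring Y) \<Longrightarrow> der (ab_null C (sqz_ab pr P J) Y) y = \<zero>\<^bsub>J\<^esub>"
proof -
  note t = to_terminal(1)[OF terminal_base_obj Y]
  show "ab_null C (sqz_ab pr P J) Y \<in> Hom C Y (sq J)"
    unfolding ab_null_def sq_ab_simps by (rule CD(2)[OF Y base_obj sq_obj[OF J] t sq_zero[OF J]])
  show "der (ab_null C (sqz_ab pr P J) Y) y = \<zero>\<^bsub>J\<^esub>" if y: "y \<in> carrier (aug_ring Y)"
    unfolding ab_null_def sq_ab_simps der_comp[OF t y]
    using hom_closed[OF t y] by (simp add: base_obj_simps der_def sqz_sec_def)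
qed

lemma sq_abobj:
  assumes J: "A_mod J"
  shows "is_abobj C (sqz_ab pr P J)"
proof -
  interpret J: module "PRing P" J by fact
  note JJ = pair_mod[OF J] and plus = sq_ab_plus[OF J] and null = sq_ab_null[OF J]
  note E = sq_hom_eqI[OF J] and neg = sq_mor(1)[OF J J neg_mod_hom[OF J]]
  have dc: "der a y \<in> carrier J" if "Y \<in> Obj C" "a \<in> Hom C Y (sq J)" "y \<in> carrier (aug_ring Y)" for Y a y
    by (rule sq_hom_form(2)[OF J that])
  show ?thesis
    unfolding is_abobj_def sq_ab_simps
  proof (intro conjI ballI)
    show "is_product C (sq J) (sq J) (sq (pair_mod J)) (sqz_mor pr P (pair_mod J) (\<lambda>z. fst (inv_into UNIV pr z)))
        (sqz_mor pr P (pair_mod J) (\<lambda>z. snd (inv_into UNIV pr z)))" by (rule sq_product(1)[OF J])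
  next
    fix Y a b c assume Y: "Y \<in> Obj C" and a: "a \<in> Hom C Y (sq J)" and b: "b \<in> Hom C Y (sq J)" and c: "c \<in> Hom C Y (sq J)"
    show "ab_plus C (sqz_ab pr P J) Y (ab_plus C (sqz_ab pr P J) Y a b) c =
      ab_plus C (sqz_ab pr P J) Y a (ab_plus C (sqz_ab pr P J) Y b c)"
      by (rule E[OF Y]) (simp_all add: plus[OF Y] Y a b c dc[OF Y] J.M.a_assoc)
  next
    fix Y a b assume Y: "Y \<in> Obj C" and a: "a \<in> Hom C Y (sq J)" and b: "b \<in> Hom C Y (sq J)"
    show "ab_plus C (sqz_ab pr P J) Y a b = ab_plus C (sqz_ab pr P J) Y b a"
      by (rule E[OF Y]) (simp_all add: plus[OF Y] Y a b dc[OF Y] J.M.a_comm)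
  next
    fix Y a assume Y: "Y \<in> Obj C" and a: "a \<in> Hom C Y (sq J)"
    show "ab_plus C (sqz_ab pr P J) Y (ab_null C (sqz_ab pr P J) Y) a = a"
      by (rule E[OF Y]) (simp_all add: plus[OF Y] null[OF Y] Y a dc[OF Y])
    have n: "Comp C Y (sq J) (sq J) (sqz_mor pr P J (a_inv J)) a \<in> Hom C Y (sq J)"
      by (rule CD(2)[OF Y sq_obj[OF J] sq_obj[OF J] a neg])
    show "ab_plus C (sqz_ab pr P J) Y (Comp C Y (sq J) (sq J) (sqz_mor pr P J (a_inv J)) a) a = ab_null C (sqz_ab pr P J) Y"
      by (rule E[OF Y]) (simp_all add: plus[OF Y] null[OF Y] Y a n dc[OF Y] der_comp_sq_mor[OF J J neg_mod_hom[OF J] Y a] J.M.l_neg)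
  qed (simp_all add: sq_obj[OF J] terminal_base_obj sq_mor(1)[OF JJ(1) J JJ(5)] sq_zero[OF J] neg)
qed

subsection \<open>The equivalence with modules\<close>

lemma sq_functor: "is_functor (Mod_cat (PRing P)) (Ab C) (sqz_functor pr P)"
  unfolding is_functor_def sqz_functor_def fctr.simps
proof (intro conjI ballI)
  show "category (Mod_cat (PRing P))" by (rule category_Mod_cat)
  show "category (Ab C)" by (rule category_Ab[OF catC])
  show "sqz_ab pr P X \<in> Obj (Ab C)" if "X \<in> Obj (Mod_cat (PRing P))" for X :: "('u, 'u) module"
    using that by (simp add: Ab_simps Mod_cat_simps sq_abobj)
  show "sqz_mor pr P X f \<in> Hom (Ab C) (sqz_ab pr P X) (sqz_ab pr P Y)"
    if "X \<in> Obj (Mod_cat (PRing P))" "Y \<in> Obj (Mod_cat (PRing P))" "f \<in> Hom (Mod_cat (PRing P)) X Y" for X Y :: "('u, 'u) module" and f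
    using that by (simp add: Mod_cat_simps Ab_hom_iff[OF sq_abobj sq_abobj] sq_ab_simps sq_mor(1))
next
  fix X :: "('u, 'u) module" assume "X \<in> Obj (Mod_cat (PRing P))"
  then have X: "A_mod X" by (simp add: Mod_cat_simps)
  have i: "Ident (Mod_cat (PRing P)) X \<in> mod_hom (PRing P) X X"
    using categoryD(1)[OF category_Mod_cat, of X "PRing P"] X by (simp add: Mod_cat_simps)
  note o = sq_obj[OF X]
  show "sqz_mor pr P X (Ident (Mod_cat (PRing P)) X) = Ident (Ab C) (sqz_ab pr P X)"
    unfolding Ab_simps sq_ab_simps
    by (rule hom_eqI[OF sq_mor(1)[OF X X i] CD(1)[OF o] o o])
      (auto simp: sq_ring(1) sq_mor(2)[OF X X i[unfolded Mod_cat_simps]] fst_Ident Mod_cat_simps)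
next
  fix X Y Z :: "('u, 'u) module" and f g assume "X \<in> Obj (Mod_cat (PRing P))" "Y \<in> Obj (Mod_cat (PRing P))" "Z \<in> Obj (Mod_cat (PRing P))"
    "f \<in> Hom (Mod_cat (PRing P)) X Y" "g \<in> Hom (Mod_cat (PRing P)) Y Z"
  then have X: "A_mod X" and Y: "A_mod Y" and Z: "A_mod Z" and f: "f \<in> mod_hom (PRing P) X Y" and g: "g \<in> mod_hom (PRing P) Y Z"
    by (simp_all add: Mod_cat_simps)
  note gf = mod_hom_compose[OF X f g]
  have F: "sqz_mor pr P X f \<in> Hom C (sq X) (sq Y)" "sqz_mor pr P Y g \<in> Hom C (sq Y) (sq Z)"
    by (rule sq_mor(1)[OF X Y f], rule sq_mor(1)[OF Y Z g])
  show "sqz_mor pr P X (Comp (Mod_cat (PRing P)) X Y Z g f) =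
     Comp (Ab C) (sqz_ab pr P X) (sqz_ab pr P Y) (sqz_ab pr P Z) (sqz_mor pr P Y g) (sqz_mor pr P X f)"
    unfolding Ab_simps sq_ab_simps Mod_cat_simps
  proof (rule hom_eqI[OF sq_mor(1)[OF X Z gf] CD(2)[OF sq_obj[OF X] sq_obj[OF Y] sq_obj[OF Z] F] sq_obj[OF X] sq_obj[OF Z]])
    fix x assume x: "x \<in> carrier (aug_ring (sq X))"
    then obtain a j where e: "x = pr (a, j)" "a \<in> carrier (PRing P)" "j \<in> carrier X" by (auto simp: sq_ring(1))
    show "fst (sqz_mor pr P X (compose (carrier X) g f)) x =
         fst (Comp C (sq X) (sq Y) (sq Z) (sqz_mor pr P Y g) (sqz_mor pr P X f)) x"
      unfolding fst_Comp[OF x] using e mod_homD(1)[OF f]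
      by (simp add: sq_mor(2)[OF X Y f] sq_mor(2)[OF Y Z g] sq_mor(2)[OF X Z gf] compose_apply)
  qed
qed

text \<open>A derivation on \<open>A \<oplus> X\<close> that vanishes on \<open>A\<close> is determined by its restriction to \<open>X\<close>, where the
  Leibniz rule is linearity over \<open>A\<close>.\<close>

lemma sq_full:
  assumes X: "A_mod X" and Y: "A_mod Y" and f: "f \<in> Hom C (sq X) (sq Y)"
  shows "\<exists>h\<in>Hom (Mod_cat (PRing P)) X Y. sqz_mor pr P X h = f"
proof -
  interpret X: module "PRing P" X by fact
  interpret Y: module "PRing P" Y by fact
  let ?z = "\<zero>\<^bsub>PRing P\<^esub>"
  have o: "sq X \<in> Obj C" by (rule sq_obj[OF X])
  have pc: "pr (a, j) \<in> carrier (aug_ring (sq X))" if "a \<in> carrier (PRing P)" "j \<in> carrier X" for a j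
    using that by (auto simp: sq_ring(1))
  define h where "h = (\<lambda>j\<in>carrier X. der f (pr (?z, j)))"
  note D = derivation_der[OF Y o f, unfolded derivation_def]
  have ds: "der f (pr (a, \<zero>\<^bsub>X\<^esub>)) = \<zero>\<^bsub>Y\<^esub>" if "a \<in> carrier (PRing P)" for a
    using D that sq_sec[OF that, of X] by auto
  have da: "der f (x \<oplus>\<^bsub>aug_ring (sq X)\<^esub> y) = der f x \<oplus>\<^bsub>Y\<^esub> der f y"
    if "x \<in> carrier (aug_ring (sq X))" "y \<in> carrier (aug_ring (sq X))" for x y using D that by blast
  have dm: "der f (x \<otimes>\<^bsub>aug_ring (sq X)\<^esub> y) = (aug_prj (sq X) x \<odot>\<^bsub>Y\<^esub> der f y) \<oplus>\<^bsub>Y\<^esub> (aug_prj (sq X) y \<odot>\<^bsub>Y\<^esub> der f x)"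
    if "x \<in> carrier (aug_ring (sq X))" "y \<in> carrier (aug_ring (sq X))" for x y using D that by blast
  have dc: "der f x \<in> carrier Y" if "x \<in> carrier (aug_ring (sq X))" for x using D that by blast
  have h: "h \<in> mod_hom (PRing P) X Y"
  proof (rule mod_homI)
    show "h x \<in> carrier Y" if "x \<in> carrier X" for x using that by (simp add: h_def dc pc)
    show "h (x \<oplus>\<^bsub>X\<^esub> y) = h x \<oplus>\<^bsub>Y\<^esub> h y" if "x \<in> carrier X" "y \<in> carrier X" for x y
      using that da[of "pr (?z, x)" "pr (?z, y)"] by (simp add: h_def pc sq_ring_ops)
    show "h (r \<odot>\<^bsub>X\<^esub> x) = r \<odot>\<^bsub>Y\<^esub> h x" if "r \<in> carrier (PRing P)" "x \<in> carrier X" for r x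
      using that dm[of "pr (r, \<zero>\<^bsub>X\<^esub>)" "pr (?z, x)"] ds[of r] dc[OF pc[of ?z x]]
      by (simp add: h_def pc sq_ring_ops sq_prj)
  qed
  have "sqz_mor pr P X h = f"
  proof (rule hom_eqI[OF sq_mor(1)[OF X Y h] f o sq_obj[OF Y]])
    fix x assume x: "x \<in> carrier (aug_ring (sq X))"
    then obtain a j where e: "x = pr (a, j)" "a \<in> carrier (PRing P)" "j \<in> carrier X" by (auto simp: sq_ring(1))
    have "der f (pr (a, \<zero>\<^bsub>X\<^esub>) \<oplus>\<^bsub>aug_ring (sq X)\<^esub> pr (?z, j)) = h j"
      using e ds dc[OF pc[of ?z j]] by (subst da) (simp_all add: pc h_def)
    then have "der f x = h j" using e by (simp add: sq_ring_ops)
    then show "fst (sqz_mor pr P X h) x = fst f x"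
      using sq_hom_form(1)[OF Y o f x] e by (simp add: sq_mor(2)[OF X Y h] sq_prj)
  qed
  moreover have "h \<in> Hom (Mod_cat (PRing P)) X Y" using h by (simp add: Mod_cat_simps) (simp add: h_def)
  ultimately show ?thesis by blast
qed

lemma sq_faithful:
  assumes X: "A_mod X" and Y: "A_mod Y" and h: "h \<in> Hom (Mod_cat (PRing P)) X Y" and h': "h' \<in> Hom (Mod_cat (PRing P)) X Y"
    and eq: "sqz_mor pr P X h = sqz_mor pr P X h'"
  shows "h = h'"
proof (rule extensionalityI)
  show "h \<in> extensional (carrier X)" "h' \<in> extensional (carrier X)" using h h' by (simp_all add: Mod_cat_simps)
  have H: "h \<in> mod_hom (PRing P) X Y" "h' \<in> mod_hom (PRing P) X Y" using h h' by (simp_all add: Mod_cat_simps)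
  fix j assume j: "j \<in> carrier X"
  have "pr (\<zero>\<^bsub>PRing P\<^esub>, h j) = pr (\<zero>\<^bsub>PRing P\<^esub>, h' j)"
    using sq_mor(2)[OF X Y H(1) A.zero_closed j] sq_mor(2)[OF X Y H(2) A.zero_closed j] by (simp add: eq)
  then show "h j = h' j" by simp
qed

text \<open>The augmentation ideal of an abelian group object, as an \<open>A\<close>-module through the section.\<close>

definition aug_module :: "('u, 'u) aug_prelog \<Rightarrow> ('u, 'u) module" where
  "aug_module X = \<lparr>carrier = {b \<in> carrier (aug_ring X). aug_prj X b = \<zero>\<^bsub>PRing P\<^esub>},
     mult = undefined, one = undefined, zero = \<zero>\<^bsub>aug_ring X\<^esub>, add = add (aug_ring X),
     smult = (\<lambda>a b. aug_sec X a \<otimes>\<^bsub>aug_ring X\<^esub> b)\<rparr>"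

lemma aug_module:
  assumes X: "X \<in> Obj C"
  shows "A_mod (aug_module X)"
proof -
  interpret X: cring "aug_ring X" by (rule objD(1)[OF X])
  note S = sec_simps[OF X] and PP = prj_simps[OF X]
  show ?thesis
  proof (rule moduleI)
    show "abelian_group (aug_module X)"
    proof (rule abelian_groupI)
      fix x assume "x \<in> carrier (aug_module X)"
      then show "\<exists>y\<in>carrier (aug_module X). y \<oplus>\<^bsub>aug_module X\<^esub> x = \<zero>\<^bsub>aug_module X\<^esub>"
        by (intro bexI[of _ "\<ominus>\<^bsub>aug_ring X\<^esub> x"]) (auto simp: aug_module_def PP X.l_neg)
    qed (auto simp: aug_module_def PP X.a_ac)
  qed (auto simp: aug_module_def A.cring_axioms S PP X.l_distr X.r_distr X.m_assoc)
qed

text \<open>The augmentation ideal \<open>J\<close> has square zero, so \<open>(a, j) \<mapsto> s a + j\<close> is a ring map \<open>A \<oplus> J \<rightarrow> B\<close>, with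
  inverse \<open>b \<mapsto> (p b, b - s(p b))\<close>.\<close>

lemma ab_ess_surj:
  assumes g: "is_abobj C g"
  shows "\<exists>J e. A_mod J \<and> isomorphism (Ab C) (sqz_ab pr P J) g e"
proof -
  let ?G = "ab_obj g"
  have o: "?G \<in> Obj C" by (rule abobjD(1)[OF g])
  interpret B: cring "aug_ring ?G" by (rule objD(1)[OF o])
  note S = sec_simps[OF o] and PP = prj_simps[OF o] and sq0 = ab_square_zero[OF g]
  define J where "J = aug_module ?G"
  have J: "A_mod J" unfolding J_def by (rule aug_module[OF o])
  interpret J: module "PRing P" J by (rule J)
  have Jc: "j \<in> carrier J \<longleftrightarrow> j \<in> carrier (aug_ring ?G) \<and> aug_prj ?G j = \<zero>\<^bsub>PRing P\<^esub>" for j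
    by (auto simp: J_def aug_module_def)
  have Jo: "\<zero>\<^bsub>J\<^esub> = \<zero>\<^bsub>aug_ring ?G\<^esub>" "i \<oplus>\<^bsub>J\<^esub> j = i \<oplus>\<^bsub>aug_ring ?G\<^esub> j"
    "a \<odot>\<^bsub>J\<^esub> j = aug_sec ?G a \<otimes>\<^bsub>aug_ring ?G\<^esub> j" for i j a
    by (simp_all add: J_def aug_module_def)
  note so = sq_obj[OF J]
  have "\<exists>f\<in>Hom C (sq J) ?G. \<forall>x\<in>carrier (aug_ring (sq J)). fst f x =
      (\<lambda>x. aug_sec ?G (fst (inv_into UNIV pr x)) \<oplus>\<^bsub>aug_ring ?G\<^esub> snd (inv_into UNIV pr x)) x"
  proof (rule hom_lift[OF so o])
    show "(\<lambda>x. aug_sec ?G (fst (inv_into UNIV pr x)) \<oplus>\<^bsub>aug_ring ?G\<^esub> snd (inv_into UNIV pr x)) \<in> ring_hom (aug_ring (sq J)) (aug_ring ?G)"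
    proof (rule ring_hom_memI)
      fix x y assume "x \<in> carrier (aug_ring (sq J))" "y \<in> carrier (aug_ring (sq J))"
      then obtain a i b j where e: "x = pr (a, i)" "y = pr (b, j)"
        and h: "a \<in> carrier (PRing P)" "b \<in> carrier (PRing P)" "i \<in> carrier J" "j \<in> carrier J"
        by (auto simp: sq_ring(1))
      have h': "i \<in> carrier (aug_ring ?G)" "j \<in> carrier (aug_ring ?G)" "i \<otimes>\<^bsub>aug_ring ?G\<^esub> j = \<zero>\<^bsub>aug_ring ?G\<^esub>"
        using h sq0 by (auto simp: Jc)
      show "aug_sec ?G (fst (inv_into UNIV pr x)) \<oplus>\<^bsub>aug_ring ?G\<^esub> snd (inv_into UNIV pr x) \<in> carrier (aug_ring ?G)"
        using h h' by (simp add: e S)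
      show "aug_sec ?G (fst (inv_into UNIV pr (x \<oplus>\<^bsub>aug_ring (sq J)\<^esub> y))) \<oplus>\<^bsub>aug_ring ?G\<^esub> snd (inv_into UNIV pr (x \<oplus>\<^bsub>aug_ring (sq J)\<^esub> y)) =
        aug_sec ?G (fst (inv_into UNIV pr x)) \<oplus>\<^bsub>aug_ring ?G\<^esub> snd (inv_into UNIV pr x) \<oplus>\<^bsub>aug_ring ?G\<^esub>
        (aug_sec ?G (fst (inv_into UNIV pr y)) \<oplus>\<^bsub>aug_ring ?G\<^esub> snd (inv_into UNIV pr y))"
        using h h' by (simp add: e S sq_ring_ops Jo B.a_ac)
      show "aug_sec ?G (fst (inv_into UNIV pr (x \<otimes>\<^bsub>aug_ring (sq J)\<^esub> y))) \<oplus>\<^bsub>aug_ring ?G\<^esub> snd (inv_into UNIV pr (x \<otimes>\<^bsub>aug_ring (sq J)\<^esub> y)) =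
        (aug_sec ?G (fst (inv_into UNIV pr x)) \<oplus>\<^bsub>aug_ring ?G\<^esub> snd (inv_into UNIV pr x)) \<otimes>\<^bsub>aug_ring ?G\<^esub>
        (aug_sec ?G (fst (inv_into UNIV pr y)) \<oplus>\<^bsub>aug_ring ?G\<^esub> snd (inv_into UNIV pr y))"
        using h h' by (simp add: e S sq_ring_ops Jo B.l_distr B.r_distr B.a_ac B.m_comm)
    next
      show "aug_sec ?G (fst (inv_into UNIV pr \<one>\<^bsub>aug_ring (sq J)\<^esub>)) \<oplus>\<^bsub>aug_ring ?G\<^esub> snd (inv_into UNIV pr \<one>\<^bsub>aug_ring (sq J)\<^esub>) = \<one>\<^bsub>aug_ring ?G\<^esub>"
        by (simp add: sq_ring(3) S Jo)
    qed
    show "aug_sec ?G (fst (inv_into UNIV pr (aug_sec (sq J) a))) \<oplus>\<^bsub>aug_ring ?G\<^esub> snd (inv_into UNIV pr (aug_sec (sq J) a)) = aug_sec ?G a"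
      if "a \<in> carrier (PRing P)" for a using that by (simp add: sq_sec S Jo)
    show "aug_prj ?G (aug_sec ?G (fst (inv_into UNIV pr x)) \<oplus>\<^bsub>aug_ring ?G\<^esub> snd (inv_into UNIV pr x)) = aug_prj (sq J) x"
      if "x \<in> carrier (aug_ring (sq J))" for x using that by (auto simp: sq_ring(1) sq_prj S PP Jc)
  qed
  then obtain e where e: "e \<in> Hom C (sq J) ?G" and
    ev: "\<And>a j. a \<in> carrier (PRing P) \<Longrightarrow> j \<in> carrier J \<Longrightarrow> fst e (pr (a, j)) = aug_sec ?G a \<oplus>\<^bsub>aug_ring ?G\<^esub> j"
    by (auto simp: sq_ring(1))
  define d where "d b = b \<ominus>\<^bsub>aug_ring ?G\<^esub> aug_sec ?G (aug_prj ?G b)" for b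
  have dJ: "d b \<in> carrier J" if "b \<in> carrier (aug_ring ?G)" for b
    using that by (simp add: d_def Jc S PP) (simp add: a_minus_def A.r_neg PP)
  have bd: "b = aug_sec ?G (aug_prj ?G b) \<oplus>\<^bsub>aug_ring ?G\<^esub> d b" if "b \<in> carrier (aug_ring ?G)" for b
    using that by (simp add: d_def a_minus_def S PP B.a_lcomm[of "aug_sec ?G (aug_prj ?G b)" b] B.r_neg)
  \<comment> \<open>Since \<open>d b\<close> is the only solution of \<open>b = s(p b) + d b\<close>, the rules for \<open>d\<close> follow by expanding sums and products.\<close>
  have dun: "i = d b" if "b \<in> carrier (aug_ring ?G)" "i \<in> carrier (aug_ring ?G)" "b = aug_sec ?G (aug_prj ?G b) \<oplus>\<^bsub>aug_ring ?G\<^esub> i" for b i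
  proof -
    have "aug_sec ?G (aug_prj ?G b) \<oplus>\<^bsub>aug_ring ?G\<^esub> i = aug_sec ?G (aug_prj ?G b) \<oplus>\<^bsub>aug_ring ?G\<^esub> d b"
      using that(3) bd[OF that(1)] by simp
    moreover have sc: "aug_sec ?G (aug_prj ?G b) \<in> carrier (aug_ring ?G)" "d b \<in> carrier (aug_ring ?G)"
      using that(1) dJ[OF that(1)] by (simp_all add: S PP Jc)
    ultimately have "i \<oplus>\<^bsub>aug_ring ?G\<^esub> aug_sec ?G (aug_prj ?G b) = d b \<oplus>\<^bsub>aug_ring ?G\<^esub> aug_sec ?G (aug_prj ?G b)"
      using that(2) by (simp add: B.a_comm)
    then show ?thesis using B.add.right_cancel[OF sc(1) that(2) sc(2)] by simp
  qed
  have der: "derivation ?G J d"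
    unfolding derivation_def
  proof (intro conjI ballI)
    fix b c assume b: "b \<in> carrier (aug_ring ?G)" and c: "c \<in> carrier (aug_ring ?G)"
    note db = dJ[OF b, unfolded Jc] dJ[OF c, unfolded Jc]
    have z: "d b \<otimes>\<^bsub>aug_ring ?G\<^esub> d c = \<zero>\<^bsub>aug_ring ?G\<^esub>" using db sq0 by blast
    let ?s = "aug_sec ?G (aug_prj ?G b)" and ?t = "aug_sec ?G (aug_prj ?G c)"
    have st: "?s \<in> carrier (aug_ring ?G)" "?t \<in> carrier (aug_ring ?G)" using b c by (simp_all add: S PP)
    have "b \<oplus>\<^bsub>aug_ring ?G\<^esub> c = (?s \<oplus>\<^bsub>aug_ring ?G\<^esub> d b) \<oplus>\<^bsub>aug_ring ?G\<^esub> (?t \<oplus>\<^bsub>aug_ring ?G\<^esub> d c)"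
      using bd[OF b] bd[OF c] by simp
    also have "\<dots> = aug_sec ?G (aug_prj ?G (b \<oplus>\<^bsub>aug_ring ?G\<^esub> c)) \<oplus>\<^bsub>aug_ring ?G\<^esub> (d b \<oplus>\<^bsub>aug_ring ?G\<^esub> d c)"
      using b c db st by (simp add: S PP B.a_ac)
    finally show "d (b \<oplus>\<^bsub>aug_ring ?G\<^esub> c) = d b \<oplus>\<^bsub>J\<^esub> d c"
      unfolding Jo using dun[of "b \<oplus>\<^bsub>aug_ring ?G\<^esub> c" "d b \<oplus>\<^bsub>aug_ring ?G\<^esub> d c"] b c db by simp
    have "b \<otimes>\<^bsub>aug_ring ?G\<^esub> c = (?s \<oplus>\<^bsub>aug_ring ?G\<^esub> d b) \<otimes>\<^bsub>aug_ring ?G\<^esub> (?t \<oplus>\<^bsub>aug_ring ?G\<^esub> d c)"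
      using bd[OF b] bd[OF c] by simp
    also have "\<dots> = aug_sec ?G (aug_prj ?G (b \<otimes>\<^bsub>aug_ring ?G\<^esub> c)) \<oplus>\<^bsub>aug_ring ?G\<^esub>
        (?s \<otimes>\<^bsub>aug_ring ?G\<^esub> d c \<oplus>\<^bsub>aug_ring ?G\<^esub> ?t \<otimes>\<^bsub>aug_ring ?G\<^esub> d b)"
      using b c db st z by (simp add: S PP B.l_distr B.r_distr B.a_ac B.m_comm)
    finally show "d (b \<otimes>\<^bsub>aug_ring ?G\<^esub> c) = (aug_prj ?G b \<odot>\<^bsub>J\<^esub> d c) \<oplus>\<^bsub>J\<^esub> (aug_prj ?G c \<odot>\<^bsub>J\<^esub> d b)"
      unfolding Jo
      using dun[of "b \<otimes>\<^bsub>aug_ring ?G\<^esub> c" "?s \<otimes>\<^bsub>aug_ring ?G\<^esub> d c \<oplus>\<^bsub>aug_ring ?G\<^esub> ?t \<otimes>\<^bsub>aug_ring ?G\<^esub> d b"] b c db st by simp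
  next
    fix a assume "a \<in> carrier (PRing P)"
    then show "d (aug_sec ?G a) = \<zero>\<^bsub>J\<^esub>" by (simp add: d_def S Jo a_minus_def B.r_neg)
  qed (rule dJ)
  then obtain e' where e': "e' \<in> Hom C ?G (sq J)" and e'v: "\<And>b. b \<in> carrier (aug_ring ?G) \<Longrightarrow> der e' b = d b"
    using derivation_hom[OF J o] by blast
  have e'w: "fst e' b = pr (aug_prj ?G b, d b)" if "b \<in> carrier (aug_ring ?G)" for b
    using sq_hom_form(1)[OF J o e' that] e'v[OF that] by simp
  have 1: "Comp C (sq J) ?G (sq J) e' e = Ident C (sq J)"
  proof (rule hom_eqI[OF CD(2)[OF so o so e e'] CD(1)[OF so] so so])
    fix x assume x: "x \<in> carrier (aug_ring (sq J))"
    then obtain a j where xe: "x = pr (a, j)" and h: "a \<in> carrier (PRing P)" "j \<in> carrier J" by (auto simp: sq_ring(1))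
    have jc: "j \<in> carrier (aug_ring ?G)" "aug_prj ?G j = \<zero>\<^bsub>PRing P\<^esub>" using h by (simp_all add: Jc)
    have "j = d (aug_sec ?G a \<oplus>\<^bsub>aug_ring ?G\<^esub> j)" by (rule dun) (use h jc in \<open>simp_all add: S PP\<close>)
    then show "fst (Comp C (sq J) ?G (sq J) e' e) x = fst (Ident C (sq J)) x"
      unfolding fst_Comp[OF x] fst_Ident[OF x] using h jc by (simp add: xe ev e'w S PP)
  qed
  have 2: "Comp C ?G (sq J) ?G e e' = Ident C ?G"
  proof (rule hom_eqI[OF CD(2)[OF o so o e' e] CD(1)[OF o] o o])
    fix b assume b: "b \<in> carrier (aug_ring ?G)"
    then show "fst (Comp C ?G (sq J) ?G e e') b = fst (Ident C ?G) b"
      unfolding fst_Comp[OF b] fst_Ident[OF b] using bd[OF b] by (simp add: e'w ev PP dJ)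
  qed
  have "isomorphism (Ab C) (sqz_ab pr P J) g e"
    unfolding isomorphism_def Ab_simps sq_ab_simps Ab_hom_iff[OF sq_abobj[OF J] g] Ab_hom_iff[OF g sq_abobj[OF J]]
    using e 1 2 by (intro conjI bexI[of _ e']) (simp_all add: Ab_hom_iff[OF g sq_abobj[OF J]] sq_ab_simps e')
  with J show ?thesis by blast
qed

theorem sq_equivalence: "is_equivalence (Mod_cat (PRing P)) (Ab C) (sqz_functor pr P)"
proof (rule equivalenceI[OF sq_functor])
  have s: "fobj (sqz_functor pr P) X = sqz_ab pr P X" "fmor (sqz_functor pr P) X Y f = sqz_mor pr P X f" for X Y :: "('u, 'u) module" and f
    by (simp_all add: sqz_functor_def)
  fix X Y :: "('u, 'u) module" and g assume "X \<in> Obj (Mod_cat (PRing P))" "Y \<in> Obj (Mod_cat (PRing P))"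
    "g \<in> Hom (Ab C) (fobj (sqz_functor pr P) X) (fobj (sqz_functor pr P) Y)"
  then show "\<exists>f\<in>Hom (Mod_cat (PRing P)) X Y. fmor (sqz_functor pr P) X Y f = g"
    using sq_full[of X Y g] by (simp only: s Mod_cat_simps(1) Ab_hom_iff[OF sq_abobj sq_abobj] sq_ab_simps)
next
  fix X Y :: "('u, 'u) module" and f f' assume "X \<in> Obj (Mod_cat (PRing P))" "Y \<in> Obj (Mod_cat (PRing P))"
    "f \<in> Hom (Mod_cat (PRing P)) X Y" "f' \<in> Hom (Mod_cat (PRing P)) X Y"
    "fmor (sqz_functor pr P) X Y f = fmor (sqz_functor pr P) X Y f'"
  then show "f = f'" using sq_faithful[of X Y f f'] by (simp add: sqz_functor_def Mod_cat_simps(1))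
next
  fix Y assume "Y \<in> Obj (Ab C)"
  then have "is_abobj C Y" by (simp add: Ab_simps)
  then obtain J e where "A_mod J" "isomorphism (Ab C) (sqz_ab pr P J) Y e" using ab_ess_surj[of Y] by blast
  then show "\<exists>X\<in>Obj (Mod_cat (PRing P)). \<exists>e. isomorphism (Ab C) (fobj (sqz_functor pr P) X) Y e"
    by (intro bexI[of _ J] exI[of _ e]) (simp_all add: Mod_cat_simps(1) sqz_functor_def)
qed

end

section \<open>Quotients and presentations of modules\<close>

lemma mod_hom_minus:
  assumes X: "module R X" and Y: "module R Y" and h: "h \<in> mod_hom R X Y"
    and x: "x \<in> carrier X" "y \<in> carrier X"
  shows "h (x \<ominus>\<^bsub>X\<^esub> y) = h x \<ominus>\<^bsub>Y\<^esub> h y"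
proof -
  interpret X: module R X by fact
  interpret Y: module R Y by fact
  note H = mod_homD[OF h]
  have "h (x \<ominus>\<^bsub>X\<^esub> y) \<oplus>\<^bsub>Y\<^esub> h y = h x"
    using x by (simp flip: H(2) add: a_minus_def X.M.a_assoc X.M.l_neg)
  then show ?thesis
    using x H(1) X.M.minus_closed by (metis Y.M.add.inv_solve_right a_inv_def a_minus_def)
qed

lemma minus_eq_zero_iff:
  assumes "abelian_group X" "x \<in> carrier X" "y \<in> carrier X"
  shows "x \<ominus>\<^bsub>X\<^esub> y = \<zero>\<^bsub>X\<^esub> \<longleftrightarrow> x = y"
proof -
  interpret abelian_group X by fact
  show ?thesis using assms(2,3) by (metis a_minus_def local.minus_minus minus_equality r_neg minus_closed a_inv_closed)
qed

lemma restrict_scalars_simps [simp]: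
  "carrier (restrict_scalars u X) = carrier X" "\<zero>\<^bsub>restrict_scalars u X\<^esub> = \<zero>\<^bsub>X\<^esub>"
  "add (restrict_scalars u X) = add X" "s \<odot>\<^bsub>restrict_scalars u X\<^esub> x = u s \<odot>\<^bsub>X\<^esub> x"
  by (simp_all add: restrict_scalars_def)

lemma module_restrict_scalars:
  assumes "cring S" "u \<in> ring_hom S R" "module R X"
  shows "module S (restrict_scalars u X)"
proof -
  interpret X: module R X by fact
  note U = ring_hom_closed[OF assms(2)] ring_hom_mult[OF assms(2)] ring_hom_add[OF assms(2)] ring_hom_one[OF assms(2)]
  have "abelian_group (restrict_scalars u X)"
  proof (rule abelian_groupI)
    fix x assume "x \<in> carrier (restrict_scalars u X)"
    then show "\<exists>y\<in>carrier (restrict_scalars u X). y \<oplus>\<^bsub>restrict_scalars u X\<^esub> x = \<zero>\<^bsub>restrict_scalars u X\<^esub>"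
      by (intro bexI[of _ "\<ominus>\<^bsub>X\<^esub> x"]) (simp_all add: X.M.l_neg)
  qed (simp_all add: X.M.a_ac)
  then show ?thesis
    by (intro moduleI assms(1)) (simp_all add: U X.smult_l_distr X.smult_r_distr X.smult_assoc1)
qed

locale quotient_module = module R X for R :: "'r ring" and X :: "('r, 'x) module" (structure) +
  fixes K assumes K: "submodule K R X"
begin

lemma K_sub: "K \<subseteq> carrier X" and K_smult: "r \<in> carrier R \<Longrightarrow> x \<in> K \<Longrightarrow> r \<odot> x \<in> K"
  using submoduleE[OF K] by auto

sublocale Q: abelian_subgroup K X
  using submodule.axioms(1)[OF K] abelian_group_axioms by (intro abelian_subgroupI3 additive_subgroup.intro)

lemma coset_eq_iff: "x \<in> carrier X \<Longrightarrow> y \<in> carrier X \<Longrightarrow> K +> x = K +> y \<longleftrightarrow> x \<ominus> y \<in> K"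
proof -
  assume x: "x \<in> carrier X" and y: "y \<in> carrier X"
  have "K +> x = K +> y \<longleftrightarrow> x \<in> K +> y"
  proof
    show "K +> x = K +> y \<Longrightarrow> x \<in> K +> y" using Q.a_rcos_self[OF x] by simp
    show "x \<in> K +> y \<Longrightarrow> K +> x = K +> y" using Q.a_repr_independence'[OF _ y] by simp
  qed
  then show ?thesis using Q.a_rcos_module[OF y x] by (simp add: a_minus_def)
qed

lemma coset_mem: "y \<in> K +> x \<Longrightarrow> x \<in> carrier X \<Longrightarrow> y \<in> carrier X \<and> K +> y = K +> x"
proof
  assume y: "y \<in> K +> x" and x: "x \<in> carrier X"
  show "y \<in> carrier X" using y K_sub x by (auto simp: a_r_coset_def')
  show "K +> y = K +> x" by (rule Q.a_repr_independence'[OF y x, symmetric])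
qed

lemma quot_carrier: "carrier (quot_module X K) = (\<lambda>x. K +> x) ` carrier X"
  by (auto simp: quot_module_def A_RCOSETS_def')

lemma quot_ops:
  assumes "x \<in> carrier X"
  shows "y \<in> carrier X \<Longrightarrow> (K +> x) \<oplus>\<^bsub>quot_module X K\<^esub> (K +> y) = K +> (x \<oplus> y)"
    and "r \<in> carrier R \<Longrightarrow> r \<odot>\<^bsub>quot_module X K\<^esub> (K +> x) = K +> (r \<odot> x)"
    and "\<zero>\<^bsub>quot_module X K\<^esub> = K +> \<zero>"
proof -
  show "y \<in> carrier X \<Longrightarrow> (K +> x) \<oplus>\<^bsub>quot_module X K\<^esub> (K +> y) = K +> (x \<oplus> y)"
    using assms by (simp add: quot_module_def Q.a_rcos_sum)
  show "\<zero>\<^bsub>quot_module X K\<^esub> = K +> \<zero>" using K_sub by (simp add: quot_module_def)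
  assume r: "r \<in> carrier R"
  have "K +> (r \<odot> y) = K +> (r \<odot> x)" if "y \<in> K +> x" for y
  proof -
    have y: "y \<in> carrier X" using coset_mem[OF that assms] by (rule conjunct1)
    have yx: "y \<ominus> x \<in> K" using coset_eq_iff[OF y assms] coset_mem[OF that assms] by simp
    have "r \<odot> y \<ominus> r \<odot> x \<in> K"
      using K_smult[OF r yx] r assms y by (simp add: a_minus_def smult_r_distr smult_r_minus)
    then show ?thesis using coset_eq_iff[of "r \<odot> y" "r \<odot> x"] y r assms by simp
  qed
  then have c: "(\<Union>y\<in>K +> x. K +> (r \<odot> y)) = (\<Union>y\<in>K +> x. K +> (r \<odot> x))" by (intro SUP_cong refl)
  have "K +> x \<noteq> {}" using Q.a_rcos_self[OF assms] by blast
  then have "(\<Union>y\<in>K +> x. K +> (r \<odot> x)) = K +> (r \<odot> x)" by simp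
  then show "r \<odot>\<^bsub>quot_module X K\<^esub> (K +> x) = K +> (r \<odot> x)"
    unfolding quot_module_def using c by simp
qed

lemma quot_abelian_group: "abelian_group (quot_module X K)"
proof (rule abelian_groupI)
  fix u assume "u \<in> carrier (quot_module X K)"
  then obtain x where "u = K +> x" "x \<in> carrier X" by (auto simp: quot_carrier)
  then show "\<exists>v\<in>carrier (quot_module X K). v \<oplus>\<^bsub>quot_module X K\<^esub> u = \<zero>\<^bsub>quot_module X K\<^esub>"
    by (intro bexI[of _ "K +> (\<ominus> x)"]) (simp_all add: quot_carrier quot_ops M.l_neg)
qed (auto simp: quot_carrier quot_ops[OF M.zero_closed] quot_ops M.a_ac)

lemma quot_module: "module R (quot_module X K)"
  by (rule moduleI) (auto simp: R.cring_axioms quot_abelian_group quot_carrier quot_ops smult_l_distr smult_r_distr smult_assoc1)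

lemma quot_proj: "(\<lambda>x. K +> x) \<in> mod_hom R X (quot_module X K)"
  by (rule mod_homI) (simp_all add: quot_carrier quot_ops)

lemma quot_lift_apply:
  assumes Y: "module R Y" and h: "h \<in> mod_hom R X Y" and z: "\<forall>k\<in>K. h k = \<zero>\<^bsub>Y\<^esub>" and x: "x \<in> carrier X"
  shows "h ` (K +> x) = {h x}" "the_elem (h ` (K +> x)) = h x"
proof -
  have "h y = h x" if "y \<in> K +> x" for y
  proof -
    have y1: "y \<in> carrier X" using coset_mem[OF that x] by (rule conjunct1)
    have y2: "y \<ominus> x \<in> K" using coset_eq_iff[OF y1 x] coset_mem[OF that x] by simp
    note y = y1 y2
    have "h y \<ominus>\<^bsub>Y\<^esub> h x = \<zero>\<^bsub>Y\<^esub>" using bspec[OF z y(2)] mod_hom_minus[OF module_axioms Y h y(1) x] by simp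
    then show ?thesis using minus_eq_zero_iff[OF module.axioms(2)[OF Y]] mod_homD(1)[OF h] x y by simp
  qed
  note eq = this
  show "h ` (K +> x) = {h x}"
  proof (intro equalityI subsetI)
    fix z assume "z \<in> h ` (K +> x)"
    then obtain y where "y \<in> K +> x" "z = h y" by blast
    then show "z \<in> {h x}" using eq[of y] by simp
  qed (use Q.a_rcos_self[OF x] in blast)
  then show "the_elem (h ` (K +> x)) = h x" by simp
qed

lemma quot_lift:
  assumes Y: "module R Y" and h: "h \<in> mod_hom R X Y" and z: "\<forall>k\<in>K. h k = \<zero>\<^bsub>Y\<^esub>"
  shows "(\<lambda>U. the_elem (h ` U)) \<in> mod_hom R (quot_module X K) Y"
  using mod_homD[OF h] by (intro mod_homI) (auto simp: quot_carrier quot_ops quot_lift_apply[OF Y h z])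

end

lemma quotient_moduleI: "module R X \<Longrightarrow> submodule K R X \<Longrightarrow> quotient_module R X K"
  by (simp add: quotient_module_def quotient_module_axioms_def)

lemma submodule_kernel:
  assumes X: "module R X" and Y: "module R Y" and h: "h \<in> mod_hom R X Y"
  shows "submodule {x \<in> carrier X. h x = \<zero>\<^bsub>Y\<^esub>} R X"
proof -
  interpret X: module R X by fact
  interpret Y: module R Y by fact
  note H = mod_homD[OF h] mod_hom_zero[OF X Y h]
  show ?thesis
  proof (rule X.submoduleI)
    fix a assume a: "a \<in> {x \<in> carrier X. h x = \<zero>\<^bsub>Y\<^esub>}"
    then have "h (\<zero>\<^bsub>X\<^esub> \<ominus>\<^bsub>X\<^esub> a) = \<zero>\<^bsub>Y\<^esub>" using mod_hom_minus[OF X Y h, of "\<zero>\<^bsub>X\<^esub>" a] by (simp add: H a_minus_def)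
    then show "\<ominus>\<^bsub>X\<^esub> a \<in> {x \<in> carrier X. h x = \<zero>\<^bsub>Y\<^esub>}" using a by (simp add: a_minus_def)
  qed (auto simp: H)
qed

lemma gen_submodule:
  assumes X: "module R X" and E: "E \<subseteq> carrier X"
  shows "submodule (gen_submodule R X E) R X" "E \<subseteq> gen_submodule R X E"
    and "submodule K R X \<Longrightarrow> E \<subseteq> K \<Longrightarrow> gen_submodule R X E \<subseteq> K"
proof -
  interpret X: module R X by fact
  have "carrier X \<in> {K. submodule K R X \<and> E \<subseteq> K}" using X.carrier_is_submodule E by simp
  then have sub: "gen_submodule R X E \<subseteq> carrier X" by (auto simp: gen_submodule_def)
  show "submodule (gen_submodule R X E) R X"
    by (rule X.submoduleI[OF sub])
      (auto simp: gen_submodule_def dest: X.submoduleE(3-5) subgroup.one_closed[OF submodule.axioms(1)])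
  show "E \<subseteq> gen_submodule R X E" by (auto simp: gen_submodule_def)
  show "submodule K R X \<Longrightarrow> E \<subseteq> K \<Longrightarrow> gen_submodule R X E \<subseteq> K" by (auto simp: gen_submodule_def)
qed

lemma gen_submodule_kills:
  assumes X: "module R X" and Y: "module R Y" and h: "h \<in> mod_hom R X Y" and E: "E \<subseteq> carrier X"
    and z: "\<forall>e\<in>E. h e = \<zero>\<^bsub>Y\<^esub>"
  shows "\<forall>k\<in>gen_submodule R X E. h k = \<zero>\<^bsub>Y\<^esub>"
  using gen_submodule(3)[OF X E submodule_kernel[OF X Y h]] E z by auto

subsection \<open>Free modules\<close>

locale free_mod =
  fixes R :: "'r ring" and S :: "'s set"
  assumes R: "cring R"
begin

sublocale R: cring R by (rule R)

abbreviation "F \<equiv> free_module R S"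

definition supp :: "('s \<Rightarrow> 'r) \<Rightarrow> 's set" where "supp c = {s. c s \<noteq> \<zero>\<^bsub>R\<^esub>}"

lemma free_carrier:
  "c \<in> carrier F \<longleftrightarrow> (\<forall>s. c s \<in> carrier R) \<and> supp c \<subseteq> S \<and> finite (supp c)"
  by (auto simp: free_module_def supp_def)

lemma free_ops: "\<zero>\<^bsub>F\<^esub> = (\<lambda>s. \<zero>\<^bsub>R\<^esub>)" "c \<oplus>\<^bsub>F\<^esub> d = (\<lambda>s. c s \<oplus>\<^bsub>R\<^esub> d s)" "r \<odot>\<^bsub>F\<^esub> c = (\<lambda>s. r \<otimes>\<^bsub>R\<^esub> c s)"
  by (simp_all add: free_module_def)

lemma supp_add: "supp (\<lambda>s. c s \<oplus>\<^bsub>R\<^esub> d s) \<subseteq> supp c \<union> supp d"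
  by (auto simp: supp_def)

lemma supp_smult: "r \<in> carrier R \<Longrightarrow> supp (\<lambda>s. r \<otimes>\<^bsub>R\<^esub> c s) \<subseteq> supp c"
  by (auto simp: supp_def)

lemma free_closed:
  "c \<in> carrier F \<Longrightarrow> d \<in> carrier F \<Longrightarrow> (\<lambda>s. c s \<oplus>\<^bsub>R\<^esub> d s) \<in> carrier F"
  "r \<in> carrier R \<Longrightarrow> c \<in> carrier F \<Longrightarrow> (\<lambda>s. r \<otimes>\<^bsub>R\<^esub> c s) \<in> carrier F"
  "(\<lambda>s. \<zero>\<^bsub>R\<^esub>) \<in> carrier F"
proof -
  show "(\<lambda>s. c s \<oplus>\<^bsub>R\<^esub> d s) \<in> carrier F" if "c \<in> carrier F" "d \<in> carrier F"
    using that finite_subset[OF supp_add[of c d]] subset_trans[OF supp_add[of c d]] by (simp add: free_carrier)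
  show "(\<lambda>s. r \<otimes>\<^bsub>R\<^esub> c s) \<in> carrier F" if "r \<in> carrier R" "c \<in> carrier F"
    using that finite_subset[OF supp_smult[of r c]] subset_trans[OF supp_smult[of r c]] by (simp add: free_carrier)
  show "(\<lambda>s. \<zero>\<^bsub>R\<^esub>) \<in> carrier F" by (simp add: free_carrier supp_def)
qed

lemma module_free: "module R F"
proof (rule moduleI)
  have c: "c s \<in> carrier R" if "c \<in> carrier F" for c s using that by (simp add: free_carrier)
  show "abelian_group F"
  proof (rule abelian_groupI)
    fix c assume cc: "c \<in> carrier F"
    then have "supp (\<lambda>s. \<ominus>\<^bsub>R\<^esub> c s) = supp c" using c[OF cc] R.add.inv_eq_1_iff by (auto simp: supp_def)
    then have "(\<lambda>s. \<ominus>\<^bsub>R\<^esub> c s) \<in> carrier F" using cc unfolding free_carrier by simp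
    then show "\<exists>y\<in>carrier F. y \<oplus>\<^bsub>F\<^esub> c = \<zero>\<^bsub>F\<^esub>"
      using c[OF cc] by (intro bexI[of _ "\<lambda>s. \<ominus>\<^bsub>R\<^esub> c s"]) (simp_all add: free_ops R.l_neg)
  qed (simp_all add: free_ops free_closed c R.a_ac)
next
  have c: "c s \<in> carrier R" if "c \<in> carrier F" for c s using that by (simp add: free_carrier)
  show "a \<odot>\<^bsub>F\<^esub> c \<in> carrier F" if "a \<in> carrier R" "c \<in> carrier F" for a c
    using that by (simp add: free_ops free_closed)
  show "(a \<oplus>\<^bsub>R\<^esub> b) \<odot>\<^bsub>F\<^esub> c = a \<odot>\<^bsub>F\<^esub> c \<oplus>\<^bsub>F\<^esub> b \<odot>\<^bsub>F\<^esub> c"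
    "(a \<otimes>\<^bsub>R\<^esub> b) \<odot>\<^bsub>F\<^esub> c = a \<odot>\<^bsub>F\<^esub> (b \<odot>\<^bsub>F\<^esub> c)"
    if "a \<in> carrier R" "b \<in> carrier R" "c \<in> carrier F" for a b c
    using that c[of c] by (simp_all add: free_ops R.l_distr R.m_assoc)
  show "a \<odot>\<^bsub>F\<^esub> (c \<oplus>\<^bsub>F\<^esub> d) = a \<odot>\<^bsub>F\<^esub> c \<oplus>\<^bsub>F\<^esub> a \<odot>\<^bsub>F\<^esub> d"
    if "a \<in> carrier R" "c \<in> carrier F" "d \<in> carrier F" for a c d
    using that c[of c] c[of d] by (simp add: free_ops R.r_distr)
  show "\<one>\<^bsub>R\<^esub> \<odot>\<^bsub>F\<^esub> c = c" if "c \<in> carrier F" for c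
    using c[OF that] by (simp add: free_ops)
qed (rule R)

lemma basis_vec: "s \<in> S \<Longrightarrow> basis_vec R s \<in> carrier F"
proof -
  assume "s \<in> S"
  moreover have "supp (basis_vec R s) \<subseteq> {s}" by (auto simp: supp_def basis_vec_def)
  ultimately show ?thesis unfolding free_carrier using finite_subset by (auto simp: basis_vec_def)
qed

lemma lin_ext_superset:
  assumes X: "module R X" and h: "h \<in> S \<rightarrow> carrier X" and c: "c \<in> carrier F"
    and T: "finite T" "supp c \<subseteq> T" "T \<subseteq> S"
  shows "lin_ext R X h c = (\<Oplus>\<^bsub>X\<^esub>s\<in>T. c s \<odot>\<^bsub>X\<^esub> h s)"
proof -
  interpret X: module R X by fact
  have c': "c s \<in> carrier R" for s using c by (simp add: free_carrier)
  have hT: "h s \<in> carrier X" if "s \<in> T" for s using that T(3) h by auto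
  show ?thesis
    unfolding lin_ext_def supp_def[symmetric]
    by (rule X.M.add.finprod_mono_neutral_cong_left) (use T c' in \<open>auto simp: supp_def hT\<close>)
qed

lemma lin_ext_mod_hom:
  assumes X: "module R X" and h: "h \<in> S \<rightarrow> carrier X"
  shows "lin_ext R X h \<in> mod_hom R F X"
proof -
  interpret X: module R X by fact
  note E = lin_ext_superset[OF X h]
  have hs: "h s \<in> carrier X" if "s \<in> S" for s using that h by auto
  show ?thesis
  proof (rule mod_homI)
    fix c assume c: "c \<in> carrier F"
    then have c': "c s \<in> carrier R" "supp c \<subseteq> S" "finite (supp c)" for s by (simp_all add: free_carrier)
    have i: "(\<lambda>s. c s \<odot>\<^bsub>X\<^esub> h s) \<in> T \<rightarrow> carrier X" if "T \<subseteq> S" for T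
      using that c'(1) h by (intro Pi_I X.smult_closed) auto
    show "lin_ext R X h c \<in> carrier X" unfolding E[OF c c'(3) subset_refl c'(2)] by (intro X.M.finsum_closed i c')
    show "lin_ext R X h (r \<odot>\<^bsub>F\<^esub> c) = r \<odot>\<^bsub>X\<^esub> lin_ext R X h c" if r: "r \<in> carrier R" for r
    proof -
      have "lin_ext R X h (r \<odot>\<^bsub>F\<^esub> c) = (\<Oplus>\<^bsub>X\<^esub>s\<in>supp c. (r \<otimes>\<^bsub>R\<^esub> c s) \<odot>\<^bsub>X\<^esub> h s)"
        unfolding free_ops using E[OF free_closed(2)[OF r c] c'(3) supp_smult[OF r] c'(2)] .
      also have "\<dots> = (\<Oplus>\<^bsub>X\<^esub>s\<in>supp c. r \<odot>\<^bsub>X\<^esub> (c s \<odot>\<^bsub>X\<^esub> h s))"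
        by (rule X.M.finsum_cong') (use c' hs r in \<open>auto simp: X.smult_assoc1 subsetD\<close>)
      also have "\<dots> = r \<odot>\<^bsub>X\<^esub> lin_ext R X h c"
        unfolding E[OF c c'(3) subset_refl c'(2)] by (rule X.finsum_smult_ldistr[symmetric]) (use c' r i in auto)
      finally show ?thesis .
    qed
    fix d assume d: "d \<in> carrier F"
    then have d': "d s \<in> carrier R" "supp d \<subseteq> S" "finite (supp d)" for s by (simp_all add: free_carrier)
    let ?T = "supp c \<union> supp d"
    have T: "finite ?T" "supp c \<subseteq> ?T" "supp d \<subseteq> ?T" "?T \<subseteq> S" using c' d' by auto
    have "lin_ext R X h (c \<oplus>\<^bsub>F\<^esub> d) = (\<Oplus>\<^bsub>X\<^esub>s\<in>?T. (c s \<oplus>\<^bsub>R\<^esub> d s) \<odot>\<^bsub>X\<^esub> h s)"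
      unfolding free_ops using E[OF free_closed(1)[OF c d] T(1) supp_add T(4)] .
    also have "\<dots> = (\<Oplus>\<^bsub>X\<^esub>s\<in>?T. c s \<odot>\<^bsub>X\<^esub> h s \<oplus>\<^bsub>X\<^esub> d s \<odot>\<^bsub>X\<^esub> h s)"
      by (rule X.M.finsum_cong') (use T c' d' hs in \<open>auto simp: X.smult_l_distr subsetD\<close>)
    also have "\<dots> = lin_ext R X h c \<oplus>\<^bsub>X\<^esub> lin_ext R X h d"
      unfolding E[OF c T(1,2,4)] E[OF d T(1,3,4)] by (rule X.M.finsum_addf) (use T c' d' hs in \<open>auto simp: subsetD\<close>)
    finally show "lin_ext R X h (c \<oplus>\<^bsub>F\<^esub> d) = lin_ext R X h c \<oplus>\<^bsub>X\<^esub> lin_ext R X h d" .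
  qed
qed

lemma lin_ext_basis:
  assumes X: "module R X" and h: "h \<in> S \<rightarrow> carrier X" and s: "s \<in> S"
  shows "lin_ext R X h (basis_vec R s) = h s"
proof -
  interpret X: module R X by fact
  have "lin_ext R X h (basis_vec R s) = (\<Oplus>\<^bsub>X\<^esub>t\<in>{s}. basis_vec R s t \<odot>\<^bsub>X\<^esub> h t)"
    by (rule lin_ext_superset[OF X h basis_vec[OF s]]) (use s in \<open>auto simp: supp_def basis_vec_def\<close>)
  also have "\<dots> = h s"
  proof -
    have "h s \<in> carrier X" using h s by auto
    then show ?thesis
      using X.M.finsum_insert[of "{}" s "\<lambda>t. basis_vec R s t \<odot>\<^bsub>X\<^esub> h t"] by (simp add: basis_vec_def)
  qed
  finally show ?thesis .
qed

lemma free_ext: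
  assumes X: "module R X" and f: "f \<in> mod_hom R F X" and g: "g \<in> mod_hom R F X"
    and eq: "\<And>s. s \<in> S \<Longrightarrow> f (basis_vec R s) = g (basis_vec R s)" and c: "c \<in> carrier F"
  shows "f c = g c"
proof -
  have "\<forall>c. c \<in> carrier F \<and> supp c \<subseteq> T \<longrightarrow> f c = g c" if "finite T" "T \<subseteq> S" for T
    using that
  proof (induction T)
    case empty
    show ?case
    proof (intro allI impI)
      fix c assume "c \<in> carrier F \<and> supp c \<subseteq> {}"
      then have "c = \<zero>\<^bsub>F\<^esub>" by (auto simp: supp_def free_ops)
      then show "f c = g c" using mod_hom_zero[OF module_free X f] mod_hom_zero[OF module_free X g] by simp
    qed
  next
    case (insert s T)
    show ?case
    proof (intro allI impI)
      fix c assume c: "c \<in> carrier F \<and> supp c \<subseteq> insert s T"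
      then have c': "c t \<in> carrier R" for t by (simp add: free_carrier)
      define d where "d = (\<lambda>t. if t = s then \<zero>\<^bsub>R\<^esub> else c t)"
      have ds: "supp d \<subseteq> T" using c by (auto simp: supp_def d_def)
      then have d: "d \<in> carrier F" using c' insert(1,4) finite_subset by (auto simp: free_carrier d_def)
      have sF: "basis_vec R s \<in> carrier F" using insert by (intro basis_vec) simp
      have sF': "c s \<odot>\<^bsub>F\<^esub> basis_vec R s \<in> carrier F" using free_closed(2)[OF c' sF] by (simp add: free_ops)
      have e: "c = c s \<odot>\<^bsub>F\<^esub> basis_vec R s \<oplus>\<^bsub>F\<^esub> d"
        by (rule ext) (simp add: free_ops basis_vec_def d_def c')
      have "f d = g d" using insert ds d by blast
      then have "f (c s \<odot>\<^bsub>F\<^esub> basis_vec R s \<oplus>\<^bsub>F\<^esub> d) = g (c s \<odot>\<^bsub>F\<^esub> basis_vec R s \<oplus>\<^bsub>F\<^esub> d)"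
        using insert eq[of s] c' sF sF' d by (simp add: mod_homD(2,3)[OF f] mod_homD(2,3)[OF g])
      then show "f c = g c" using e by simp
    qed
  qed
  then show ?thesis using c free_carrier by blast
qed

end

subsection \<open>Modules given by generators and relations\<close>

locale presentation = free_mod R S for R :: "'r ring" and S :: "'s set" +
  fixes E :: "('s \<Rightarrow> 'r) set"
  assumes E: "E \<subseteq> carrier (free_module R S)"
begin

interpretation Q: quotient_module R F "gen_submodule R F E"
  by (intro quotient_moduleI module_free gen_submodule(1) E)

abbreviation "X \<equiv> presented_module R S E"
abbreviation "gen \<equiv> presented_gen R S E"
definition "proj = (\<lambda>x. gen_submodule R F E +>\<^bsub>F\<^esub> x)"

lemma module_presented: "module R X" unfolding presented_module_def by (rule Q.quot_module)

lemma proj: "proj \<in> mod_hom R F X" unfolding presented_module_def proj_def by (rule Q.quot_proj)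

lemma proj_basis: "proj (basis_vec R s) = gen s" by (simp add: proj_def presented_gen_def)

lemma gen_closed: "s \<in> S \<Longrightarrow> gen s \<in> carrier X"
  using mod_homD(1)[OF proj basis_vec] by (simp add: proj_basis)

lemma relation:
  assumes "x \<ominus>\<^bsub>F\<^esub> y \<in> E" "x \<in> carrier F" "y \<in> carrier F"
  shows "proj x = proj y"
proof -
  have "x \<ominus>\<^bsub>F\<^esub> y \<in> gen_submodule R F E" using gen_submodule(2)[OF module_free E] assms(1) by blast
  then show ?thesis unfolding proj_def using assms by (simp add: Q.coset_eq_iff)
qed

lemma presented_ext:
  assumes Y: "module R Y" and f: "f \<in> mod_hom R X Y" and g: "g \<in> mod_hom R X Y"
    and eq: "\<And>s. s \<in> S \<Longrightarrow> f (gen s) = g (gen s)" and x: "x \<in> carrier X"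
  shows "f x = g x"
proof -
  obtain c where c: "c \<in> carrier F" "x = proj c"
    using x by (auto simp: presented_module_def Q.quot_carrier proj_def)
  have "(\<lambda>c. f (proj c)) \<in> mod_hom R F Y" "(\<lambda>c. g (proj c)) \<in> mod_hom R F Y"
    using mod_homD[OF proj] mod_homD[OF f] mod_homD[OF g] by (intro mod_homI; simp)+
  then have "f (proj c) = g (proj c)"
    by (rule free_ext[OF Y]) (simp_all add: proj_basis eq c)
  then show ?thesis by (simp add: c)
qed

lemma presented_lift:
  assumes Y: "module R Y" and h: "h \<in> S \<rightarrow> carrier Y"
    and z: "\<forall>e\<in>E. lin_ext R Y h e = \<zero>\<^bsub>Y\<^esub>"
  shows "presented_lift R Y h \<in> mod_hom R X Y" "s \<in> S \<Longrightarrow> presented_lift R Y h (gen s) = h s"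
proof -
  note L = lin_ext_mod_hom[OF Y h]
  note k = gen_submodule_kills[OF module_free Y L E z]
  have e: "presented_lift R Y h = (\<lambda>U. the_elem (lin_ext R Y h ` U))" by (simp add: presented_lift_def fun_eq_iff)
  show "presented_lift R Y h \<in> mod_hom R X Y"
    unfolding e presented_module_def by (rule Q.quot_lift[OF Y L k])
  show "s \<in> S \<Longrightarrow> presented_lift R Y h (gen s) = h s"
    unfolding e presented_gen_def
    by (simp add: Q.quot_lift_apply[OF Y L k] basis_vec lin_ext_basis[OF Y h])
qed

end

text \<open>Relations are written as differences \<open>x - y\<close>; this is how a map on symbols is checked to respect
  them.\<close>

lemma lin_ext_relation:
  assumes R: "cring R" and Y: "module R Y" and h: "h \<in> S \<rightarrow> carrier Y"
    and x: "x \<in> carrier (free_module R S)" and y: "y \<in> carrier (free_module R S)"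
    and eq: "lin_ext R Y h x = lin_ext R Y h y"
  shows "lin_ext R Y h (x \<ominus>\<^bsub>free_module R S\<^esub> y) = \<zero>\<^bsub>Y\<^esub>"
proof -
  interpret free_mod R S by (rule free_mod.intro[OF R])
  note L = lin_ext_mod_hom[OF Y h]
  show ?thesis
    using mod_hom_minus[OF module_free Y L x y] eq minus_eq_zero_iff[OF module.axioms(2)[OF Y]] mod_homD(1)[OF L] x y by simp
qed

subsection \<open>Extension of scalars\<close>

locale ext_scal =
  fixes T :: "'t ring" and \<phi> :: "'r \<Rightarrow> 't" and R :: "'r ring" and Z :: "('r, 'x) module"
  assumes T: "cring T" and Rr: "cring R" and phi: "\<phi> \<in> ring_hom R T" and Zm: "module R Z"
begin

interpretation T: cring T by (rule T)
interpretation Z: module R Z by (rule Zm)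
interpretation Fr: free_mod T "carrier T \<times> carrier Z" by (rule free_mod.intro[OF T])

abbreviation "F \<equiv> free_module T (carrier T \<times> carrier Z)"
abbreviation "e \<equiv> basis_vec T"

lemma phi_closed: "r \<in> carrier R \<Longrightarrow> \<phi> r \<in> carrier T" by (rule ring_hom_closed[OF phi])

interpretation FM: module T F by (rule Fr.module_free)

lemma rels: "ext_scalars_rels T \<phi> R Z \<subseteq> carrier F"
  unfolding ext_scalars_rels_def Let_def
  by (auto intro!: FM.M.minus_closed FM.M.a_closed FM.smult_closed Fr.basis_vec simp: phi_closed)

interpretation Pr: presentation T "carrier T \<times> carrier Z" "ext_scalars_rels T \<phi> R Z"
  by unfold_locales (rule rels)

abbreviation "X \<equiv> ext_scalars T \<phi> R Z"
abbreviation "tn \<equiv> ext_scalars_tens T \<phi> R Z"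

lemma module_ext: "module T X" unfolding ext_scalars_def by (rule Pr.module_presented)

lemma tn_gen: "tn t x = Pr.gen (t, x)" by (simp add: ext_scalars_tens_def)

lemma tn_closed: "t \<in> carrier T \<Longrightarrow> x \<in> carrier Z \<Longrightarrow> tn t x \<in> carrier X"
  unfolding tn_gen ext_scalars_def by (rule Pr.gen_closed) simp

lemma rels_mem:
  assumes "t \<in> carrier T" "x \<in> carrier Z"
  shows "s \<in> carrier T \<Longrightarrow> e (s \<oplus>\<^bsub>T\<^esub> t, x) \<ominus>\<^bsub>F\<^esub> (e (s, x) \<oplus>\<^bsub>F\<^esub> e (t, x)) \<in> ext_scalars_rels T \<phi> R Z"
    and "y \<in> carrier Z \<Longrightarrow> e (t, x \<oplus>\<^bsub>Z\<^esub> y) \<ominus>\<^bsub>F\<^esub> (e (t, x) \<oplus>\<^bsub>F\<^esub> e (t, y)) \<in> ext_scalars_rels T \<phi> R Z"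
    and "r \<in> carrier R \<Longrightarrow> e (t \<otimes>\<^bsub>T\<^esub> \<phi> r, x) \<ominus>\<^bsub>F\<^esub> e (t, r \<odot>\<^bsub>Z\<^esub> x) \<in> ext_scalars_rels T \<phi> R Z"
    and "s \<in> carrier T \<Longrightarrow> e (s \<otimes>\<^bsub>T\<^esub> t, x) \<ominus>\<^bsub>F\<^esub> (s \<odot>\<^bsub>F\<^esub> e (t, x)) \<in> ext_scalars_rels T \<phi> R Z"
  using assms unfolding ext_scalars_rels_def Let_def by blast+

lemma tn_rules:
  assumes t: "t \<in> carrier T" and x: "x \<in> carrier Z"
  shows "s \<in> carrier T \<Longrightarrow> tn (s \<oplus>\<^bsub>T\<^esub> t) x = tn s x \<oplus>\<^bsub>X\<^esub> tn t x"
    and "y \<in> carrier Z \<Longrightarrow> tn t (x \<oplus>\<^bsub>Z\<^esub> y) = tn t x \<oplus>\<^bsub>X\<^esub> tn t y"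
    and "r \<in> carrier R \<Longrightarrow> tn (t \<otimes>\<^bsub>T\<^esub> \<phi> r) x = tn t (r \<odot>\<^bsub>Z\<^esub> x)"
    and "s \<in> carrier T \<Longrightarrow> tn (s \<otimes>\<^bsub>T\<^esub> t) x = s \<odot>\<^bsub>X\<^esub> tn t x"
proof -
  note pj = mod_homD[OF Pr.proj, folded ext_scalars_def]
  note b = Fr.basis_vec
  show "tn (s \<oplus>\<^bsub>T\<^esub> t) x = tn s x \<oplus>\<^bsub>X\<^esub> tn t x" if s: "s \<in> carrier T"
  proof -
    have "Pr.proj (e (s \<oplus>\<^bsub>T\<^esub> t, x)) = Pr.proj (e (s, x) \<oplus>\<^bsub>F\<^esub> e (t, x))"
      using s t x by (intro Pr.relation rels_mem) (simp_all add: b)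
    then show ?thesis using s t x by (simp add: tn_gen pj b flip: Pr.proj_basis)
  qed
  show "tn t (x \<oplus>\<^bsub>Z\<^esub> y) = tn t x \<oplus>\<^bsub>X\<^esub> tn t y" if y: "y \<in> carrier Z"
  proof -
    have "Pr.proj (e (t, x \<oplus>\<^bsub>Z\<^esub> y)) = Pr.proj (e (t, x) \<oplus>\<^bsub>F\<^esub> e (t, y))"
      using y t x by (intro Pr.relation rels_mem) (simp_all add: b)
    then show ?thesis using y t x by (simp add: tn_gen pj b flip: Pr.proj_basis)
  qed
  show "tn (t \<otimes>\<^bsub>T\<^esub> \<phi> r) x = tn t (r \<odot>\<^bsub>Z\<^esub> x)" if r: "r \<in> carrier R"
  proof -
    have "Pr.proj (e (t \<otimes>\<^bsub>T\<^esub> \<phi> r, x)) = Pr.proj (e (t, r \<odot>\<^bsub>Z\<^esub> x))"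
      using r t x by (intro Pr.relation rels_mem) (simp_all add: b phi_closed)
    then show ?thesis by (simp add: tn_gen flip: Pr.proj_basis)
  qed
  show "tn (s \<otimes>\<^bsub>T\<^esub> t) x = s \<odot>\<^bsub>X\<^esub> tn t x" if s: "s \<in> carrier T"
  proof -
    have "Pr.proj (e (s \<otimes>\<^bsub>T\<^esub> t, x)) = Pr.proj (s \<odot>\<^bsub>F\<^esub> e (t, x))"
      using s t x by (intro Pr.relation rels_mem) (simp_all add: b)
    then show ?thesis using s t x by (simp add: tn_gen pj b flip: Pr.proj_basis)
  qed
qed

lemma tn_smult: "t \<in> carrier T \<Longrightarrow> x \<in> carrier Z \<Longrightarrow> tn t x = t \<odot>\<^bsub>X\<^esub> tn \<one>\<^bsub>T\<^esub> x"
  using tn_rules(4)[of "\<one>\<^bsub>T\<^esub>" x t] by simp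

lemma tn_one_smult: "r \<in> carrier R \<Longrightarrow> x \<in> carrier Z \<Longrightarrow> tn \<one>\<^bsub>T\<^esub> (r \<odot>\<^bsub>Z\<^esub> x) = \<phi> r \<odot>\<^bsub>X\<^esub> tn \<one>\<^bsub>T\<^esub> x"
  using tn_rules(3)[of "\<one>\<^bsub>T\<^esub>" x r] tn_smult[of "\<phi> r" x] by (simp add: phi_closed)

lemma ext_ext:
  assumes Y: "module T Y" and f: "f \<in> mod_hom T X Y" and g: "g \<in> mod_hom T X Y"
    and eq: "\<And>x. x \<in> carrier Z \<Longrightarrow> f (tn \<one>\<^bsub>T\<^esub> x) = g (tn \<one>\<^bsub>T\<^esub> x)" and x: "x \<in> carrier X"
  shows "f x = g x"
proof (rule Pr.presented_ext[OF Y f[unfolded ext_scalars_def] g[unfolded ext_scalars_def] _ x[unfolded ext_scalars_def]])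
  fix s assume "s \<in> carrier T \<times> carrier Z"
  then obtain t z where s: "s = (t, z)" "t \<in> carrier T" "z \<in> carrier Z" by auto
  then have "f (tn t z) = g (tn t z)"
    by (simp add: tn_smult[of t z] mod_homD(3)[OF f] mod_homD(3)[OF g] tn_closed eq)
  then show "f (Pr.gen s) = g (Pr.gen s)" by (simp add: s tn_gen)
qed

text \<open>The lift is stated for any function \<open>H\<close> that agrees with \<open>(t, x) \<mapsto> t h(x)\<close> on the generating symbols,
  because the maps on extended modules are given by their values on all symbols.\<close>

lemma ext_lift:
  assumes Y: "module T Y" and h: "h \<in> mod_hom R Z (restrict_scalars \<phi> Y)"
    and H: "\<And>t x. t \<in> carrier T \<Longrightarrow> x \<in> carrier Z \<Longrightarrow> H (t, x) = t \<odot>\<^bsub>Y\<^esub> h x"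
  shows "presented_lift T Y H \<in> mod_hom T X Y"
    and "t \<in> carrier T \<Longrightarrow> x \<in> carrier Z \<Longrightarrow> presented_lift T Y H (tn t x) = t \<odot>\<^bsub>Y\<^esub> h x"
proof -
  interpret Y: module T Y by fact
  note h' = mod_homD[OF h, simplified]
  have Hc: "H \<in> carrier T \<times> carrier Z \<rightarrow> carrier Y" by (auto simp: H h')
  note L = mod_homD[OF Fr.lin_ext_mod_hom[OF Y Hc]]
  note Lb = Fr.lin_ext_basis[OF Y Hc]
  note b = Fr.basis_vec
  have z: "\<forall>r\<in>ext_scalars_rels T \<phi> R Z. lin_ext T Y H r = \<zero>\<^bsub>Y\<^esub>"
    unfolding ext_scalars_rels_def Let_def
    by (auto intro!: lin_ext_relation[OF T Y Hc]
        simp: b L Lb H phi_closed h' Y.smult_l_distr Y.smult_r_distr Y.smult_assoc1)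
  note lift = Pr.presented_lift[OF Y Hc z]
  show "presented_lift T Y H \<in> mod_hom T X Y" unfolding ext_scalars_def by (rule lift(1))
  show "t \<in> carrier T \<Longrightarrow> x \<in> carrier Z \<Longrightarrow> presented_lift T Y H (tn t x) = t \<odot>\<^bsub>Y\<^esub> h x"
    using lift(2)[of "(t, x)"] by (simp add: tn_gen H)
qed

end

section \<open>Monoid rings and tensor products of rings\<close>

lemma frag_extend_diff_fun:
  "frag_extend (\<lambda>a. f a - g a) c = frag_extend f c - frag_extend g c"
  using subset_UNIV by (induction c rule: frag_induction) (auto simp: frag_extend_diff)

lemma frag_extend_zero_fun: "frag_extend (\<lambda>a. 0) c = 0"
  by (rule frag_extend_eq_0) simp

lemma monoid_ring_simps:
  "c \<in> carrier (monoid_ring N) \<longleftrightarrow> Poly_Mapping.keys c \<subseteq> carrier N"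
  "\<one>\<^bsub>monoid_ring N\<^esub> = frag_of \<one>\<^bsub>N\<^esub>" "\<zero>\<^bsub>monoid_ring N\<^esub> = 0" "c \<oplus>\<^bsub>monoid_ring N\<^esub> d = c + d"
  by (simp_all add: monoid_ring_def)

lemma monoid_ring_mult:
  "frag_of a \<otimes>\<^bsub>monoid_ring N\<^esub> frag_of b = frag_of (a \<otimes>\<^bsub>N\<^esub> b)"
  "(c - c') \<otimes>\<^bsub>monoid_ring N\<^esub> d = c \<otimes>\<^bsub>monoid_ring N\<^esub> d - c' \<otimes>\<^bsub>monoid_ring N\<^esub> d"
  "c \<otimes>\<^bsub>monoid_ring N\<^esub> (d - d') = c \<otimes>\<^bsub>monoid_ring N\<^esub> d - c \<otimes>\<^bsub>monoid_ring N\<^esub> d'"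
  "0 \<otimes>\<^bsub>monoid_ring N\<^esub> d = 0" "c \<otimes>\<^bsub>monoid_ring N\<^esub> 0 = 0"
  by (simp_all add: monoid_ring_def frag_extend_diff frag_extend_diff_fun frag_extend_zero_fun)

locale mon_ring = N: comm_monoid N for N :: "('n, 'z) monoid_scheme" (structure)
begin

abbreviation "ZN \<equiv> monoid_ring N"

lemma frag_carrier: "n \<in> carrier N \<Longrightarrow> frag_of n \<in> carrier ZN" by (simp add: monoid_ring_simps)

lemma diff_carrier: "c \<in> carrier ZN \<Longrightarrow> d \<in> carrier ZN \<Longrightarrow> c - d \<in> carrier ZN"
  using keys_diff[of c d] by (auto simp: monoid_ring_simps)

lemma mon_ring_induct [consumes 1, case_names zero one diff]:
  assumes "c \<in> carrier ZN" "P 0" "\<And>n. n \<in> carrier N \<Longrightarrow> P (frag_of n)"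
    "\<And>a b. a \<in> carrier ZN \<Longrightarrow> b \<in> carrier ZN \<Longrightarrow> P a \<Longrightarrow> P b \<Longrightarrow> P (a - b)"
  shows "P c"
proof -
  have "Poly_Mapping.keys c \<subseteq> carrier N" using assms(1) by (simp add: monoid_ring_simps)
  then have "c \<in> carrier ZN \<and> P c"
    by (induction c rule: frag_induction) (simp_all add: assms frag_carrier diff_carrier, simp add: monoid_ring_simps)
  then show ?thesis ..
qed

lemma mult_carrier: "c \<in> carrier ZN \<Longrightarrow> d \<in> carrier ZN \<Longrightarrow> c \<otimes>\<^bsub>ZN\<^esub> d \<in> carrier ZN"
proof (induction c rule: mon_ring_induct)
  case (one n)
  from one(2) one(1) show ?case
    by (induction d rule: mon_ring_induct) (simp_all add: monoid_ring_mult frag_carrier diff_carrier, simp_all add: monoid_ring_simps)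
qed (simp_all add: monoid_ring_mult diff_carrier, simp add: monoid_ring_simps)

lemma mult_comm: "c \<in> carrier ZN \<Longrightarrow> d \<in> carrier ZN \<Longrightarrow> c \<otimes>\<^bsub>ZN\<^esub> d = d \<otimes>\<^bsub>ZN\<^esub> c"
proof (induction c rule: mon_ring_induct)
  case (one n)
  from one(2) one(1) show ?case
    by (induction d rule: mon_ring_induct) (simp_all add: monoid_ring_mult N.m_comm)
qed (simp_all add: monoid_ring_mult)

lemma mult_assoc:
  assumes "c \<in> carrier ZN" "d \<in> carrier ZN" "e \<in> carrier ZN"
  shows "c \<otimes>\<^bsub>ZN\<^esub> d \<otimes>\<^bsub>ZN\<^esub> e = c \<otimes>\<^bsub>ZN\<^esub> (d \<otimes>\<^bsub>ZN\<^esub> e)"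
  using assms
proof (induction c rule: mon_ring_induct)
  case (one n)
  from one(2,3,1) show ?case
  proof (induction d rule: mon_ring_induct)
    case (one m)
    from one(2,1,3) show ?case
      by (induction e rule: mon_ring_induct) (simp_all add: monoid_ring_mult N.m_assoc)
  qed (simp_all add: monoid_ring_mult)
qed (simp_all add: monoid_ring_mult)

lemma mult_one: "c \<in> carrier ZN \<Longrightarrow> \<one>\<^bsub>ZN\<^esub> \<otimes>\<^bsub>ZN\<^esub> c = c"
  by (induction c rule: mon_ring_induct) (simp_all add: monoid_ring_mult monoid_ring_simps(2))

lemma mult_distr:
  "(c + c') \<otimes>\<^bsub>ZN\<^esub> d = c \<otimes>\<^bsub>ZN\<^esub> d + c' \<otimes>\<^bsub>ZN\<^esub> d"
  using monoid_ring_mult(2)[where c = c and c' = "- c'" and N = N and d = d]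
    monoid_ring_mult(2)[where c = 0 and c' = "c'" and N = N and d = d] by (simp add: monoid_ring_mult(4))

lemma cring_monoid_ring: "cring ZN"
proof (rule cringI)
  have ab: "a + b \<in> carrier ZN" if "a \<in> carrier ZN" "b \<in> carrier ZN" for a b
    using that keys_add[of a b] by (auto simp: monoid_ring_simps)
  show "abelian_group ZN"
  proof (rule abelian_groupI)
    fix c assume "c \<in> carrier ZN"
    then show "\<exists>d\<in>carrier ZN. d \<oplus>\<^bsub>ZN\<^esub> c = \<zero>\<^bsub>ZN\<^esub>"
      by (intro bexI[of _ "- c"]) (simp_all add: monoid_ring_simps)
  qed (simp_all add: monoid_ring_simps(2-4) ab add_ac, simp_all add: monoid_ring_simps)
  show "Group.comm_monoid ZN"
    by (rule comm_monoidI) (erule mult_carrier, assumption, simp add: monoid_ring_simps, erule mult_assoc, assumption+,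
       erule mult_one, erule mult_comm, assumption)
qed (simp add: monoid_ring_simps(4) mult_distr)

lemma mon_ring_minus: "c \<in> carrier ZN \<Longrightarrow> d \<in> carrier ZN \<Longrightarrow> c \<ominus>\<^bsub>ZN\<^esub> d = c - d"
proof -
  assume c: "c \<in> carrier ZN" "d \<in> carrier ZN"
  interpret Z: cring ZN by (rule cring_monoid_ring)
  have "(c - d) \<oplus>\<^bsub>ZN\<^esub> d = c" by (simp add: monoid_ring_simps)
  moreover have "(c \<ominus>\<^bsub>ZN\<^esub> d) \<oplus>\<^bsub>ZN\<^esub> d = c" using c by (simp add: a_minus_def Z.a_assoc Z.l_neg)
  ultimately show ?thesis using Z.add.right_cancel[of d "c - d" "c \<ominus>\<^bsub>ZN\<^esub> d"] c diff_carrier by simp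
qed

text \<open>The monoid elements generate \<open>\<int>[N]\<close> under subtraction.\<close>

lemma hom_eq_on_frag:
  assumes D: "ring D" and f: "f \<in> ring_hom ZN D" and g: "g \<in> ring_hom ZN D"
    and eq: "\<And>n. n \<in> carrier N \<Longrightarrow> f (frag_of n) = g (frag_of n)" and c: "c \<in> carrier ZN"
  shows "f c = g c"
proof -
  have Z: "ring ZN" using cring_monoid_ring by (rule cring.axioms(1))
  note F = ring_hom_zero_minus[OF Z D f] and G = ring_hom_zero_minus[OF Z D g]
  from c show ?thesis
  proof (induction c rule: mon_ring_induct)
    case zero
    show ?case using F(1) G(1) by (simp add: monoid_ring_simps)
  next
    case (diff a b)
    then show ?case using F(3)[of a b] G(3)[of a b] by (simp add: mon_ring_minus)
  qed (rule eq)
qed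

context
  fixes D :: "'d ring" and h :: "'n \<Rightarrow> 'd"
  assumes D: "cring D" and h: "h \<in> carrier N \<rightarrow> carrier D"
begin

interpretation D: cring D by (rule D)

lemma hc: "n \<in> carrier N \<Longrightarrow> h n \<in> carrier D" using h by auto

text \<open>Enlarging the index set beyond the support, so that the sums for \<open>c\<close>, \<open>d\<close> and \<open>c + d\<close> run over the
  same set.\<close>

lemma lift_superset:
  assumes c: "c \<in> carrier ZN" and T: "finite T" "Poly_Mapping.keys c \<subseteq> T" "T \<subseteq> carrier N"
  shows "monoid_ring_lift D h c = (\<Oplus>\<^bsub>D\<^esub>n\<in>T. [Poly_Mapping.lookup c n] \<cdot>\<^bsub>D\<^esub> h n)"
proof -
  have z: "[Poly_Mapping.lookup c i] \<cdot>\<^bsub>D\<^esub> h i = \<zero>\<^bsub>D\<^esub>" if "i \<in> T - Poly_Mapping.keys c" for i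
  proof -
    have "Poly_Mapping.lookup c i = 0" using that by (simp add: in_keys_iff)
    then show ?thesis by (simp add: add_pow_def)
  qed
  show ?thesis unfolding monoid_ring_lift_def
    by (rule D.add.finprod_mono_neutral_cong_left[OF T(1,2)]) (use T(3) hc z in \<open>auto intro!: D.add.int_pow_closed\<close>)
qed

lemma lift_closed: "c \<in> carrier ZN \<Longrightarrow> monoid_ring_lift D h c \<in> carrier D"
  unfolding monoid_ring_lift_def
  by (rule D.finsum_closed) (auto simp: monoid_ring_simps intro!: D.add.int_pow_closed hc)

lemma lift_frag: "n \<in> carrier N \<Longrightarrow> monoid_ring_lift D h (frag_of n) = h n"
  using D.finsum_insert[of "{}" n "\<lambda>m. [Poly_Mapping.lookup (frag_of n) m] \<cdot>\<^bsub>D\<^esub> h m"] hc[of n]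
  by (simp add: monoid_ring_lift_def D.add.int_pow_1)

lemma lift_add:
  assumes c: "c \<in> carrier ZN" and d: "d \<in> carrier ZN"
  shows "monoid_ring_lift D h (c + d) = monoid_ring_lift D h c \<oplus>\<^bsub>D\<^esub> monoid_ring_lift D h d"
proof -
  let ?T = "Poly_Mapping.keys c \<union> Poly_Mapping.keys d"
  have T: "finite ?T" "?T \<subseteq> carrier N" using c d by (simp_all add: monoid_ring_simps)
  have k: "Poly_Mapping.keys (c + d) \<subseteq> ?T" by (rule keys_add)
  have cd: "c + d \<in> carrier ZN" using k T(2) by (auto simp: monoid_ring_simps)
  have hT: "n \<in> ?T \<Longrightarrow> h n \<in> carrier D" for n using T(2) hc by blast
  have "monoid_ring_lift D h (c + d) = (\<Oplus>\<^bsub>D\<^esub>n\<in>?T. [Poly_Mapping.lookup c n] \<cdot>\<^bsub>D\<^esub> h n \<oplus>\<^bsub>D\<^esub> [Poly_Mapping.lookup d n] \<cdot>\<^bsub>D\<^esub> h n)"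
    unfolding lift_superset[OF cd T(1) k T(2)]
    by (rule D.finsum_cong') (auto simp: lookup_add D.add.int_pow_mult hT intro!: D.a_closed D.add.int_pow_closed)
  also have "\<dots> = monoid_ring_lift D h c \<oplus>\<^bsub>D\<^esub> monoid_ring_lift D h d"
    unfolding lift_superset[OF c T(1) Un_upper1 T(2)] lift_superset[OF d T(1) Un_upper2 T(2)]
    by (rule D.finsum_addf) (auto intro!: D.add.int_pow_closed hT)
  finally show ?thesis .
qed

lemma lift_diff:
  assumes c: "c \<in> carrier ZN" and d: "d \<in> carrier ZN"
  shows "monoid_ring_lift D h (c - d) = monoid_ring_lift D h c \<ominus>\<^bsub>D\<^esub> monoid_ring_lift D h d"
proof -
  have "monoid_ring_lift D h c = monoid_ring_lift D h (c - d) \<oplus>\<^bsub>D\<^esub> monoid_ring_lift D h d"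
    using lift_add[OF diff_carrier[OF c d] d] by simp
  then show ?thesis using lift_closed diff_carrier c d
    by (simp add: a_minus_def D.a_assoc D.r_neg)
qed

lemma lift_zero: "monoid_ring_lift D h 0 = \<zero>\<^bsub>D\<^esub>"
  by (simp add: monoid_ring_lift_def)

end

lemma lift_ring_hom:
  fixes D :: "'d ring"
  assumes D: "cring D" and h: "h \<in> mon_hom N D"
  shows "monoid_ring_lift D h \<in> ring_hom ZN D"
proof -
  interpret D: cring D by (rule D)
  interpret Z: cring ZN by (rule cring_monoid_ring)
  have h': "h \<in> carrier N \<rightarrow> carrier D" by (rule mon_hom_Pi[OF h])
  note L = lift_closed[OF D h'] lift_frag[OF D h'] lift_diff[OF D h'] lift_zero[OF D h'] and H = mon_homD[OF h]
  show ?thesis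
  proof (rule ring_hom_memI)
    fix c d assume c: "c \<in> carrier ZN" and d: "d \<in> carrier ZN"
    show "monoid_ring_lift D h c \<in> carrier D" by (rule L(1)[OF c])
    show "monoid_ring_lift D h (c \<oplus>\<^bsub>ZN\<^esub> d) = monoid_ring_lift D h c \<oplus>\<^bsub>D\<^esub> monoid_ring_lift D h d"
      using lift_add[OF D h' c d] by (simp add: monoid_ring_simps)
    from c d show "monoid_ring_lift D h (c \<otimes>\<^bsub>ZN\<^esub> d) = monoid_ring_lift D h c \<otimes>\<^bsub>D\<^esub> monoid_ring_lift D h d"
    proof (induction c rule: mon_ring_induct)
      case (one n)
      from one(2) one(1) show ?case
        by (induction d rule: mon_ring_induct)
          (simp_all add: monoid_ring_mult L H mult_carrier frag_carrier a_minus_def D.r_distr D.r_minus)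
    qed (simp_all add: monoid_ring_mult L mult_carrier a_minus_def D.l_distr D.l_minus)
  next
    show "monoid_ring_lift D h \<one>\<^bsub>ZN\<^esub> = \<one>\<^bsub>D\<^esub>" by (simp add: monoid_ring_simps L H)
  qed
qed

end

locale ring_tensor =
  fixes R :: "'r ring" and B :: "'b ring" and \<phi> :: "'r \<Rightarrow> 'b" and C :: "'c ring" and \<psi> :: "'r \<Rightarrow> 'c"
  assumes B: "cring B" and C: "cring C"
    and phi: "\<phi> \<in> carrier R \<rightarrow> carrier B" and psi: "\<psi> \<in> carrier R \<rightarrow> carrier C"
begin

interpretation B: cring B by (rule B)
interpretation C: cring C by (rule C)

lemma mon_ring_BC: "mon_ring (B \<times>\<times> C)"
  by (rule mon_ring.intro, rule comm_monoid_DirProd) (rule B.comm_monoid_axioms C.comm_monoid_axioms)+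

interpretation Z: mon_ring "B \<times>\<times> C" by (rule mon_ring_BC)
interpretation Zr: cring "monoid_ring (B \<times>\<times> C)" by (rule Z.cring_monoid_ring)

abbreviation "Z2 \<equiv> monoid_ring (B \<times>\<times> C)"
abbreviation "TR \<equiv> tensor_ring R B \<phi> C \<psi>"
abbreviation "I \<equiv> tensor_ideal R B \<phi> C \<psi>"
abbreviation "tn \<equiv> tens R B \<phi> C \<psi>"

lemma fr: "b \<in> carrier B \<Longrightarrow> c \<in> carrier C \<Longrightarrow> frag_of (b, c) \<in> carrier Z2"
  by (rule Z.frag_carrier) simp

lemma add_carr: "x \<in> carrier Z2 \<Longrightarrow> y \<in> carrier Z2 \<Longrightarrow> x + y \<in> carrier Z2"
  using Zr.a_closed[of x y] by (simp only: monoid_ring_simps(4))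

lemma rels_carrier: "tensor_rels R B \<phi> C \<psi> \<subseteq> carrier Z2"
  using phi psi unfolding tensor_rels_def
  by (auto intro!: Z.diff_carrier add_carr fr)

lemma ideal_I: "ideal I Z2"
  unfolding tensor_ideal_def by (rule Zr.genideal_ideal[OF rels_carrier])

lemma cring_tensor: "cring TR"
  unfolding tensor_ring_def by (rule ideal.quotient_is_cring[OF ideal_I Z.cring_monoid_ring])

lemma quot_hom: "(\<lambda>x. I +>\<^bsub>Z2\<^esub> x) \<in> ring_hom Z2 TR"
  unfolding tensor_ring_def by (rule ideal.rcos_ring_hom[OF ideal_I])

lemma tn_closed: "b \<in> carrier B \<Longrightarrow> c \<in> carrier C \<Longrightarrow> tn b c \<in> carrier TR"
  unfolding tens_def by (rule ring_hom_closed[OF quot_hom fr])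

lemma tn_mult:
  assumes "b \<in> carrier B" "c \<in> carrier C" "b' \<in> carrier B" "c' \<in> carrier C"
  shows "tn b c \<otimes>\<^bsub>TR\<^esub> tn b' c' = tn (b \<otimes>\<^bsub>B\<^esub> b') (c \<otimes>\<^bsub>C\<^esub> c')"
  using assms ring_hom_mult[OF quot_hom fr fr, of b c b' c'] by (simp add: tens_def monoid_ring_mult)

lemma tn_one: "\<one>\<^bsub>TR\<^esub> = tn \<one>\<^bsub>B\<^esub> \<one>\<^bsub>C\<^esub>"
  using ring_hom_one[OF quot_hom] by (simp add: tens_def monoid_ring_simps)

lemma relation:
  assumes "x - y \<in> tensor_rels R B \<phi> C \<psi>" "x \<in> carrier Z2" "y \<in> carrier Z2"
  shows "I +>\<^bsub>Z2\<^esub> x = I +>\<^bsub>Z2\<^esub> y"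
proof -
  have "x \<ominus>\<^bsub>Z2\<^esub> y \<in> I"
    using assms Zr.genideal_self[OF rels_carrier] by (auto simp: Z.mon_ring_minus tensor_ideal_def)
  then show ?thesis using Zr.quotient_eq_iff_same_a_r_cos[OF ideal_I assms(2,3)] by simp
qed

lemma tn_rules:
  assumes b: "b \<in> carrier B" and c: "c \<in> carrier C"
  shows "b' \<in> carrier B \<Longrightarrow> tn (b \<oplus>\<^bsub>B\<^esub> b') c = tn b c \<oplus>\<^bsub>TR\<^esub> tn b' c"
    and "c' \<in> carrier C \<Longrightarrow> tn b (c \<oplus>\<^bsub>C\<^esub> c') = tn b c \<oplus>\<^bsub>TR\<^esub> tn b c'"
    and "r \<in> carrier R \<Longrightarrow> tn (\<phi> r \<otimes>\<^bsub>B\<^esub> b) c = tn b (\<psi> r \<otimes>\<^bsub>C\<^esub> c)"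
proof -
  show "tn (b \<oplus>\<^bsub>B\<^esub> b') c = tn b c \<oplus>\<^bsub>TR\<^esub> tn b' c" if b': "b' \<in> carrier B"
  proof -
    have "I +>\<^bsub>Z2\<^esub> frag_of (b \<oplus>\<^bsub>B\<^esub> b', c) = I +>\<^bsub>Z2\<^esub> (frag_of (b, c) + frag_of (b', c))"
      by (rule relation) (use b c b' in \<open>simp_all add: fr add_carr\<close>, unfold tensor_rels_def, blast)
    then show ?thesis using ring_hom_add[OF quot_hom fr[OF b c] fr[OF b' c]] by (simp add: tens_def monoid_ring_simps(4))
  qed
  show "tn b (c \<oplus>\<^bsub>C\<^esub> c') = tn b c \<oplus>\<^bsub>TR\<^esub> tn b c'" if c': "c' \<in> carrier C"
  proof -
    have "I +>\<^bsub>Z2\<^esub> frag_of (b, c \<oplus>\<^bsub>C\<^esub> c') = I +>\<^bsub>Z2\<^esub> (frag_of (b, c) + frag_of (b, c'))"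
      by (rule relation) (use b c c' in \<open>simp_all add: fr add_carr\<close>, unfold tensor_rels_def, blast)
    then show ?thesis using ring_hom_add[OF quot_hom fr[OF b c] fr[OF b c']] by (simp add: tens_def monoid_ring_simps(4))
  qed
  show "tn (\<phi> r \<otimes>\<^bsub>B\<^esub> b) c = tn b (\<psi> r \<otimes>\<^bsub>C\<^esub> c)" if r: "r \<in> carrier R"
  proof -
    have rc: "\<phi> r \<in> carrier B" "\<psi> r \<in> carrier C" using r phi psi by auto
    have "I +>\<^bsub>Z2\<^esub> frag_of (\<phi> r \<otimes>\<^bsub>B\<^esub> b, c) = I +>\<^bsub>Z2\<^esub> frag_of (b, \<psi> r \<otimes>\<^bsub>C\<^esub> c)"
      by (rule relation) (use b c r rc in \<open>simp_all add: fr\<close>, unfold tensor_rels_def, blast)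
    then show ?thesis by (simp add: tens_def)
  qed
qed

lemma tn_left_hom: "(\<lambda>b. tn b \<one>\<^bsub>C\<^esub>) \<in> ring_hom B TR"
  by (rule ring_hom_memI) (simp_all add: tn_closed tn_mult tn_rules tn_one)

lemma tn_right_hom: "(\<lambda>c. tn \<one>\<^bsub>B\<^esub> c) \<in> ring_hom C TR"
  by (rule ring_hom_memI) (simp_all add: tn_closed tn_mult tn_rules tn_one)

lemma tn_balanced: "r \<in> carrier R \<Longrightarrow> tn (\<phi> r) \<one>\<^bsub>C\<^esub> = tn \<one>\<^bsub>B\<^esub> (\<psi> r)"
proof -
  assume r: "r \<in> carrier R"
  then have "\<phi> r \<in> carrier B" "\<psi> r \<in> carrier C" using phi psi by auto
  then show ?thesis using tn_rules(3)[OF B.one_closed C.one_closed r] by simp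
qed

lemma tn_split: "b \<in> carrier B \<Longrightarrow> c \<in> carrier C \<Longrightarrow> tn b c = tn b \<one>\<^bsub>C\<^esub> \<otimes>\<^bsub>TR\<^esub> tn \<one>\<^bsub>B\<^esub> c"
  by (simp add: tn_mult)

lemma tensor_hom_eq:
  assumes D: "ring D" and f: "f \<in> ring_hom TR D" and g: "g \<in> ring_hom TR D"
    and l: "\<And>b. b \<in> carrier B \<Longrightarrow> f (tn b \<one>\<^bsub>C\<^esub>) = g (tn b \<one>\<^bsub>C\<^esub>)"
    and r: "\<And>c. c \<in> carrier C \<Longrightarrow> f (tn \<one>\<^bsub>B\<^esub> c) = g (tn \<one>\<^bsub>B\<^esub> c)"
    and x: "x \<in> carrier TR"
  shows "f x = g x"
proof -
  obtain z where z: "z \<in> carrier Z2" "x = I +>\<^bsub>Z2\<^esub> z"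
    using x by (auto simp: tensor_ring_def FactRing_def A_RCOSETS_def')
  have "(\<lambda>z. f (I +>\<^bsub>Z2\<^esub> z)) z = (\<lambda>z. g (I +>\<^bsub>Z2\<^esub> z)) z"
  proof (rule Z.hom_eq_on_frag[OF D _ _ _ z(1)])
    show "(\<lambda>z. f (I +>\<^bsub>Z2\<^esub> z)) \<in> ring_hom Z2 D" "(\<lambda>z. g (I +>\<^bsub>Z2\<^esub> z)) \<in> ring_hom Z2 D"
      using ring_hom_trans[OF quot_hom f] ring_hom_trans[OF quot_hom g] by (simp_all add: comp_def)
    fix n assume "n \<in> carrier (B \<times>\<times> C)"
    then obtain b c where n: "n = (b, c)" "b \<in> carrier B" "c \<in> carrier C" by auto
    then have "f (tn b c) = g (tn b c)"
      by (simp add: tn_split[of b c] ring_hom_mult[OF f] ring_hom_mult[OF g] tn_closed l r)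
    then show "f (I +>\<^bsub>Z2\<^esub> frag_of n) = g (I +>\<^bsub>Z2\<^esub> frag_of n)" by (simp add: tens_def n)
  qed
  then show ?thesis by (simp add: z)
qed

lemma tensor_lift:
  assumes D: "cring D" and u: "u \<in> ring_hom B D" and v: "v \<in> ring_hom C D"
    and uv: "\<forall>r\<in>carrier R. u (\<phi> r) = v (\<psi> r)"
  shows "tensor_lift D u v \<in> ring_hom TR D"
    and "b \<in> carrier B \<Longrightarrow> c \<in> carrier C \<Longrightarrow> tensor_lift D u v (tn b c) = u b \<otimes>\<^bsub>D\<^esub> v c"
proof -
  interpret D: cring D by (rule D)
  note U = ring_hom_closed[OF u] ring_hom_mult[OF u] ring_hom_add[OF u] ring_hom_one[OF u]
  note V = ring_hom_closed[OF v] ring_hom_mult[OF v] ring_hom_add[OF v] ring_hom_one[OF v]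
  define h where "h = (\<lambda>(b, c). u b \<otimes>\<^bsub>D\<^esub> v c)"
  have hm: "h \<in> mon_hom (B \<times>\<times> C) D"
    by (rule mon_homI) (auto simp: h_def U V D.m_ac)
  let ?l = "monoid_ring_lift D h"
  have l: "?l \<in> ring_hom Z2 D" by (rule Z.lift_ring_hom[OF D hm])
  have lf: "?l (frag_of (b, c)) = u b \<otimes>\<^bsub>D\<^esub> v c" if "b \<in> carrier B" "c \<in> carrier C" for b c
    using Z.lift_frag[OF D mon_hom_Pi[OF hm], of "(b, c)"] that by (simp add: h_def)
  interpret L: ring_hom_ring Z2 D ?l
    by (rule ring_hom_ringI2) (rule Zr.ring_axioms D.ring_axioms l)+
  have ld: "?l (x - y) = ?l x \<ominus>\<^bsub>D\<^esub> ?l y" if "x \<in> carrier Z2" "y \<in> carrier Z2" for x y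
    using that L.hom_closed Z.lift_diff[OF D mon_hom_Pi[OF hm]] by simp
  have la: "?l (x + y) = ?l x \<oplus>\<^bsub>D\<^esub> ?l y" if "x \<in> carrier Z2" "y \<in> carrier Z2" for x y
    using that ring_hom_add[OF l] by (simp add: monoid_ring_simps(4))
  have pr: "\<phi> r \<in> carrier B" "\<psi> r \<in> carrier C" if "r \<in> carrier R" for r using that phi psi by auto
  have z: "?l x = \<zero>\<^bsub>D\<^esub>" if xr: "x \<in> tensor_rels R B \<phi> C \<psi>" for x
  proof -
    consider b b' c where "x = frag_of (b \<oplus>\<^bsub>B\<^esub> b', c) - (frag_of (b, c) + frag_of (b', c))"
        "b \<in> carrier B" "b' \<in> carrier B" "c \<in> carrier C"
      | b c c' where "x = frag_of (b, c \<oplus>\<^bsub>C\<^esub> c') - (frag_of (b, c) + frag_of (b, c'))"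
        "b \<in> carrier B" "c \<in> carrier C" "c' \<in> carrier C"
      | r b c where "x = frag_of (\<phi> r \<otimes>\<^bsub>B\<^esub> b, c) - frag_of (b, \<psi> r \<otimes>\<^bsub>C\<^esub> c)"
        "r \<in> carrier R" "b \<in> carrier B" "c \<in> carrier C"
      using xr unfolding tensor_rels_def by blast
    then show ?thesis
    proof cases
      case 1
      then show ?thesis by (simp add: ld la fr add_carr lf U V D.l_distr) (simp add: a_minus_def D.r_neg U V)
    next
      case 2
      then show ?thesis by (simp add: ld la fr add_carr lf U V D.r_distr) (simp add: a_minus_def D.r_neg U V)
    next
      case 3
      have "u (\<phi> r) = v (\<psi> r)" using uv 3 by blast
      with 3 show ?thesis by (simp add: ld fr lf U V pr D.m_ac) (simp add: a_minus_def D.r_neg U V pr)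
    qed
  qed
  have "tensor_rels R B \<phi> C \<psi> \<subseteq> a_kernel Z2 D ?l"
  proof
    fix x assume x: "x \<in> tensor_rels R B \<phi> C \<psi>"
    then have "x \<in> carrier Z2" using rels_carrier by blast
    then show "x \<in> a_kernel Z2 D ?l" using z[OF x] unfolding a_kernel_def' by simp
  qed
  then have "I \<subseteq> a_kernel Z2 D ?l"
    unfolding tensor_ideal_def by (rule Zr.genideal_minimal[OF L.kernel_is_ideal])
  note Ik = this
  have lI: "?l i = \<zero>\<^bsub>D\<^esub>" "i \<in> carrier Z2" if "i \<in> I" for i
    using subsetD[OF Ik that] unfolding a_kernel_def' by simp_all
  have img: "?l ` (I +>\<^bsub>Z2\<^esub> x) = {?l x}" if x: "x \<in> carrier Z2" for x
  proof -
    have e: "?l (i \<oplus>\<^bsub>Z2\<^esub> x) = ?l x" if "i \<in> I" for i using lI[OF that] x by simp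
    have z0: "\<zero>\<^bsub>Z2\<^esub> \<in> I" using additive_subgroup.zero_closed[OF ideal.axioms(1)[OF ideal_I]] .
    have c: "I +>\<^bsub>Z2\<^esub> x = (\<lambda>i. i \<oplus>\<^bsub>Z2\<^esub> x) ` I" by (auto simp: a_r_coset_def')
    have "?l ` (I +>\<^bsub>Z2\<^esub> x) = (\<lambda>i. ?l x) ` I" unfolding c image_image by (rule image_cong) (simp_all add: e)
    then show ?thesis using z0 by (simp only: image_constant)
  qed
  have val: "tensor_lift D u v (I +>\<^bsub>Z2\<^esub> x) = ?l x" if "x \<in> carrier Z2" for x
    using img[OF that] by (simp add: tensor_lift_def h_def)
  show "b \<in> carrier B \<Longrightarrow> c \<in> carrier C \<Longrightarrow> tensor_lift D u v (tn b c) = u b \<otimes>\<^bsub>D\<^esub> v c"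
    by (simp add: tens_def val fr lf)
  show "tensor_lift D u v \<in> ring_hom TR D"
  proof (rule ring_hom_memI)
    have c: "\<exists>z\<in>carrier Z2. x = I +>\<^bsub>Z2\<^esub> z" if "x \<in> carrier TR" for x
      using that by (auto simp: tensor_ring_def FactRing_def A_RCOSETS_def')
    fix x y assume "x \<in> carrier TR" "y \<in> carrier TR"
    then obtain z w where e: "x = I +>\<^bsub>Z2\<^esub> z" "y = I +>\<^bsub>Z2\<^esub> w" and zw: "z \<in> carrier Z2" "w \<in> carrier Z2"
      using c by metis
    show "tensor_lift D u v x \<in> carrier D" using zw by (simp add: e val)
    show "tensor_lift D u v (x \<otimes>\<^bsub>TR\<^esub> y) = tensor_lift D u v x \<otimes>\<^bsub>D\<^esub> tensor_lift D u v y"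
      using zw val[of "z \<otimes>\<^bsub>Z2\<^esub> w"] by (simp add: e val flip: ring_hom_mult[OF quot_hom])
    show "tensor_lift D u v (x \<oplus>\<^bsub>TR\<^esub> y) = tensor_lift D u v x \<oplus>\<^bsub>D\<^esub> tensor_lift D u v y"
      using zw val[of "z \<oplus>\<^bsub>Z2\<^esub> w"] by (simp add: e val flip: ring_hom_add[OF quot_hom])
  next
    show "tensor_lift D u v \<one>\<^bsub>TR\<^esub> = \<one>\<^bsub>D\<^esub>"
      using val[of "\<one>\<^bsub>Z2\<^esub>"] by (simp flip: ring_hom_one[OF quot_hom])
  qed
qed

end

section \<open>Logarithmic differentials\<close>

lemma additive_int_multiple:
  fixes X :: "('a, 'x) ring_scheme" and Y :: "('b, 'y) ring_scheme"
  assumes X: "abelian_group X" and Y: "abelian_group Y"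
    and h: "\<And>x. x \<in> carrier X \<Longrightarrow> h x \<in> carrier Y"
    and add: "\<And>x y. x \<in> carrier X \<Longrightarrow> y \<in> carrier X \<Longrightarrow> h (x \<oplus>\<^bsub>X\<^esub> y) = h x \<oplus>\<^bsub>Y\<^esub> h y"
    and x: "x \<in> carrier X"
  shows "h (add_pow X (k::int) x) = add_pow Y k (h x)"
proof -
  have "h \<in> hom (add_monoid X) (add_monoid Y)" using h add by (auto simp: hom_def)
  then interpret group_hom "add_monoid X" "add_monoid Y" h
    using abelian_group.a_group[OF X] abelian_group.a_group[OF Y] by (simp add: group_hom_def group_hom_axioms_def)
  show ?thesis using hom_int_pow[of x k] x by (simp add: add_pow_def)
qed

lemma int_to_ring_hom:
  fixes B :: "'b ring"
  assumes "cring B"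
  shows "int_to B \<in> ring_hom \<Z> B"
proof -
  interpret cring B by fact
  show ?thesis
  proof (rule ring_hom_memI)
    show "int_to B (x \<otimes>\<^bsub>\<Z>\<^esub> y) = int_to B x \<otimes>\<^bsub>B\<^esub> int_to B y" for x y
      using add.int_pow_pow[OF one_closed, of y x] by (simp add: int_to_def add_pow_ldistr_int add_pow_rdistr_int mult.commute)
  qed (simp_all add: int_to_def add.int_pow_mult)
qed

lemma int_to_smult:
  fixes B :: "'b ring" and Y :: "('b, 'y) module"
  assumes "module B Y" "y \<in> carrier Y"
  shows "int_to B k \<odot>\<^bsub>Y\<^esub> y = add_pow Y k y"
proof -
  interpret module B Y by fact
  have "add_pow B k \<one>\<^bsub>B\<^esub> \<odot>\<^bsub>Y\<^esub> y = add_pow Y k (\<one>\<^bsub>B\<^esub> \<odot>\<^bsub>Y\<^esub> y)"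
    by (rule additive_int_multiple[OF R.abelian_group_axioms M.abelian_group_axioms, where h = "\<lambda>b. b \<odot>\<^bsub>Y\<^esub> y"])
      (use assms(2) in \<open>simp_all add: smult_l_distr\<close>)
  then show ?thesis using assms(2) by (simp add: int_to_def)
qed

lemma gp_module_simps [simp]:
  "carrier (gp_module N) = carrier (gp N)" "\<zero>\<^bsub>gp_module N\<^esub> = \<one>\<^bsub>gp N\<^esub>"
  "x \<oplus>\<^bsub>gp_module N\<^esub> y = x \<otimes>\<^bsub>gp N\<^esub> y" "k \<odot>\<^bsub>gp_module N\<^esub> x = x [^]\<^bsub>gp N\<^esub> k"
  by (simp_all add: gp_module_def)

lemma module_gp:
  assumes N: "comm_monoid N"
  shows "module \<Z> (gp_module N)"
proof -
  interpret G: comm_group "gp N" by (rule comm_group_gp[OF N])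
  show ?thesis
  proof (rule moduleI)
    show "abelian_group (gp_module N)"
    proof (rule abelian_groupI)
      fix x assume "x \<in> carrier (gp_module N)"
      then show "\<exists>y\<in>carrier (gp_module N). y \<oplus>\<^bsub>gp_module N\<^esub> x = \<zero>\<^bsub>gp_module N\<^esub>"
        by (intro bexI[of _ "inv\<^bsub>gp N\<^esub> x"]) simp_all
    qed (simp_all add: G.m_ac)
  qed (simp_all add: int_is_cring G.int_pow_mult G.int_pow_distrib G.int_pow_pow mult.commute)
qed

text \<open>Additive maps are linear over \<open>\<int>\<close>, which acts on a \<open>B\<close>-module through \<open>\<int> \<rightarrow> B\<close>.\<close>

lemma gp_additive_mod_hom:
  fixes B :: "'b ring" and Y :: "('b, 'y) module"
  assumes N: "comm_monoid N" and Y: "module B Y"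
    and l: "\<And>x. x \<in> carrier (gp N) \<Longrightarrow> l x \<in> carrier Y"
    and add: "\<And>x y. x \<in> carrier (gp N) \<Longrightarrow> y \<in> carrier (gp N) \<Longrightarrow> l (x \<otimes>\<^bsub>gp N\<^esub> y) = l x \<oplus>\<^bsub>Y\<^esub> l y"
  shows "l \<in> mod_hom \<Z> (gp_module N) (restrict_scalars (int_to B) Y)"
proof (rule mod_homI)
  interpret G: comm_group "gp N" by (rule comm_group_gp[OF N])
  interpret Y: module B Y by (rule Y)
  have "l \<in> hom (gp N) (add_monoid Y)" using l add by (auto simp: hom_def)
  then interpret group_hom "gp N" "add_monoid Y" l
    using Y.M.a_group G.is_group by (simp add: group_hom_def group_hom_axioms_def)
  show "l (k \<odot>\<^bsub>gp_module N\<^esub> x) = k \<odot>\<^bsub>restrict_scalars (int_to B) Y\<^esub> l x" if "x \<in> carrier (gp_module N)" for k x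
    using that hom_int_pow[of x k] int_to_smult[OF Y, of "l x" k] l by (simp add: add_pow_def)
qed (simp_all add: l add)

subsection \<open>Kaehler differentials\<close>

lemma kaehler_presentation:
  assumes B: "cring B"
  shows "presentation B (carrier B) (kaehler_rels B)"
proof -
  interpret Fr: free_mod B "carrier B" by (rule free_mod.intro[OF B])
  interpret FM: module B "free_module B (carrier B)" by (rule Fr.module_free)
  have "kaehler_rels B \<subseteq> carrier (free_module B (carrier B))"
    unfolding kaehler_rels_def Let_def
    by (auto intro!: FM.M.minus_closed FM.M.a_closed FM.smult_closed Fr.basis_vec)
  then show ?thesis by (intro presentation.intro free_mod.intro presentation_axioms.intro B)
qed

lemma kaehler:
  assumes B: "cring B"
  shows "module B (kaehler B)"
    and "b \<in> carrier B \<Longrightarrow> kaehler_d B b \<in> carrier (kaehler B)"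
    and "b \<in> carrier B \<Longrightarrow> c \<in> carrier B \<Longrightarrow> kaehler_d B (b \<oplus>\<^bsub>B\<^esub> c) = kaehler_d B b \<oplus>\<^bsub>kaehler B\<^esub> kaehler_d B c"
    and "b \<in> carrier B \<Longrightarrow> c \<in> carrier B \<Longrightarrow> kaehler_d B (b \<otimes>\<^bsub>B\<^esub> c) =
      b \<odot>\<^bsub>kaehler B\<^esub> kaehler_d B c \<oplus>\<^bsub>kaehler B\<^esub> c \<odot>\<^bsub>kaehler B\<^esub> kaehler_d B b"
proof -
  interpret B: cring B by (rule B)
  interpret presentation B "carrier B" "kaehler_rels B" by (rule kaehler_presentation[OF B])
  interpret FM: module B "free_module B (carrier B)" by (rule module_free)
  note pj = mod_homD[OF proj, folded kaehler_def]
  show "module B (kaehler B)" unfolding kaehler_def by (rule module_presented)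
  show "b \<in> carrier B \<Longrightarrow> kaehler_d B b \<in> carrier (kaehler B)" unfolding kaehler_def kaehler_d_def by (rule gen_closed)
  show "kaehler_d B (b \<oplus>\<^bsub>B\<^esub> c) = kaehler_d B b \<oplus>\<^bsub>kaehler B\<^esub> kaehler_d B c" if "b \<in> carrier B" "c \<in> carrier B"
  proof -
    have "basis_vec B (b \<oplus>\<^bsub>B\<^esub> c) \<ominus>\<^bsub>F\<^esub> (basis_vec B b \<oplus>\<^bsub>F\<^esub> basis_vec B c) \<in> kaehler_rels B"
      using that unfolding kaehler_rels_def Let_def by blast
    from relation[OF this] show ?thesis using that by (simp add: kaehler_d_def basis_vec pj flip: proj_basis)
  qed
  show "kaehler_d B (b \<otimes>\<^bsub>B\<^esub> c) =
      b \<odot>\<^bsub>kaehler B\<^esub> kaehler_d B c \<oplus>\<^bsub>kaehler B\<^esub> c \<odot>\<^bsub>kaehler B\<^esub> kaehler_d B b" if "b \<in> carrier B" "c \<in> carrier B"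
  proof -
    have "basis_vec B (b \<otimes>\<^bsub>B\<^esub> c) \<ominus>\<^bsub>F\<^esub> (b \<odot>\<^bsub>F\<^esub> basis_vec B c \<oplus>\<^bsub>F\<^esub> c \<odot>\<^bsub>F\<^esub> basis_vec B b) \<in> kaehler_rels B"
      using that unfolding kaehler_rels_def Let_def by blast
    from relation[OF this] show ?thesis using that by (simp add: kaehler_d_def basis_vec pj flip: proj_basis)
  qed
qed

lemma kaehler_ext:
  assumes B: "cring B" and Y: "module B Y" and f: "f \<in> mod_hom B (kaehler B) Y" and g: "g \<in> mod_hom B (kaehler B) Y"
    and eq: "\<And>b. b \<in> carrier B \<Longrightarrow> f (kaehler_d B b) = g (kaehler_d B b)" and w: "w \<in> carrier (kaehler B)"
  shows "f w = g w"
  using presentation.presented_ext[OF kaehler_presentation[OF B] Y, folded kaehler_def kaehler_d_def, OF f g eq w] by blast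

lemma kaehler_lift:
  assumes B: "cring B" and Y: "module B Y" and D: "D \<in> carrier B \<rightarrow> carrier Y"
    and add: "\<And>b c. b \<in> carrier B \<Longrightarrow> c \<in> carrier B \<Longrightarrow> D (b \<oplus>\<^bsub>B\<^esub> c) = D b \<oplus>\<^bsub>Y\<^esub> D c"
    and leibniz: "\<And>b c. b \<in> carrier B \<Longrightarrow> c \<in> carrier B \<Longrightarrow> D (b \<otimes>\<^bsub>B\<^esub> c) = b \<odot>\<^bsub>Y\<^esub> D c \<oplus>\<^bsub>Y\<^esub> c \<odot>\<^bsub>Y\<^esub> D b"
  shows "presented_lift B Y D \<in> mod_hom B (kaehler B) Y"
    and "b \<in> carrier B \<Longrightarrow> presented_lift B Y D (kaehler_d B b) = D b"
proof -
  interpret B: cring B by (rule B)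
  interpret presentation B "carrier B" "kaehler_rels B" by (rule kaehler_presentation[OF B])
  interpret FM: module B "free_module B (carrier B)" by (rule module_free)
  note L = mod_homD[OF lin_ext_mod_hom[OF Y D]] lin_ext_basis[OF Y D]
  have z: "\<forall>e\<in>kaehler_rels B. lin_ext B Y D e = \<zero>\<^bsub>Y\<^esub>"
  proof
    fix e assume e: "e \<in> kaehler_rels B"
    consider b c where "e = basis_vec B (b \<oplus>\<^bsub>B\<^esub> c) \<ominus>\<^bsub>F\<^esub> (basis_vec B b \<oplus>\<^bsub>F\<^esub> basis_vec B c)" "b \<in> carrier B" "c \<in> carrier B"
      | b c where "e = basis_vec B (b \<otimes>\<^bsub>B\<^esub> c) \<ominus>\<^bsub>F\<^esub> (b \<odot>\<^bsub>F\<^esub> basis_vec B c \<oplus>\<^bsub>F\<^esub> c \<odot>\<^bsub>F\<^esub> basis_vec B b)" "b \<in> carrier B" "c \<in> carrier B"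
      using e unfolding kaehler_rels_def Let_def by blast
    then show "lin_ext B Y D e = \<zero>\<^bsub>Y\<^esub>"
      by cases (simp_all add: lin_ext_relation[OF B Y D] basis_vec L add leibniz)
  qed
  show "presented_lift B Y D \<in> mod_hom B (kaehler B) Y"
    unfolding kaehler_def by (rule presented_lift(1)[OF Y D z])
  show "b \<in> carrier B \<Longrightarrow> presented_lift B Y D (kaehler_d B b) = D b"
    unfolding kaehler_d_def by (rule presented_lift(2)[OF Y D z])
qed

subsection \<open>The module of log differentials of a pre-log ring\<close>

locale log_forms =
  fixes Q :: "('b, 'n) prelog"
  assumes preQ: "prelog_ring Q"
begin

abbreviation "B \<equiv> PRing Q"
abbreviation "N \<equiv> PMon Q"
abbreviation "sumQ \<equiv> log_omega_sum Q"
abbreviation "Om \<equiv> log_omega Q"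

lemmas Bc = prelog_ringD(1)[OF preQ] and Nc = prelog_ringD(2)[OF preQ]
lemmas str = mon_homD[OF prelog_ringD(3)[OF preQ]]

interpretation B: cring B by (rule Bc)

lemma dl: "ext_scal B (int_to B) \<Z> (gp_module N)"
  by (intro ext_scal.intro Bc int_is_cring int_to_ring_hom module_gp Nc)

lemmas module_dlog = ext_scal.module_ext[OF dl, folded dlog_module_def]
lemmas dlog_closed = ext_scal.tn_closed[OF dl, folded dlog_module_def dlog_tens_def, simplified]
lemmas dlog_add = ext_scal.tn_rules(2)[OF dl, folded dlog_module_def dlog_tens_def, simplified]
lemmas dlog_smult = ext_scal.tn_smult[OF dl, folded dlog_module_def dlog_tens_def, simplified]
lemmas dlog_ext = ext_scal.ext_ext[OF dl, folded dlog_module_def dlog_tens_def, simplified]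
lemmas dlog_lift = ext_scal.ext_lift[OF dl, folded dlog_module_def dlog_tens_def, simplified]

lemma module_sum: "module B sumQ"
  unfolding log_omega_sum_def by (intro module_dsum kaehler(1) Bc module_dlog)

lemma sum_simps:
  "carrier sumQ = carrier (kaehler B) \<times> carrier (dlog_module Q)"
  "(w, t) \<oplus>\<^bsub>sumQ\<^esub> (w', t') = (w \<oplus>\<^bsub>kaehler B\<^esub> w', t \<oplus>\<^bsub>dlog_module Q\<^esub> t')"
  "b \<odot>\<^bsub>sumQ\<^esub> (w, t) = (b \<odot>\<^bsub>kaehler B\<^esub> w, b \<odot>\<^bsub>dlog_module Q\<^esub> t)"
  by (simp_all add: log_omega_sum_def)

definition log_rels where
  "log_rels = {(kaehler_d B (pstr Q n), \<zero>\<^bsub>dlog_module Q\<^esub>)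
        \<ominus>\<^bsub>sumQ\<^esub> (\<zero>\<^bsub>kaehler B\<^esub>, dlog_tens Q (pstr Q n) (to_gp N n)) | n. n \<in> carrier N}"

interpretation K: module B "kaehler B" by (rule kaehler(1)[OF Bc])
interpretation L: module B "dlog_module Q" by (rule module_dlog)
interpretation S: module B sumQ by (rule module_sum)

lemma rel_terms:
  assumes "n \<in> carrier N"
  shows "(kaehler_d B (pstr Q n), \<zero>\<^bsub>dlog_module Q\<^esub>) \<in> carrier sumQ"
    "(\<zero>\<^bsub>kaehler B\<^esub>, dlog_tens Q (pstr Q n) (to_gp N n)) \<in> carrier sumQ"
  using assms by (simp_all add: sum_simps kaehler(2)[OF Bc] str dlog_closed mon_homD(1)[OF to_gp_mon_hom[OF Nc]])

lemma rels_sub: "log_rels \<subseteq> carrier sumQ"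
  unfolding log_rels_def using rel_terms S.M.minus_closed by blast

lemma ker_gen: "log_omega_ker Q = gen_submodule B sumQ log_rels"
  by (simp add: log_omega_ker_def log_rels_def)

lemma quot: "quotient_module B sumQ (log_omega_ker Q)"
  unfolding ker_gen by (intro quotient_moduleI module_sum gen_submodule(1) rels_sub)

interpretation quotient_module B sumQ "log_omega_ker Q" by (rule quot)

lemma module_Om: "module B Om" unfolding log_omega_def by (rule quot_module)

definition cl where "cl z = log_omega_ker Q +>\<^bsub>sumQ\<^esub> z"
text \<open>The differentials \<open>d b\<close> and \<open>dlog x\<close>, which generate the module.\<close>

definition od where "od b = cl (kaehler_d B b, \<zero>\<^bsub>dlog_module Q\<^esub>)"
definition ol where "ol x = cl (\<zero>\<^bsub>kaehler B\<^esub>, dlog_tens Q \<one>\<^bsub>B\<^esub> x)"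

lemma cl_hom: "cl \<in> mod_hom B sumQ Om"
  unfolding log_omega_def cl_def[abs_def] by (rule quot_proj)

lemmas cl_simps = mod_homD[OF cl_hom]

lemma inl: "(\<lambda>w. (w, \<zero>\<^bsub>dlog_module Q\<^esub>)) \<in> mod_hom B (kaehler B) sumQ"
  by (rule mod_homI) (simp_all add: sum_simps)

lemma inr: "(\<lambda>t. (\<zero>\<^bsub>kaehler B\<^esub>, t)) \<in> mod_hom B (dlog_module Q) sumQ"
  by (rule mod_homI) (simp_all add: sum_simps)

lemma od_closed: "b \<in> carrier B \<Longrightarrow> od b \<in> carrier Om"
  unfolding od_def by (intro cl_simps) (simp add: sum_simps kaehler(2)[OF Bc])

lemma ol_closed: "x \<in> carrier (gp N) \<Longrightarrow> ol x \<in> carrier Om"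
  unfolding ol_def by (intro cl_simps) (simp add: sum_simps dlog_closed)

lemma od_add: "b \<in> carrier B \<Longrightarrow> c \<in> carrier B \<Longrightarrow> od (b \<oplus>\<^bsub>B\<^esub> c) = od b \<oplus>\<^bsub>Om\<^esub> od c"
  unfolding od_def by (subst cl_simps(2)[symmetric]) (simp_all add: sum_simps kaehler[OF Bc])

lemma od_leibniz: "b \<in> carrier B \<Longrightarrow> c \<in> carrier B \<Longrightarrow> od (b \<otimes>\<^bsub>B\<^esub> c) = b \<odot>\<^bsub>Om\<^esub> od c \<oplus>\<^bsub>Om\<^esub> c \<odot>\<^bsub>Om\<^esub> od b"
  unfolding od_def by (simp add: sum_simps kaehler[OF Bc] flip: cl_simps)

lemma ol_add: "x \<in> carrier (gp N) \<Longrightarrow> y \<in> carrier (gp N) \<Longrightarrow> ol (x \<otimes>\<^bsub>gp N\<^esub> y) = ol x \<oplus>\<^bsub>Om\<^esub> ol y"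
  unfolding ol_def by (subst cl_simps(2)[symmetric]) (simp_all add: sum_simps dlog_closed dlog_add)

lemma cl_dlog: "b \<in> carrier B \<Longrightarrow> x \<in> carrier (gp N) \<Longrightarrow> cl (\<zero>\<^bsub>kaehler B\<^esub>, dlog_tens Q b x) = b \<odot>\<^bsub>Om\<^esub> ol x"
  unfolding ol_def by (subst cl_simps(3)[symmetric]) (simp_all add: sum_simps dlog_closed dlog_smult[of b x, symmetric])

lemma od_str: "n \<in> carrier N \<Longrightarrow> od (pstr Q n) = pstr Q n \<odot>\<^bsub>Om\<^esub> ol (to_gp N n)"
proof -
  assume n: "n \<in> carrier N"
  have "(kaehler_d B (pstr Q n), \<zero>\<^bsub>dlog_module Q\<^esub>) \<ominus>\<^bsub>sumQ\<^esub> (\<zero>\<^bsub>kaehler B\<^esub>, dlog_tens Q (pstr Q n) (to_gp N n)) \<in> log_omega_ker Q"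
    unfolding ker_gen by (rule subsetD[OF gen_submodule(2)[OF module_sum rels_sub]]) (use n in \<open>auto simp: log_rels_def\<close>)
  then have "cl (kaehler_d B (pstr Q n), \<zero>\<^bsub>dlog_module Q\<^esub>) = cl (\<zero>\<^bsub>kaehler B\<^esub>, dlog_tens Q (pstr Q n) (to_gp N n))"
    unfolding cl_def using coset_eq_iff rel_terms[OF n] by simp
  then show ?thesis
    using n cl_dlog[of "pstr Q n" "to_gp N n"] by (simp add: od_def str mon_homD(1)[OF to_gp_mon_hom[OF Nc]])
qed

lemma Om_ext:
  assumes Y: "module B Y" and f: "f \<in> mod_hom B Om Y" and g: "g \<in> mod_hom B Om Y"
    and d: "\<And>b. b \<in> carrier B \<Longrightarrow> f (od b) = g (od b)"
    and l: "\<And>x. x \<in> carrier (gp N) \<Longrightarrow> f (ol x) = g (ol x)" and w: "w \<in> carrier Om"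
  shows "f w = g w"
proof -
  interpret Y: module B Y by (rule Y)
  note F = mod_homD[OF f] and G = mod_homD[OF g]
  note Il = mod_homD[OF inl] and Ir = mod_homD[OF inr]
  obtain u t where z: "w = cl (u, t)" "u \<in> carrier (kaehler B)" "t \<in> carrier (dlog_module Q)"
    using w unfolding log_omega_def quot_carrier cl_def by (auto simp: sum_simps)
  have "(\<lambda>w. f (cl (w, \<zero>\<^bsub>dlog_module Q\<^esub>))) u = (\<lambda>w. g (cl (w, \<zero>\<^bsub>dlog_module Q\<^esub>))) u"
  proof (rule kaehler_ext[OF Bc Y _ _ _ z(2)])
    show "(\<lambda>w. f (cl (w, \<zero>\<^bsub>dlog_module Q\<^esub>))) \<in> mod_hom B (kaehler B) Y"
      "(\<lambda>w. g (cl (w, \<zero>\<^bsub>dlog_module Q\<^esub>))) \<in> mod_hom B (kaehler B) Y"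
      by (rule mod_homI; simp add: F G Il cl_simps)+
  qed (use d in \<open>simp add: od_def\<close>)
  moreover have "(\<lambda>w. f (cl (\<zero>\<^bsub>kaehler B\<^esub>, w))) t = (\<lambda>w. g (cl (\<zero>\<^bsub>kaehler B\<^esub>, w))) t"
  proof (rule dlog_ext[OF Y _ _ _ z(3)])
    show "(\<lambda>w. f (cl (\<zero>\<^bsub>kaehler B\<^esub>, w))) \<in> mod_hom B (dlog_module Q) Y"
      "(\<lambda>w. g (cl (\<zero>\<^bsub>kaehler B\<^esub>, w))) \<in> mod_hom B (dlog_module Q) Y"
      by (rule mod_homI; simp add: F G Ir cl_simps)+
  qed (use l in \<open>simp add: ol_def\<close>)
  moreover have "cl (u, t) = cl (u, \<zero>\<^bsub>dlog_module Q\<^esub>) \<oplus>\<^bsub>Om\<^esub> cl (\<zero>\<^bsub>kaehler B\<^esub>, t)"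
    using z by (subst cl_simps(2)[symmetric]) (simp_all add: sum_simps)
  ultimately show ?thesis using z Il(1) Ir(1) by (simp add: F G cl_simps)
qed

text \<open>A map out of the log differentials, written as in the definition of their functoriality.\<close>

lemma Om_lift:
  assumes Y: "module B Y" and H: "H \<in> mod_hom B sumQ Y"
    and rel: "\<And>n. n \<in> carrier N \<Longrightarrow> H (kaehler_d B (pstr Q n), \<zero>\<^bsub>dlog_module Q\<^esub>) =
      H (\<zero>\<^bsub>kaehler B\<^esub>, dlog_tens Q (pstr Q n) (to_gp N n))"
  shows "(\<lambda>U. the_elem (H ` U)) \<in> mod_hom B Om Y" "z \<in> carrier sumQ \<Longrightarrow> the_elem (H ` cl z) = H z"
proof -
  have "H e = \<zero>\<^bsub>Y\<^esub>" if er: "e \<in> log_rels" for e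
  proof -
    obtain n where n: "n \<in> carrier N" and e: "e = (kaehler_d B (pstr Q n), \<zero>\<^bsub>dlog_module Q\<^esub>)
        \<ominus>\<^bsub>sumQ\<^esub> (\<zero>\<^bsub>kaehler B\<^esub>, dlog_tens Q (pstr Q n) (to_gp N n))"
      using er unfolding log_rels_def by blast
    show ?thesis unfolding e mod_hom_minus[OF module_sum Y H rel_terms[OF n]]
      using rel[OF n] minus_eq_zero_iff[OF module.axioms(2)[OF Y]] mod_homD(1)[OF H] rel_terms[OF n] by simp
  qed
  then have k: "\<forall>k\<in>log_omega_ker Q. H k = \<zero>\<^bsub>Y\<^esub>"
    unfolding ker_gen by (intro gen_submodule_kills[OF module_sum Y H rels_sub]) blast
  show "(\<lambda>U. the_elem (H ` U)) \<in> mod_hom B Om Y" unfolding log_omega_def by (rule quot_lift[OF Y H k])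
  show "z \<in> carrier sumQ \<Longrightarrow> the_elem (H ` cl z) = H z" unfolding cl_def by (rule quot_lift_apply(2)[OF Y H k])
qed

text \<open>The log differentials represent log derivations \<open>(D, l)\<close>.\<close>

lemma Om_universal:
  fixes Y :: "('b, 'y) module"
  assumes Y: "module B Y" and D: "D \<in> carrier B \<rightarrow> carrier Y"
    and add: "\<And>b c. b \<in> carrier B \<Longrightarrow> c \<in> carrier B \<Longrightarrow> D (b \<oplus>\<^bsub>B\<^esub> c) = D b \<oplus>\<^bsub>Y\<^esub> D c"
    and leibniz: "\<And>b c. b \<in> carrier B \<Longrightarrow> c \<in> carrier B \<Longrightarrow> D (b \<otimes>\<^bsub>B\<^esub> c) = b \<odot>\<^bsub>Y\<^esub> D c \<oplus>\<^bsub>Y\<^esub> c \<odot>\<^bsub>Y\<^esub> D b"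
    and l: "\<And>x. x \<in> carrier (gp N) \<Longrightarrow> l x \<in> carrier Y"
    and l_add: "\<And>x y. x \<in> carrier (gp N) \<Longrightarrow> y \<in> carrier (gp N) \<Longrightarrow> l (x \<otimes>\<^bsub>gp N\<^esub> y) = l x \<oplus>\<^bsub>Y\<^esub> l y"
    and rel: "\<And>n. n \<in> carrier N \<Longrightarrow> D (pstr Q n) = pstr Q n \<odot>\<^bsub>Y\<^esub> l (to_gp N n)"
  shows "\<exists>h\<in>mod_hom B Om Y. (\<forall>b\<in>carrier B. h (od b) = D b) \<and> (\<forall>x\<in>carrier (gp N). h (ol x) = l x)"
proof -
  interpret Y: module B Y by (rule Y)
  note lm = gp_additive_mod_hom[OF Nc Y l l_add]
  define kl where "kl = presented_lift B Y D"
  define ll where "ll = presented_lift B Y (\<lambda>(b, x). b \<odot>\<^bsub>Y\<^esub> l x)"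
  note KL = kaehler_lift[OF Bc Y D add leibniz, folded kl_def]
  have LL: "ll \<in> mod_hom B (dlog_module Q) Y" "b \<in> carrier B \<Longrightarrow> x \<in> carrier (gp N) \<Longrightarrow> ll (dlog_tens Q b x) = b \<odot>\<^bsub>Y\<^esub> l x" for b x
    unfolding ll_def by (rule dlog_lift[OF Y lm]; simp)+
  note kz = mod_hom_zero[OF kaehler(1)[OF Bc] Y KL(1)] and lz = mod_hom_zero[OF module_dlog Y LL(1)]
  note k' = mod_homD[OF KL(1)] and l' = mod_homD[OF LL(1)]
  define H where "H = (\<lambda>(w, t). kl w \<oplus>\<^bsub>Y\<^esub> ll t)"
  have H: "H \<in> mod_hom B sumQ Y"
    by (rule mod_homI) (auto simp: H_def sum_simps k' l' Y.M.a_ac Y.smult_r_distr)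
  have "H (kaehler_d B (pstr Q n), \<zero>\<^bsub>dlog_module Q\<^esub>) = H (\<zero>\<^bsub>kaehler B\<^esub>, dlog_tens Q (pstr Q n) (to_gp N n))"
    if "n \<in> carrier N" for n
    using that rel[OF that] l by (simp add: H_def kz lz KL LL str mon_homD(1)[OF to_gp_mon_hom[OF Nc]])
  note lift = Om_lift[OF Y H this]
  show ?thesis
  proof (intro bexI[of _ "\<lambda>U. the_elem (H ` U)"] conjI ballI)
    show "the_elem (H ` od b) = D b" if "b \<in> carrier B" for b
      using that D funcset_mem[OF D that] unfolding od_def by (subst lift(2)) (simp_all add: sum_simps kaehler(2)[OF Bc] H_def KL lz)
    show "the_elem (H ` ol x) = l x" if "x \<in> carrier (gp N)" for x
      using that l unfolding ol_def by (subst lift(2)) (simp_all add: sum_simps dlog_closed H_def LL kz)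
  qed (rule lift(1))
qed

end

lemma log_omega_map:
  fixes Q :: "('b, 'n) prelog" and Q' :: "('c, 'k) prelog"
  assumes Q: "prelog_ring Q" and Q': "prelog_ring Q'" and h: "(u, v) \<in> prelog_hom Q Q'"
  shows "log_omega_map Q Q' (u, v) \<in> mod_hom (PRing Q) (log_omega Q) (restrict_scalars u (log_omega Q'))"
    and "b \<in> carrier (PRing Q) \<Longrightarrow> log_omega_map Q Q' (u, v) (log_forms.od Q b) = log_forms.od Q' (u b)"
    and "x \<in> carrier (gp (PMon Q)) \<Longrightarrow> log_omega_map Q Q' (u, v) (log_forms.ol Q x) = log_forms.ol Q' (gp_map (PMon Q') v x)"
proof -
  interpret F: log_forms Q by (rule log_forms.intro[OF Q])
  interpret F': log_forms Q' by (rule log_forms.intro[OF Q'])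
  interpret B: cring "PRing Q" by (rule F.Bc)
  interpret B': cring "PRing Q'" by (rule F'.Bc)
  have u: "u \<in> ring_hom (PRing Q) (PRing Q')" and v: "v \<in> mon_hom (PMon Q) (PMon Q')"
    and uv: "\<And>m. m \<in> carrier (PMon Q) \<Longrightarrow> pstr Q' (v m) = u (pstr Q m)"
    using h by (auto simp: prelog_hom_def)
  note U = ring_hom_closed[OF u] ring_hom_mult[OF u] ring_hom_add[OF u] ring_hom_one[OF u]
  note V = mon_homD[OF gp_map_mon_hom[OF F.Nc F'.Nc v]] and v' = mon_homD[OF v]
  note rs = module_restrict_scalars[OF F.Bc u]
  note KM = rs[OF kaehler(1)[OF F'.Bc]] and DM = rs[OF F'.module_dlog] and OM = rs[OF F'.module_Om]
  have k: "kaehler_map (PRing Q) (PRing Q') u \<in> mod_hom (PRing Q) (kaehler (PRing Q)) (restrict_scalars u (kaehler (PRing Q')))"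
    "b \<in> carrier (PRing Q) \<Longrightarrow> kaehler_map (PRing Q) (PRing Q') u (kaehler_d (PRing Q) b) = kaehler_d (PRing Q') (u b)" for b
    unfolding kaehler_map_def by (rule kaehler_lift[OF F.Bc KM]; auto simp: U kaehler[OF F'.Bc])+
  interpret D': module "PRing Q'" "dlog_module Q'" by (rule F'.module_dlog)
  interpret K': module "PRing Q'" "kaehler (PRing Q')" by (rule kaehler(1)[OF F'.Bc])
  have lm: "(\<lambda>x. dlog_tens Q' \<one>\<^bsub>PRing Q'\<^esub> (gp_map (PMon Q') v x)) \<in>
      mod_hom \<Z> (gp_module (PMon Q)) (restrict_scalars (int_to (PRing Q)) (restrict_scalars u (dlog_module Q')))"
    by (rule gp_additive_mod_hom[OF F.Nc DM]) (simp_all add: F'.dlog_closed V F'.dlog_add)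
  have d: "dlog_map Q Q' (u, v) \<in> mod_hom (PRing Q) (dlog_module Q) (restrict_scalars u (dlog_module Q'))"
    "b \<in> carrier (PRing Q) \<Longrightarrow> x \<in> carrier (gp (PMon Q)) \<Longrightarrow>
      dlog_map Q Q' (u, v) (dlog_tens Q b x) = u b \<odot>\<^bsub>dlog_module Q'\<^esub> dlog_tens Q' \<one>\<^bsub>PRing Q'\<^esub> (gp_map (PMon Q') v x)" for b x
    unfolding dlog_map_def prod.case
    using F.dlog_lift[OF DM lm, of "\<lambda>(b, x). dlog_tens Q' (u b) (gp_map (PMon Q') v x)"]
    by (simp_all add: F'.dlog_smult[of "u _"] U V)
  define H where "H = (\<lambda>(w, t). log_omega_ker Q' +>\<^bsub>log_omega_sum Q'\<^esub>
                  (kaehler_map (PRing Q) (PRing Q') u w, dlog_map Q Q' (u, v) t))"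
  have Hc: "H (w, t) = F'.cl (kaehler_map (PRing Q) (PRing Q') u w, dlog_map Q Q' (u, v) t)" for w t
    by (simp add: H_def F'.cl_def)
  note k' = mod_homD[OF k(1), simplified] and d' = mod_homD[OF d(1), simplified]
  note kz = mod_hom_zero[OF kaehler(1)[OF F.Bc] KM k(1), simplified] and dz = mod_hom_zero[OF F.module_dlog DM d(1), simplified]
  have H: "H \<in> mod_hom (PRing Q) (log_omega_sum Q) (restrict_scalars u (log_omega Q'))"
    by (rule mod_homI) (auto simp: Hc F.sum_simps F'.sum_simps k' d' U simp flip: F'.cl_simps intro!: F'.cl_simps(1))
  have od: "H (kaehler_d (PRing Q) b, \<zero>\<^bsub>dlog_module Q\<^esub>) = F'.od (u b)" if "b \<in> carrier (PRing Q)" for b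
    using that by (simp add: Hc k dz F'.od_def)
  have ol: "H (\<zero>\<^bsub>kaehler (PRing Q)\<^esub>, dlog_tens Q b x) = u b \<odot>\<^bsub>log_omega Q'\<^esub> F'.ol (gp_map (PMon Q') v x)"
    if "b \<in> carrier (PRing Q)" "x \<in> carrier (gp (PMon Q))" for b x
    using that F'.cl_dlog[of "u b" "gp_map (PMon Q') v x"] by (simp add: Hc kz d U V flip: F'.dlog_smult)
  have "H (kaehler_d (PRing Q) (pstr Q n), \<zero>\<^bsub>dlog_module Q\<^esub>) =
      H (\<zero>\<^bsub>kaehler (PRing Q)\<^esub>, dlog_tens Q (pstr Q n) (to_gp (PMon Q) n))" if "n \<in> carrier (PMon Q)" for n
    using that F'.od_str[of "v n"]
    by (simp add: od ol F.str uv v' gp_map_to_gp[OF F.Nc F'.Nc v] mon_homD(1)[OF to_gp_mon_hom[OF F.Nc]])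
  note lift = F.Om_lift[OF OM H this]
  have e: "log_omega_map Q Q' (u, v) = (\<lambda>U. the_elem (H ` U))" by (simp add: log_omega_map_def H_def fun_eq_iff)
  show "log_omega_map Q Q' (u, v) \<in> mod_hom (PRing Q) (log_omega Q) (restrict_scalars u (log_omega Q'))"
    unfolding e by (rule lift(1))
  show "log_omega_map Q Q' (u, v) (F.od b) = F'.od (u b)" if "b \<in> carrier (PRing Q)"
    unfolding e using that by (subst F.od_def, subst lift(2)) (simp_all add: F.sum_simps kaehler(2)[OF F.Bc] od module.axioms(2)[OF F.module_dlog] abelian_monoid.zero_closed abelian_group.axioms(1))
  show "log_omega_map Q Q' (u, v) (F.ol x) = F'.ol (gp_map (PMon Q') v x)" if "x \<in> carrier (gp (PMon Q))"
  proof -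
    interpret O': module "PRing Q'" "log_omega Q'" by (rule F'.module_Om)
    show ?thesis
      unfolding e using that
      by (subst F.ol_def, subst lift(2)) (simp_all add: F.sum_simps F.dlog_closed ol U V F'.ol_closed module.axioms(2)[OF kaehler(1)[OF F.Bc]] abelian_monoid.zero_closed abelian_group.axioms(1))
  qed
qed

subsection \<open>Base change to \<open>A\<close>\<close>

locale over_obj =
  fixes X :: "('a, 'm) prelog" and Y :: "('b, 'n) prelog" and f :: "'b \<Rightarrow> 'a" and g :: "'n \<Rightarrow> 'm"
  assumes preX: "prelog_ring X" and preY: "prelog_ring Y" and fg: "(f, g) \<in> prelog_hom Y X"
begin

abbreviation "A \<equiv> PRing X"
abbreviation "M \<equiv> PMon X"
abbreviation "B \<equiv> PRing Y"
abbreviation "N \<equiv> PMon Y"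
abbreviation "T \<equiv> LogDiff_obj X (Y, f, g)"

lemmas Ac = prelog_ringD(1)[OF preX] and Bc = prelog_ringD(1)[OF preY]
lemmas Mc = prelog_ringD(2)[OF preX] and Nc = prelog_ringD(2)[OF preY]
lemmas alpha = mon_homD[OF prelog_ringD(3)[OF preX]] and beta = mon_homD[OF prelog_ringD(3)[OF preY]]

lemma f: "f \<in> ring_hom B A" and g: "g \<in> mon_hom N M"
  and fg_str: "n \<in> carrier N \<Longrightarrow> pstr X (g n) = f (pstr Y n)"
  using fg by (auto simp: prelog_hom_def)

lemmas f_simps = ring_hom_closed[OF f] ring_hom_mult[OF f] ring_hom_add[OF f] ring_hom_one[OF f]
lemmas g_simps = mon_homD[OF g]
lemmas togp = mon_homD[OF to_gp_mon_hom[OF Nc]]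

lemma LF: "log_forms Y" by (rule log_forms.intro[OF preY])

abbreviation "od \<equiv> log_forms.od Y"
abbreviation "ol \<equiv> log_forms.ol Y"

lemmas Om = log_forms.module_Om[OF LF] log_forms.od_closed[OF LF] log_forms.ol_closed[OF LF]
  log_forms.od_add[OF LF] log_forms.od_leibniz[OF LF] log_forms.ol_add[OF LF] log_forms.od_str[OF LF]

lemma ES: "ext_scal A f B (log_omega Y)"
  by (intro ext_scal.intro Ac Bc f Om(1))

lemma T_eq: "T = ext_scalars A f B (log_omega Y)" by (simp add: LogDiff_obj_def)

text \<open>The generators \<open>1 \<otimes> w\<close>, in particular \<open>1 \<otimes> d b\<close> and \<open>1 \<otimes> dlog x\<close>.\<close>

definition tn where "tn w = ext_scalars_tens A f B (log_omega Y) \<one>\<^bsub>A\<^esub> w"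
definition td where "td b = tn (od b)"
definition tl where "tl x = tn (ol x)"

interpretation A: cring A by (rule Ac)
interpretation B: cring B by (rule Bc)

lemma module_T: "module A T" unfolding T_eq by (rule ext_scal.module_ext[OF ES])

lemma tn: "w \<in> carrier (log_omega Y) \<Longrightarrow> tn w \<in> carrier T"
  "w \<in> carrier (log_omega Y) \<Longrightarrow> w' \<in> carrier (log_omega Y) \<Longrightarrow> tn (w \<oplus>\<^bsub>log_omega Y\<^esub> w') = tn w \<oplus>\<^bsub>T\<^esub> tn w'"
  "b \<in> carrier B \<Longrightarrow> w \<in> carrier (log_omega Y) \<Longrightarrow> tn (b \<odot>\<^bsub>log_omega Y\<^esub> w) = f b \<odot>\<^bsub>T\<^esub> tn w"
  unfolding T_eq tn_def
  by (simp_all add: ext_scal.tn_closed[OF ES] ext_scal.tn_rules(2)[OF ES] ext_scal.tn_one_smult[OF ES])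

lemma td_rules:
  "b \<in> carrier B \<Longrightarrow> td b \<in> carrier T"
  "x \<in> carrier (gp N) \<Longrightarrow> tl x \<in> carrier T"
  "b \<in> carrier B \<Longrightarrow> c \<in> carrier B \<Longrightarrow> td (b \<oplus>\<^bsub>B\<^esub> c) = td b \<oplus>\<^bsub>T\<^esub> td c"
  "b \<in> carrier B \<Longrightarrow> c \<in> carrier B \<Longrightarrow> td (b \<otimes>\<^bsub>B\<^esub> c) = f b \<odot>\<^bsub>T\<^esub> td c \<oplus>\<^bsub>T\<^esub> f c \<odot>\<^bsub>T\<^esub> td b"
  "x \<in> carrier (gp N) \<Longrightarrow> y \<in> carrier (gp N) \<Longrightarrow> tl (x \<otimes>\<^bsub>gp N\<^esub> y) = tl x \<oplus>\<^bsub>T\<^esub> tl y"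
  "n \<in> carrier N \<Longrightarrow> td (pstr Y n) = f (pstr Y n) \<odot>\<^bsub>T\<^esub> tl (to_gp N n)"
proof -
  interpret O: module B "log_omega Y" by (rule Om(1))
  show "b \<in> carrier B \<Longrightarrow> td b \<in> carrier T"
    "x \<in> carrier (gp N) \<Longrightarrow> tl x \<in> carrier T"
    "b \<in> carrier B \<Longrightarrow> c \<in> carrier B \<Longrightarrow> td (b \<oplus>\<^bsub>B\<^esub> c) = td b \<oplus>\<^bsub>T\<^esub> td c"
    "b \<in> carrier B \<Longrightarrow> c \<in> carrier B \<Longrightarrow> td (b \<otimes>\<^bsub>B\<^esub> c) = f b \<odot>\<^bsub>T\<^esub> td c \<oplus>\<^bsub>T\<^esub> f c \<odot>\<^bsub>T\<^esub> td b"
    "x \<in> carrier (gp N) \<Longrightarrow> y \<in> carrier (gp N) \<Longrightarrow> tl (x \<otimes>\<^bsub>gp N\<^esub> y) = tl x \<oplus>\<^bsub>T\<^esub> tl y"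
    "n \<in> carrier N \<Longrightarrow> td (pstr Y n) = f (pstr Y n) \<odot>\<^bsub>T\<^esub> tl (to_gp N n)"
    by (simp_all add: td_def tl_def tn Om beta togp)
qed

lemma T_ext:
  assumes J: "module A J" and h: "h \<in> mod_hom A T J" and k: "k \<in> mod_hom A T J"
    and d: "\<And>b. b \<in> carrier B \<Longrightarrow> h (td b) = k (td b)"
    and l: "\<And>x. x \<in> carrier (gp N) \<Longrightarrow> h (tl x) = k (tl x)" and t: "t \<in> carrier T"
  shows "h t = k t"
proof (rule ext_scal.ext_ext[OF ES J h[unfolded T_eq] k[unfolded T_eq] _ t[unfolded T_eq]])
  fix w assume w: "w \<in> carrier (log_omega Y)"
  have "h (tn w) = k (tn w)"
  proof (rule log_forms.Om_ext[OF LF module_restrict_scalars[OF Bc f J] _ _ _ _ w, where f = "\<lambda>w. h (tn w)" and g = "\<lambda>w. k (tn w)"])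
    show "(\<lambda>w. h (tn w)) \<in> mod_hom B (log_omega Y) (restrict_scalars f J)"
      "(\<lambda>w. k (tn w)) \<in> mod_hom B (log_omega Y) (restrict_scalars f J)"
      by (rule mod_homI; simp add: tn mod_homD[OF h] mod_homD[OF k] f_simps)+
  qed (use d l in \<open>simp_all add: td_def tl_def\<close>)
  then show "h (ext_scalars_tens A f B (log_omega Y) \<one>\<^bsub>A\<^esub> w) = k (ext_scalars_tens A f B (log_omega Y) \<one>\<^bsub>A\<^esub> w)"
    by (simp add: tn_def)
qed

text \<open>After base change the differentials represent log derivations over \<open>f\<close> into \<open>A\<close>-modules: restrict the
  module along \<open>f\<close>, use the universal property over \<open>B\<close>, and extend the scalars of the result.\<close>

lemma T_universal:
  fixes J :: "('a, 'j) module"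
  assumes J: "module A J" and D: "\<And>b. b \<in> carrier B \<Longrightarrow> D b \<in> carrier J"
    and add: "\<And>b c. b \<in> carrier B \<Longrightarrow> c \<in> carrier B \<Longrightarrow> D (b \<oplus>\<^bsub>B\<^esub> c) = D b \<oplus>\<^bsub>J\<^esub> D c"
    and leibniz: "\<And>b c. b \<in> carrier B \<Longrightarrow> c \<in> carrier B \<Longrightarrow> D (b \<otimes>\<^bsub>B\<^esub> c) = f b \<odot>\<^bsub>J\<^esub> D c \<oplus>\<^bsub>J\<^esub> f c \<odot>\<^bsub>J\<^esub> D b"
    and l: "\<And>x. x \<in> carrier (gp N) \<Longrightarrow> l x \<in> carrier J"
    and l_add: "\<And>x y. x \<in> carrier (gp N) \<Longrightarrow> y \<in> carrier (gp N) \<Longrightarrow> l (x \<otimes>\<^bsub>gp N\<^esub> y) = l x \<oplus>\<^bsub>J\<^esub> l y"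
    and rel: "\<And>n. n \<in> carrier N \<Longrightarrow> D (pstr Y n) = f (pstr Y n) \<odot>\<^bsub>J\<^esub> l (to_gp N n)"
  shows "\<exists>h\<in>mod_hom A T J. (\<forall>b\<in>carrier B. h (td b) = D b) \<and> (\<forall>x\<in>carrier (gp N). h (tl x) = l x)"
proof -
  interpret J: module A J by (rule J)
  have D': "D \<in> carrier B \<rightarrow> carrier (restrict_scalars f J)" using D by simp
  obtain h where h: "h \<in> mod_hom B (log_omega Y) (restrict_scalars f J)"
    "\<And>b. b \<in> carrier B \<Longrightarrow> h (od b) = D b" "\<And>x. x \<in> carrier (gp N) \<Longrightarrow> h (ol x) = l x"
    using log_forms.Om_universal[OF LF module_restrict_scalars[OF Bc f J] D', of l] add leibniz l l_add rel by auto
  let ?H = "\<lambda>(t, w). t \<odot>\<^bsub>J\<^esub> h w"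
  note lift = ext_scal.ext_lift[OF ES J h(1), of ?H, simplified]
  have v: "presented_lift A J ?H (tn w) = h w" if "w \<in> carrier (log_omega Y)" for w
    using lift(2)[of "\<one>\<^bsub>A\<^esub>" w] that mod_homD(1)[OF h(1) that] by (simp add: tn_def)
  show ?thesis
    unfolding T_eq using lift(1) h(2,3) v Om(2,3) by (intro bexI[of _ "presented_lift A J ?H"]) (simp_all add: td_def tl_def)
qed

end

locale over_mor = X: over_obj X Y f g + Y: over_obj X Y' f' g'
  for X :: "('a, 'm) prelog" and Y :: "('b, 'n) prelog" and f g
    and Y' :: "('c, 'k) prelog" and f' g' +
  fixes u :: "'b \<Rightarrow> 'c" and v :: "'n \<Rightarrow> 'k"
  assumes uv: "(u, v) \<in> prelog_hom Y Y'"
    and fu: "b \<in> carrier (PRing Y) \<Longrightarrow> f' (u b) = f b"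
    and gv: "n \<in> carrier (PMon Y) \<Longrightarrow> g' (v n) = g n"
begin

lemma u: "u \<in> ring_hom X.B Y.B" and v: "v \<in> mon_hom X.N Y.N"
  and uv_str: "n \<in> carrier X.N \<Longrightarrow> pstr Y' (v n) = u (pstr Y n)"
  using uv by (auto simp: prelog_hom_def)

lemmas u_simps = ring_hom_closed[OF u] ring_hom_mult[OF u] ring_hom_add[OF u] ring_hom_one[OF u]
lemmas v_simps = mon_homD[OF v]
lemmas gv_simps = mon_homD[OF gp_map_mon_hom[OF X.Nc Y.Nc v]]

abbreviation "lmor \<equiv> LogDiff_mor X (Y, f, g) (Y', f', g') (u, v)"

lemma LogDiff_mor:
  shows "lmor \<in> mod_hom X.A X.T Y.T"
    and "lmor \<in> extensional (carrier X.T)"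
    and "b \<in> carrier X.B \<Longrightarrow> lmor (X.td b) = Y.td (u b)"
    and "x \<in> carrier (gp X.N) \<Longrightarrow> lmor (X.tl x) = Y.tl (gp_map Y.N v x)"
proof -
  interpret A: cring X.A by (rule X.Ac)
  note m = log_omega_map[OF X.preY Y.preY uv]
  interpret T': module X.A Y.T by (rule Y.module_T)
  interpret T: module X.A X.T by (rule X.module_T)
  note m1 = mod_homD[OF m(1), simplified]
  have h: "(\<lambda>w. Y.tn (log_omega_map Y Y' (u, v) w)) \<in> mod_hom X.B (log_omega Y) (restrict_scalars f Y.T)"
    by (rule mod_homI) (simp_all add: m1 Y.tn u_simps fu)
  let ?H = "\<lambda>(a, w). ext_scalars_tens X.A f' Y.B (log_omega Y') a (log_omega_map Y Y' (u, v) w)"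
  have H: "?H (a, w) = a \<odot>\<^bsub>Y.T\<^esub> Y.tn (log_omega_map Y Y' (u, v) w)" if "a \<in> carrier X.A" "w \<in> carrier (log_omega Y)" for a w
    using that ext_scal.tn_smult[OF Y.ES, of a "log_omega_map Y Y' (u, v) w"] m1 by (simp add: Y.tn_def Y.T_eq)
  have L: "presented_lift X.A Y.T ?H \<in> mod_hom X.A X.T Y.T"
    "w \<in> carrier (log_omega Y) \<Longrightarrow> presented_lift X.A Y.T ?H (X.tn w) = Y.tn (log_omega_map Y Y' (u, v) w)" for w
    using ext_scal.ext_lift[OF X.ES Y.module_T h, of ?H] H m1 Y.tn(1)
    unfolding X.T_eq X.tn_def by simp_all
  have e: "lmor = restrict (presented_lift X.A Y.T ?H) (carrier X.T)"
    by (simp add: LogDiff_mor_def restrict_def)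
  show "lmor \<in> extensional (carrier X.T)" by (simp add: e)
  show "lmor \<in> mod_hom X.A X.T Y.T" using mod_homD[OF L(1)] unfolding e by (intro mod_homI) simp_all
  show "b \<in> carrier X.B \<Longrightarrow> lmor (X.td b) = Y.td (u b)"
    using X.td_rules(1)[of b] X.Om(2)[of b] by (simp add: e X.td_def Y.td_def L m)
  show "x \<in> carrier (gp X.N) \<Longrightarrow> lmor (X.tl x) = Y.tl (gp_map Y.N v x)"
    using X.td_rules(2)[of x] X.Om(3)[of x] by (simp add: e X.tl_def Y.tl_def L m)
qed

end

section \<open>The repletion of the coproduct\<close>

lemma comm_monoid_rep_monoid:
  assumes N: "comm_monoid N" and M: "comm_monoid M" and f: "f \<in> mon_hom N M"
  shows "comm_monoid (rep_monoid N M f)"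
proof -
  interpret M: comm_monoid M by (rule M)
  interpret G: comm_group "gp N" by (rule comm_group_gp[OF N])
  note F = mon_homD[OF gp_map_mon_hom[OF N M f]] and T = mon_homD[OF to_gp_mon_hom[OF M]]
  show ?thesis
    by (rule comm_monoidI) (auto simp: rep_monoid_simps F T M.m_ac G.m_ac)
qed

lemma to_rep_mon_hom:
  assumes N: "comm_monoid N" and M: "comm_monoid M" and f: "f \<in> mon_hom N M"
  shows "to_rep N f \<in> mon_hom N (rep_monoid N M f)"
  by (rule mon_homI)
    (simp_all add: to_rep_def rep_monoid_simps mon_homD[OF f] mon_homD[OF to_gp_mon_hom[OF N]] gp_map_to_gp[OF N M f])

lemma mon_hom_frag_of: "comm_monoid N \<Longrightarrow> frag_of \<in> mon_hom N (monoid_ring N)"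
  by (rule mon_homI) (simp_all add: monoid_ring_simps monoid_ring_mult)

lemma mon_hom_comp: "f \<in> mon_hom L M \<Longrightarrow> g \<in> mon_hom M N \<Longrightarrow> (\<lambda>x. g (f x)) \<in> mon_hom L N"
  by (rule mon_homI) (simp_all add: mon_homD)

lemma ring_hom_comp: "f \<in> ring_hom L M \<Longrightarrow> g \<in> ring_hom M N \<Longrightarrow> (\<lambda>x. g (f x)) \<in> ring_hom L N"
  using ring_hom_trans[of f L M g N] by (simp add: comp_def)

lemma ring_hom_mon_hom: "f \<in> ring_hom R S \<Longrightarrow> f \<in> mon_hom R S"
  by (rule mon_homI) (simp_all add: ring_hom_closed ring_hom_mult ring_hom_one)

lemma mon_hom_mult:
  assumes "comm_monoid N" "f \<in> mon_hom L N" "g \<in> mon_hom L N"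
  shows "(\<lambda>x. f x \<otimes>\<^bsub>N\<^esub> g x) \<in> mon_hom L N"
proof -
  interpret comm_monoid N by fact
  show ?thesis using mon_homD[OF assms(2)] mon_homD[OF assms(3)] by (intro mon_homI) (simp_all add: m_ac)
qed

lemma mon_hom_inv:
  assumes "comm_group N" "f \<in> mon_hom L N"
  shows "(\<lambda>x. inv\<^bsub>N\<^esub> (f x)) \<in> mon_hom L N"
proof -
  interpret comm_group N by fact
  show ?thesis using mon_homD[OF assms(2)] by (intro mon_homI) (simp_all add: inv_mult)
qed

context over_obj
begin

interpretation A: cring A by (rule Ac)
interpretation B: cring B by (rule Bc)
interpretation M: comm_monoid M by (rule Mc)
interpretation N: comm_monoid N by (rule Nc)

abbreviation "MN \<equiv> M \<times>\<times> N"
abbreviation "cp \<equiv> coprod_prelog X Y"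
abbreviation "AB \<equiv> PRing cp"
abbreviation "cg \<equiv> snd (coprod_aug X (f, g))"
abbreviation "cf \<equiv> fst (coprod_aug X (f, g))"
abbreviation "ct \<equiv> coprod_tens X Y"

lemma MNc: "comm_monoid MN" by (rule comm_monoid_DirProd[OF Mc Nc])

interpretation MN: comm_monoid MN by (rule MNc)

lemma ABt: "ring_tensor \<Z> A (int_to A) B (int_to B)"
  using ring_hom_Pi[OF int_to_ring_hom[OF Ac]] ring_hom_Pi[OF int_to_ring_hom[OF Bc]]
  by (intro ring_tensor.intro Ac Bc)

lemma AB_simps: "AB = tensor_ring \<Z> A (int_to A) B (int_to B)" "PMon cp = MN" "pstr cp (m, n) = ct (pstr X m) (pstr Y n)"
  by (simp_all add: coprod_prelog_def)

lemmas ct_rules = ring_tensor.tn_closed[OF ABt, folded AB_simps(1) coprod_tens_def]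
  ring_tensor.tn_mult[OF ABt, folded AB_simps(1) coprod_tens_def]
  ring_tensor.tn_one[OF ABt, folded AB_simps(1) coprod_tens_def]
lemmas ABc = ring_tensor.cring_tensor[OF ABt, folded AB_simps(1)]
lemmas ct_left = ring_tensor.tn_left_hom[OF ABt, folded AB_simps(1) coprod_tens_def]
lemmas ct_right = ring_tensor.tn_right_hom[OF ABt, folded AB_simps(1) coprod_tens_def]
lemmas ct_split = ring_tensor.tn_split[OF ABt, folded AB_simps(1) coprod_tens_def]
lemmas AB_eq = ring_tensor.tensor_hom_eq[OF ABt, folded AB_simps(1) coprod_tens_def]
lemmas AB_lift = ring_tensor.tensor_lift[OF ABt, folded AB_simps(1) coprod_tens_def]

lemma int_compat:
  fixes D :: "'d ring"
  assumes D: "cring D" and s: "s \<in> ring_hom A D" and t: "t \<in> ring_hom B D"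
  shows "\<forall>r\<in>carrier \<Z>. s (int_to A r) = t (int_to B r)"
proof
  interpret D: cring D by (rule D)
  fix r
  have "s (int_to A r) = int_to D r" unfolding int_to_def
    using additive_int_multiple[OF A.abelian_group_axioms D.abelian_group_axioms, of s "\<one>\<^bsub>A\<^esub>" r]
    by (simp add: ring_hom_closed[OF s] ring_hom_add[OF s] ring_hom_one[OF s])
  moreover have "t (int_to B r) = int_to D r" unfolding int_to_def
    using additive_int_multiple[OF B.abelian_group_axioms D.abelian_group_axioms, of t "\<one>\<^bsub>B\<^esub>" r]
    by (simp add: ring_hom_closed[OF t] ring_hom_add[OF t] ring_hom_one[OF t])
  ultimately show "s (int_to A r) = t (int_to B r)" by simp
qed

lemma AB_lift':
  fixes D :: "'d ring"
  assumes D: "cring D" and s: "s \<in> ring_hom A D" and t: "t \<in> ring_hom B D"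
  shows "tensor_lift D s t \<in> ring_hom AB D"
    and "a \<in> carrier A \<Longrightarrow> b \<in> carrier B \<Longrightarrow> tensor_lift D s t (ct a b) = s a \<otimes>\<^bsub>D\<^esub> t b"
  by (rule AB_lift(1)[OF D s t int_compat[OF D s t]], rule AB_lift(2)[OF D s t int_compat[OF D s t]])

lemma cp_str: "pstr cp \<in> mon_hom MN AB"
  by (rule mon_homI) (auto simp: AB_simps(3) ct_rules alpha beta)

lemma cf: "cf \<in> ring_hom AB A" "a \<in> carrier A \<Longrightarrow> b \<in> carrier B \<Longrightarrow> cf (ct a b) = a \<otimes>\<^bsub>A\<^esub> f b"
proof -
  have i: "(\<lambda>a. a) \<in> ring_hom A A" by (rule ring_hom_memI) simp_all
  show "cf \<in> ring_hom AB A" "a \<in> carrier A \<Longrightarrow> b \<in> carrier B \<Longrightarrow> cf (ct a b) = a \<otimes>\<^bsub>A\<^esub> f b"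
    unfolding coprod_aug_def prod.case fst_conv by (rule AB_lift'[OF Ac i f])+
qed

lemma cg: "cg (m, n) = m \<otimes>\<^bsub>M\<^esub> g n" by (simp add: coprod_aug_def)

lemma cg_hom: "cg \<in> mon_hom MN M"
  by (rule mon_homI) (auto simp: cg g_simps M.m_ac)

abbreviation "Rep \<equiv> rep_monoid MN M cg"
abbreviation "ZMN \<equiv> monoid_ring MN"
abbreviation "ZRep \<equiv> monoid_ring Rep"

lemma Repc: "comm_monoid Rep" by (rule comm_monoid_rep_monoid[OF MNc Mc cg_hom])

lemmas ZMN = mon_ring.intro[OF MNc]
lemmas ZRep = mon_ring.intro[OF Repc]
lemmas ZRepc = mon_ring.cring_monoid_ring[OF ZRep]

interpretation Rep: comm_monoid Rep by (rule Repc)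
interpretation ZRep: cring ZRep by (rule ZRepc)

text \<open>The two ring maps out of \<open>\<int>[M \<oplus> N]\<close> over which the ring of the repletion is a tensor product.\<close>

definition bas where "bas = monoid_ring_lift AB (pstr cp)"
definition toR where "toR = monoid_ring_lift ZRep (\<lambda>n. frag_of (to_rep MN cg n))"

lemma bas: "bas \<in> ring_hom ZMN AB" "z \<in> carrier MN \<Longrightarrow> bas (frag_of z) = pstr cp z"
  unfolding bas_def
  by (rule mon_ring.lift_ring_hom[OF ZMN ABc cp_str], rule mon_ring.lift_frag[OF ZMN ABc mon_hom_Pi[OF cp_str]])

lemmas to_rep_hom = to_rep_mon_hom[OF MNc Mc cg_hom]

lemma toR: "toR \<in> ring_hom ZMN ZRep" "z \<in> carrier MN \<Longrightarrow> toR (frag_of z) = frag_of (to_rep MN cg z)"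
proof -
  have h: "(\<lambda>n. frag_of (to_rep MN cg n)) \<in> mon_hom MN ZRep"
    by (rule mon_hom_comp[OF to_rep_hom mon_hom_frag_of[OF Repc]])
  show "toR \<in> ring_hom ZMN ZRep" "z \<in> carrier MN \<Longrightarrow> toR (frag_of z) = frag_of (to_rep MN cg z)"
    unfolding toR_def
    by (rule mon_ring.lift_ring_hom[OF ZMN ZRepc h], rule mon_ring.lift_frag[OF ZMN ZRepc mon_hom_Pi[OF h]])
qed

abbreviation "C \<equiv> ab_rep_ring X (Y, f, g)"
abbreviation "pt \<equiv> prelog_rep_tens cp X cg"

lemma C_eq: "C = tensor_ring ZMN AB bas ZRep toR"
  by (simp add: ab_rep_ring_def prelog_rep_def Let_def AB_simps(2) bas_def toR_def)

lemma pt_eq: "pt = tens ZMN AB bas ZRep toR"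
  by (simp add: prelog_rep_tens_def Let_def AB_simps(2) bas_def toR_def fun_eq_iff)

lemma Ct: "ring_tensor ZMN AB bas ZRep toR"
  using ring_hom_Pi[OF bas(1)] ring_hom_Pi[OF toR(1)] by (intro ring_tensor.intro ABc ZRepc)

lemmas Cc = ring_tensor.cring_tensor[OF Ct, folded C_eq]
lemmas pt_rules = ring_tensor.tn_closed[OF Ct, folded C_eq pt_eq] ring_tensor.tn_mult[OF Ct, folded C_eq pt_eq]
  ring_tensor.tn_one[OF Ct, folded C_eq pt_eq]
lemmas pt_left = ring_tensor.tn_left_hom[OF Ct, folded C_eq pt_eq]
lemmas pt_right = ring_tensor.tn_right_hom[OF Ct, folded C_eq pt_eq]
lemmas pt_balanced = ring_tensor.tn_balanced[OF Ct, folded C_eq pt_eq]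
lemmas C_hom_eq = ring_tensor.tensor_hom_eq[OF Ct, folded C_eq pt_eq]
lemmas C_tensor_lift = ring_tensor.tensor_lift[OF Ct, folded C_eq pt_eq]

interpretation C: cring C by (rule Cc)

text \<open>The kernel of \<open>(M \<oplus> N)\<^sup>g\<^sup>p \<rightarrow> M\<^sup>g\<^sup>p\<close> is a copy of \<open>N\<^sup>g\<^sup>p\<close>, embedded by \<open>x \<mapsto> (g x)\<^sup>-\<^sup>1 x\<close>; so every
  element of the repletion is the product of an element of \<open>M\<close> and an element \<open>(1, \<kappa> x)\<close>.\<close>

definition \<kappa> where
  "\<kappa> x = gp_map MN (\<lambda>n. (\<one>\<^bsub>M\<^esub>, n)) x \<otimes>\<^bsub>gp MN\<^esub> inv\<^bsub>gp MN\<^esub> (gp_map MN (\<lambda>n. (g n, \<one>\<^bsub>N\<^esub>)) x)"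

interpretation GMN: comm_group "gp MN" by (rule comm_group_gp[OF MNc])
interpretation GM: comm_group "gp M" by (rule comm_group_gp[OF Mc])
interpretation GN: comm_group "gp N" by (rule comm_group_gp[OF Nc])

lemma inc: "(\<lambda>n. (\<one>\<^bsub>M\<^esub>, n)) \<in> mon_hom N MN" "(\<lambda>n. (g n, \<one>\<^bsub>N\<^esub>)) \<in> mon_hom N MN"
  "(\<lambda>m. (m, \<one>\<^bsub>N\<^esub>)) \<in> mon_hom M MN" "fst \<in> mon_hom MN M" "snd \<in> mon_hom MN N"
  by (rule mon_homI; force simp: g_simps)+

lemmas inc_gp = mon_homD[OF gp_map_mon_hom[OF Nc MNc inc(1)]] mon_homD[OF gp_map_mon_hom[OF Nc MNc inc(2)]]
  mon_homD[OF gp_map_mon_hom[OF Mc MNc inc(3)]]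
lemmas prj_gp = mon_homD[OF gp_map_mon_hom[OF MNc Mc inc(4)]] mon_homD[OF gp_map_mon_hom[OF MNc Nc inc(5)]]
lemmas cg_gp = mon_homD[OF gp_map_mon_hom[OF MNc Mc cg_hom]]

lemma \<kappa>_hom: "\<kappa> \<in> mon_hom (gp N) (gp MN)"
  unfolding \<kappa>_def[abs_def]
  by (intro mon_hom_mult mon_hom_inv gp_map_mon_hom inc MNc Nc GMN.comm_group_axioms GMN.comm_monoid_axioms)

lemmas kap = mon_homD[OF \<kappa>_hom]

lemma \<kappa>_gp:
  assumes x: "x \<in> carrier (gp N)"
  shows "gp_map M cg (\<kappa> x) = \<one>\<^bsub>gp M\<^esub>" "gp_map N snd (\<kappa> x) = x"
proof -
  have "gp_map M cg (gp_map MN (\<lambda>n. (\<one>\<^bsub>M\<^esub>, n)) x) = gp_map M g x"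
    "gp_map M cg (gp_map MN (\<lambda>n. (g n, \<one>\<^bsub>N\<^esub>)) x) = gp_map M g x"
    by (rule gp_map_comp[OF Nc MNc Mc inc(1) cg_hom x], simp add: cg g_simps,
        rule gp_map_comp[OF Nc MNc Mc inc(2) cg_hom x], simp add: cg g_simps)
  then show "gp_map M cg (\<kappa> x) = \<one>\<^bsub>gp M\<^esub>"
    using x mon_homD(1)[OF gp_map_mon_hom[OF Nc Mc g]] by (simp add: \<kappa>_def cg_gp inc_gp gp_map_inv[OF MNc Mc cg_hom])
  have "gp_map N snd (gp_map MN (\<lambda>n. (\<one>\<^bsub>M\<^esub>, n)) x) = gp_map N (\<lambda>n. n) x"
    "gp_map N snd (gp_map MN (\<lambda>n. (g n, \<one>\<^bsub>N\<^esub>)) x) = gp_map N (\<lambda>n. \<one>\<^bsub>N\<^esub>) x"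
    by (rule gp_map_comp[OF Nc MNc Nc inc(1) inc(5) x], simp,
        rule gp_map_comp[OF Nc MNc Nc inc(2) inc(5) x], simp)
  moreover have "gp_map N (\<lambda>n. n) x = x" by (rule gp_map_ident[OF Nc x]) simp
  moreover have "gp_map N (\<lambda>n. \<one>\<^bsub>N\<^esub>) x = \<one>\<^bsub>gp N\<^esub>"
  proof -
    have "(\<lambda>n. \<one>\<^bsub>N\<^esub>) \<in> mon_hom N N" by (rule mon_homI) simp_all
    then show ?thesis using x by (auto simp: gp_carrier gp_map_gfrac[OF Nc Nc] gp_one)
  qed
  ultimately show "gp_map N snd (\<kappa> x) = x"
    using x by (simp add: \<kappa>_def prj_gp inc_gp gp_map_inv[OF MNc Nc inc(5)])
qed

text \<open>For \<open>z = (a, b) / (c, d)\<close> the equation \<open>m = z\<close> in \<open>M\<^sup>g\<^sup>p\<close> says \<open>m = a g(b) / (c g(d))\<close>, and the \<open>N\<^sup>g\<^sup>p\<close>-part of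
  \<open>z\<close> is embedded as \<open>(g(d), b) / (g(b), d)\<close>; the product of the two fractions is \<open>z\<close>.\<close>

lemma rep_decomp:
  assumes z: "(m, z) \<in> carrier Rep"
  shows "(m, z) = to_rep MN cg (m, \<one>\<^bsub>N\<^esub>) \<otimes>\<^bsub>Rep\<^esub> (\<one>\<^bsub>M\<^esub>, \<kappa> (gp_map N snd z))"
    and "m \<in> carrier M" "gp_map N snd z \<in> carrier (gp N)"
proof -
  have m: "m \<in> carrier M" and zc: "z \<in> carrier (gp MN)" and mz: "to_gp M m = gp_map M cg z"
    using z by (auto simp: rep_monoid_simps)
  show "m \<in> carrier M" by (rule m)
  show pz: "gp_map N snd z \<in> carrier (gp N)" using zc by (simp add: prj_gp)
  obtain a b c d where e: "z = gfrac MN (a, b) (c, d)"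
    and h: "a \<in> carrier M" "b \<in> carrier N" "c \<in> carrier M" "d \<in> carrier N"
    using zc by (auto simp: gp_carrier)
  have "to_gp MN (m, \<one>\<^bsub>N\<^esub>) = gp_map MN (\<lambda>m. (m, \<one>\<^bsub>N\<^esub>)) (gp_map M cg z)"
    unfolding mz[symmetric] using m by (simp add: gp_map_to_gp[OF Mc MNc inc(3)])
  also have "\<dots> = gfrac MN (a \<otimes>\<^bsub>M\<^esub> g b, \<one>\<^bsub>N\<^esub>) (c \<otimes>\<^bsub>M\<^esub> g d, \<one>\<^bsub>N\<^esub>)"
    unfolding e using h by (simp add: gp_map_gfrac[OF MNc Mc cg_hom] gp_map_gfrac[OF Mc MNc inc(3)] cg g_simps)
  finally have t: "to_gp MN (m, \<one>\<^bsub>N\<^esub>) = gfrac MN (a \<otimes>\<^bsub>M\<^esub> g b, \<one>\<^bsub>N\<^esub>) (c \<otimes>\<^bsub>M\<^esub> g d, \<one>\<^bsub>N\<^esub>)" .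
  have k: "\<kappa> (gp_map N snd z) = gfrac MN (g d, b) (g b, d)"
    unfolding e \<kappa>_def using h
    by (simp add: gp_map_gfrac[OF MNc Nc inc(5)] gp_map_gfrac[OF Nc MNc inc(1)] gp_map_gfrac[OF Nc MNc inc(2)]
        gfrac_inv[OF MNc] gfrac_mult[OF MNc] g_simps)
  have "z = to_gp MN (m, \<one>\<^bsub>N\<^esub>) \<otimes>\<^bsub>gp MN\<^esub> \<kappa> (gp_map N snd z)"
    unfolding t k unfolding e using h
    by (simp add: gfrac_mult[OF MNc] g_simps gfrac_eq_iff[OF MNc] M.m_ac) blast
  then show "(m, z) = to_rep MN cg (m, \<one>\<^bsub>N\<^esub>) \<otimes>\<^bsub>Rep\<^esub> (\<one>\<^bsub>M\<^esub>, \<kappa> (gp_map N snd z))"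
    using m by (simp add: to_rep_def rep_monoid_simps cg g_simps)
qed

subsection \<open>The universal property of its ring\<close>

text \<open>The structure maps of \<open>A\<close>, \<open>B\<close> and \<open>N\<^sup>g\<^sup>p\<close> into the ring \<open>C\<close> of the repletion. By \<open>ry_str\<close>, \<open>C_ext\<close> and
  \<open>C_lift\<close> below, \<open>C\<close> is universal for such maps with \<open>\<beta>(n) = f(\<beta>(n)) [n]\<close>.\<close>

definition rs where "rs a = pt (ct a \<one>\<^bsub>B\<^esub>) \<one>\<^bsub>ZRep\<^esub>"
definition ry where "ry b = pt (ct \<one>\<^bsub>A\<^esub> b) \<one>\<^bsub>ZRep\<^esub>"
definition re where "re x = pt \<one>\<^bsub>AB\<^esub> (frag_of (\<one>\<^bsub>M\<^esub>, \<kappa> x))"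

lemma rs: "rs \<in> ring_hom A C" unfolding rs_def[abs_def] by (rule ring_hom_comp[OF ct_left pt_left])
lemma ry: "ry \<in> ring_hom B C" unfolding ry_def[abs_def] by (rule ring_hom_comp[OF ct_right pt_left])

lemma kap_Rep: "x \<in> carrier (gp N) \<Longrightarrow> (\<one>\<^bsub>M\<^esub>, \<kappa> x) \<in> carrier Rep"
  by (simp add: rep_monoid_simps kap \<kappa>_gp mon_homD(3)[OF to_gp_mon_hom[OF Mc]])

lemma re: "re \<in> mon_hom (gp N) C"
proof -
  have "(\<lambda>x. (\<one>\<^bsub>M\<^esub>, \<kappa> x)) \<in> mon_hom (gp N) Rep"
  proof (rule mon_homI)
    fix x y assume "x \<in> carrier (gp N)" "y \<in> carrier (gp N)"
    then show "(\<one>\<^bsub>M\<^esub>, \<kappa> (x \<otimes>\<^bsub>gp N\<^esub> y)) = (\<one>\<^bsub>M\<^esub>, \<kappa> x) \<otimes>\<^bsub>Rep\<^esub> (\<one>\<^bsub>M\<^esub>, \<kappa> y)"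
      by (simp add: rep_monoid_simps kap)
  qed (simp_all add: kap_Rep, simp add: rep_monoid_simps kap)
  then show ?thesis
    unfolding re_def[abs_def]
    by (rule mon_hom_comp[OF mon_hom_comp[OF _ mon_hom_frag_of[OF Repc]] ring_hom_mon_hom[OF pt_right]])
qed

lemma pt_to_rep: "m \<in> carrier M \<Longrightarrow> n \<in> carrier N \<Longrightarrow>
    pt \<one>\<^bsub>AB\<^esub> (frag_of (to_rep MN cg (m, n))) = rs (pstr X m) \<otimes>\<^bsub>C\<^esub> ry (pstr Y n)"
proof -
  interpret AB: cring AB by (rule ABc)
  assume h: "m \<in> carrier M" "n \<in> carrier N"
  then have "pt \<one>\<^bsub>AB\<^esub> (frag_of (to_rep MN cg (m, n))) = pt (pstr cp (m, n)) \<one>\<^bsub>ZRep\<^esub>"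
    using pt_balanced[of "frag_of (m, n)"] bas(2)[of "(m, n)"] toR(2)[of "(m, n)"] by (simp add: monoid_ring_simps)
  also have "\<dots> = rs (pstr X m) \<otimes>\<^bsub>C\<^esub> ry (pstr Y n)"
    using h ring_hom_mult[OF pt_left, of "ct (pstr X m) \<one>\<^bsub>B\<^esub>" "ct \<one>\<^bsub>A\<^esub> (pstr Y n)"]
    by (simp add: rs_def ry_def AB_simps(3) ct_split[of "pstr X m" "pstr Y n"] ct_rules(1) alpha beta)
  finally show ?thesis .
qed

lemma pt_rep: "(m, z) \<in> carrier Rep \<Longrightarrow> pt \<one>\<^bsub>AB\<^esub> (frag_of (m, z)) = rs (pstr X m) \<otimes>\<^bsub>C\<^esub> re (gp_map N snd z)"
proof -
  assume z: "(m, z) \<in> carrier Rep"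
  note d = rep_decomp[OF z]
  let ?a = "to_rep MN cg (m, \<one>\<^bsub>N\<^esub>)" and ?b = "(\<one>\<^bsub>M\<^esub>, \<kappa> (gp_map N snd z))"
  have c: "?a \<in> carrier Rep" "?b \<in> carrier Rep"
    using mon_homD(1)[OF to_rep_hom, of "(m, \<one>\<^bsub>N\<^esub>)"] d kap_Rep by simp_all
  have "pt \<one>\<^bsub>AB\<^esub> (frag_of (m, z)) = pt \<one>\<^bsub>AB\<^esub> (frag_of ?a \<otimes>\<^bsub>ZRep\<^esub> frag_of ?b)"
    by (subst d(1)) (simp only: monoid_ring_mult)
  also have "\<dots> = pt \<one>\<^bsub>AB\<^esub> (frag_of ?a) \<otimes>\<^bsub>C\<^esub> pt \<one>\<^bsub>AB\<^esub> (frag_of ?b)"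
    by (rule ring_hom_mult[OF pt_right]) (rule mon_ring.frag_carrier[OF ZRep c(1)], rule mon_ring.frag_carrier[OF ZRep c(2)])
  also have "\<dots> = rs (pstr X m) \<otimes>\<^bsub>C\<^esub> re (gp_map N snd z)"
    using d pt_to_rep[of m "\<one>\<^bsub>N\<^esub>"] by (simp add: re_def beta ring_hom_one[OF ry] ring_hom_closed[OF rs] alpha)
  finally show ?thesis .
qed

text \<open>Two ways of writing the image of \<open>(1, n) \<in> M \<oplus> N\<close>: it is \<open>1 \<otimes> \<beta>(n)\<close>, and it decomposes as
  \<open>g(n)\<close> times the image of \<open>[n]\<close>.\<close>

lemma ry_str: "n \<in> carrier N \<Longrightarrow> ry (pstr Y n) = rs (f (pstr Y n)) \<otimes>\<^bsub>C\<^esub> re (to_gp N n)"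
proof -
  assume n: "n \<in> carrier N"
  have "to_rep MN cg (\<one>\<^bsub>M\<^esub>, n) = (g n, to_gp MN (\<one>\<^bsub>M\<^esub>, n))" using n by (simp add: to_rep_def cg g_simps)
  moreover have "to_rep MN cg (\<one>\<^bsub>M\<^esub>, n) \<in> carrier Rep" using n mon_homD(1)[OF to_rep_hom, of "(\<one>\<^bsub>M\<^esub>, n)"] by simp
  ultimately have "rs (pstr X \<one>\<^bsub>M\<^esub>) \<otimes>\<^bsub>C\<^esub> ry (pstr Y n) = rs (pstr X (g n)) \<otimes>\<^bsub>C\<^esub> re (gp_map N snd (to_gp MN (\<one>\<^bsub>M\<^esub>, n)))"
    using pt_rep[of "g n" "to_gp MN (\<one>\<^bsub>M\<^esub>, n)"] pt_to_rep[of "\<one>\<^bsub>M\<^esub>" n] n by simp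
  then show ?thesis
    using n by (simp add: alpha ring_hom_one[OF rs] ring_hom_closed[OF ry] beta gp_map_to_gp[OF MNc Nc inc(5)] fg_str)
qed

lemma C_ext:
  assumes D: "ring D" and F: "F \<in> ring_hom C D" and G: "G \<in> ring_hom C D"
    and s: "\<And>a. a \<in> carrier A \<Longrightarrow> F (rs a) = G (rs a)" and y: "\<And>b. b \<in> carrier B \<Longrightarrow> F (ry b) = G (ry b)"
    and e: "\<And>x. x \<in> carrier (gp N) \<Longrightarrow> F (re x) = G (re x)" and c: "c \<in> carrier C"
  shows "F c = G c"
proof (rule C_hom_eq[OF D F G _ _ c])
  fix b assume b: "b \<in> carrier AB"
  show "F (pt b \<one>\<^bsub>ZRep\<^esub>) = G (pt b \<one>\<^bsub>ZRep\<^esub>)"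
    by (rule AB_eq[OF D ring_hom_comp[OF pt_left F] ring_hom_comp[OF pt_left G] _ _ b])
      (use s y in \<open>simp_all add: rs_def ry_def\<close>)
next
  fix z assume z: "z \<in> carrier ZRep"
  show "F (pt \<one>\<^bsub>AB\<^esub> z) = G (pt \<one>\<^bsub>AB\<^esub> z)"
  proof (rule mon_ring.hom_eq_on_frag[OF ZRep D ring_hom_comp[OF pt_right F] ring_hom_comp[OF pt_right G] _ z])
    fix w assume w: "w \<in> carrier Rep"
    obtain m x where e': "w = (m, x)" by (cases w)
    note d = rep_decomp[of m x]
    show "F (pt \<one>\<^bsub>AB\<^esub> (frag_of w)) = G (pt \<one>\<^bsub>AB\<^esub> (frag_of w))"
      using w d pt_rep[of m x]
      by (simp add: e' ring_hom_mult[OF F] ring_hom_mult[OF G] ring_hom_closed[OF rs] mon_homD(1)[OF re] alpha s e)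
  qed
qed

lemma C_lift:
  fixes D :: "'d ring"
  assumes D: "cring D" and s: "s \<in> ring_hom A D" and y: "y \<in> ring_hom B D" and e: "e \<in> mon_hom (gp N) D"
    and rel: "\<And>n. n \<in> carrier N \<Longrightarrow> y (pstr Y n) = s (f (pstr Y n)) \<otimes>\<^bsub>D\<^esub> e (to_gp N n)"
  shows "\<exists>F\<in>ring_hom C D. (\<forall>a\<in>carrier A. F (rs a) = s a) \<and> (\<forall>b\<in>carrier B. F (ry b) = y b) \<and>
    (\<forall>x\<in>carrier (gp N). F (re x) = e x)"
proof -
  interpret D: cring D by (rule D)
  interpret AB: cring AB by (rule ABc)
  note S = ring_hom_closed[OF s] ring_hom_mult[OF s] ring_hom_one[OF s]
  note Yy = ring_hom_closed[OF y] ring_hom_one[OF y]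
  let ?l = "tensor_lift D s y"
  note l = AB_lift'[OF D s y]
  \<comment> \<open>On the repletion the map is forced by its decomposition into \<open>M\<close> and \<open>N\<^sup>g\<^sup>p\<close>.\<close>
  define h where "h = (\<lambda>(m, z :: (('m \<times> 'n) \<times> 'm \<times> 'n) set). s (pstr X m) \<otimes>\<^bsub>D\<^esub> e (gp_map N snd z))"
  have hm: "h \<in> mon_hom Rep D"
    by (rule mon_homI) (auto simp: h_def rep_monoid_simps S alpha mon_homD[OF e] prj_gp D.m_ac)
  let ?r = "monoid_ring_lift D h"
  note r = mon_ring.lift_ring_hom[OF ZRep D hm] mon_ring.lift_frag[OF ZRep D mon_hom_Pi[OF hm]]
  have compat: "\<forall>z\<in>carrier ZMN. ?l (bas z) = ?r (toR z)"
  proof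
    fix z assume z: "z \<in> carrier ZMN"
    show "?l (bas z) = ?r (toR z)"
    proof (rule mon_ring.hom_eq_on_frag[OF ZMN D.ring_axioms ring_hom_comp[OF bas(1) l(1)] ring_hom_comp[OF toR(1) r(1)] _ z])
      fix w assume w: "w \<in> carrier MN"
      then obtain m n where e': "w = (m, n)" "m \<in> carrier M" "n \<in> carrier N" by auto
      have "h (to_rep MN cg w) = s (pstr X m) \<otimes>\<^bsub>D\<^esub> y (pstr Y n)"
        using e' by (simp add: h_def to_rep_def cg gp_map_to_gp[OF MNc Nc inc(5)] alpha g_simps S fg_str[symmetric] rel mon_homD[OF e] togp D.m_assoc)
      then show "?l (bas (frag_of w)) = ?r (toR (frag_of w))"
        using w e' mon_homD(1)[OF to_rep_hom w] by (simp add: bas(2)[of "(m, n)"] toR(2)[of "(m, n)"] r(2)[of "to_rep MN cg (m, n)"] AB_simps(3) l(2) alpha beta)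
    qed
  qed
  note F = C_tensor_lift[OF D l(1) r(1) compat]
  show ?thesis
  proof (intro bexI[of _ "tensor_lift D ?l ?r"] conjI ballI F(1))
    show "tensor_lift D ?l ?r (rs a) = s a" if "a \<in> carrier A" for a
      using that by (simp add: rs_def F(2) ct_rules(1) l(2) ring_hom_one[OF r(1)] S Yy)
    show "tensor_lift D ?l ?r (ry b) = y b" if "b \<in> carrier B" for b
      using that by (simp add: ry_def F(2) ct_rules(1) l(2) ring_hom_one[OF r(1)] S Yy)
    show "tensor_lift D ?l ?r (re x) = e x" if "x \<in> carrier (gp N)" for x
    proof -
      have "tensor_lift D ?l ?r (re x) = h (\<one>\<^bsub>M\<^esub>, \<kappa> x)"
        using that kap_Rep[OF that] mon_ring.frag_carrier[OF ZRep kap_Rep[OF that]] mon_homD(1)[OF hm kap_Rep[OF that]]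
        by (simp add: re_def F(2) ring_hom_one[OF l(1)] r)
      then show ?thesis using that by (simp add: h_def \<kappa>_gp alpha S mon_homD[OF e])
    qed
  qed
qed

definition aug where "aug = fst (prelog_rep_aug X cf)"

lemma aug: "aug \<in> ring_hom C A" "a \<in> carrier A \<Longrightarrow> aug (rs a) = a" "b \<in> carrier B \<Longrightarrow> aug (ry b) = f b"
  "x \<in> carrier (gp N) \<Longrightarrow> aug (re x) = \<one>\<^bsub>A\<^esub>"
proof -
  interpret AB: cring AB by (rule ABc)
  define h where "h = (\<lambda>(m, z :: (('m \<times> 'n) \<times> 'm \<times> 'n) set). pstr X m)"
  have hm: "h \<in> mon_hom Rep A"
    by (rule mon_homI) (auto simp: h_def rep_monoid_simps alpha)
  let ?r = "monoid_ring_lift A h"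
  note r = mon_ring.lift_ring_hom[OF ZRep Ac hm] mon_ring.lift_frag[OF ZRep Ac mon_hom_Pi[OF hm]]
  have compat: "\<forall>z\<in>carrier ZMN. cf (bas z) = ?r (toR z)"
  proof
    fix z assume z: "z \<in> carrier ZMN"
    show "cf (bas z) = ?r (toR z)"
    proof (rule mon_ring.hom_eq_on_frag[OF ZMN A.ring_axioms ring_hom_comp[OF bas(1) cf(1)] ring_hom_comp[OF toR(1) r(1)] _ z])
      fix w assume w: "w \<in> carrier MN"
      then obtain m n where e': "w = (m, n)" "m \<in> carrier M" "n \<in> carrier N" by auto
      then have "h (to_rep MN cg w) = pstr X m \<otimes>\<^bsub>A\<^esub> f (pstr Y n)"
        by (simp add: h_def to_rep_def cg alpha g_simps fg_str)
      then show "cf (bas (frag_of w)) = ?r (toR (frag_of w))"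
        using w e' mon_homD(1)[OF to_rep_hom w] by (simp add: bas(2)[of "(m, n)"] toR(2)[of "(m, n)"] r(2)[of "to_rep MN cg (m, n)"] AB_simps(3) cf(2) alpha beta)
    qed
  qed
  note F = C_tensor_lift[OF Ac cf(1) r(1) compat]
  have e: "aug = tensor_lift A cf ?r" by (simp add: aug_def prelog_rep_aug_def h_def)
  show "aug \<in> ring_hom C A" unfolding e by (rule F(1))
  show "a \<in> carrier A \<Longrightarrow> aug (rs a) = a"
    by (simp add: e rs_def F(2) ct_rules(1) cf(2) ring_hom_one[OF r(1)] f_simps)
  show "b \<in> carrier B \<Longrightarrow> aug (ry b) = f b"
    by (simp add: e ry_def F(2) ct_rules(1) cf(2) ring_hom_one[OF r(1)] f_simps)
  show "x \<in> carrier (gp N) \<Longrightarrow> aug (re x) = \<one>\<^bsub>A\<^esub>"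
  proof -
    assume x: "x \<in> carrier (gp N)"
    have "aug (re x) = h (\<one>\<^bsub>M\<^esub>, \<kappa> x)"
      using kap_Rep[OF x] mon_ring.frag_carrier[OF ZRep kap_Rep[OF x]] mon_homD(1)[OF hm kap_Rep[OF x]]
      by (simp add: e re_def F(2) ring_hom_one[OF cf(1)] r)
    then show "aug (re x) = \<one>\<^bsub>A\<^esub>" by (simp add: h_def alpha)
  qed
qed

end

section \<open>The conormal module of an augmented algebra\<close>

text \<open>An \<open>A\<close>-algebra \<open>C\<close> with augmentation \<open>e\<close>; below \<open>om c\<close>, the class of \<open>c - s(e c)\<close>, is the universal
  derivation of \<open>C\<close> over \<open>A\<close> into modules on which \<open>C\<close> acts through \<open>e\<close>.\<close>

locale aug_alg =
  fixes A :: "'a ring" and C :: "'c ring" and s :: "'a \<Rightarrow> 'c" and e :: "'c \<Rightarrow> 'a"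
  assumes Ac: "cring A" and Cc: "cring C" and s: "s \<in> ring_hom A C" and e: "e \<in> ring_hom C A"
    and es: "a \<in> carrier A \<Longrightarrow> e (s a) = a"
begin

interpretation A: cring A by (rule Ac)
interpretation C: cring C by (rule Cc)

abbreviation "I \<equiv> a_kernel C A e"
abbreviation "K \<equiv> ideal_prod C I I"
abbreviation "Q \<equiv> C Quot K"
abbreviation "cl c \<equiv> K +>\<^bsub>C\<^esub> c"
abbreviation "Mo \<equiv> conormal_module C I s"

interpretation eh: ring_hom_cring C A e
  using e by (intro ring_hom_cring.intro Cc Ac ring_hom_cring_axioms.intro)

lemma I_iff: "c \<in> I \<longleftrightarrow> c \<in> carrier C \<and> e c = \<zero>\<^bsub>A\<^esub>"
  unfolding a_kernel_def' mem_Collect_eq by (rule refl)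

lemma ideal_I: "ideal I C"
  by (rule ring_hom_ring.kernel_is_ideal[OF ring_hom_ringI2[OF C.ring_axioms A.ring_axioms e]])

lemma ideal_K: "ideal K C"
  by (rule C.ideal_prod_is_ideal[OF ideal_I ideal_I])

lemma Qc: "cring Q" by (rule ideal.quotient_is_cring[OF ideal_K Cc])
lemma cl_hom: "cl \<in> ring_hom C Q" by (rule ideal.rcos_ring_hom[OF ideal_K])

interpretation Q: cring Q by (rule Qc)
interpretation clh: ring_hom_cring C Q cl
  using cl_hom by (intro ring_hom_cring.intro Cc Qc ring_hom_cring_axioms.intro)

lemmas s_simps = ring_hom_closed[OF s] ring_hom_mult[OF s] ring_hom_add[OF s] ring_hom_one[OF s]
lemmas e_simps = eh.hom_closed eh.hom_mult eh.hom_add eh.hom_one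

definition om where "om c = cl (c \<ominus>\<^bsub>C\<^esub> s (e c))"

lemma diff_I: "c \<in> carrier C \<Longrightarrow> c \<ominus>\<^bsub>C\<^esub> s (e c) \<in> I"
  by (simp add: I_iff a_minus_def s_simps es A.r_neg)

lemma om_eq: "c \<in> carrier C \<Longrightarrow> om c = cl c \<ominus>\<^bsub>Q\<^esub> cl (s (e c))"
  by (simp add: om_def a_minus_def s_simps)

lemma om_I: "c \<in> I \<Longrightarrow> om c = cl c"
proof -
  assume c: "c \<in> I"
  have "s \<zero>\<^bsub>A\<^esub> = \<zero>\<^bsub>C\<^esub>" using ring_hom_zero[OF s] A.ring_axioms C.ring_axioms by blast
  then show ?thesis using c by (simp add: om_def I_iff a_minus_def)
qed

lemma cl_square_zero: "x \<in> I \<Longrightarrow> y \<in> I \<Longrightarrow> cl x \<otimes>\<^bsub>Q\<^esub> cl y = \<zero>\<^bsub>Q\<^esub>"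
proof -
  assume x: "x \<in> I" and y: "y \<in> I"
  have "x \<otimes>\<^bsub>C\<^esub> y \<in> K" by (rule ideal_prod.prod[OF x y])
  then have "cl (x \<otimes>\<^bsub>C\<^esub> y) = K"
    by (rule abelian_subgroup.a_rcos_const[OF abelian_subgroupI3[OF ideal.axioms(1)[OF ideal_K] C.abelian_group_axioms]])
  moreover have "K = \<zero>\<^bsub>Q\<^esub>" by (simp only: FactRing_def ring.simps)
  ultimately show ?thesis using ring_hom_mult[OF cl_hom, of x y] x[unfolded I_iff] y[unfolded I_iff] by metis
qed

lemma Mo_simps:
  "carrier Mo = cl ` I" "\<zero>\<^bsub>Mo\<^esub> = \<zero>\<^bsub>Q\<^esub>" "x \<oplus>\<^bsub>Mo\<^esub> y = x \<oplus>\<^bsub>Q\<^esub> y" "a \<odot>\<^bsub>Mo\<^esub> x = cl (s a) \<otimes>\<^bsub>Q\<^esub> x"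
  by (simp_all add: conormal_module_def Let_def)

lemma om_rules:
  "c \<in> carrier C \<Longrightarrow> om c \<in> carrier Mo"
  "a \<in> carrier A \<Longrightarrow> om (s a) = \<zero>\<^bsub>Mo\<^esub>"
  "c \<in> carrier C \<Longrightarrow> d \<in> carrier C \<Longrightarrow> om (c \<oplus>\<^bsub>C\<^esub> d) = om c \<oplus>\<^bsub>Mo\<^esub> om d"
  "c \<in> carrier C \<Longrightarrow> d \<in> carrier C \<Longrightarrow> om (c \<otimes>\<^bsub>C\<^esub> d) = e c \<odot>\<^bsub>Mo\<^esub> om d \<oplus>\<^bsub>Mo\<^esub> e d \<odot>\<^bsub>Mo\<^esub> om c"
proof -
  show "c \<in> carrier C \<Longrightarrow> om c \<in> carrier Mo"
    unfolding Mo_simps om_def by (rule imageI, rule diff_I)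
  show "a \<in> carrier A \<Longrightarrow> om (s a) = \<zero>\<^bsub>Mo\<^esub>"
    by (simp add: om_eq s_simps es Mo_simps a_minus_def Q.r_neg)
  show "om (c \<oplus>\<^bsub>C\<^esub> d) = om c \<oplus>\<^bsub>Mo\<^esub> om d" if c: "c \<in> carrier C" and d: "d \<in> carrier C"
    using c d by (simp add: om_eq s_simps Mo_simps a_minus_def Q.a_ac Q.minus_add)
  show "om (c \<otimes>\<^bsub>C\<^esub> d) = e c \<odot>\<^bsub>Mo\<^esub> om d \<oplus>\<^bsub>Mo\<^esub> e d \<odot>\<^bsub>Mo\<^esub> om c" if c: "c \<in> carrier C" and d: "d \<in> carrier C"
  proof -
    \<comment> \<open>With \<open>x\<close>, \<open>y\<close> the classes of \<open>c\<close>, \<open>d\<close> and \<open>p\<close>, \<open>q\<close> those of \<open>s(e c)\<close>, \<open>s(e d)\<close>, the first summand vanishes.\<close>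
    have alg: "x \<otimes>\<^bsub>Q\<^esub> y \<ominus>\<^bsub>Q\<^esub> p \<otimes>\<^bsub>Q\<^esub> q = (x \<ominus>\<^bsub>Q\<^esub> p) \<otimes>\<^bsub>Q\<^esub> (y \<ominus>\<^bsub>Q\<^esub> q) \<oplus>\<^bsub>Q\<^esub> (p \<otimes>\<^bsub>Q\<^esub> (y \<ominus>\<^bsub>Q\<^esub> q) \<oplus>\<^bsub>Q\<^esub> q \<otimes>\<^bsub>Q\<^esub> (x \<ominus>\<^bsub>Q\<^esub> p))"
      if "x \<in> carrier Q" "y \<in> carrier Q" "p \<in> carrier Q" "q \<in> carrier Q" for x y p q
      using that by algebra
    have "om c \<otimes>\<^bsub>Q\<^esub> om d = \<zero>\<^bsub>Q\<^esub>" unfolding om_def by (rule cl_square_zero[OF diff_I[OF c] diff_I[OF d]])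
    then show ?thesis
      using c d alg[of "cl c" "cl d" "cl (s (e c))" "cl (s (e d))"] by (simp add: om_eq s_simps Mo_simps)
  qed
qed

lemma Mo_om: "x \<in> carrier Mo \<Longrightarrow> \<exists>c\<in>I. x = om c"
  by (auto simp: Mo_simps om_I)

lemma module_Mo: "module A Mo"
proof -
  have cI: "cl ` I \<subseteq> carrier Q" by (auto simp: I_iff)
  note T = subsetD[OF cI]
  have cl0: "\<zero>\<^bsub>Q\<^esub> \<in> cl ` I"
    by (rule image_eqI[of _ _ "\<zero>\<^bsub>C\<^esub>"]) (simp_all add: I_iff)
  have clp: "x \<oplus>\<^bsub>Q\<^esub> y \<in> cl ` I" if x: "x \<in> cl ` I" and y: "y \<in> cl ` I" for x y
  proof -
    obtain c d where c: "x = cl c" "y = cl d" "c \<in> I" "d \<in> I" using x y by auto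
    then show ?thesis by (intro image_eqI[of _ _ "c \<oplus>\<^bsub>C\<^esub> d"]) (simp_all add: I_iff)
  qed
  have cls: "cl (s a) \<otimes>\<^bsub>Q\<^esub> x \<in> cl ` I" if a: "a \<in> carrier A" and x: "x \<in> cl ` I" for a x
  proof -
    obtain c where c: "x = cl c" "c \<in> I" using x by auto
    then show ?thesis using a by (intro image_eqI[of _ _ "s a \<otimes>\<^bsub>C\<^esub> c"]) (simp_all add: I_iff s_simps es)
  qed
  have neg: "\<exists>y\<in>cl ` I. y \<oplus>\<^bsub>Q\<^esub> x = \<zero>\<^bsub>Q\<^esub>" if x: "x \<in> cl ` I" for x
  proof -
    obtain c where c: "x = cl c" "c \<in> I" using x by auto
    have "cl (\<ominus>\<^bsub>C\<^esub> c) \<in> cl ` I" by (rule imageI) (use c in \<open>simp add: I_iff\<close>)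
    moreover have "cl (\<ominus>\<^bsub>C\<^esub> c) \<oplus>\<^bsub>Q\<^esub> x = \<zero>\<^bsub>Q\<^esub>" using c by (simp add: I_iff Q.l_neg)
    ultimately show ?thesis by (rule rev_bexI)
  qed
  show ?thesis
  proof (rule moduleI[OF Ac])
    show "abelian_group Mo"
      by (rule abelian_groupI; (unfold Mo_simps)?) (simp_all only: clp cl0 neg T Q.a_ac Q.l_zero Q.r_zero)
    show "\<And>a x. a \<in> carrier A \<Longrightarrow> x \<in> carrier Mo \<Longrightarrow> a \<odot>\<^bsub>Mo\<^esub> x \<in> carrier Mo"
      by (simp add: Mo_simps cls)
  qed (simp_all add: Mo_simps T s_simps Q.l_distr Q.r_distr Q.m_assoc)
qed

text \<open>Maps out of \<open>I / I\<^sup>2\<close> are given by their values on all representatives of a coset; an additive map that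
  vanishes on products of elements of \<open>I\<close> has only one value there.\<close>

lemma coset_image:
  fixes J :: "('j, 'z) ring_scheme"
  assumes J: "abelian_group J" and h: "h \<in> carrier C \<rightarrow> carrier J"
    and add: "\<And>x y. x \<in> carrier C \<Longrightarrow> y \<in> carrier C \<Longrightarrow> h (x \<oplus>\<^bsub>C\<^esub> y) = h x \<oplus>\<^bsub>J\<^esub> h y"
    and kill: "\<And>x y. x \<in> I \<Longrightarrow> y \<in> I \<Longrightarrow> h (x \<otimes>\<^bsub>C\<^esub> y) = \<zero>\<^bsub>J\<^esub>" and c: "c \<in> carrier C"
  shows "h ` cl c = {h c}"
proof -
  interpret J: abelian_group J by (rule J)
  have IC: "x \<in> carrier C" if "x \<in> I" for x using that by (simp add: I_iff)
  have k: "x \<in> carrier C \<and> h x = \<zero>\<^bsub>J\<^esub>" if "x \<in> K" for x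
    using that by (induction rule: ideal_prod.induct) (simp_all add: IC kill add)
  have "h x = h c" if x: "x \<in> cl c" for x
  proof -
    obtain y where y: "y \<in> K" "x = y \<oplus>\<^bsub>C\<^esub> c" using x by (auto simp: a_r_coset_def')
    moreover have "h c \<in> carrier J" using h c by auto
    ultimately show ?thesis using c k by (simp add: add)
  qed
  then have "h ` cl c \<subseteq> {h c}" by (intro image_subsetI) (simp only: singleton_iff)
  moreover have "h c \<in> h ` cl c"
  proof (rule imageI)
    show "c \<in> cl c"
    by (rule abelian_subgroup.a_rcos_self[OF abelian_subgroupI3[OF ideal.axioms(1)[OF ideal_K] C.abelian_group_axioms] c])
  qed
  ultimately show ?thesis by (metis empty_iff subset_singletonD)
qed

text \<open>A map of augmented \<open>A\<close>-algebras \<open>C \<rightarrow> A \<oplus> J\<close> sends \<open>I\<close> into \<open>J\<close>, hence kills \<open>I\<^sup>2\<close>.\<close>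

lemma conormal_lift:
  fixes J :: "('a, 'j) module"
  assumes J: "module A J" and F: "F \<in> ring_hom C (sqz_ring A J)"
    and fst: "\<And>c. c \<in> carrier C \<Longrightarrow> fst (F c) = e c" and Fs: "\<And>a. a \<in> carrier A \<Longrightarrow> F (s a) = (a, \<zero>\<^bsub>J\<^esub>)"
  shows "\<exists>\<phi>\<in>mod_hom A Mo J. \<forall>c\<in>carrier C. \<phi> (om c) = snd (F c)"
proof -
  interpret J: module A J by (rule J)
  note Fc = ring_hom_closed[OF F, unfolded sqz_ring_simps]
  have F1: "F c = (e c, snd (F c))" "snd (F c) \<in> carrier J" if "c \<in> carrier C" for c
    using fst[OF that] Fc[OF that] by (simp_all add: prod_eq_iff mem_Times_iff)
  have add: "snd (F (x \<oplus>\<^bsub>C\<^esub> y)) = snd (F x) \<oplus>\<^bsub>J\<^esub> snd (F y)" if "x \<in> carrier C" "y \<in> carrier C" for x y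
    using ring_hom_add[OF F that] F1(1)[OF that(1)] F1(1)[OF that(2)] by (metis sqz_ring_simps(3) snd_conv)
  have mult: "snd (F (x \<otimes>\<^bsub>C\<^esub> y)) = e x \<odot>\<^bsub>J\<^esub> snd (F y) \<oplus>\<^bsub>J\<^esub> e y \<odot>\<^bsub>J\<^esub> snd (F x)" if "x \<in> carrier C" "y \<in> carrier C" for x y
    using ring_hom_mult[OF F that] F1(1)[OF that(1)] F1(1)[OF that(2)] by (metis sqz_ring_simps(2) snd_conv)
  define \<phi> where "\<phi> U = the_elem ((\<lambda>c. snd (F c)) ` U)" for U
  have cos: "\<phi> (cl c) = snd (F c)" if "c \<in> carrier C" for c
    unfolding \<phi>_def using coset_image[OF J.abelian_group_axioms, of "\<lambda>c. snd (F c)" c] that F1(2)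
    by (simp add: add mult I_iff)
  have neg: "snd (F (c \<ominus>\<^bsub>C\<^esub> s (e c))) = snd (F c)" if c: "c \<in> carrier C" for c
  proof -
    have "snd (F c) = snd (F ((c \<ominus>\<^bsub>C\<^esub> s (e c)) \<oplus>\<^bsub>C\<^esub> s (e c)))"
      using c by (simp add: a_minus_def C.a_assoc C.l_neg s_simps)
    also have "\<dots> = snd (F (c \<ominus>\<^bsub>C\<^esub> s (e c)))" using c F1(2) by (subst add) (simp_all add: s_simps Fs)
    finally show ?thesis by simp
  qed
  show ?thesis
  proof (intro bexI[of _ \<phi>] ballI mod_homI)
    show "\<phi> (om c) = snd (F c)" if "c \<in> carrier C" for c
      using that diff_I[OF that] by (simp add: om_def cos neg s_simps)
    fix x assume "x \<in> carrier Mo"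
    then obtain c where c: "c \<in> I" "c \<in> carrier C" "x = cl c" by (auto simp: Mo_simps I_iff)
    show "\<phi> x \<in> carrier J" using c F1(2) by (simp add: cos)
    show "\<phi> (x \<oplus>\<^bsub>Mo\<^esub> y) = \<phi> x \<oplus>\<^bsub>J\<^esub> \<phi> y" if "y \<in> carrier Mo" for y
    proof -
      obtain d where d: "d \<in> carrier C" "y = cl d" using \<open>y \<in> carrier Mo\<close> by (auto simp: Mo_simps I_iff)
      then show ?thesis using c cos[of "c \<oplus>\<^bsub>C\<^esub> d"] by (simp add: Mo_simps cos add)
    qed
    show "\<phi> (a \<odot>\<^bsub>Mo\<^esub> x) = a \<odot>\<^bsub>J\<^esub> \<phi> x" if "a \<in> carrier A" for a
      using that c F1(2)[OF c(2)] cos[of "s a \<otimes>\<^bsub>C\<^esub> c"] by (simp add: Mo_simps cos mult s_simps es I_iff Fs)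
  qed
qed

lemma om_ring_hom: "(\<lambda>c. (e c, om c)) \<in> ring_hom C (sqz_ring A Mo)"
proof -
  interpret Mo: module A Mo by (rule module_Mo)
  have "om \<one>\<^bsub>C\<^esub> = \<zero>\<^bsub>Mo\<^esub>" using om_rules(2)[of "\<one>\<^bsub>A\<^esub>"] by (simp add: s_simps)
  then show ?thesis by (intro ring_hom_memI) (simp_all add: sqz_ring_simps om_rules)
qed

end

lemma sqz_ring_hom:
  assumes J: "module A J" and J': "module A J'" and h: "h \<in> mod_hom A J J'"
  shows "(\<lambda>(a, j). (a, h j)) \<in> ring_hom (sqz_ring A J) (sqz_ring A J')"
proof -
  interpret J: module A J by (rule J)
  show ?thesis
    by (rule ring_hom_memI) (auto simp: sqz_ring_simps mod_homD[OF h] mod_hom_zero[OF J J' h])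
qed

text \<open>The map on \<open>I / I\<^sup>2\<close> is read off from representatives, on which a map of augmented algebras commutes
  with \<open>om\<close>.\<close>

lemma conormal_map:
  assumes "aug_alg A C s e" and "aug_alg A C' s' e'" and F: "F \<in> ring_hom C C'"
    and Fs: "\<And>a. a \<in> carrier A \<Longrightarrow> F (s a) = s' a" and Fe: "\<And>c. c \<in> carrier C \<Longrightarrow> e' (F c) = e c"
  defines "h \<equiv> \<lambda>U. the_elem ((\<lambda>c. ideal_prod C' (a_kernel C' A e') (a_kernel C' A e') +>\<^bsub>C'\<^esub> F c) ` U)"
  shows "h \<in> mod_hom A (conormal_module C (a_kernel C A e) s) (conormal_module C' (a_kernel C' A e') s')"
    and "c \<in> carrier C \<Longrightarrow> h (aug_alg.om A C s e c) = aug_alg.om A C' s' e' (F c)"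
proof -
  interpret X: aug_alg A C s e by fact
  interpret Y: aug_alg A C' s' e' by fact
  interpret Q: cring Y.Q by (rule Y.Qc)
  interpret C: cring C by (rule X.Cc)
  interpret C': cring C' by (rule Y.Cc)
  interpret A: cring A by (rule X.Ac)
  interpret Fh: ring_hom_cring C C' F
    using F by (intro ring_hom_cring.intro X.Cc Y.Cc ring_hom_cring_axioms.intro)
  note cl = ring_hom_closed[OF Y.cl_hom] ring_hom_add[OF Y.cl_hom] ring_hom_mult[OF Y.cl_hom]
  have FI: "x \<in> X.I \<Longrightarrow> F x \<in> Y.I" for x by (simp add: X.I_iff Y.I_iff Fe)
  have cos: "h (X.cl c) = Y.cl (F c)" if c: "c \<in> carrier C" for c
  proof -
    have kill: "Y.cl (F (x \<otimes>\<^bsub>C\<^esub> y)) = \<zero>\<^bsub>Y.Q\<^esub>" if x: "x \<in> X.I" and y: "y \<in> X.I" for x y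
      using x y Y.cl_square_zero[OF FI[OF x] FI[OF y]] by (simp add: X.I_iff cl)
    have "(\<lambda>c. Y.cl (F c)) ` X.cl c = {Y.cl (F c)}"
      using X.coset_image[OF Q.abelian_group_axioms, of "\<lambda>c. Y.cl (F c)" c] c kill by (simp add: cl)
    then show ?thesis by (simp add: h_def)
  qed
  show v: "h (X.om c) = Y.om (F c)" if c: "c \<in> carrier C" for c
    using c by (simp add: X.om_def Y.om_def cos X.s_simps X.e_simps a_minus_def Fs Fe)
  show "h \<in> mod_hom A X.Mo Y.Mo"
  proof (rule mod_homI)
    fix x assume "x \<in> carrier X.Mo"
    then obtain c where c: "c \<in> X.I" "c \<in> carrier C" "x = X.cl c" by (auto simp: X.Mo_simps X.I_iff)
    show "h x \<in> carrier Y.Mo" using c FI by (simp add: cos Y.Mo_simps)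
    show "h (x \<oplus>\<^bsub>X.Mo\<^esub> y) = h x \<oplus>\<^bsub>Y.Mo\<^esub> h y" if "y \<in> carrier X.Mo" for y
    proof -
      obtain d where d: "d \<in> carrier C" "y = X.cl d" using \<open>y \<in> carrier X.Mo\<close> by (auto simp: X.Mo_simps X.I_iff)
      then show ?thesis using c cos[of "c \<oplus>\<^bsub>C\<^esub> d"]
        by (simp add: X.Mo_simps Y.Mo_simps cos ring_hom_add[OF X.cl_hom] cl)
    qed
    show "h (a \<odot>\<^bsub>X.Mo\<^esub> x) = a \<odot>\<^bsub>Y.Mo\<^esub> h x" if "a \<in> carrier A" for a
      using that c cos[of "s a \<otimes>\<^bsub>C\<^esub> c"] by (simp add: X.Mo_simps Y.Mo_simps cos X.s_simps Fs ring_hom_mult[OF X.cl_hom] cl flip: Fs)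
  qed
qed

section \<open>The replete abelianization\<close>

context over_obj
begin

interpretation A: cring A by (rule Ac)
interpretation B: cring B by (rule Bc)
interpretation C: cring C by (rule Cc)
interpretation T: module A T by (rule module_T)
interpretation GN: comm_group "gp N" by (rule comm_group_gp[OF Nc])

lemma aug_alg: "aug_alg A C rs aug"
  by (rule aug_alg.intro[OF Ac Cc rs aug(1)]) (rule aug(2))

abbreviation "U \<equiv> Ab_rep_obj X (Y, f, g)"
abbreviation "om \<equiv> aug_alg.om A C rs aug"

lemma ab_rep_simps:
  "ab_rep_unit X (Y, f, g) = rs" "ab_rep_ideal X (Y, f, g) = a_kernel C A aug"
  by (simp_all add: ab_rep_unit_def rs_def fun_eq_iff AB_simps(2) ab_rep_ideal_def aug_def)

lemma U_eq: "U = conormal_module C (a_kernel C A aug) rs"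
  by (simp only: Ab_rep_obj_def ab_rep_simps)

lemmas om_rules = aug_alg.om_rules[OF aug_alg, folded U_eq]
lemmas module_U = aug_alg.module_Mo[OF aug_alg, folded U_eq]

interpretation U: module A U by (rule module_U)

text \<open>The classes in \<open>I / I\<^sup>2\<close> that correspond to \<open>d b\<close> and \<open>dlog x\<close>.\<close>

definition ud where "ud b = om (ry b)"
definition ul where "ul x = om (re x)"

lemmas ry_simps = ring_hom_closed[OF ry] ring_hom_mult[OF ry] ring_hom_add[OF ry] ring_hom_one[OF ry]
lemmas re_simps = mon_homD[OF re]
lemmas rs_simps = ring_hom_closed[OF rs] ring_hom_mult[OF rs] ring_hom_add[OF rs] ring_hom_one[OF rs]

lemma ud_rules:
  "b \<in> carrier B \<Longrightarrow> ud b \<in> carrier U"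
  "x \<in> carrier (gp N) \<Longrightarrow> ul x \<in> carrier U"
  "b \<in> carrier B \<Longrightarrow> c \<in> carrier B \<Longrightarrow> ud (b \<oplus>\<^bsub>B\<^esub> c) = ud b \<oplus>\<^bsub>U\<^esub> ud c"
  "b \<in> carrier B \<Longrightarrow> c \<in> carrier B \<Longrightarrow> ud (b \<otimes>\<^bsub>B\<^esub> c) = f b \<odot>\<^bsub>U\<^esub> ud c \<oplus>\<^bsub>U\<^esub> f c \<odot>\<^bsub>U\<^esub> ud b"
  "x \<in> carrier (gp N) \<Longrightarrow> y \<in> carrier (gp N) \<Longrightarrow> ul (x \<otimes>\<^bsub>gp N\<^esub> y) = ul x \<oplus>\<^bsub>U\<^esub> ul y"
  "n \<in> carrier N \<Longrightarrow> ud (pstr Y n) = f (pstr Y n) \<odot>\<^bsub>U\<^esub> ul (to_gp N n)"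
  by (simp_all add: ud_def ul_def om_rules ry_simps re_simps rs_simps aug ry_str f_simps beta togp U.M.a_comm)

text \<open>The two modules represent the same functor: log derivations \<open>(D, l)\<close> of \<open>(B, N)\<close> in \<open>J\<close> are the
  same as ring maps from the repletion to \<open>A \<oplus> J\<close> over \<open>A\<close> and under \<open>A\<close>, namely \<open>a \<mapsto> (a, 0)\<close>,
  \<open>b \<mapsto> (f b, D b)\<close>, \<open>x \<mapsto> (1, l x)\<close>.\<close>

lemma ab_rep_log_forms:
  "\<exists>\<phi> \<psi>. \<phi> \<in> mod_hom A U T \<and> \<psi> \<in> mod_hom A T U \<and> (\<forall>u\<in>carrier U. \<psi> (\<phi> u) = u) \<and> (\<forall>t\<in>carrier T. \<phi> (\<psi> t) = t) \<and>
    (\<forall>b\<in>carrier B. \<phi> (ud b) = td b \<and> \<psi> (td b) = ud b) \<and> (\<forall>x\<in>carrier (gp N). \<phi> (ul x) = tl x \<and> \<psi> (tl x) = ul x)"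
proof -
  let ?S = "sqz_ring A T"
  have S: "cring ?S" by (rule cring_sqz_ring[OF module_T])
  \<comment> \<open>The map \<open>\<psi>\<close> classifies the log derivation \<open>(ud, ul)\<close>; the map \<open>\<phi>\<close> comes from the ring map to \<open>A \<oplus> T\<close> that belongs to \<open>(td, tl)\<close>.\<close>
  obtain \<psi> where \<psi>: "\<psi> \<in> mod_hom A T U" "\<forall>b\<in>carrier B. \<psi> (td b) = ud b" "\<forall>x\<in>carrier (gp N). \<psi> (tl x) = ul x"
    using T_universal[OF module_U, of ud ul] ud_rules by auto
  have td1: "td \<one>\<^bsub>B\<^esub> = \<zero>\<^bsub>T\<^esub>"
    using td_rules(4)[of "\<one>\<^bsub>B\<^esub>" "\<one>\<^bsub>B\<^esub>"] td_rules(1)[of "\<one>\<^bsub>B\<^esub>"] by (simp add: f_simps)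
  have tl1: "tl \<one>\<^bsub>gp N\<^esub> = \<zero>\<^bsub>T\<^esub>"
    using td_rules(5)[of "\<one>\<^bsub>gp N\<^esub>" "\<one>\<^bsub>gp N\<^esub>"] td_rules(2)[of "\<one>\<^bsub>gp N\<^esub>"] by simp
  have s: "(\<lambda>a. (a, \<zero>\<^bsub>T\<^esub>)) \<in> ring_hom A ?S"
    by (rule ring_hom_memI) (simp_all add: sqz_ring_simps)
  have y: "(\<lambda>b. (f b, td b)) \<in> ring_hom B ?S"
    by (rule ring_hom_memI) (simp_all add: sqz_ring_simps f_simps td_rules td1)
  have e: "(\<lambda>x. (\<one>\<^bsub>A\<^esub>, tl x)) \<in> mon_hom (gp N) ?S"
    by (rule mon_homI) (simp_all add: sqz_ring_simps td_rules tl1 T.M.a_comm)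
  obtain F where F: "F \<in> ring_hom C ?S" "\<forall>a\<in>carrier A. F (rs a) = (a, \<zero>\<^bsub>T\<^esub>)"
    "\<forall>b\<in>carrier B. F (ry b) = (f b, td b)" "\<forall>x\<in>carrier (gp N). F (re x) = (\<one>\<^bsub>A\<^esub>, tl x)"
    using C_lift[OF S s y e] by (auto simp: sqz_ring_simps td_rules f_simps beta togp)
  have "fst \<in> ring_hom ?S A" by (rule ring_hom_memI) (auto simp: sqz_ring_simps)
  from ring_hom_comp[OF F(1) this] have "fst (F c) = aug c" if "c \<in> carrier C" for c
    using that F(2-4) aug by (intro C_ext[OF A.ring_axioms, of "\<lambda>c. fst (F c)" aug c]) simp_all
  then obtain \<phi> where \<phi>: "\<phi> \<in> mod_hom A U T" "\<forall>c\<in>carrier C. \<phi> (om c) = snd (F c)"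
    using aug_alg.conormal_lift[OF aug_alg module_T F(1), folded U_eq] F(2) by auto
  have gen: "\<forall>b\<in>carrier B. \<phi> (ud b) = td b" "\<forall>x\<in>carrier (gp N). \<phi> (ul x) = tl x"
    using F(3,4) \<phi>(2) by (simp_all add: ud_def ul_def ry_simps re_simps)
  have "\<phi> (\<psi> t) = t" if t: "t \<in> carrier T" for t
  proof (rule T_ext[OF module_T _ _ _ _ t, of "\<lambda>t. \<phi> (\<psi> t)" "\<lambda>t. t"])
    show "(\<lambda>t. \<phi> (\<psi> t)) \<in> mod_hom A T T" "(\<lambda>t. t) \<in> mod_hom A T T"
      by (rule mod_homI; simp add: mod_homD[OF \<phi>(1)] mod_homD[OF \<psi>(1)])+
  qed (use gen \<psi> in simp_all)
  moreover have "\<psi> (\<phi> u) = u" if u: "u \<in> carrier U" for u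
  proof -
    obtain c where c: "c \<in> carrier C" "u = om c"
      using aug_alg.Mo_om[OF aug_alg, folded U_eq, OF u] by (auto simp: aug_alg.I_iff[OF aug_alg])
    \<comment> \<open>Two ring maps \<open>C \<rightarrow> A \<oplus> U\<close> that agree on the generators of \<open>C\<close>.\<close>
    have "(aug c, om c) = (\<lambda>(a, j). (a, \<psi> j)) (F c)"
    proof (rule C_ext[OF _ aug_alg.om_ring_hom[OF aug_alg, folded U_eq]
          ring_hom_comp[OF F(1) sqz_ring_hom[OF module_T module_U \<psi>(1)]] _ _ _ c(1)])
      show "ring (sqz_ring A U)" by (rule cring.axioms(1)[OF cring_sqz_ring[OF module_U]])
    qed (use F(2-4) \<psi> aug mod_hom_zero[OF module_T module_U \<psi>(1)] in \<open>simp_all add: om_rules ud_def ul_def\<close>)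
    then have "om c = \<psi> (snd (F c))" by (simp add: case_prod_beta)
    moreover have "\<phi> (om c) = snd (F c)" using \<phi>(2) c(1) by blast
    ultimately show ?thesis using c(2) by metis
  qed
  ultimately show ?thesis using \<phi>(1) \<psi> gen by (intro exI[of _ \<phi>] exI[of _ \<psi>]) simp
qed

text \<open>The module \<open>I / I\<^sup>2\<close> inherits its generators from the log differentials through the isomorphism.\<close>

lemma U_ext:
  assumes J: "module A J" and h: "h \<in> mod_hom A U J" and k: "k \<in> mod_hom A U J"
    and d: "\<And>b. b \<in> carrier B \<Longrightarrow> h (ud b) = k (ud b)"
    and l: "\<And>x. x \<in> carrier (gp N) \<Longrightarrow> h (ul x) = k (ul x)" and u: "u \<in> carrier U"
  shows "h u = k u"
proof -
  obtain \<phi> \<psi> where \<phi>: "\<phi> \<in> mod_hom A U T" "\<psi> \<in> mod_hom A T U" "\<forall>u\<in>carrier U. \<psi> (\<phi> u) = u"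
    "\<forall>b\<in>carrier B. \<psi> (td b) = ud b" "\<forall>x\<in>carrier (gp N). \<psi> (tl x) = ul x"
    using ab_rep_log_forms by auto
  have "(\<lambda>t. h (\<psi> t)) \<in> mod_hom A T J" "(\<lambda>t. k (\<psi> t)) \<in> mod_hom A T J"
    by (rule mod_homI; simp add: mod_homD[OF \<phi>(2)] mod_homD[OF h] mod_homD[OF k])+
  then have "h (\<psi> (\<phi> u)) = k (\<psi> (\<phi> u))"
    by (rule T_ext[OF J]) (use \<phi> d l u mod_homD(1)[OF \<phi>(1) u] in simp_all)
  then show ?thesis using \<phi> u by simp
qed

end

section \<open>Functoriality and naturality\<close>

context over_mor
begin

interpretation AB': cring Y.AB by (rule Y.ABc)
interpretation C': cring Y.C by (rule Y.Cc)
interpretation A: cring X.A by (rule X.Ac)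
interpretation B: cring X.B by (rule X.Bc)
interpretation B': cring Y.B by (rule Y.Bc)
interpretation M: comm_monoid X.M by (rule X.Mc)
interpretation N: comm_monoid X.N by (rule X.Nc)
interpretation N': comm_monoid Y.N by (rule Y.Nc)
interpretation GN: comm_group "gp X.N" by (rule comm_group_gp[OF X.Nc])
interpretation GMN: comm_group "gp X.MN" by (rule comm_group_gp[OF X.MNc])
interpretation GMN': comm_group "gp Y.MN" by (rule comm_group_gp[OF Y.MNc])

abbreviation "V \<equiv> \<lambda>(m, k). (m, v k)"
abbreviation "W \<equiv> tensor_lift Y.AB (\<lambda>a. Y.ct a \<one>\<^bsub>Y.B\<^esub>) (\<lambda>c. Y.ct \<one>\<^bsub>X.A\<^esub> (u c))"
abbreviation "gV \<equiv> gp_map Y.MN V"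
abbreviation "F \<equiv> ab_rep_ring_map X (Y, f, g) (Y', f', g') (u, v)"

lemma W: "W \<in> ring_hom X.AB Y.AB"
  "a \<in> carrier X.A \<Longrightarrow> b \<in> carrier X.B \<Longrightarrow> W (X.ct a b) = Y.ct a (u b)"
proof -
  note t = X.AB_lift'[OF Y.ABc Y.ct_left ring_hom_comp[OF u Y.ct_right]]
  show "W \<in> ring_hom X.AB Y.AB" by (rule t(1))
  show "W (X.ct a b) = Y.ct a (u b)" if "a \<in> carrier X.A" "b \<in> carrier X.B"
    using that t(2)[OF that] Y.ct_split[of a "u b"] by (simp add: u_simps)
qed

lemma V: "V \<in> mon_hom X.MN Y.MN"
  by (rule mon_homI) (auto simp: v_simps)

lemma gV: "z \<in> carrier (gp X.MN) \<Longrightarrow> gp_map X.M Y.cg (gV z) = gp_map X.M X.cg z"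
  by (rule gp_map_comp[OF X.MNc Y.MNc X.Mc V Y.cg_hom]) (auto simp: X.cg Y.cg gv)

lemmas gV_simps = mon_homD[OF gp_map_mon_hom[OF X.MNc Y.MNc V]]

text \<open>The embedding of \<open>N\<^sup>g\<^sup>p\<close> into \<open>(M \<oplus> N)\<^sup>g\<^sup>p\<close> is natural because \<open>v\<close> is a map over \<open>M\<close>.\<close>

lemma gV_\<kappa>:
  assumes x: "x \<in> carrier (gp X.N)"
  shows "gV (X.\<kappa> x) = Y.\<kappa> (gp_map Y.N v x)"
proof -
  have 1: "gV (gp_map X.MN (\<lambda>n. (\<one>\<^bsub>X.M\<^esub>, n)) x) = gp_map Y.MN (\<lambda>n. (\<one>\<^bsub>X.M\<^esub>, v n)) x"
    by (rule gp_map_comp[OF X.Nc X.MNc Y.MNc X.inc(1) V x]) simp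
  have 2: "gV (gp_map X.MN (\<lambda>n. (g n, \<one>\<^bsub>X.N\<^esub>)) x) = gp_map Y.MN (\<lambda>n. (g n, \<one>\<^bsub>Y.N\<^esub>)) x"
    by (rule gp_map_comp[OF X.Nc X.MNc Y.MNc X.inc(2) V x]) (simp add: v_simps)
  have 3: "gp_map Y.MN (\<lambda>n. (\<one>\<^bsub>X.M\<^esub>, n)) (gp_map Y.N v x) = gp_map Y.MN (\<lambda>n. (\<one>\<^bsub>X.M\<^esub>, v n)) x"
    by (rule gp_map_comp[OF X.Nc Y.Nc Y.MNc v Y.inc(1) x]) simp
  have 4: "gp_map Y.MN (\<lambda>n. (g' n, \<one>\<^bsub>Y.N\<^esub>)) (gp_map Y.N v x) = gp_map Y.MN (\<lambda>n. (g n, \<one>\<^bsub>Y.N\<^esub>)) x"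
    by (rule gp_map_comp[OF X.Nc Y.Nc Y.MNc v Y.inc(2) x]) (simp add: gv)
  show ?thesis
    unfolding X.\<kappa>_def Y.\<kappa>_def 3 4
    using x 1 2 X.inc_gp(1,4) by (simp add: gV_simps gp_map_inv[OF X.MNc Y.MNc V])
qed

text \<open>The induced map of repletions is given by tensor products and monoid rings; on generators it is the
  identity of \<open>A\<close>, \<open>u\<close> and \<open>v\<^sup>g\<^sup>p\<close>.\<close>

lemma F:
  shows "F \<in> ring_hom X.C Y.C"
    and "a \<in> carrier X.A \<Longrightarrow> F (X.rs a) = Y.rs a"
    and "b \<in> carrier X.B \<Longrightarrow> F (X.ry b) = Y.ry (u b)"
    and "x \<in> carrier (gp X.N) \<Longrightarrow> F (X.re x) = Y.re (gp_map Y.N v x)"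
proof -
  let ?h = "\<lambda>(m, x). frag_of (m, gV x)"
  let ?R = "monoid_ring_lift Y.ZRep ?h"
  have RepV: "(m, gV z) \<in> carrier Y.Rep" if "(m, z) \<in> carrier X.Rep" for m z
    using that by (simp add: rep_monoid_simps gV_simps gV)
  have h: "?h \<in> mon_hom X.Rep Y.ZRep"
  proof -
    have "(\<lambda>(m, x). (m, gV x)) \<in> mon_hom X.Rep Y.Rep"
      using RepV by (intro mon_homI) (auto simp: rep_monoid_simps gV_simps)
    from mon_hom_comp[OF this mon_hom_frag_of[OF Y.Repc]] show ?thesis by (simp only: case_prod_unfold)
  qed
  note R = mon_ring.lift_ring_hom[OF X.ZRep Y.ZRepc h] mon_ring.lift_frag[OF X.ZRep Y.ZRepc mon_hom_Pi[OF h]]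
  note l = ring_hom_comp[OF W(1) Y.pt_left] and r = ring_hom_comp[OF R(1) Y.pt_right]
  have compat: "\<forall>z\<in>carrier X.ZMN. Y.pt (W (X.bas z)) \<one>\<^bsub>Y.ZRep\<^esub> = Y.pt \<one>\<^bsub>Y.AB\<^esub> (?R (X.toR z))"
  proof
    fix z assume z: "z \<in> carrier X.ZMN"
    show "Y.pt (W (X.bas z)) \<one>\<^bsub>Y.ZRep\<^esub> = Y.pt \<one>\<^bsub>Y.AB\<^esub> (?R (X.toR z))"
    proof (rule mon_ring.hom_eq_on_frag[OF X.ZMN C'.ring_axioms ring_hom_comp[OF X.bas(1) l] ring_hom_comp[OF X.toR(1) r] _ z])
      fix w assume w: "w \<in> carrier X.MN"
      then obtain m n where e: "w = (m, n)" "m \<in> carrier X.M" "n \<in> carrier X.N" by auto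
      have Vw: "(m, v n) \<in> carrier Y.MN" using e by (simp add: v_simps)
      have 1: "W (X.bas (frag_of w)) = Y.bas (frag_of (m, v n))"
        using e X.bas(2)[OF w] Y.bas(2)[OF Vw] by (simp add: X.AB_simps(3) Y.AB_simps(3) W(2) X.alpha X.beta uv_str)
      have "?R (X.toR (frag_of w)) = frag_of (X.cg w, gV (to_gp X.MN w))"
        using X.toR(2)[OF w] R(2)[OF mon_homD(1)[OF X.to_rep_hom w]] by (simp add: to_rep_def)
      also have "\<dots> = Y.toR (frag_of (m, v n))"
        using e Y.toR(2)[OF Vw] w by (simp add: to_rep_def X.cg Y.cg gv gp_map_to_gp[OF X.MNc Y.MNc V])
      finally show "Y.pt (W (X.bas (frag_of w))) \<one>\<^bsub>Y.ZRep\<^esub> = Y.pt \<one>\<^bsub>Y.AB\<^esub> (?R (X.toR (frag_of w)))"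
        unfolding 1 using Y.pt_balanced[OF mon_ring.frag_carrier[OF Y.ZMN Vw]] by simp
    qed
  qed
  note T = X.C_tensor_lift[OF Y.Cc l r compat]
  have C': "PRing (prelog_rep Y.cp X Y.cg) = Y.C" by (simp add: ab_rep_ring_def)
  have F: "F = tensor_lift Y.C (\<lambda>b. Y.pt (W b) \<one>\<^bsub>Y.ZRep\<^esub>) (\<lambda>z. Y.pt \<one>\<^bsub>Y.AB\<^esub> (?R z))"
    by (simp add: ab_rep_ring_map_def prelog_rep_map_def coprod_map_def Let_def Y.AB_simps(2) C')
  show "F \<in> ring_hom X.C Y.C" unfolding F by (rule T(1))
  have one: "Y.pt \<one>\<^bsub>Y.AB\<^esub> \<one>\<^bsub>Y.ZRep\<^esub> = \<one>\<^bsub>Y.C\<^esub>" by (simp add: Y.pt_rules)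
  interpret ZR: cring X.ZRep by (rule X.ZRepc)
  interpret AB: cring X.AB by (rule X.ABc)
  note ctc = X.ct_rules(1) Y.ct_rules(1)
  note cl = ring_hom_closed[OF Y.pt_left] ring_hom_closed[OF Y.pt_right]
  show "a \<in> carrier X.A \<Longrightarrow> F (X.rs a) = Y.rs a"
    using T(2)[of "X.ct a \<one>\<^bsub>X.B\<^esub>" "\<one>\<^bsub>X.ZRep\<^esub>"]
    by (simp add: F X.rs_def Y.rs_def ctc cl W(2) u_simps ring_hom_one[OF R(1)] one)
  show "b \<in> carrier X.B \<Longrightarrow> F (X.ry b) = Y.ry (u b)"
    using T(2)[of "X.ct \<one>\<^bsub>X.A\<^esub> b" "\<one>\<^bsub>X.ZRep\<^esub>"]
    by (simp add: F X.ry_def Y.ry_def ctc cl W(2) u_simps ring_hom_one[OF R(1)] one)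
  show "F (X.re x) = Y.re (gp_map Y.N v x)" if x: "x \<in> carrier (gp X.N)"
  proof -
    note k = X.kap_Rep[OF x]
    have c: "frag_of (\<one>\<^bsub>X.M\<^esub>, Y.\<kappa> (gp_map Y.N v x)) \<in> carrier Y.ZRep"
      by (rule mon_ring.frag_carrier[OF Y.ZRep Y.kap_Rep]) (simp add: gv_simps x)
    show ?thesis
      using T(2)[of "\<one>\<^bsub>X.AB\<^esub>", OF _ mon_ring.frag_carrier[OF X.ZRep k]] c
      by (simp add: F X.re_def Y.re_def R(2)[OF k] cl gV_\<kappa>[OF x] ring_hom_one[OF W(1)] one)
  qed
qed

abbreviation "umor \<equiv> Ab_rep_mor X (Y, f, g) (Y', f', g') (u, v)"

lemma Ab_rep_mor:
  shows "umor \<in> mod_hom X.A X.U Y.U"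
    and "umor \<in> extensional (carrier X.U)"
    and "b \<in> carrier X.B \<Longrightarrow> umor (X.ud b) = Y.ud (u b)"
    and "x \<in> carrier (gp X.N) \<Longrightarrow> umor (X.ul x) = Y.ul (gp_map Y.N v x)"
proof -
  have "Y.aug (F c) = X.aug c" if "c \<in> carrier X.C" for c
    by (rule X.C_ext[OF A.ring_axioms ring_hom_comp[OF F(1) Y.aug(1)] X.aug(1) _ _ _ that])
      (simp_all add: F X.aug Y.aug u_simps gv_simps fu)
  note m = conormal_map[OF X.aug_alg Y.aug_alg F(1) F(2) this, folded X.U_eq Y.U_eq]
  let ?h = "\<lambda>U. the_elem ((\<lambda>c. ideal_prod Y.C (a_kernel Y.C X.A Y.aug) (a_kernel Y.C X.A Y.aug) +>\<^bsub>Y.C\<^esub> F c) ` U)"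
  have e: "umor = restrict ?h (carrier X.U)"
    by (simp add: Ab_rep_mor_def Y.ab_rep_simps restrict_def)
  interpret U: module X.A X.U by (rule X.module_U)
  show "umor \<in> extensional (carrier X.U)" by (simp add: e)
  show "umor \<in> mod_hom X.A X.U Y.U" using mod_homD[OF m(1)] unfolding e by (intro mod_homI) simp_all
  show "b \<in> carrier X.B \<Longrightarrow> umor (X.ud b) = Y.ud (u b)"
    using X.ud_rules(1)[of b] unfolding e by (simp add: X.ud_def Y.ud_def m(2) X.ry_simps F)
  show "x \<in> carrier (gp X.N) \<Longrightarrow> umor (X.ul x) = Y.ul (gp_map Y.N v x)"
    using X.ud_rules(2)[of x] unfolding e by (simp add: X.ul_def Y.ul_def m(2) X.re_simps F)
qed

lemma ab_rep_iso_natural: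
  assumes p: "p \<in> mod_hom X.A X.U X.T" "\<forall>b\<in>carrier X.B. p (X.ud b) = X.td b" "\<forall>x\<in>carrier (gp X.N). p (X.ul x) = X.tl x"
    and q: "q \<in> mod_hom X.A Y.U Y.T" "\<forall>b\<in>carrier Y.B. q (Y.ud b) = Y.td b" "\<forall>x\<in>carrier (gp Y.N). q (Y.ul x) = Y.tl x"
    and w: "w \<in> carrier X.U"
  shows "lmor (p w) = q (umor w)"
proof (rule X.U_ext[OF Y.module_T _ _ _ _ w, of "\<lambda>w. lmor (p w)" "\<lambda>w. q (umor w)"])
  show "(\<lambda>w. lmor (p w)) \<in> mod_hom X.A X.U Y.T"
    by (rule mod_homI) (simp_all add: mod_homD[OF p(1)] mod_homD[OF LogDiff_mor(1)])
  show "(\<lambda>w. q (umor w)) \<in> mod_hom X.A X.U Y.T"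
    by (rule mod_homI) (simp_all add: mod_homD[OF q(1)] mod_homD[OF Ab_rep_mor(1)])
qed (use p q in \<open>simp_all add: LogDiff_mor Ab_rep_mor u_simps gv_simps\<close>)

end

subsection \<open>The two functors\<close>

lemma over_objI:
  assumes "log_ring P" and "(Y, f, g) \<in> Obj (over_cat Log_cat P)"
  shows "over_obj P Y f g"
  using assms by (intro over_obj.intro) (auto simp: over_cat_simps Log_simps log_ring_def prelog_hom_def)

lemma over_morI:
  assumes P: "log_ring P" and Y: "(Y, f, g) \<in> Obj (over_cat Log_cat P)" and Y': "(Y', f', g') \<in> Obj (over_cat Log_cat P)"
    and h: "(u, v) \<in> Hom (over_cat Log_cat P) (Y, f, g) (Y', f', g')"
  shows "over_mor P Y f g Y' f' g' u v"
proof -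
  have "(u, v) \<in> prelog_hom Y Y'" using h by (simp add: over_cat_simps Log_simps prelog_hom_def)
  moreover have c: "compose (carrier (PRing Y)) f' u = f" "compose (carrier (PMon Y)) g' v = g"
    using h by (simp_all add: over_cat_simps Log_simps)
  have "f' (u b) = f b" if "b \<in> carrier (PRing Y)" for b using that fun_cong[OF c(1), of b] by (simp add: compose_def)
  moreover have "g' (v n) = g n" if "n \<in> carrier (PMon Y)" for n using that fun_cong[OF c(2), of n] by (simp add: compose_def)
  ultimately show ?thesis
    by (intro over_mor.intro over_mor_axioms.intro over_objI[OF P Y] over_objI[OF P Y']) simp_all
qed

context
  fixes P :: "('u, 'u) prelog"
  assumes P: "log_ring P"
begin

lemma category_over: "category (over_cat Log_cat P)"
  by (rule category_over_cat[OF category_Log_cat]) (simp add: Log_simps P)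

lemma over_Ident:
  assumes Z: "(Y, f, g) \<in> Obj (over_cat Log_cat P)"
  shows "Ident (over_cat Log_cat P) (Y, f, g) = (\<lambda>b\<in>carrier (PRing Y). b, \<lambda>n\<in>carrier (PMon Y). n)"
    and "over_mor P Y f g Y f g (\<lambda>b\<in>carrier (PRing Y). b) (\<lambda>n\<in>carrier (PMon Y). n)"
proof -
  show 1: "Ident (over_cat Log_cat P) (Y, f, g) = (\<lambda>b\<in>carrier (PRing Y). b, \<lambda>n\<in>carrier (PMon Y). n)"
    by (simp add: over_cat_simps Log_simps)
  show "over_mor P Y f g Y f g (\<lambda>b\<in>carrier (PRing Y). b) (\<lambda>n\<in>carrier (PMon Y). n)"
    by (rule over_morI[OF P Z Z]) (metis 1 category_over categoryD(1) Z)
qed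

lemma over_Comp:
  assumes Z: "(Y, f, g) \<in> Obj (over_cat Log_cat P)" "(Y', f', g') \<in> Obj (over_cat Log_cat P)" "(Y'', f'', g'') \<in> Obj (over_cat Log_cat P)"
    and h: "(u, v) \<in> Hom (over_cat Log_cat P) (Y, f, g) (Y', f', g')" and k: "(u', v') \<in> Hom (over_cat Log_cat P) (Y', f', g') (Y'', f'', g'')"
  shows "Comp (over_cat Log_cat P) (Y, f, g) (Y', f', g') (Y'', f'', g'') (u', v') (u, v) =
      (compose (carrier (PRing Y)) u' u, compose (carrier (PMon Y)) v' v)"
    and "over_mor P Y f g Y'' f'' g'' (compose (carrier (PRing Y)) u' u) (compose (carrier (PMon Y)) v' v)"
proof -
  show 1: "Comp (over_cat Log_cat P) (Y, f, g) (Y', f', g') (Y'', f'', g'') (u', v') (u, v) =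
      (compose (carrier (PRing Y)) u' u, compose (carrier (PMon Y)) v' v)"
    by (simp add: over_cat_simps Log_simps)
  show "over_mor P Y f g Y'' f'' g'' (compose (carrier (PRing Y)) u' u) (compose (carrier (PMon Y)) v' v)"
    by (rule over_morI[OF P Z(1,3)]) (simp only: 1[symmetric], rule categoryD(2)[OF category_over Z h k])
qed

lemma gp_map_compose:
  assumes Z: "over_mor P Y f g Y' f' g' u v" "over_mor P Y' f' g' Y'' f'' g'' u' v'" and x: "x \<in> carrier (gp (PMon Y))"
  shows "gp_map (PMon Y'') v' (gp_map (PMon Y') v x) = gp_map (PMon Y'') (compose (carrier (PMon Y)) v' v) x"
proof -
  interpret p: over_mor P Y f g Y' f' g' u v by (rule Z(1))
  interpret q: over_mor P Y' f' g' Y'' f'' g'' u' v' by (rule Z(2))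
  show ?thesis by (rule gp_map_comp[OF p.X.Nc p.Y.Nc q.Y.Nc p.v q.v x]) (simp add: compose_def)
qed

text \<open>Both functors send an object to a module generated by elements \<open>G1 b\<close> for \<open>b \<in> B\<close> and \<open>G2 x\<close> for
  \<open>x \<in> N\<^sup>g\<^sup>p\<close>, and a morphism \<open>(u, v)\<close> to the linear map given by \<open>u\<close> and \<open>v\<^sup>g\<^sup>p\<close> on these generators. This
  alone implies compatibility with identities and composition.\<close>

lemma functor_on_generators:
  fixes O1 :: "('u, 'u) prelog \<times> ('u \<Rightarrow> 'u) \<times> ('u \<Rightarrow> 'u) \<Rightarrow> ('u, 'x) module"
    and G1 :: "('u, 'u) prelog \<Rightarrow> ('u \<Rightarrow> 'u) \<Rightarrow> ('u \<Rightarrow> 'u) \<Rightarrow> 'u \<Rightarrow> 'x"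
    and G2 :: "('u, 'u) prelog \<Rightarrow> ('u \<Rightarrow> 'u) \<Rightarrow> ('u \<Rightarrow> 'u) \<Rightarrow> ('u \<times> 'u) set \<Rightarrow> 'x"
  assumes obj: "\<And>Y f g. over_obj P Y f g \<Longrightarrow> module (PRing P) (O1 (Y, f, g)) \<and>
      (\<forall>b\<in>carrier (PRing Y). G1 Y f g b \<in> carrier (O1 (Y, f, g))) \<and> (\<forall>x\<in>carrier (gp (PMon Y)). G2 Y f g x \<in> carrier (O1 (Y, f, g)))"
    and ext: "\<And>Y f g J h k t. over_obj P Y f g \<Longrightarrow> module (PRing P) J \<Longrightarrow> h \<in> mod_hom (PRing P) (O1 (Y, f, g)) J \<Longrightarrow>
      k \<in> mod_hom (PRing P) (O1 (Y, f, g)) J \<Longrightarrow> (\<And>b. b \<in> carrier (PRing Y) \<Longrightarrow> h (G1 Y f g b) = k (G1 Y f g b)) \<Longrightarrow>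
      (\<And>x. x \<in> carrier (gp (PMon Y)) \<Longrightarrow> h (G2 Y f g x) = k (G2 Y f g x)) \<Longrightarrow> t \<in> carrier (O1 (Y, f, g)) \<Longrightarrow> h t = (k t :: 'x)"
    and mor: "\<And>Y f g Y' f' g' u v. over_mor P Y f g Y' f' g' u v \<Longrightarrow>
      M1 (Y, f, g) (Y', f', g') (u, v) \<in> mod_hom (PRing P) (O1 (Y, f, g)) (O1 (Y', f', g')) \<and>
      M1 (Y, f, g) (Y', f', g') (u, v) \<in> extensional (carrier (O1 (Y, f, g))) \<and>
      (\<forall>b\<in>carrier (PRing Y). M1 (Y, f, g) (Y', f', g') (u, v) (G1 Y f g b) = G1 Y' f' g' (u b)) \<and>
      (\<forall>x\<in>carrier (gp (PMon Y)). M1 (Y, f, g) (Y', f', g') (u, v) (G2 Y f g x) = G2 Y' f' g' (gp_map (PMon Y') v x))"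
  shows "is_functor (over_cat Log_cat P) (Mod_cat (PRing P)) \<lparr>fobj = O1, fmor = M1\<rparr>"
  unfolding is_functor_def fctr.simps
proof (intro conjI ballI)
  let ?O = "over_cat Log_cat P"
  show "category ?O" by (rule category_over)
  show "category (Mod_cat (PRing P))" by (rule category_Mod_cat)
  fix Z assume Z: "Z \<in> Obj ?O"
  obtain Y f g where e: "Z = (Y, f, g)" by (metis prod.exhaust)
  note Z = Z[unfolded e] and o = over_objI[OF P Z[unfolded e]]
  show "O1 Z \<in> Obj (Mod_cat (PRing P))" using obj[OF o] by (simp add: e Mod_cat_simps)
  show "M1 Z Z (Ident ?O Z) = Ident (Mod_cat (PRing P)) (O1 Z)"
  proof -
    note m = mor[OF over_Ident(2)[OF Z]]
    interpret over_obj P Y f g by (rule o)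
    have i: "(\<lambda>x. x) \<in> mod_hom (PRing P) (O1 (Y, f, g)) (O1 (Y, f, g))" by (rule mod_homI) simp_all
    have n: "gp_map (PMon Y) (\<lambda>n\<in>carrier (PMon Y). n) x = x" if "x \<in> carrier (gp (PMon Y))" for x
      by (rule gp_map_ident[OF Nc that]) simp
    show ?thesis unfolding e over_Ident(1)[OF Z] Mod_cat_simps
    proof (rule extensionalityI[of _ "carrier (O1 (Y, f, g))"])
      fix x assume x: "x \<in> carrier (O1 (Y, f, g))"
      then show "M1 (Y, f, g) (Y, f, g) (\<lambda>b\<in>carrier (PRing Y). b, \<lambda>n\<in>carrier (PMon Y). n) x = (\<lambda>x\<in>carrier (O1 (Y, f, g)). x) x"
        using ext[OF o conjunct1[OF obj[OF o]] conjunct1[OF m] i _ _ x] m by (simp add: n)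
    qed (use m in simp_all)
  qed
  fix Z' assume Z': "Z' \<in> Obj ?O"
  obtain Y' f' g' where e': "Z' = (Y', f', g')" by (metis prod.exhaust)
  note Z' = Z'[unfolded e'] and o' = over_objI[OF P Z'[unfolded e']]
  fix h assume h: "h \<in> Hom ?O Z Z'"
  obtain u v where eh: "h = (u, v)" by (metis prod.exhaust)
  note h = h[unfolded e e' eh]
  note oh = over_morI[OF P Z Z' h]
  show "M1 Z Z' h \<in> Hom (Mod_cat (PRing P)) (O1 Z) (O1 Z')" using mor[OF oh] by (simp add: e e' eh Mod_cat_simps)
next
  let ?O = "over_cat Log_cat P"
  fix Z Z' Z'' h k assume Z: "Z \<in> Obj ?O" and Z': "Z' \<in> Obj ?O" and Z'': "Z'' \<in> Obj ?O" and h: "h \<in> Hom ?O Z Z'" and k: "k \<in> Hom ?O Z' Z''"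
  obtain Y f g Y' f' g' Y'' f'' g'' u v u' v' where e: "Z = (Y, f, g)" "Z' = (Y', f', g')" "Z'' = (Y'', f'', g'')" "h = (u, v)" "k = (u', v')"
    by (metis prod.exhaust)
  note Z = Z[unfolded e] and Z' = Z'[unfolded e] and Z'' = Z''[unfolded e] and h = h[unfolded e] and k = k[unfolded e]
  note C = over_Comp[OF Z Z' Z'' h k] and oh = over_morI[OF P Z Z' h] and ok = over_morI[OF P Z' Z'' k]
  note m = mor[OF C(2)] and mh = mor[OF oh] and mk = mor[OF ok]
  note o = over_objI[OF P Z] and o'' = over_objI[OF P Z'']
  interpret p: over_mor P Y f g Y' f' g' u v by (rule oh)
  let ?h = "M1 (Y, f, g) (Y', f', g') (u, v)" and ?k = "M1 (Y', f', g') (Y'', f'', g'') (u', v')"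
  have c: "(\<lambda>x. ?k (?h x)) \<in> mod_hom (PRing P) (O1 (Y, f, g)) (O1 (Y'', f'', g''))"
    using mod_homD[OF conjunct1[OF mh]] mod_homD[OF conjunct1[OF mk]] by (intro mod_homI) simp_all
  show "M1 Z Z'' (Comp ?O Z Z' Z'' k h) = Comp (Mod_cat (PRing P)) (O1 Z) (O1 Z') (O1 Z'') (M1 Z' Z'' k) (M1 Z Z' h)"
    unfolding e C(1) Mod_cat_simps
  proof (rule extensionalityI[of _ "carrier (O1 (Y, f, g))"])
    fix x assume x: "x \<in> carrier (O1 (Y, f, g))"
    then show "M1 (Y, f, g) (Y'', f'', g'') (compose (carrier (PRing Y)) u' u, compose (carrier (PMon Y)) v' v) x =
        compose (carrier (O1 (Y, f, g))) ?k ?h x"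
      using ext[OF o conjunct1[OF obj[OF o'']] conjunct1[OF m] c _ _ x] m mh mk
      by (simp add: compose_def p.u_simps p.gv_simps gp_map_compose[OF oh ok, unfolded compose_def])
  qed (use m in \<open>simp_all add: compose_def\<close>)
qed

lemma Ab_rep_functor: "is_functor (over_cat Log_cat P) (Mod_cat (PRing P)) (Ab_rep_functor P)"
  unfolding Ab_rep_functor_def
proof (rule functor_on_generators[of _ "over_obj.ud P" "over_obj.ul P"], goal_cases)
  case (1 Y f g)
  then interpret over_obj P Y f g .
  show ?case by (simp add: module_U ud_rules)
next
  case (2 Y f g J h k t)
  show ?case by (rule over_obj.U_ext[OF 2])
next
  case (3 Y f g Y' f' g' u v)
  then interpret over_mor P Y f g Y' f' g' u v .
  show ?case by (simp add: Ab_rep_mor)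
qed

lemma LogDiff_functor: "is_functor (over_cat Log_cat P) (Mod_cat (PRing P)) (LogDiff_functor P)"
  unfolding LogDiff_functor_def
proof (rule functor_on_generators[of _ "\<lambda>Y f g. over_obj.td P Y f" "\<lambda>Y f g. over_obj.tl P Y f"], goal_cases)
  case (1 Y f g)
  then interpret over_obj P Y f g .
  show ?case by (simp add: module_T td_rules)
next
  case (2 Y f g J h k t)
  show ?case by (rule over_obj.T_ext[OF 2])
next
  case (3 Y f g Y' f' g' u v)
  then interpret over_mor P Y f g Y' f' g' u v .
  show ?case by (simp add: LogDiff_mor)
qed

lemma Ab_rep_iso_log_forms:
  "\<exists>\<phi>. natural_mod_iso (over_cat Log_cat P) (PRing P) (Ab_rep_functor P) (LogDiff_functor P) \<phi>"
proof -
  \<comment> \<open>The isomorphisms are chosen so that they match the generators, which makes them natural.\<close>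
  define good where "good = (\<lambda>(Y :: ('u, 'u) prelog, f, g) \<phi>. \<phi> \<in> mod_iso (PRing P) (Ab_rep_obj P (Y, f, g)) (LogDiff_obj P (Y, f, g)) \<and>
    (\<forall>b\<in>carrier (PRing Y). \<phi> (over_obj.ud P Y f g b) = over_obj.td P Y f b) \<and>
    (\<forall>x\<in>carrier (gp (PMon Y)). \<phi> (over_obj.ul P Y f g x) = over_obj.tl P Y f x))"
  define \<Phi> where "\<Phi> Z = (SOME \<phi>. good Z \<phi>)" for Z
  have good: "good (Y, f, g) (\<Phi> (Y, f, g))" if o: "over_obj P Y f g" for Y :: "('u, 'u) prelog" and f g
    unfolding \<Phi>_def
  proof (rule someI_ex[where P = "good (Y, f, g)"])
    interpret over_obj P Y f g by (rule o)
    obtain \<phi> \<psi> where h: "\<phi> \<in> mod_hom A U T" "\<psi> \<in> mod_hom A T U" "\<forall>u\<in>carrier U. \<psi> (\<phi> u) = u" "\<forall>t\<in>carrier T. \<phi> (\<psi> t) = t"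
      "\<forall>b\<in>carrier B. \<phi> (ud b) = td b" "\<forall>x\<in>carrier (gp N). \<phi> (ul x) = tl x"
      using ab_rep_log_forms by auto
    have "bij_betw \<phi> (carrier U) (carrier T)"
      by (rule bij_betw_byWitness[of _ \<psi>]) (use h mod_homD(1)[OF h(1)] mod_homD(1)[OF h(2)] in auto)
    then show "\<exists>\<phi>. good (Y, f, g) \<phi>" using h by (auto simp: good_def mod_iso_def)
  qed
  show ?thesis
    unfolding natural_mod_iso_def Ab_rep_functor_def LogDiff_functor_def fctr.simps
  proof (intro exI[of _ \<Phi>] conjI ballI)
    fix Z assume Z: "Z \<in> Obj (over_cat Log_cat P)"
    obtain Y f g where e: "Z = (Y, f, g)" by (metis prod.exhaust)
    note o = over_objI[OF P Z[unfolded e]]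
    show "\<Phi> Z \<in> mod_iso (PRing P) (Ab_rep_obj P Z) (LogDiff_obj P Z)" using good[OF o] by (simp add: e good_def)
    fix Z' h x assume Z': "Z' \<in> Obj (over_cat Log_cat P)" and h: "h \<in> Hom (over_cat Log_cat P) Z Z'" and x: "x \<in> carrier (Ab_rep_obj P Z)"
    obtain Y' f' g' u v where e': "Z' = (Y', f', g')" "h = (u, v)" by (metis prod.exhaust)
    interpret over_mor P Y f g Y' f' g' u v by (rule over_morI[OF P]) (use Z Z' h in \<open>simp_all add: e e'\<close>)
    show "LogDiff_mor P Z Z' h (\<Phi> Z x) = \<Phi> Z' (Ab_rep_mor P Z Z' h x)"
      using good[OF o] good[OF Y.over_obj_axioms] x unfolding e e' good_def mod_iso_def
      by (intro ab_rep_iso_natural) simp_all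
  qed
qed

end

theorem proposition1p9:
  fixes AM :: "('u, 'u) prelog" and pr :: "'u \<times> 'u \<Rightarrow> 'u"
  assumes pr: "inj pr"
    and AM: "log_ring AM"
  shows "is_equivalence (LogRep_cat AM) (under_over_cat CRing_cat (PRing AM)) forget_log \<and>
    is_equivalence (Mod_cat (PRing AM)) (Ab (LogRep_cat AM)) (sqz_functor pr AM) \<and>
    is_functor (over_cat Log_cat AM) (Mod_cat (PRing AM)) (Ab_rep_functor AM) \<and>
    is_functor (over_cat Log_cat AM) (Mod_cat (PRing AM)) (LogDiff_functor AM) \<and>
    (\<exists>\<phi>. natural_mod_iso (over_cat Log_cat AM) (PRing AM) (Ab_rep_functor AM) (LogDiff_functor AM) \<phi>)"
  using forget_log_equivalence[OF pr AM] log_base.sq_equivalence[OF log_base.intro[OF pr AM]]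
    Ab_rep_functor[OF AM] LogDiff_functor[OF AM] Ab_rep_iso_log_forms[OF AM]
  by blast

end
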